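(* Let $\mathbb{K}$ be an algebraically closed field of characteristic zero, let $\mathcal{C}$ be a fusion category over $\mathbb{K}$ equipped with a spherical pivotal structure $p_X\colon X\to X^{\vee\vee}$, and let $F=\mathrm{K}(\mathcal{C})\otimes_{\mathbb{Z}}\mathbb{K}$ be its fusion algebra. Let $\mathcal{M}\colon\mathcal{C}\to\mathrm{End}(\mathcal{B})$ be a finite pivotal module category over $\mathcal{C}$. Then the NIM-rep $\mathsf{N}=\mathrm{K}(\mathcal{B})\otimes_{\mathbb{Z}}\mathbb{K}$ and the encircling module $\mathsf{E}=\mathrm{Nat}(\mathrm{id}_{\mathcal{B}})$ are isomorphic $F$-modules.
   Context: $\mathrm{K}(-)$ denotes the Grothendieck group (a ring for a monoidal category). A module category over $\mathcal{C}$ is a $\mathbb{K}$-linear category $\mathcal{B}$ with a monoidal functor $\mathcal{M}\colon\mathcal{C}\to\mathrm{End}(\mathcal{B})$, where $\mathrm{End}(\mathcal{B})$ is the category of linear endofunctors of $\mathcal{B}$ with tensor product given by composition, $G\otimes H=G\circ H$. It is finite if $\mathcal{B}$ is semisimple with finitely many simple objects. NIM-rep: $\mathsf{N}=\mathrm{K}(\mathcal{B})\otimes_{\mathbb{Z}}\mathbb{K}$ with $F$-action induced by $[X]\cdot[b]=[\mathcal{M}(X)(b)]$. Encircling module: $\mathsf{E}$ is the vector space $\mathrm{Nat}(\mathrm{id}_{\mathcal{B}})$ of natural endotransformations of the identity functor, with $F$-action, for $X\in\mathcal{C}$, $$X\cdot\alpha=\mathcal{M}(\mathrm{ann}_{X^\vee})\circ\big(\mathcal{M}(p_X)\otimes\alpha\otimes\mathrm{id}_{\mathcal{M}(X)^\vee}\big)\circ\mathcal{M}(\mathrm{cre}_X),$$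 where $\mathrm{cre}_X\colon\mathbf{1}\to X\otimes X^\vee$ and $\mathrm{ann}_{X^\vee}\colon X^{\vee\vee}\otimes X^\vee\to\mathbf{1}$ are the duality (creation/annihilation) morphisms, and $\mathcal{M}(X^\vee)$ is canonically identified with $\mathcal{M}(X)^\vee$. Pivotal module category: let $\mathcal{D}$ be the full subcategory of $\mathrm{End}(\mathcal{B})$ consisting of subobjects of objects of the form $\mathcal{M}(X)$, $X\in\mathcal{C}$. Then $\mathcal{M}$ is pivotal if the image under $\mathcal{M}$ of the pivotal structure of $\mathcal{C}$ induces a pivotal structure on $\mathcal{D}$, i.e. for all $X,Y\in\mathcal{C}$ and all $\alpha\in\mathrm{Hom}_{\mathcal{D}}(\mathcal{M}(X),\mathcal{M}(Y))$ (not only those in the image of $\mathcal{M}$) one has $\mathcal{M}(p_Y)\circ\alpha=\alpha^{\vee\vee}\circ\mathcal{M}(p_X)$. *)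

theory Defs
  imports
    "HOL-Algebra.Algebraic_Closure_Type"
    "HOL-Algebra.Free_Abelian_Groups"
    "HOL-Algebra.Generated_Groups"
    "HOL-Library.FuncSet"
begin

no_notation Polynomials.var (\<open>X\<index>\<close>)

section \<open>Linear categories\<close>

record ('o, 'm) cat =
  Ob :: "'o set"
  Ar :: "'m set"
  Dom :: "'m \<Rightarrow> 'o"
  Cod :: "'m \<Rightarrow> 'o"
  Id :: "'o \<Rightarrow> 'm"
  Cmp :: "'m \<Rightarrow> 'm \<Rightarrow> 'm" (infixr \<open>\<bullet>\<index>\<close> 65)

definition Hom :: "('o, 'm, 'z) cat_scheme \<Rightarrow> 'o \<Rightarrow> 'o \<Rightarrow> 'm set" where
  "Hom C A B = {f \<in> Ar C. Dom C f = A \<and> Cod C f = B}"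

locale category =
  fixes C :: "('o, 'm, 'z) cat_scheme" (structure)
  assumes Dom_Ob: "f \<in> Ar C \<Longrightarrow> Dom C f \<in> Ob C"
    and Cod_Ob: "f \<in> Ar C \<Longrightarrow> Cod C f \<in> Ob C"
    and Id_Hom: "A \<in> Ob C \<Longrightarrow> Id C A \<in> Hom C A A"
    and Cmp_Hom: "\<lbrakk>f \<in> Hom C A B; g \<in> Hom C B D\<rbrakk> \<Longrightarrow> g \<bullet> f \<in> Hom C A D"
    and Cmp_assoc: "\<lbrakk>f \<in> Hom C A B; g \<in> Hom C B D; h \<in> Hom C D E\<rbrakk> \<Longrightarrow>
      (h \<bullet> g) \<bullet> f = h \<bullet> (g \<bullet> f)"
    and Cmp_Id_right: "f \<in> Hom C A B \<Longrightarrow> f \<bullet> Id C A = f"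
    and Cmp_Id_left: "f \<in> Hom C A B \<Longrightarrow> Id C B \<bullet> f = f"

definition inverse_ars :: "('o, 'm, 'z) cat_scheme \<Rightarrow> 'm \<Rightarrow> 'm \<Rightarrow> bool" where
  "inverse_ars C f g \<longleftrightarrow> f \<in> Ar C \<and> g \<in> Hom C (Cod C f) (Dom C f) \<and>
     Cmp C g f = Id C (Dom C f) \<and> Cmp C f g = Id C (Cod C f)"

definition iso_ar :: "('o, 'm, 'z) cat_scheme \<Rightarrow> 'm \<Rightarrow> bool" where
  "iso_ar C f \<longleftrightarrow> (\<exists>g. inverse_ars C f g)"

definition inv_ar :: "('o, 'm, 'z) cat_scheme \<Rightarrow> 'm \<Rightarrow> 'm" where
  "inv_ar C f = (THE g. inverse_ars C f g)"

definition iso_obs :: "('o, 'm, 'z) cat_scheme \<Rightarrow> 'o \<Rightarrow> 'o \<Rightarrow> bool" where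
  "iso_obs C A B \<longleftrightarrow> (\<exists>f \<in> Hom C A B. iso_ar C f)"

definition mono_ar :: "('o, 'm, 'z) cat_scheme \<Rightarrow> 'm \<Rightarrow> bool" where
  "mono_ar C f \<longleftrightarrow> f \<in> Ar C \<and>
     (\<forall>A. \<forall>g \<in> Hom C A (Dom C f). \<forall>h \<in> Hom C A (Dom C f). Cmp C f g = Cmp C f h \<longrightarrow> g = h)"

definition epi_ar :: "('o, 'm, 'z) cat_scheme \<Rightarrow> 'm \<Rightarrow> bool" where
  "epi_ar C f \<longleftrightarrow> f \<in> Ar C \<and>
     (\<forall>B. \<forall>g \<in> Hom C (Cod C f) B. \<forall>h \<in> Hom C (Cod C f) B. Cmp C g f = Cmp C h f \<longrightarrow> g = h)"

definition zero_ob :: "('o, 'm, 'z) cat_scheme \<Rightarrow> 'o \<Rightarrow> bool" where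
  "zero_ob C Z \<longleftrightarrow> Z \<in> Ob C \<and>
     (\<forall>A \<in> Ob C. (\<exists>!f. f \<in> Hom C Z A) \<and> (\<exists>!f. f \<in> Hom C A Z))"

definition simple_ob :: "('o, 'm, 'z) cat_scheme \<Rightarrow> 'o \<Rightarrow> bool" where
  "simple_ob C S \<longleftrightarrow> S \<in> Ob C \<and> \<not> zero_ob C S \<and>
     (\<forall>T. \<forall>m \<in> Hom C T S. mono_ar C m \<longrightarrow> zero_ob C T \<or> iso_ar C m)"

text \<open>The ground field is a type \<^typ>\<open>'k\<close>; \<open>ring_of_type_algebra\<close> is the corresponding
  ring record.\<close>

record ('o, 'm, 'k) lincat = "('o, 'm) cat" +
  Zero :: "'o \<Rightarrow> 'o \<Rightarrow> 'm"
  Add :: "'m \<Rightarrow> 'm \<Rightarrow> 'm"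
  Scale :: "'k \<Rightarrow> 'm \<Rightarrow> 'm"

text \<open>Here and below, the fields \<open>mult\<close> and \<open>one\<close> of a module record carry no meaning.\<close>

definition hom_space :: "('o, 'm, 'k, 'z) lincat_scheme \<Rightarrow> 'o \<Rightarrow> 'o \<Rightarrow> ('k, 'm) module" where
  "hom_space C A B = \<lparr>carrier = Hom C A B, monoid.mult = undefined, monoid.one = undefined,
     ring.zero = Zero C A B, ring.add = Add C, module.smult = Scale C\<rparr>"

locale lin_category = category C
  for C :: "('o, 'm, 'k :: field, 'z) lincat_scheme" (structure) +
  assumes hom_module: "\<lbrakk>A \<in> Ob C; B \<in> Ob C\<rbrakk> \<Longrightarrow>
      module (ring_of_type_algebra :: 'k ring) (hom_space C A B)"
    and Cmp_Add_left: "\<lbrakk>f \<in> Hom C A B; g \<in> Hom C B D; h \<in> Hom C B D\<rbrakk> \<Longrightarrow>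
      Add C g h \<bullet> f = Add C (g \<bullet> f) (h \<bullet> f)"
    and Cmp_Add_right: "\<lbrakk>f \<in> Hom C A B; g \<in> Hom C A B; h \<in> Hom C B D\<rbrakk> \<Longrightarrow>
      h \<bullet> Add C f g = Add C (h \<bullet> f) (h \<bullet> g)"
    and Cmp_Scale_left: "\<lbrakk>f \<in> Hom C A B; g \<in> Hom C B D\<rbrakk> \<Longrightarrow>
      Scale C k g \<bullet> f = Scale C k (g \<bullet> f)"
    and Cmp_Scale_right: "\<lbrakk>f \<in> Hom C A B; g \<in> Hom C B D\<rbrakk> \<Longrightarrow>
      g \<bullet> Scale C k f = Scale C k (g \<bullet> f)"

definition fin_dim_hom :: "('o, 'm, 'k :: field, 'z) lincat_scheme \<Rightarrow> 'o \<Rightarrow> 'o \<Rightarrow> bool" where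
  "fin_dim_hom C A B \<longleftrightarrow> (\<exists>S \<subseteq> Hom C A B. finite S \<and>
     (\<forall>f \<in> Hom C A B. \<exists>c. f = finsum (hom_space C A B) (\<lambda>s. Scale C (c s) s) S))"

text \<open>\<open>A\<close> is the direct sum of \<open>S 0, \<dots>, S (n - 1)\<close> with inclusions \<open>i\<close> and projections \<open>p\<close>;
  for \<open>n = 0\<close> this says that \<open>A\<close> is a zero object.\<close>

definition direct_sum ::
  "('o, 'm, 'k, 'z) lincat_scheme \<Rightarrow> 'o \<Rightarrow> nat \<Rightarrow> (nat \<Rightarrow> 'o) \<Rightarrow> (nat \<Rightarrow> 'm) \<Rightarrow> (nat \<Rightarrow> 'm) \<Rightarrow> bool" where
  "direct_sum C A n S i p \<longleftrightarrow> A \<in> Ob C \<and>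
     (\<forall>r < n. S r \<in> Ob C \<and> i r \<in> Hom C (S r) A \<and> p r \<in> Hom C A (S r)) \<and>
     (\<forall>r < n. \<forall>s < n. Cmp C (p r) (i s) = (if r = s then Id C (S r) else Zero C (S s) (S r))) \<and>
     finsum (hom_space C A A) (\<lambda>r. Cmp C (i r) (p r)) {..<n} = Id C A"

definition is_ker :: "('o, 'm, 'k, 'z) lincat_scheme \<Rightarrow> 'm \<Rightarrow> 'm \<Rightarrow> bool" where
  "is_ker C f m \<longleftrightarrow> f \<in> Ar C \<and> m \<in> Ar C \<and> Cod C m = Dom C f \<and>
     Cmp C f m = Zero C (Dom C m) (Cod C f) \<and>
     (\<forall>A. \<forall>g \<in> Hom C A (Dom C f). Cmp C f g = Zero C A (Cod C f) \<longrightarrow>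
        (\<exists>!h. h \<in> Hom C A (Dom C m) \<and> Cmp C m h = g))"

definition is_coker :: "('o, 'm, 'k, 'z) lincat_scheme \<Rightarrow> 'm \<Rightarrow> 'm \<Rightarrow> bool" where
  "is_coker C f e \<longleftrightarrow> f \<in> Ar C \<and> e \<in> Ar C \<and> Dom C e = Cod C f \<and>
     Cmp C e f = Zero C (Dom C f) (Cod C e) \<and>
     (\<forall>B. \<forall>g \<in> Hom C (Cod C f) B. Cmp C g f = Zero C (Dom C f) B \<longrightarrow>
        (\<exists>!h. h \<in> Hom C (Cod C e) B \<and> Cmp C h e = g))"

locale abelian_category = lin_category +
  assumes direct_sums: "(\<And>r. r < n \<Longrightarrow> S r \<in> Ob C) \<Longrightarrow> \<exists>A i p. direct_sum C A n S i p"
    and kernels: "f \<in> Ar C \<Longrightarrow> \<exists>m. is_ker C f m"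
    and cokernels: "f \<in> Ar C \<Longrightarrow> \<exists>e. is_coker C f e"
    and mono_normal: "mono_ar C m \<Longrightarrow> \<exists>f. is_ker C f m"
    and epi_normal: "epi_ar C e \<Longrightarrow> \<exists>f. is_coker C f e"

locale finite_semisimple_category = abelian_category +
  assumes finite_dim: "\<lbrakk>A \<in> Ob C; B \<in> Ob C\<rbrakk> \<Longrightarrow> fin_dim_hom C A B"
    and semisimple: "A \<in> Ob C \<Longrightarrow>
      \<exists>n S i p. direct_sum C A n S i p \<and> (\<forall>r < n. simple_ob C (S r))"
    and finitely_many_simples: "\<exists>T. finite T \<and> (\<forall>S. simple_ob C S \<longrightarrow> (\<exists>S' \<in> T. iso_obs C S S'))"


section \<open>Functors and natural transformations\<close>

record ('o, 'm, 'p, 'n) fct =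
  Fob :: "'o \<Rightarrow> 'p"
  Far :: "'m \<Rightarrow> 'n"

locale lin_functor = lin_category C + D: lin_category D
  for C :: "('o, 'm, 'k :: field, 'z) lincat_scheme" (structure)
    and D :: "('p, 'n, 'k, 'y) lincat_scheme" +
  fixes F :: "('o, 'm, 'p, 'n, 'x) fct_scheme"
  assumes Fob_Ob: "A \<in> Ob C \<Longrightarrow> Fob F A \<in> Ob D"
    and Far_Hom: "f \<in> Hom C A B \<Longrightarrow> Far F f \<in> Hom D (Fob F A) (Fob F B)"
    and Far_Id: "A \<in> Ob C \<Longrightarrow> Far F (Id C A) = Id D (Fob F A)"
    and Far_Cmp: "\<lbrakk>f \<in> Hom C A B; g \<in> Hom C B E\<rbrakk> \<Longrightarrow>
      Far F (g \<bullet> f) = Far F g \<bullet>\<^bsub>D\<^esub> Far F f"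
    and Far_Add: "\<lbrakk>f \<in> Hom C A B; g \<in> Hom C A B\<rbrakk> \<Longrightarrow>
      Far F (Add C f g) = Add D (Far F f) (Far F g)"
    and Far_Scale: "f \<in> Hom C A B \<Longrightarrow> Far F (Scale C k f) = Scale D k (Far F f)"

record ('o, 'm, 'p, 'n) ntrans =
  Src :: "('o, 'm, 'p, 'n) fct"
  Tgt :: "('o, 'm, 'p, 'n) fct"
  Cpt :: "'o \<Rightarrow> 'n"

definition natural_family :: "('o, 'm, 'z) cat_scheme \<Rightarrow> ('p, 'n, 'y) cat_scheme \<Rightarrow> ('o, 'm, 'p, 'n) ntrans \<Rightarrow> bool" where
  "natural_family C D \<eta> \<longleftrightarrow>
     (\<forall>A \<in> Ob C. Cpt \<eta> A \<in> Hom D (Fob (Src \<eta>) A) (Fob (Tgt \<eta>) A)) \<and>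
     (\<forall>A B. \<forall>f \<in> Hom C A B.
        Cmp D (Cpt \<eta> B) (Far (Src \<eta>) f) = Cmp D (Far (Tgt \<eta>) f) (Cpt \<eta> A))"


section \<open>Monoidal categories and functors\<close>

text \<open>\<open>Assoc C X Y Z\<close> goes from \<open>(X \<boxtimes> Y) \<boxtimes> Z\<close> to \<open>X \<boxtimes> (Y \<boxtimes> Z)\<close>.\<close>

record ('o, 'm, 'k) moncat = "('o, 'm, 'k) lincat" +
  Tob :: "'o \<Rightarrow> 'o \<Rightarrow> 'o" (infixr \<open>\<boxtimes>\<index>\<close> 75)
  Tar :: "'m \<Rightarrow> 'm \<Rightarrow> 'm" (infixr \<open>\<boxdot>\<index>\<close> 75)
  Unit :: "'o"
  Assoc :: "'o \<Rightarrow> 'o \<Rightarrow> 'o \<Rightarrow> 'm"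
  Lun :: "'o \<Rightarrow> 'm"
  Run :: "'o \<Rightarrow> 'm"

locale mon_category = lin_category C
  for C :: "('o, 'm, 'k :: field, 'z) moncat_scheme" (structure) +
  assumes Tob_Ob: "\<lbrakk>X \<in> Ob C; Y \<in> Ob C\<rbrakk> \<Longrightarrow> X \<boxtimes> Y \<in> Ob C"
    and Tar_Hom: "\<lbrakk>f \<in> Hom C X X'; g \<in> Hom C Y Y'\<rbrakk> \<Longrightarrow> f \<boxdot> g \<in> Hom C (X \<boxtimes> Y) (X' \<boxtimes> Y')"
    and Tar_Id: "\<lbrakk>X \<in> Ob C; Y \<in> Ob C\<rbrakk> \<Longrightarrow> Id C X \<boxdot> Id C Y = Id C (X \<boxtimes> Y)"
    and Tar_Cmp: "\<lbrakk>f \<in> Hom C X X'; f' \<in> Hom C X' X''; g \<in> Hom C Y Y'; g' \<in> Hom C Y' Y''\<rbrakk> \<Longrightarrow>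
      (f' \<bullet> f) \<boxdot> (g' \<bullet> g) = (f' \<boxdot> g') \<bullet> (f \<boxdot> g)"
    and Tar_Add_left: "\<lbrakk>f \<in> Hom C X X'; f' \<in> Hom C X X'; g \<in> Hom C Y Y'\<rbrakk> \<Longrightarrow>
      Add C f f' \<boxdot> g = Add C (f \<boxdot> g) (f' \<boxdot> g)"
    and Tar_Add_right: "\<lbrakk>f \<in> Hom C X X'; g \<in> Hom C Y Y'; g' \<in> Hom C Y Y'\<rbrakk> \<Longrightarrow>
      f \<boxdot> Add C g g' = Add C (f \<boxdot> g) (f \<boxdot> g')"
    and Tar_Scale_left: "\<lbrakk>f \<in> Hom C X X'; g \<in> Hom C Y Y'\<rbrakk> \<Longrightarrow>
      Scale C k f \<boxdot> g = Scale C k (f \<boxdot> g)"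
    and Tar_Scale_right: "\<lbrakk>f \<in> Hom C X X'; g \<in> Hom C Y Y'\<rbrakk> \<Longrightarrow>
      f \<boxdot> Scale C k g = Scale C k (f \<boxdot> g)"
    and Unit_Ob: "Unit C \<in> Ob C"
    and Assoc_Hom: "\<lbrakk>X \<in> Ob C; Y \<in> Ob C; Z \<in> Ob C\<rbrakk> \<Longrightarrow>
      Assoc C X Y Z \<in> Hom C ((X \<boxtimes> Y) \<boxtimes> Z) (X \<boxtimes> (Y \<boxtimes> Z))"
    and Assoc_iso: "\<lbrakk>X \<in> Ob C; Y \<in> Ob C; Z \<in> Ob C\<rbrakk> \<Longrightarrow> iso_ar C (Assoc C X Y Z)"
    and Assoc_natural: "\<lbrakk>f \<in> Hom C X X'; g \<in> Hom C Y Y'; h \<in> Hom C Z Z'\<rbrakk> \<Longrightarrow>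
      Assoc C X' Y' Z' \<bullet> ((f \<boxdot> g) \<boxdot> h) = (f \<boxdot> (g \<boxdot> h)) \<bullet> Assoc C X Y Z"
    and Lun_Hom: "X \<in> Ob C \<Longrightarrow> Lun C X \<in> Hom C (Unit C \<boxtimes> X) X"
    and Lun_iso: "X \<in> Ob C \<Longrightarrow> iso_ar C (Lun C X)"
    and Lun_natural: "f \<in> Hom C X Y \<Longrightarrow> Lun C Y \<bullet> (Id C (Unit C) \<boxdot> f) = f \<bullet> Lun C X"
    and Run_Hom: "X \<in> Ob C \<Longrightarrow> Run C X \<in> Hom C (X \<boxtimes> Unit C) X"
    and Run_iso: "X \<in> Ob C \<Longrightarrow> iso_ar C (Run C X)"
    and Run_natural: "f \<in> Hom C X Y \<Longrightarrow> Run C Y \<bullet> (f \<boxdot> Id C (Unit C)) = f \<bullet> Run C X"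
    and pentagon: "\<lbrakk>W \<in> Ob C; X \<in> Ob C; Y \<in> Ob C; Z \<in> Ob C\<rbrakk> \<Longrightarrow>
      Assoc C W X (Y \<boxtimes> Z) \<bullet> Assoc C (W \<boxtimes> X) Y Z =
      (Id C W \<boxdot> Assoc C X Y Z) \<bullet> Assoc C W (X \<boxtimes> Y) Z \<bullet> (Assoc C W X Y \<boxdot> Id C Z)"
    and triangle: "\<lbrakk>X \<in> Ob C; Y \<in> Ob C\<rbrakk> \<Longrightarrow>
      (Id C X \<boxdot> Lun C Y) \<bullet> Assoc C X (Unit C) Y = Run C X \<boxdot> Id C Y"

record ('o, 'm, 'p, 'n) monfct = "('o, 'm, 'p, 'n) fct" +
  Mu :: "'o \<Rightarrow> 'o \<Rightarrow> 'n"
  Eps :: "'n"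

locale mon_functor = lin_functor C D F + C: mon_category C + D: mon_category D
  for C :: "('o, 'm, 'k :: field, 'z) moncat_scheme" (structure)
    and D :: "('p, 'n, 'k, 'y) moncat_scheme"
    and F :: "('o, 'm, 'p, 'n, 'x) monfct_scheme" +
  assumes Mu_Hom: "\<lbrakk>X \<in> Ob C; Y \<in> Ob C\<rbrakk> \<Longrightarrow>
      Mu F X Y \<in> Hom D (Fob F X \<boxtimes>\<^bsub>D\<^esub> Fob F Y) (Fob F (X \<boxtimes> Y))"
    and Mu_iso: "\<lbrakk>X \<in> Ob C; Y \<in> Ob C\<rbrakk> \<Longrightarrow> iso_ar D (Mu F X Y)"
    and Mu_natural: "\<lbrakk>f \<in> Hom C X X'; g \<in> Hom C Y Y'\<rbrakk> \<Longrightarrow>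
      Far F (f \<boxdot> g) \<bullet>\<^bsub>D\<^esub> Mu F X Y = Mu F X' Y' \<bullet>\<^bsub>D\<^esub> (Far F f \<boxdot>\<^bsub>D\<^esub> Far F g)"
    and Eps_Hom: "Eps F \<in> Hom D (Unit D) (Fob F (Unit C))"
    and Eps_iso: "iso_ar D (Eps F)"
    and Mu_Assoc: "\<lbrakk>X \<in> Ob C; Y \<in> Ob C; Z \<in> Ob C\<rbrakk> \<Longrightarrow>
      Far F (Assoc C X Y Z) \<bullet>\<^bsub>D\<^esub> Mu F (X \<boxtimes> Y) Z \<bullet>\<^bsub>D\<^esub> (Mu F X Y \<boxdot>\<^bsub>D\<^esub> Id D (Fob F Z)) =
      Mu F X (Y \<boxtimes> Z) \<bullet>\<^bsub>D\<^esub> (Id D (Fob F X) \<boxdot>\<^bsub>D\<^esub> Mu F Y Z)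
        \<bullet>\<^bsub>D\<^esub> Assoc D (Fob F X) (Fob F Y) (Fob F Z)"
    and Mu_Lun: "X \<in> Ob C \<Longrightarrow>
      Far F (Lun C X) \<bullet>\<^bsub>D\<^esub> Mu F (Unit C) X \<bullet>\<^bsub>D\<^esub> (Eps F \<boxdot>\<^bsub>D\<^esub> Id D (Fob F X)) = Lun D (Fob F X)"
    and Mu_Run: "X \<in> Ob C \<Longrightarrow>
      Far F (Run C X) \<bullet>\<^bsub>D\<^esub> Mu F X (Unit C) \<bullet>\<^bsub>D\<^esub> (Id D (Fob F X) \<boxdot>\<^bsub>D\<^esub> Eps F) = Run D (Fob F X)"


section \<open>Duality, pivotal and spherical structures, fusion categories\<close>

text \<open>\<open>V\<close> is a left dual of \<open>X\<close> with annihilation \<open>a : V \<boxtimes> X \<rightarrow> \<one>\<close> and creation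
  \<open>c : \<one> \<rightarrow> X \<boxtimes> V\<close>.\<close>

definition left_dual :: "('o, 'm, 'k, 'z) moncat_scheme \<Rightarrow> 'o \<Rightarrow> 'o \<Rightarrow> 'm \<Rightarrow> 'm \<Rightarrow> bool" where
  "left_dual C X V a c \<longleftrightarrow> X \<in> Ob C \<and> V \<in> Ob C \<and>
     a \<in> Hom C (Tob C V X) (Unit C) \<and> c \<in> Hom C (Unit C) (Tob C X V) \<and>
     Run C X \<bullet>\<^bsub>C\<^esub> (Id C X \<boxdot>\<^bsub>C\<^esub> a) \<bullet>\<^bsub>C\<^esub> Assoc C X V X \<bullet>\<^bsub>C\<^esub> (c \<boxdot>\<^bsub>C\<^esub> Id C X) \<bullet>\<^bsub>C\<^esub> inv_ar C (Lun C X) = Id C X \<and>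
     Lun C V \<bullet>\<^bsub>C\<^esub> (a \<boxdot>\<^bsub>C\<^esub> Id C V) \<bullet>\<^bsub>C\<^esub> inv_ar C (Assoc C V X V) \<bullet>\<^bsub>C\<^esub> (Id C V \<boxdot>\<^bsub>C\<^esub> c) \<bullet>\<^bsub>C\<^esub> inv_ar C (Run C V) = Id C V"

text \<open>A pairing \<open>e : W \<boxtimes> X \<rightarrow> \<one>\<close> corresponds to a morphism \<open>W \<rightarrow> V\<close>, for \<open>V\<close> a left dual of
  \<open>X\<close> with creation \<open>c\<close>.\<close>

definition mate :: "('o, 'm, 'k, 'z) moncat_scheme \<Rightarrow> 'o \<Rightarrow> 'o \<Rightarrow> 'm \<Rightarrow> 'o \<Rightarrow> 'm \<Rightarrow> 'm" where
  "mate C X V c W e =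
     Lun C V \<bullet>\<^bsub>C\<^esub> (e \<boxdot>\<^bsub>C\<^esub> Id C V) \<bullet>\<^bsub>C\<^esub> inv_ar C (Assoc C W X V) \<bullet>\<^bsub>C\<^esub> (Id C W \<boxdot>\<^bsub>C\<^esub> c) \<bullet>\<^bsub>C\<^esub> inv_ar C (Run C W)"

text \<open>The dual \<open>W \<rightarrow> V\<close> of \<open>f : X \<rightarrow> Y\<close>, where \<open>(V, c)\<close> is a left dual of \<open>X\<close> and \<open>(W, a)\<close> one
  of \<open>Y\<close>.\<close>

definition dual_ar :: "('o, 'm, 'k, 'z) moncat_scheme \<Rightarrow> 'o \<Rightarrow> 'o \<Rightarrow> 'm \<Rightarrow> 'o \<Rightarrow> 'm \<Rightarrow> 'm \<Rightarrow> 'm" where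
  "dual_ar C X V c W a f = mate C X V c W (a \<bullet>\<^bsub>C\<^esub> (Id C W \<boxdot>\<^bsub>C\<^esub> f))"

record ('o, 'm, 'k) pivcat = "('o, 'm, 'k) moncat" +
  Dual :: "'o \<Rightarrow> 'o"
  Ann :: "'o \<Rightarrow> 'm"
  Cre :: "'o \<Rightarrow> 'm"
  Piv :: "'o \<Rightarrow> 'm"

abbreviation DD :: "('o, 'm, 'k, 'z) pivcat_scheme \<Rightarrow> 'o \<Rightarrow> 'o" where
  "DD C X \<equiv> Dual C (Dual C X)"

definition Dar :: "('o, 'm, 'k, 'z) pivcat_scheme \<Rightarrow> 'm \<Rightarrow> 'm" where
  "Dar C f = dual_ar C (Dom C f) (Dual C (Dom C f)) (Cre C (Dom C f))
     (Dual C (Cod C f)) (Ann C (Cod C f)) f"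

text \<open>The canonical isomorphisms \<open>Y\<^sup>\<or> \<boxtimes> X\<^sup>\<or> \<rightarrow> (X \<boxtimes> Y)\<^sup>\<or>\<close> and \<open>\<one> \<rightarrow> \<one>\<^sup>\<or>\<close>, and the monoidal structure
  \<open>X\<^sup>\<or>\<^sup>\<or> \<boxtimes> Y\<^sup>\<or>\<^sup>\<or> \<rightarrow> (X \<boxtimes> Y)\<^sup>\<or>\<^sup>\<or>\<close>, \<open>\<one> \<rightarrow> \<one>\<^sup>\<or>\<^sup>\<or>\<close> they induce on the double dual functor.\<close>

definition Dmu :: "('o, 'm, 'k, 'z) pivcat_scheme \<Rightarrow> 'o \<Rightarrow> 'o \<Rightarrow> 'm" where
  "Dmu C X Y = mate C (X \<boxtimes>\<^bsub>C\<^esub> Y) (Dual C (X \<boxtimes>\<^bsub>C\<^esub> Y)) (Cre C (X \<boxtimes>\<^bsub>C\<^esub> Y)) (Dual C Y \<boxtimes>\<^bsub>C\<^esub> Dual C X)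
     (Ann C Y \<bullet>\<^bsub>C\<^esub> (Id C (Dual C Y) \<boxdot>\<^bsub>C\<^esub> Lun C Y) \<bullet>\<^bsub>C\<^esub> (Id C (Dual C Y) \<boxdot>\<^bsub>C\<^esub> (Ann C X \<boxdot>\<^bsub>C\<^esub> Id C Y))
       \<bullet>\<^bsub>C\<^esub> (Id C (Dual C Y) \<boxdot>\<^bsub>C\<^esub> inv_ar C (Assoc C (Dual C X) X Y))
       \<bullet>\<^bsub>C\<^esub> Assoc C (Dual C Y) (Dual C X) (X \<boxtimes>\<^bsub>C\<^esub> Y))"

definition Deps :: "('o, 'm, 'k, 'z) pivcat_scheme \<Rightarrow> 'm" where
  "Deps C = mate C (Unit C) (Dual C (Unit C)) (Cre C (Unit C)) (Unit C) (Lun C (Unit C))"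

definition DDmu :: "('o, 'm, 'k, 'z) pivcat_scheme \<Rightarrow> 'o \<Rightarrow> 'o \<Rightarrow> 'm" where
  "DDmu C X Y = Dar C (inv_ar C (Dmu C X Y)) \<bullet>\<^bsub>C\<^esub> Dmu C (Dual C Y) (Dual C X)"

definition DDeps :: "('o, 'm, 'k, 'z) pivcat_scheme \<Rightarrow> 'm" where
  "DDeps C = Dar C (inv_ar C (Deps C)) \<bullet>\<^bsub>C\<^esub> Deps C"

locale rigid_category = mon_category C
  for C :: "('o, 'm, 'k :: field, 'z) pivcat_scheme" (structure) +
  assumes left_duals: "X \<in> Ob C \<Longrightarrow> left_dual C X (Dual C X) (Ann C X) (Cre C X)"
    and right_duals: "X \<in> Ob C \<Longrightarrow> \<exists>V a c. left_dual C V X a c"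

locale pivotal_category = rigid_category +
  assumes Piv_Hom: "X \<in> Ob C \<Longrightarrow> Piv C X \<in> Hom C X (DD C X)"
    and Piv_iso: "X \<in> Ob C \<Longrightarrow> iso_ar C (Piv C X)"
    and Piv_natural: "f \<in> Hom C X Y \<Longrightarrow> Piv C Y \<bullet> f = Dar C (Dar C f) \<bullet> Piv C X"
    and Piv_tensor: "\<lbrakk>X \<in> Ob C; Y \<in> Ob C\<rbrakk> \<Longrightarrow>
      Piv C (X \<boxtimes> Y) = DDmu C X Y \<bullet> (Piv C X \<boxdot> Piv C Y)"
    and Piv_unit: "Piv C (Unit C) = DDeps C"

definition rtrace :: "('o, 'm, 'k, 'z) pivcat_scheme \<Rightarrow> 'o \<Rightarrow> 'm \<Rightarrow> 'm" where
  "rtrace C X f = Ann C (Dual C X) \<bullet>\<^bsub>C\<^esub> ((Piv C X \<bullet>\<^bsub>C\<^esub> f) \<boxdot>\<^bsub>C\<^esub> Id C (Dual C X)) \<bullet>\<^bsub>C\<^esub> Cre C X"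

definition ltrace :: "('o, 'm, 'k, 'z) pivcat_scheme \<Rightarrow> 'o \<Rightarrow> 'm \<Rightarrow> 'm" where
  "ltrace C X f =
     Ann C X \<bullet>\<^bsub>C\<^esub> (Id C (Dual C X) \<boxdot>\<^bsub>C\<^esub> (f \<bullet>\<^bsub>C\<^esub> inv_ar C (Piv C X))) \<bullet>\<^bsub>C\<^esub> Cre C (Dual C X)"

locale spherical_category = pivotal_category +
  assumes spherical: "f \<in> Hom C X X \<Longrightarrow> ltrace C X f = rtrace C X f"

locale fusion_category = rigid_category + finite_semisimple_category +
  assumes simple_unit: "simple_ob C (Unit C)"

locale spherical_fusion_category = fusion_category + spherical_category


section \<open>Module categories\<close>

text \<open>Functors and families of morphisms are extensional, so that equality of
  endofunctors and of natural transformations is equality of records.\<close>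

definition endofunctor :: "('p, 'n, 'k :: field, 'z) lincat_scheme \<Rightarrow> ('p, 'n, 'p, 'n) fct \<Rightarrow> bool" where
  "endofunctor B G \<longleftrightarrow> lin_functor B B G \<and> Fob G \<in> extensional (Ob B) \<and> Far G \<in> extensional (Ar B)"

definition id_fct :: "('p, 'n, 'z) cat_scheme \<Rightarrow> ('p, 'n, 'p, 'n) fct" where
  "id_fct B = \<lparr>Fob = (\<lambda>b \<in> Ob B. b), Far = (\<lambda>f \<in> Ar B. f)\<rparr>"

definition comp_fct :: "('p, 'n, 'z) cat_scheme \<Rightarrow>
    ('p, 'n, 'p, 'n) fct \<Rightarrow> ('p, 'n, 'p, 'n) fct \<Rightarrow> ('p, 'n, 'p, 'n) fct" where
  "comp_fct B G H = \<lparr>Fob = (\<lambda>b \<in> Ob B. Fob G (Fob H b)), Far = (\<lambda>f \<in> Ar B. Far G (Far H f))\<rparr>"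

definition id_nat :: "('p, 'n, 'z) cat_scheme \<Rightarrow> ('p, 'n, 'p, 'n) fct \<Rightarrow> ('p, 'n, 'p, 'n) ntrans" where
  "id_nat B G = \<lparr>Src = G, Tgt = G, Cpt = (\<lambda>b \<in> Ob B. Id B (Fob G b))\<rparr>"

text \<open>The strict monoidal category of linear endofunctors of \<open>B\<close>.\<close>

definition End_cat :: "('p, 'n, 'k :: field, 'z) lincat_scheme \<Rightarrow>
    (('p, 'n, 'p, 'n) fct, ('p, 'n, 'p, 'n) ntrans, 'k) moncat" where
  "End_cat B = \<lparr>
     Ob = {G. endofunctor B G},
     Ar = {\<eta>. endofunctor B (Src \<eta>) \<and> endofunctor B (Tgt \<eta>) \<and> natural_family B B \<eta> \<and>
              Cpt \<eta> \<in> extensional (Ob B)},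
     Dom = Src,
     Cod = Tgt,
     Id = id_nat B,
     Cmp = (\<lambda>\<eta> \<theta>. \<lparr>Src = Src \<theta>, Tgt = Tgt \<eta>, Cpt = (\<lambda>b \<in> Ob B. Cpt \<eta> b \<bullet>\<^bsub>B\<^esub> Cpt \<theta> b)\<rparr>),
     Zero = (\<lambda>G H. \<lparr>Src = G, Tgt = H, Cpt = (\<lambda>b \<in> Ob B. Zero B (Fob G b) (Fob H b))\<rparr>),
     Add = (\<lambda>\<eta> \<theta>. \<lparr>Src = Src \<eta>, Tgt = Tgt \<eta>, Cpt = (\<lambda>b \<in> Ob B. Add B (Cpt \<eta> b) (Cpt \<theta> b))\<rparr>),
     Scale = (\<lambda>k \<eta>. \<lparr>Src = Src \<eta>, Tgt = Tgt \<eta>, Cpt = (\<lambda>b \<in> Ob B. Scale B k (Cpt \<eta> b))\<rparr>),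
     Tob = comp_fct B,
     Tar = (\<lambda>\<eta> \<theta>. \<lparr>Src = comp_fct B (Src \<eta>) (Src \<theta>), Tgt = comp_fct B (Tgt \<eta>) (Tgt \<theta>),
              Cpt = (\<lambda>b \<in> Ob B. Cpt \<eta> (Fob (Tgt \<theta>) b) \<bullet>\<^bsub>B\<^esub> Far (Src \<eta>) (Cpt \<theta> b))\<rparr>),
     Unit = id_fct B,
     Assoc = (\<lambda>F G H. id_nat B (comp_fct B F (comp_fct B G H))),
     Lun = id_nat B,
     Run = id_nat B\<rparr>"

type_synonym ('o, 'm, 'p, 'n) module_functor =
  "('o, 'm, ('p, 'n, 'p, 'n) fct, ('p, 'n, 'p, 'n) ntrans) monfct"

text \<open>The duality morphisms exhibiting \<open>M (X\<^sup>\<or>)\<close> as the left dual of \<open>M X\<close> in a monoidal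
  category \<open>D\<close>; this is how \<open>M (X\<^sup>\<or>)\<close> is identified with \<open>(M X)\<^sup>\<or>\<close>.\<close>

definition AnnM :: "('o, 'm, 'k, 'z) pivcat_scheme \<Rightarrow> ('p, 'n, 'k, 'y) moncat_scheme \<Rightarrow>
    ('o, 'm, 'p, 'n, 'x) monfct_scheme \<Rightarrow> 'o \<Rightarrow> 'n" where
  "AnnM C D M X = inv_ar D (Eps M) \<bullet>\<^bsub>D\<^esub> Far M (Ann C X) \<bullet>\<^bsub>D\<^esub> Mu M (Dual C X) X"

definition CreM :: "('o, 'm, 'k, 'z) pivcat_scheme \<Rightarrow> ('p, 'n, 'k, 'y) moncat_scheme \<Rightarrow>
    ('o, 'm, 'p, 'n, 'x) monfct_scheme \<Rightarrow> 'o \<Rightarrow> 'n" where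
  "CreM C D M X = inv_ar D (Mu M X (Dual C X)) \<bullet>\<^bsub>D\<^esub> Far M (Cre C X) \<bullet>\<^bsub>D\<^esub> Eps M"

text \<open>The dual \<open>(M Y)\<^sup>\<or> \<rightarrow> (M X)\<^sup>\<or>\<close> of an arbitrary \<open>\<alpha> : M X \<rightarrow> M Y\<close>.\<close>

definition DarM :: "('o, 'm, 'k, 'z) pivcat_scheme \<Rightarrow> ('p, 'n, 'k, 'y) moncat_scheme \<Rightarrow>
    ('o, 'm, 'p, 'n, 'x) monfct_scheme \<Rightarrow> 'o \<Rightarrow> 'o \<Rightarrow> 'n \<Rightarrow> 'n" where
  "DarM C D M X Y \<alpha> = dual_ar D (Fob M X) (Fob M (Dual C X)) (CreM C D M X)
     (Fob M (Dual C Y)) (AnnM C D M Y) \<alpha>"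

locale module_category = C: mon_category C + B: lin_category B + mon_functor C "End_cat B" M
  for C :: "('o, 'm, 'k :: field, 'z) pivcat_scheme"
    and B :: "('p, 'n, 'k, 'y) lincat_scheme"
    and M :: "('o, 'm, 'p, 'n) module_functor"

locale finite_pivotal_module_category = module_category C B M +
    C: pivotal_category C + B: finite_semisimple_category B
  for C :: "('o, 'm, 'k :: field, 'z) pivcat_scheme"
    and B :: "('p, 'n, 'k, 'y) lincat_scheme"
    and M :: "('o, 'm, 'p, 'n) module_functor" +
  assumes pivotal: "\<lbrakk>X \<in> Ob C; Y \<in> Ob C; \<alpha> \<in> Hom (End_cat B) (Fob M X) (Fob M Y)\<rbrakk> \<Longrightarrow>
    Far M (Piv C Y) \<bullet>\<^bsub>End_cat B\<^esub> \<alpha> =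
    DarM C (End_cat B) M (Dual C Y) (Dual C X) (DarM C (End_cat B) M X Y \<alpha>) \<bullet>\<^bsub>End_cat B\<^esub> Far M (Piv C X)"


section \<open>Grothendieck groups and extension of scalars\<close>

definition presented_group :: "'a set \<Rightarrow> ('a \<Rightarrow>\<^sub>0 int) set \<Rightarrow> ('a \<Rightarrow>\<^sub>0 int) set monoid" where
  "presented_group S R = free_Abelian_group S Mod generate (free_Abelian_group S) R"

definition coset_of :: "'a set \<Rightarrow> ('a \<Rightarrow>\<^sub>0 int) set \<Rightarrow> ('a \<Rightarrow>\<^sub>0 int) \<Rightarrow> ('a \<Rightarrow>\<^sub>0 int) set" where
  "coset_of S R a = generate (free_Abelian_group S) R #>\<^bsub>free_Abelian_group S\<^esub> a"

text \<open>The biadditive map into \<open>presented_group S R\<close> induced by a map \<open>m\<close> on generators.\<close>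

definition quot_bilin :: "'c set \<Rightarrow> ('c \<Rightarrow>\<^sub>0 int) set \<Rightarrow> ('a \<Rightarrow> 'b \<Rightarrow> 'c) \<Rightarrow>
    ('a \<Rightarrow>\<^sub>0 int) set \<Rightarrow> ('b \<Rightarrow>\<^sub>0 int) set \<Rightarrow> ('c \<Rightarrow>\<^sub>0 int) set" where
  "quot_bilin S R m U V = (\<Union>a \<in> U. \<Union>b \<in> V.
     coset_of S R (frag_extend (\<lambda>x. frag_extend (\<lambda>y. frag_of (m x y)) b) a))"

text \<open>The additive map from a presented group into a vector space \<open>V\<close> induced by a map
  \<open>f\<close> on generators; it is constant on the elements of a coset \<open>U\<close>.\<close>

definition quot_lin :: "('k :: field, 'v) module \<Rightarrow> ('a \<Rightarrow> 'v) \<Rightarrow> ('a \<Rightarrow>\<^sub>0 int) set \<Rightarrow> 'v" where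
  "quot_lin V f U = the_elem ((\<lambda>a. finsum V
     (\<lambda>x. of_int (Poly_Mapping.lookup a x) \<odot>\<^bsub>V\<^esub> f x) (Poly_Mapping.keys a)) ` U)"

definition short_exact :: "('o, 'm, 'k, 'z) lincat_scheme \<Rightarrow> 'm \<Rightarrow> 'm \<Rightarrow> bool" where
  "short_exact C f g \<longleftrightarrow> is_ker C g f \<and> is_coker C f g"

definition K0_rels :: "('o, 'm, 'k, 'z) lincat_scheme \<Rightarrow> ('o \<Rightarrow>\<^sub>0 int) set" where
  "K0_rels C = {frag_of (Cod C f) - frag_of (Dom C f) - frag_of (Cod C g) | f g. short_exact C f g}"

definition K0 :: "('o, 'm, 'k, 'z) lincat_scheme \<Rightarrow> ('o \<Rightarrow>\<^sub>0 int) set monoid" where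
  "K0 C = presented_group (Ob C) (K0_rels C)"

definition K0_class :: "('o, 'm, 'k, 'z) lincat_scheme \<Rightarrow> 'o \<Rightarrow> ('o \<Rightarrow>\<^sub>0 int) set" where
  "K0_class C X = coset_of (Ob C) (K0_rels C) (frag_of X)"

definition K0_mult :: "('o, 'm, 'k, 'z) moncat_scheme \<Rightarrow>
    ('o \<Rightarrow>\<^sub>0 int) set \<Rightarrow> ('o \<Rightarrow>\<^sub>0 int) set \<Rightarrow> ('o \<Rightarrow>\<^sub>0 int) set" where
  "K0_mult C = quot_bilin (Ob C) (K0_rels C) (Tob C)"

text \<open>The tensor product over the integers of an abelian group \<open>G\<close>, written multiplicatively,
  with the additive group of the field \<^typ>\<open>'k\<close>.\<close>

definition tensor_gens :: "('g, 'z) monoid_scheme \<Rightarrow> ('g \<times> 'k) set" where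
  "tensor_gens G = carrier G \<times> UNIV"

definition tensor_rels :: "('g, 'z) monoid_scheme \<Rightarrow> ('g \<times> 'k :: field \<Rightarrow>\<^sub>0 int) set" where
  "tensor_rels G =
     {frag_of (g \<otimes>\<^bsub>G\<^esub> h, k) - frag_of (g, k) - frag_of (h, k) | g h k. g \<in> carrier G \<and> h \<in> carrier G} \<union>
     {frag_of (g, k + l) - frag_of (g, k) - frag_of (g, l) | g k l. g \<in> carrier G}"

definition tensor_field :: "('g, 'z) monoid_scheme \<Rightarrow> ('g \<times> 'k :: field \<Rightarrow>\<^sub>0 int) set monoid" where
  "tensor_field G = presented_group (tensor_gens G) (tensor_rels G)"

type_synonym ('o, 'k) K0_field = "(('o \<Rightarrow>\<^sub>0 int) set \<times> 'k \<Rightarrow>\<^sub>0 int) set"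

text \<open>\<open>(g \<otimes> k) (h \<otimes> l) = g h \<otimes> k l\<close>\<close>

definition fusion_algebra :: "('o, 'm, 'k :: field, 'z) moncat_scheme \<Rightarrow> ('o, 'k) K0_field ring" where
  "fusion_algebra C = \<lparr>
     carrier = carrier (tensor_field (K0 C)),
     monoid.mult = quot_bilin (tensor_gens (K0 C)) (tensor_rels (K0 C))
       (\<lambda>(g, k) (h, l). (K0_mult C g h, k * l)),
     monoid.one = coset_of (tensor_gens (K0 C)) (tensor_rels (K0 C)) (frag_of (K0_class C (Unit C), 1)),
     ring.zero = \<one>\<^bsub>tensor_field (K0 C)\<^esub>,
     ring.add = monoid.mult (tensor_field (K0 C))\<rparr>"


section \<open>The NIM-rep and the encircling module\<close>

text \<open>Left modules over a not necessarily commutative ring; the library's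
  \<^locale>\<open>module\<close> requires a commutative one.\<close>

locale left_module = R?: ring R + M?: abelian_group M
  for R :: "('a, 'r) ring_scheme" (structure) and M :: "('a, 'b, 's) module_scheme" (structure) +
  assumes smult_closed: "\<lbrakk>a \<in> carrier R; x \<in> carrier M\<rbrakk> \<Longrightarrow> a \<odot>\<^bsub>M\<^esub> x \<in> carrier M"
    and smult_l_distr: "\<lbrakk>a \<in> carrier R; b \<in> carrier R; x \<in> carrier M\<rbrakk> \<Longrightarrow>
      (a \<oplus>\<^bsub>R\<^esub> b) \<odot>\<^bsub>M\<^esub> x = a \<odot>\<^bsub>M\<^esub> x \<oplus>\<^bsub>M\<^esub> b \<odot>\<^bsub>M\<^esub> x"
    and smult_r_distr: "\<lbrakk>a \<in> carrier R; x \<in> carrier M; y \<in> carrier M\<rbrakk> \<Longrightarrow>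
      a \<odot>\<^bsub>M\<^esub> (x \<oplus>\<^bsub>M\<^esub> y) = a \<odot>\<^bsub>M\<^esub> x \<oplus>\<^bsub>M\<^esub> a \<odot>\<^bsub>M\<^esub> y"
    and smult_assoc: "\<lbrakk>a \<in> carrier R; b \<in> carrier R; x \<in> carrier M\<rbrakk> \<Longrightarrow>
      (a \<otimes>\<^bsub>R\<^esub> b) \<odot>\<^bsub>M\<^esub> x = a \<odot>\<^bsub>M\<^esub> (b \<odot>\<^bsub>M\<^esub> x)"
    and smult_one: "x \<in> carrier M \<Longrightarrow> \<one>\<^bsub>R\<^esub> \<odot>\<^bsub>M\<^esub> x = x"

definition left_modules_iso :: "('a, 'r) ring_scheme \<Rightarrow> ('a, 'b, 's) module_scheme \<Rightarrow> ('a, 'c, 't) module_scheme \<Rightarrow> bool" where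
  "left_modules_iso R M N \<longleftrightarrow> left_module R M \<and> left_module R N \<and>
     (\<exists>\<phi>. bij_betw \<phi> (carrier M) (carrier N) \<and>
        (\<forall>x \<in> carrier M. \<forall>y \<in> carrier M. \<phi> (x \<oplus>\<^bsub>M\<^esub> y) = \<phi> x \<oplus>\<^bsub>N\<^esub> \<phi> y) \<and>
        (\<forall>a \<in> carrier R. \<forall>x \<in> carrier M. \<phi> (a \<odot>\<^bsub>M\<^esub> x) = a \<odot>\<^bsub>N\<^esub> \<phi> x))"

text \<open>\<open>[X] \<cdot> [b] = [M X b]\<close>\<close>

definition K0_action :: "('p, 'n, 'k, 'y) lincat_scheme \<Rightarrow> ('o, 'm, 'p, 'n) module_functor \<Rightarrow>
    ('o \<Rightarrow>\<^sub>0 int) set \<Rightarrow> ('p \<Rightarrow>\<^sub>0 int) set \<Rightarrow> ('p \<Rightarrow>\<^sub>0 int) set" where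
  "K0_action B M = quot_bilin (Ob B) (K0_rels B) (\<lambda>X b. Fob (Fob M X) b)"

definition NIM_rep :: "('p, 'n, 'k :: field, 'y) lincat_scheme \<Rightarrow> ('o, 'm, 'p, 'n) module_functor \<Rightarrow>
    (('o, 'k) K0_field, ('p, 'k) K0_field) module" where
  "NIM_rep B M = \<lparr>
     carrier = carrier (tensor_field (K0 B)),
     monoid.mult = undefined,
     monoid.one = undefined,
     ring.zero = \<one>\<^bsub>tensor_field (K0 B)\<^esub>,
     ring.add = monoid.mult (tensor_field (K0 B)),
     module.smult = quot_bilin (tensor_gens (K0 B)) (tensor_rels (K0 B))
       (\<lambda>(g, k) (n, l). (K0_action B M g n, k * l))\<rparr>"

text \<open>Since \<^const>\<open>End_cat\<close> is strict, \<open>M (p X) \<otimes> \<alpha>\<close> is a morphism from \<open>M X\<close> to \<open>M (X\<^sup>\<or>\<^sup>\<or>)\<close>.\<close>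

definition encircle :: "('o, 'm, 'k :: field, 'z) pivcat_scheme \<Rightarrow> ('p, 'n, 'k, 'y) lincat_scheme \<Rightarrow>
    ('o, 'm, 'p, 'n) module_functor \<Rightarrow> 'o \<Rightarrow> ('p, 'n, 'p, 'n) ntrans \<Rightarrow> ('p, 'n, 'p, 'n) ntrans" where
  "encircle C B M X \<alpha> = (let D = End_cat B in
     AnnM C D M (Dual C X)
       \<bullet>\<^bsub>D\<^esub> ((Far M (Piv C X) \<boxdot>\<^bsub>D\<^esub> \<alpha>) \<boxdot>\<^bsub>D\<^esub> Id D (Fob M (Dual C X)))
       \<bullet>\<^bsub>D\<^esub> CreM C D M X)"

text \<open>\<open>([X] \<otimes> k) \<cdot> \<alpha> = k (X \<cdot> \<alpha>)\<close>\<close>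

definition encircling_module :: "('o, 'm, 'k :: field, 'z) pivcat_scheme \<Rightarrow> ('p, 'n, 'k, 'y) lincat_scheme \<Rightarrow>
    ('o, 'm, 'p, 'n) module_functor \<Rightarrow> (('o, 'k) K0_field, ('p, 'n, 'p, 'n) ntrans) module" where
  "encircling_module C B M = (let E = hom_space (End_cat B) (id_fct B) (id_fct B) in \<lparr>
     carrier = carrier E,
     monoid.mult = undefined,
     monoid.one = undefined,
     ring.zero = \<zero>\<^bsub>E\<^esub>,
     ring.add = ring.add E,
     module.smult = (\<lambda>a \<alpha>. quot_lin E
       (\<lambda>(g, k). k \<odot>\<^bsub>E\<^esub> quot_lin E (\<lambda>X. encircle C B M X \<alpha>) g) a)\<rparr>)"

end

theory Submission
  imports Defs
begin

text \<open>Let \<open>I\<close> represent the isomorphism classes of simple objects of \<open>B\<close>. Multiplicities identify the NIM-rep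
  with \<open>K\<^sup>I\<close>, an object \<open>X\<close> acting by the matrix whose entries are the multiplicities \<open>n i j\<close> of \<open>i\<close> in \<open>M X j\<close>.
  An endotransformation of the identity is given by its scalars on \<open>I\<close>, so the encircling module
  is \<open>K\<^sup>I\<close> as well, and \<open>X\<close> acts by the matrix with entries \<open>n i j * \<lambda> i j\<close>, where \<open>\<lambda> i j\<close> is the trace at \<open>i\<close>
  of an idempotent of the functor \<open>M X\<close> that projects onto one copy of \<open>i\<close> in \<open>M X j\<close>.
  Since the module category is pivotal, this trace is cyclic, also on natural transformations that do not come
  from \<open>C\<close>; so \<open>\<lambda> i j\<close> depends neither on the idempotent nor on \<open>X\<close>. Monoidality of the pivotal structure gives
  \<open>\<lambda> i k = \<lambda> i j * \<lambda> j k\<close> and \<open>\<lambda> i i = 1\<close>. Hence \<open>\<lambda> i j = d j / d i\<close> for some nonzero \<open>d\<close>, and rescaling the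
  coordinates by \<open>d\<close> turns one action into the other.\<close>

section \<open>Categories\<close>

text \<open>Nothing is known beforehand about how encircling depends on \<open>X\<close>. That it is
  additive on exact sequences, hence defined on the Grothendieck group, and that it is an action at
  all, is read off from the matrix entries \<open>n i j * \<lambda> i j\<close>: the
  \<open>n i j\<close> have these properties, and the \<open>\<lambda> i j\<close> do not depend on
  \<open>X\<close>. This independence needs transformations that exist because \<open>B\<close> is
  semisimple: a natural transformation may be prescribed freely on the simple objects, so an
  idempotent can be concentrated at a single \<open>j\<close>, and two such idempotents, for
  different \<open>X\<close>, are cyclic rearrangements of each other. That \<open>d\<close> never
  vanishes comes from duals: if \<open>i\<close> occurs in \<open>X j\<close>, then \<open>j\<close>
  occurs in the dual of \<open>X\<close> applied to \<open>i\<close>, so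
  \<open>\<lambda> i j * \<lambda> j i = \<lambda> i i = 1\<close>. Monoidality of the pivotal
  structure is stated through the inverse of the comparison between the dual of a product and the
  reversed product of the duals; its invertibility has to be proved, and follows from uniqueness of
  adjoints. The ring laws of the fusion algebra also have to be proved; they come from the action of
  \<open>C\<close> on itself.\<close>

lemma Hom_iff: "f \<in> Hom C A B \<longleftrightarrow> f \<in> Ar C \<and> Dom C f = A \<and> Cod C f = B"
  by (auto simp: Hom_def)

context category
begin

lemma HomD: "f \<in> Hom C A B \<Longrightarrow> f \<in> Ar C" "f \<in> Hom C A B \<Longrightarrow> Dom C f = A"
  "f \<in> Hom C A B \<Longrightarrow> Cod C f = B"
  "f \<in> Hom C A B \<Longrightarrow> A \<in> Ob C" "f \<in> Hom C A B \<Longrightarrow> B \<in> Ob C"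
  using Dom_Ob Cod_Ob by (auto simp: Hom_iff)

lemma Dom_Cod_Ob [simp]: "f \<in> Ar C \<Longrightarrow> Dom C f \<in> Ob C" "f \<in> Ar C \<Longrightarrow> Cod C f \<in> Ob C"
  by (auto simp: Dom_Ob Cod_Ob)

lemma Id_simps [simp]: assumes "A \<in> Ob C"
  shows "Id C A \<in> Ar C" "Dom C (Id C A) = A" "Cod C (Id C A) = A"
  using Id_Hom[OF assms] by (auto simp: Hom_iff)

lemma Cmp_simps [simp]: assumes "f \<in> Ar C" "g \<in> Ar C" "Dom C g = Cod C f"
  shows "g \<bullet> f \<in> Ar C" "Dom C (g \<bullet> f) = Dom C f" "Cod C (g \<bullet> f) = Cod C g"
  using Cmp_Hom[of f "Dom C f" "Cod C f" g "Cod C g"] assms by (auto simp: Hom_iff)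

lemma Cmp_assoc_simp [simp]:
  "\<lbrakk>f \<in> Ar C; g \<in> Ar C; h \<in> Ar C; Dom C g = Cod C f; Dom C h = Cod C g\<rbrakk> \<Longrightarrow>
    (h \<bullet> g) \<bullet> f = h \<bullet> (g \<bullet> f)"
  using Cmp_assoc by (auto simp: Hom_iff)

lemma Cmp_Id_simps [simp]:
  "\<lbrakk>f \<in> Ar C; Cod C f = A\<rbrakk> \<Longrightarrow> Id C A \<bullet> f = f"
  "\<lbrakk>f \<in> Ar C; Dom C f = A\<rbrakk> \<Longrightarrow> f \<bullet> Id C A = f"
  using Cmp_Id_left Cmp_Id_right by (auto simp: Hom_iff)

text \<open>The simplifier brackets composites to the right, so an equation
  \<open>g \<bullet> f = k\<close> no longer matches inside
  \<open>g \<bullet> (f \<bullet> h)\<close>. This version turns it into a rewrite rule for that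
  position.\<close>

lemma Cmp_reduce: assumes "g \<bullet> f = k" "h \<in> Ar C" "f \<in> Ar C" "g \<in> Ar C"
  "Dom C g = Cod C f" "Dom C f = Cod C h"
  shows "g \<bullet> (f \<bullet> h) = k \<bullet> h"
  using assms by (metis Cmp_assoc_simp)

lemma inverse_ars_unique:
  assumes "inverse_ars C f g" "inverse_ars C f h" shows "g = h"
proof -
  have *: "f \<in> Ar C" "g \<in> Ar C" "h \<in> Ar C" "Dom C g = Cod C f" "Cod C g = Dom C f"
    "Dom C h = Cod C f" "Cod C h = Dom C f" "g \<bullet> f = Id C (Dom C f)" "f \<bullet> h = Id C (Cod C f)"
    using assms by (auto simp: inverse_ars_def Hom_iff)
  have "g = g \<bullet> (f \<bullet> h)" using * by simp
  also have "\<dots> = (g \<bullet> f) \<bullet> h" by (rule Cmp_assoc_simp[symmetric]) (use * in auto)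
  also have "\<dots> = h" using * by simp
  finally show ?thesis .
qed

lemma inv_ar_eq: "inverse_ars C f g \<Longrightarrow> inv_ar C f = g"
  unfolding inv_ar_def using inverse_ars_unique by blast

lemma inverse_inv_ar: "iso_ar C f \<Longrightarrow> inverse_ars C f (inv_ar C f)"
  using inv_ar_eq by (auto simp: iso_ar_def)

lemma iso_simps [simp]: assumes "iso_ar C f"
  shows "f \<in> Ar C" "inv_ar C f \<in> Ar C" "Dom C (inv_ar C f) = Cod C f" "Cod C (inv_ar C f) = Dom C f"
    "inv_ar C f \<bullet> f = Id C (Dom C f)" "f \<bullet> inv_ar C f = Id C (Cod C f)"
  using inverse_inv_ar[OF assms] by (auto simp: inverse_ars_def Hom_iff)

lemma iso_cancel_simps [simp]: assumes "iso_ar C f"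
  shows "\<lbrakk>h \<in> Ar C; Cod C h = Dom C f\<rbrakk> \<Longrightarrow> inv_ar C f \<bullet> (f \<bullet> h) = h"
    "\<lbrakk>h \<in> Ar C; Cod C h = Cod C f\<rbrakk> \<Longrightarrow> f \<bullet> (inv_ar C f \<bullet> h) = h"
  using assms by (simp_all add: Cmp_reduce[where k = "Id C _"])

lemma iso_arI: "\<lbrakk>f \<in> Ar C; g \<in> Ar C; Dom C g = Cod C f; Cod C g = Dom C f;
    g \<bullet> f = Id C (Dom C f); f \<bullet> g = Id C (Cod C f)\<rbrakk> \<Longrightarrow> iso_ar C f"
  unfolding iso_ar_def inverse_ars_def Hom_iff by blast

lemma inv_arI: "\<lbrakk>f \<in> Ar C; g \<in> Ar C; Dom C g = Cod C f; Cod C g = Dom C f;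
    g \<bullet> f = Id C (Dom C f); f \<bullet> g = Id C (Cod C f)\<rbrakk> \<Longrightarrow> inv_ar C f = g"
  by (rule inv_ar_eq) (simp add: inverse_ars_def Hom_iff)

lemma iso_Id [simp]: "A \<in> Ob C \<Longrightarrow> iso_ar C (Id C A)" "A \<in> Ob C \<Longrightarrow> inv_ar C (Id C A) = Id C A"
  by (auto intro!: iso_arI[where g = "Id C A"] inv_arI)

lemma iso_inv [simp]: "iso_ar C f \<Longrightarrow> iso_ar C (inv_ar C f)"
  by (rule iso_arI[where g = f]) auto

lemma iso_Cmp [simp]: assumes "iso_ar C f" "iso_ar C g" "Dom C g = Cod C f"
  shows "iso_ar C (g \<bullet> f)" "inv_ar C (g \<bullet> f) = inv_ar C f \<bullet> inv_ar C g"
  using assms by (auto intro!: iso_arI[where g = "inv_ar C f \<bullet> inv_ar C g"] inv_arI)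

lemma epi_cancel: assumes "iso_ar C e" "g \<bullet> e = h \<bullet> e" "g \<in> Ar C" "h \<in> Ar C"
    "Dom C g = Cod C e" "Dom C h = Cod C e"
  shows "g = h"
proof -
  have "g = (g \<bullet> e) \<bullet> inv_ar C e" using assms(1,3,5) by simp
  also have "\<dots> = (h \<bullet> e) \<bullet> inv_ar C e" by (simp only: assms(2))
  also have "\<dots> = h" using assms(1,4,6) by simp
  finally show ?thesis .
qed

lemma mono_cancel: assumes "iso_ar C e" "e \<bullet> g = e \<bullet> h" "g \<in> Ar C" "h \<in> Ar C"
    "Cod C g = Dom C e" "Cod C h = Dom C e"
  shows "g = h"
proof -
  have "g = inv_ar C e \<bullet> (e \<bullet> g)" using assms(1,3,5) by simp
  also have "\<dots> = inv_ar C e \<bullet> (e \<bullet> h)" by (simp only: assms(2))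
  also have "\<dots> = h" using assms(1,4,6) by simp
  finally show ?thesis .
qed

lemma iso_moveL: assumes "iso_ar C e" "e \<bullet> g = h" "g \<in> Ar C" "Cod C g = Dom C e"
  shows "g = inv_ar C e \<bullet> h"
  using assms by auto

lemma iso_moveR: assumes "iso_ar C e" "g \<bullet> e = h" "g \<in> Ar C" "Dom C g = Cod C e"
  shows "g = h \<bullet> inv_ar C e"
  using assms by auto

lemma iso_obs_sym: "iso_obs C A B \<Longrightarrow> iso_obs C B A"
  unfolding iso_obs_def by (metis Hom_iff iso_inv iso_simps(2,3,4))

lemma iso_obs_trans: "iso_obs C A B \<Longrightarrow> iso_obs C B D \<Longrightarrow> iso_obs C A D"
  unfolding iso_obs_def by (metis (lifting) Hom_iff iso_Cmp(1) Cmp_simps)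

lemma iso_obsI: "f \<in> Hom C A B \<Longrightarrow> iso_ar C f \<Longrightarrow> iso_obs C A B"
  by (auto simp: iso_obs_def)

end

section \<open>Linear categories\<close>

text \<open>The finite sums of \<open>direct_sum\<close> as a function of their length, so that they
  can be treated by induction on \<open>n\<close> without opening the module of morphisms each
  time.\<close>

definition hsum :: "('o, 'm, 'k :: field, 'z) lincat_scheme \<Rightarrow> 'o \<Rightarrow> 'o \<Rightarrow> (nat \<Rightarrow> 'm) \<Rightarrow> nat \<Rightarrow> 'm" where
  "hsum C A B f n = finsum (hom_space C A B) f {..<n}"

lemma ring_of_type_algebra_simps [simp]:
  "carrier (ring_of_type_algebra :: 'k :: field ring) = UNIV"
  "x \<otimes>\<^bsub>(ring_of_type_algebra :: 'k ring)\<^esub> y = x * y"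
  "x \<oplus>\<^bsub>(ring_of_type_algebra :: 'k ring)\<^esub> y = x + y"
  "\<one>\<^bsub>(ring_of_type_algebra :: 'k ring)\<^esub> = 1"
  "\<zero>\<^bsub>(ring_of_type_algebra :: 'k ring)\<^esub> = 0"
  by (auto simp: ring_of_type_algebra_def)

lemma hom_space_simps [simp]:
  "carrier (hom_space C A B) = Hom C A B"
  "x \<oplus>\<^bsub>hom_space C A B\<^esub> y = Add C x y"
  "\<zero>\<^bsub>hom_space C A B\<^esub> = Zero C A B"
  "k \<odot>\<^bsub>hom_space C A B\<^esub> x = Scale C k x"
  by (auto simp: hom_space_def)

context lin_category
begin

lemma Zero_simps [simp]: assumes "A \<in> Ob C" "B \<in> Ob C"
  shows "Zero C A B \<in> Ar C" "Dom C (Zero C A B) = A" "Cod C (Zero C A B) = B"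
proof -
  interpret module "ring_of_type_algebra :: 'k ring" "hom_space C A B"
    by (rule hom_module) fact+
  show "Zero C A B \<in> Ar C" "Dom C (Zero C A B) = A" "Cod C (Zero C A B) = B"
    using M.zero_closed by (auto simp: Hom_iff)
qed

lemma Add_simps [simp]: assumes "f \<in> Ar C" "g \<in> Ar C" "Dom C g = Dom C f" "Cod C g = Cod C f"
  shows "Add C f g \<in> Ar C" "Dom C (Add C f g) = Dom C f" "Cod C (Add C f g) = Cod C f"
    "Add C f g = Add C g f"
proof -
  interpret module "ring_of_type_algebra :: 'k ring" "hom_space C (Dom C f) (Cod C f)"
    by (rule hom_module) (use assms in auto)
  show "Add C f g \<in> Ar C" "Dom C (Add C f g) = Dom C f" "Cod C (Add C f g) = Cod C f"
    "Add C f g = Add C g f"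
    using M.add.m_closed[of f g] M.add.m_comm[of f g] assms by (auto simp: Hom_iff)
qed

declare Add_simps(4) [simp del]

lemma Scale_simps [simp]: assumes "f \<in> Ar C"
  shows "Scale C k f \<in> Ar C" "Dom C (Scale C k f) = Dom C f" "Cod C (Scale C k f) = Cod C f"
    "Scale C l (Scale C k f) = Scale C (l * k) f" "Scale C 1 f = f"
proof -
  interpret module "ring_of_type_algebra :: 'k ring" "hom_space C (Dom C f) (Cod C f)"
    by (rule hom_module) (use assms in auto)
  show "Scale C k f \<in> Ar C" "Dom C (Scale C k f) = Dom C f" "Cod C (Scale C k f) = Cod C f"
    "Scale C l (Scale C k f) = Scale C (l * k) f" "Scale C 1 f = f"
    using smult_closed[of k f] smult_assoc1[of l k f] smult_one[of f] assms by (auto simp: Hom_iff)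
qed

lemma Scale_add: assumes "f \<in> Ar C" shows "Scale C (k + l) f = Add C (Scale C k f) (Scale C l f)"
proof -
  interpret module "ring_of_type_algebra :: 'k ring" "hom_space C (Dom C f) (Cod C f)"
    by (rule hom_module) (use assms in auto)
  show ?thesis using smult_l_distr[of k l f] assms by (auto simp: Hom_iff)
qed

lemma Add_assoc: assumes "f \<in> Ar C" "g \<in> Ar C" "h \<in> Ar C" "Dom C g = Dom C f" "Cod C g = Cod C f"
    "Dom C h = Dom C f" "Cod C h = Cod C f"
  shows "Add C (Add C f g) h = Add C f (Add C g h)"
proof -
  interpret module "ring_of_type_algebra :: 'k ring" "hom_space C (Dom C f) (Cod C f)"
    by (rule hom_module) (use assms in auto)
  show ?thesis using M.add.m_assoc[of f g h] assms by (auto simp: Hom_iff)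
qed

lemma Scale_Add: assumes "f \<in> Ar C" "g \<in> Ar C" "Dom C g = Dom C f" "Cod C g = Cod C f"
  shows "Scale C k (Add C f g) = Add C (Scale C k f) (Scale C k g)"
proof -
  interpret module "ring_of_type_algebra :: 'k ring" "hom_space C (Dom C f) (Cod C f)"
    by (rule hom_module) (use assms in auto)
  show ?thesis using smult_r_distr[of k f g] assms by (auto simp: Hom_iff)
qed

lemma Add_Zero [simp]: assumes "f \<in> Ar C" "Dom C f = A" "Cod C f = B"
  shows "Add C f (Zero C A B) = f" "Add C (Zero C A B) f = f"
    "Scale C 0 f = Zero C (Dom C f) (Cod C f)" 
proof -
  interpret module "ring_of_type_algebra :: 'k ring" "hom_space C A B"
    by (rule hom_module) (use assms in auto)
  show "Add C f (Zero C A B) = f" "Add C (Zero C A B) f = f"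
    using M.add.r_one[of f] M.add.l_one[of f] assms by (auto simp: Hom_iff)
  show "Scale C 0 f = Zero C (Dom C f) (Cod C f)"
    using smult_l_null[of f] assms by (auto simp: Hom_iff)
qed

lemma Scale_Zero [simp]: assumes "A \<in> Ob C" "B \<in> Ob C"
  shows "Scale C k (Zero C A B) = Zero C A B"
proof -
  interpret module "ring_of_type_algebra :: 'k ring" "hom_space C A B"
    by (rule hom_module) (use assms in auto)
  show ?thesis using smult_r_null[of k] by auto
qed

lemma Add_neg [simp]: assumes "f \<in> Ar C"
  shows "Add C f (Scale C (- 1) f) = Zero C (Dom C f) (Cod C f)"
    "Add C (Scale C (- 1) f) f = Zero C (Dom C f) (Cod C f)"
proof -
  have "Add C (Scale C 1 f) (Scale C (- 1) f) = Scale C 0 f"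
    using Scale_add[of f 1 "- 1"] assms by simp
  then show *: "Add C f (Scale C (- 1) f) = Zero C (Dom C f) (Cod C f)" using assms by simp
  show "Add C (Scale C (- 1) f) f = Zero C (Dom C f) (Cod C f)"
    unfolding *[symmetric] using assms by (intro Add_simps(4)) auto
qed

text \<open>The record has no subtraction; a difference is written
  \<open>Add C f (Scale C (- 1) g)\<close>.\<close>

lemma Add_neg_eqD: assumes "Add C f (Scale C (- 1) g) = Zero C A B" "f \<in> Ar C" "g \<in> Ar C"
   "Dom C f = A" "Cod C f = B" "Dom C g = A" "Cod C g = B" 
 shows "f = g"
proof -
  have "f = Add C f (Add C (Scale C (- 1) g) g)" using assms by simp
  also have "\<dots> = Add C (Add C f (Scale C (- 1) g)) g" using assms by (subst Add_assoc) auto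
  also have "\<dots> = g" using assms by simp
  finally show ?thesis .
qed

lemma Cmp_lin_simps [simp]:
  "\<lbrakk>f \<in> Ar C; g \<in> Ar C; h \<in> Ar C; Cod C f = Dom C g; Dom C h = Dom C g; Cod C h = Cod C g\<rbrakk> \<Longrightarrow>
    Add C g h \<bullet> f = Add C (g \<bullet> f) (h \<bullet> f)"
  "\<lbrakk>f \<in> Ar C; g \<in> Ar C; h \<in> Ar C; Cod C f = Dom C h; Dom C f = Dom C g; Cod C f = Cod C g\<rbrakk> \<Longrightarrow>
    h \<bullet> Add C f g = Add C (h \<bullet> f) (h \<bullet> g)"
  "\<lbrakk>f \<in> Ar C; g \<in> Ar C; Cod C f = Dom C g\<rbrakk> \<Longrightarrow> Scale C k g \<bullet> f = Scale C k (g \<bullet> f)"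
  "\<lbrakk>f \<in> Ar C; g \<in> Ar C; Cod C f = Dom C g\<rbrakk> \<Longrightarrow> g \<bullet> Scale C k f = Scale C k (g \<bullet> f)"
  using Cmp_Add_left[of f "Dom C f" "Dom C g" g "Cod C g" h]
    Cmp_Add_right[of f "Dom C f" "Dom C h" g h "Cod C h"]
    Cmp_Scale_left[of f "Dom C f" "Dom C g" g "Cod C g" k]
    Cmp_Scale_right[of f "Dom C f" "Dom C g" g "Cod C g" k] by (auto simp: Hom_iff)

lemma Cmp_Zero_simps [simp]:
  "\<lbrakk>f \<in> Ar C; Cod C f = A; B \<in> Ob C\<rbrakk> \<Longrightarrow> Zero C A B \<bullet> f = Zero C (Dom C f) B"
  "\<lbrakk>f \<in> Ar C; Dom C f = B; A \<in> Ob C\<rbrakk> \<Longrightarrow> f \<bullet> Zero C A B = Zero C A (Cod C f)"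
proof -
  assume *: "f \<in> Ar C" "Cod C f = A" "B \<in> Ob C"
  then have "Scale C 0 (Zero C A B) \<bullet> f = Scale C 0 (Zero C A B \<bullet> f)"
    by (intro Cmp_lin_simps) auto
  moreover have "A \<in> Ob C" using * by auto
  ultimately show "Zero C A B \<bullet> f = Zero C (Dom C f) B" using * by simp
next
  assume *: "f \<in> Ar C" "Dom C f = B" "A \<in> Ob C"
  then have "f \<bullet> Scale C 0 (Zero C A B) = Scale C 0 (f \<bullet> Zero C A B)"
    by (intro Cmp_lin_simps) auto
  moreover have "B \<in> Ob C" using * by auto
  ultimately show "f \<bullet> Zero C A B = Zero C A (Cod C f)" using * by simp
qed

lemma hsum_0 [simp]: assumes "A \<in> Ob C" "B \<in> Ob C" shows "hsum C A B f 0 = Zero C A B"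
proof -
  interpret module "ring_of_type_algebra :: 'k ring" "hom_space C A B"
    by (rule hom_module) (use assms in auto)
  show ?thesis by (simp add: hsum_def)
qed

lemma hsum_Suc: assumes "\<And>r. r < Suc n \<Longrightarrow> f r \<in> Hom C A B"
  shows "hsum C A B f (Suc n) = Add C (f n) (hsum C A B f n)"
proof -
  have "A \<in> Ob C" "B \<in> Ob C" using assms[of 0] HomD by blast+
  then interpret module "ring_of_type_algebra :: 'k ring" "hom_space C A B"
    by (rule hom_module)
  show ?thesis using assms by (simp add: hsum_def lessThan_Suc M.finsum_insert Pi_def)
qed

lemma hsum_Hom: assumes "\<And>r. r < n \<Longrightarrow> f r \<in> Hom C A B" "A \<in> Ob C" "B \<in> Ob C"
  shows "hsum C A B f n \<in> Hom C A B"
  using assms(1)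
proof (induction n)
  case 0
  then show ?case using assms by (simp add: Hom_iff)
next
  case (Suc n)
  then show ?case by (simp add: hsum_Suc Hom_iff)
qed

lemma hsum_cong: assumes "\<And>r. r < n \<Longrightarrow> f r = g r" "\<And>r. r < n \<Longrightarrow> g r \<in> Hom C A B" "A \<in> Ob C" "B \<in> Ob C"
  shows "hsum C A B f n = hsum C A B g n"
  using assms(1,2)
proof (induction n)
  case 0
  then show ?case using assms by simp
next
  case (Suc n)
  then show ?case by (simp add: hsum_Suc)
qed

lemma hsum_Zero: assumes "\<And>r. r < n \<Longrightarrow> f r = Zero C A B" "A \<in> Ob C" "B \<in> Ob C"
  shows "hsum C A B f n = Zero C A B"
  using assms(1)
proof (induction n)
  case (Suc n)
  then show ?case using assms by (simp add: hsum_Suc Hom_iff)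
qed (use assms in auto)

lemma hsum_single: assumes "\<And>r. r < n \<Longrightarrow> r \<noteq> s \<Longrightarrow> f r = Zero C A B" "s < n" "f s \<in> Hom C A B"
  shows "hsum C A B f n = f s"
  using assms(1,2)
proof (induction n)
  case (Suc n)
  have AB: "A \<in> Ob C" "B \<in> Ob C" using HomD assms(3) by blast+
  have H: "r < Suc n \<Longrightarrow> f r \<in> Hom C A B" for r
    using Suc.prems assms(3) AB by (cases "r = s") (auto simp: Hom_iff)
  have e: "hsum C A B f (Suc n) = Add C (f n) (hsum C A B f n)"
    by (rule hsum_Suc) (rule H)
  show ?case
  proof (cases "n = s")
    case True
    then have "hsum C A B f n = Zero C A B" using AB Suc by (intro hsum_Zero) auto
    then show ?thesis unfolding e using True assms(3) by (simp add: Hom_iff)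
  next
    case False
    then have "hsum C A B f n = f s" "f n = Zero C A B" using Suc by auto
    then show ?thesis unfolding e using AB assms(3) by (simp add: Hom_iff)
  qed
qed auto

lemma hsum_additive:
  assumes "\<And>r. r < n \<Longrightarrow> f r \<in> Hom C A B" "A \<in> Ob C" "B \<in> Ob C"
    and "\<And>x y. x \<in> Hom C A B \<Longrightarrow> y \<in> Hom C A B \<Longrightarrow> L (Add C x y) = L x + L y"
  shows "L (hsum C A B f n) = (\<Sum>r<n. L (f r) :: 'w :: ab_group_add)"
  using assms(1)
proof (induction n)
  case 0
  \<comment> \<open>Additivity alone forces \<open>L\<close> to send the zero morphism to 0, since
    zero plus zero is zero.\<close>
  have "L (Add C (Zero C A B) (Zero C A B)) = L (Zero C A B) + L (Zero C A B)"
    using assms by (intro assms) (auto simp: Hom_iff)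
  then show ?case using assms by simp
next
  case (Suc n)
  then show ?case using assms(2-) hsum_Hom[of n f A B] by (subst hsum_Suc[where A = A and B = B]) simp_all
qed

end

text \<open>One induction covers composition with a fixed morphism on either side and the
  application of a linear functor: all are additive maps between morphism spaces that preserve
  zero.\<close>

lemma (in lin_category) hsum_map:
  assumes D: "lin_category D" and "\<And>r. r < n \<Longrightarrow> f r \<in> Hom C A B" "A \<in> Ob C" "B \<in> Ob C"
    and L: "\<And>x. x \<in> Hom C A B \<Longrightarrow> L x \<in> Hom D A' B'"
    "\<And>x y. x \<in> Hom C A B \<Longrightarrow> y \<in> Hom C A B \<Longrightarrow> L (Add C x y) = Add D (L x) (L y)"
    and L0: "L (Zero C A B) = Zero D A' B'"
  shows "L (hsum C A B f n) = hsum D A' B' (\<lambda>r. L (f r)) n"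
  using assms(2)
proof (induction n)
  case 0
  interpret D: lin_category D by fact
  have "Zero C A B \<in> Hom C A B" using assms(3,4) by (simp add: Hom_iff)
  then have "A' \<in> Ob D" "B' \<in> Ob D" using D.HomD(4,5)[OF L(1)] by blast+
  then show ?case using assms(3,4) L0 by simp
next
  case (Suc n)
  interpret D: lin_category D by fact
  have *: "r < Suc n \<Longrightarrow> L (f r) \<in> Hom D A' B'" for r using L(1) Suc(2) by blast
  have "L (hsum C A B f (Suc n)) = L (Add C (f n) (hsum C A B f n))"
    by (subst hsum_Suc[where A = A and B = B]) (use Suc.prems in simp_all)
  also have "\<dots> = Add D (L (f n)) (L (hsum C A B f n))"
    by (intro L(2) hsum_Hom) (use Suc.prems assms(3,4) in simp_all)
  also have "\<dots> = Add D (L (f n)) (hsum D A' B' (\<lambda>r. L (f r)) n)"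
    by (subst Suc.IH) (use Suc.prems in simp_all)
  also have "\<dots> = hsum D A' B' (\<lambda>r. L (f r)) (Suc n)"
    by (rule D.hsum_Suc[symmetric]) (rule *)
  finally show ?case .
qed

context lin_category
begin

lemma Cmp_hsum_right:
  assumes "\<And>r. r < n \<Longrightarrow> f r \<in> Hom C A B" "A \<in> Ob C" "h \<in> Hom C B D"
  shows "h \<bullet> hsum C A B f n = hsum C A D (\<lambda>r. h \<bullet> f r) n"
  by (rule hsum_map) (use assms lin_category_axioms in \<open>auto simp: Hom_iff\<close>)

lemma Cmp_hsum_left:
  assumes "\<And>r. r < n \<Longrightarrow> f r \<in> Hom C A B" "B \<in> Ob C" "h \<in> Hom C D A"
  shows "hsum C A B f n \<bullet> h = hsum C D B (\<lambda>r. f r \<bullet> h) n"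
  by (rule hsum_map[where L = "\<lambda>x. x \<bullet> h"]) (use assms lin_category_axioms in \<open>auto simp: Hom_iff\<close>)

lemma direct_sumD:
  assumes "direct_sum C A n S i p"
  shows "A \<in> Ob C" "r < n \<Longrightarrow> S r \<in> Ob C"
    "r < n \<Longrightarrow> i r \<in> Ar C" "r < n \<Longrightarrow> Dom C (i r) = S r" "r < n \<Longrightarrow> Cod C (i r) = A"
    "r < n \<Longrightarrow> p r \<in> Ar C" "r < n \<Longrightarrow> Dom C (p r) = A" "r < n \<Longrightarrow> Cod C (p r) = S r"
    "r < n \<Longrightarrow> p r \<bullet> i r = Id C (S r)" "\<lbrakk>r < n; s < n; r \<noteq> s\<rbrakk> \<Longrightarrow> p r \<bullet> i s = Zero C (S s) (S r)"
    "hsum C A A (\<lambda>r. i r \<bullet> p r) n = Id C A"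
  using assms by (auto simp: direct_sum_def Hom_iff hsum_def)

lemma direct_sum_expand_right:
  assumes "direct_sum C A n S i p" "f \<in> Hom C A B"
  shows "f = hsum C A B (\<lambda>r. f \<bullet> i r \<bullet> p r) n"
proof -
  note d = direct_sumD[OF assms(1)]
  have "f = f \<bullet> hsum C A A (\<lambda>r. i r \<bullet> p r) n" using assms d by (auto simp: Hom_iff)
  also have "\<dots> = hsum C A B (\<lambda>r. f \<bullet> i r \<bullet> p r) n"
    using assms d by (intro Cmp_hsum_right) (auto simp: Hom_iff)
  finally show ?thesis .
qed

lemma direct_sum_expand_left:
  assumes "direct_sum C A n S i p" "f \<in> Hom C B A"
  shows "f = hsum C B A (\<lambda>r. i r \<bullet> p r \<bullet> f) n"
proof -
  note d = direct_sumD[OF assms(1)]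
  have "f = hsum C A A (\<lambda>r. i r \<bullet> p r) n \<bullet> f" using assms d by (auto simp: Hom_iff)
  also have "\<dots> = hsum C B A (\<lambda>r. (i r \<bullet> p r) \<bullet> f) n"
    using assms d by (intro Cmp_hsum_left) (auto simp: Hom_iff)
  also have "\<dots> = hsum C B A (\<lambda>r. i r \<bullet> p r \<bullet> f) n"
    using assms d by (intro hsum_cong) (auto simp: Hom_iff)
  finally show ?thesis .
qed

text \<open>Both morphisms are recovered from their restrictions to the summands by inserting the
  identity of \<open>A\<close> as the sum of the \<open>i r \<bullet> p r\<close>.\<close>

lemma direct_sum_eq_right:
  assumes "direct_sum C A n S i p" "f \<in> Hom C A B" "g \<in> Hom C A B"
    "\<And>r. r < n \<Longrightarrow> f \<bullet> i r = g \<bullet> i r"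
  shows "f = g"
proof -
  note d = direct_sumD[OF assms(1)]
  have "hsum C A B (\<lambda>r. f \<bullet> i r \<bullet> p r) n = hsum C A B (\<lambda>r. g \<bullet> i r \<bullet> p r) n"
  proof (rule hsum_cong)
    fix r assume r: "r < n"
    have "(f \<bullet> i r) \<bullet> p r = (g \<bullet> i r) \<bullet> p r" using assms(4)[OF r] by simp
    then show "f \<bullet> i r \<bullet> p r = g \<bullet> i r \<bullet> p r" "g \<bullet> i r \<bullet> p r \<in> Hom C A B"
      using r d assms(2,3) by (auto simp: Hom_iff)
  qed (use HomD(4,5)[OF assms(2)] in auto)
  then show ?thesis using direct_sum_expand_right[OF assms(1,2)] direct_sum_expand_right[OF assms(1,3)] by simp
qed

lemma direct_sum_eq_left:
  assumes "direct_sum C A n S i p" "f \<in> Hom C B A" "g \<in> Hom C B A"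
    "\<And>r. r < n \<Longrightarrow> p r \<bullet> f = p r \<bullet> g"
  shows "f = g"
proof -
  note d = direct_sumD[OF assms(1)]
  have "hsum C B A (\<lambda>r. i r \<bullet> p r \<bullet> f) n = hsum C B A (\<lambda>r. i r \<bullet> p r \<bullet> g) n"
    by (rule hsum_cong) (use d assms(2-) HomD(4,5)[OF assms(2)] in \<open>auto simp: Hom_iff\<close>)
  then show ?thesis using direct_sum_expand_left[OF assms(1,2)] direct_sum_expand_left[OF assms(1,3)] by simp
qed

text \<open>Every morphism into or out of \<open>Z\<close> can be composed with the identity of
  \<open>Z\<close>, so it vanishes once that identity does.\<close>

lemma zero_ob_iff: "zero_ob C Z \<longleftrightarrow> Z \<in> Ob C \<and> Id C Z = Zero C Z Z"
proof
  assume Z: "zero_ob C Z"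
  then have "\<exists>!f. f \<in> Hom C Z Z" "Z \<in> Ob C" by (auto simp: zero_ob_def)
  then show "Z \<in> Ob C \<and> Id C Z = Zero C Z Z" by (auto simp: Hom_iff)
next
  assume Z: "Z \<in> Ob C \<and> Id C Z = Zero C Z Z"
  have "f = Zero C Z A" if "f \<in> Hom C Z A" for f A
  proof -
    have "f = f \<bullet> Id C Z" using that by (auto simp: Hom_iff)
    also have "\<dots> = f \<bullet> Zero C Z Z" using Z by simp
    also have "\<dots> = Zero C Z A" using Z that by (auto simp: Hom_iff)
    finally show ?thesis .
  qed
  moreover have "f = Zero C A Z" if "f \<in> Hom C A Z" for f A
  proof -
    have "f = Id C Z \<bullet> f" using that by (auto simp: Hom_iff)
    also have "\<dots> = Zero C Z Z \<bullet> f" using Z by simp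
    also have "\<dots> = Zero C A Z" using Z that by (auto simp: Hom_iff)
    finally show ?thesis .
  qed
  moreover have "Zero C Z A \<in> Hom C Z A" "Zero C A Z \<in> Hom C A Z" if "A \<in> Ob C" for A
    using that Z by (simp_all add: Hom_iff)
  ultimately show "zero_ob C Z" using Z unfolding zero_ob_def by blast
qed

end

section \<open>Split exact sequences\<close>

text \<open>A short exact sequence with a chosen splitting, given purely by equations. Equations
  between composites and sums survive every linear functor, whereas the kernel and cokernel
  properties in \<open>short_exact\<close> are universal statements that need not.\<close>

definition split_exact :: "('o, 'm, 'k, 'z) lincat_scheme \<Rightarrow> 'm \<Rightarrow> 'm \<Rightarrow> 'm \<Rightarrow> 'm \<Rightarrow> bool" where
  "split_exact C f g s t \<longleftrightarrow> f \<in> Ar C \<and> g \<in> Ar C \<and> s \<in> Ar C \<and> t \<in> Ar C \<and>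
     Dom C g = Cod C f \<and> Dom C s = Cod C g \<and> Cod C s = Cod C f \<and> Dom C t = Cod C f \<and> Cod C t = Dom C f \<and>
     Cmp C t f = Id C (Dom C f) \<and> Cmp C g s = Id C (Cod C g) \<and> Cmp C g f = Zero C (Dom C f) (Cod C g) \<and>
     Add C (Cmp C f t) (Cmp C s g) = Id C (Cod C f)"

context lin_category
begin

lemma split_exact_short_exact:
  assumes "split_exact C f g s t" shows "short_exact C f g"
proof -
  have d [simp]: "f \<in> Ar C" "g \<in> Ar C" "s \<in> Ar C" "t \<in> Ar C" "Dom C g = Cod C f" "Dom C s = Cod C g"
    "Cod C s = Cod C f" "Dom C t = Cod C f" "Cod C t = Dom C f" and
    e: "t \<bullet> f = Id C (Dom C f)" "g \<bullet> s = Id C (Cod C g)" "g \<bullet> f = Zero C (Dom C f) (Cod C g)"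
    and one: "Add C (f \<bullet> t) (s \<bullet> g) = Id C (Cod C f)"
    using assms by (auto simp: split_exact_def)
  have "\<exists>!h. h \<in> Hom C A (Dom C f) \<and> f \<bullet> h = x" if "x \<in> Hom C A (Cod C f)" "g \<bullet> x = Zero C A (Cod C g)" for x A
  proof (rule ex1I[where a = "t \<bullet> x"])
    have x: "x \<in> Ar C" "Cod C x = Cod C f" "Dom C x = A" using that by (auto simp: Hom_iff)
    then have "A \<in> Ob C" by auto
    have "x = Add C (f \<bullet> t) (s \<bullet> g) \<bullet> x" using x one by simp
    also have "\<dots> = f \<bullet> t \<bullet> x" using x that(2) \<open>A \<in> Ob C\<close> by simp
    finally show "t \<bullet> x \<in> Hom C A (Dom C f) \<and> f \<bullet> t \<bullet> x = x" using x by (simp add: Hom_iff)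
    fix h assume h: "h \<in> Hom C A (Dom C f) \<and> f \<bullet> h = x"
    then have "h = (t \<bullet> f) \<bullet> h" by (simp add: Hom_iff e(1))
    also have "\<dots> = t \<bullet> (f \<bullet> h)" using h by (intro Cmp_assoc_simp) (simp_all add: Hom_iff)
    finally show "h = t \<bullet> x" using h by simp
  qed
  moreover have "\<exists>!h. h \<in> Hom C (Cod C g) B \<and> h \<bullet> g = x" if "x \<in> Hom C (Cod C f) B" "x \<bullet> f = Zero C (Dom C f) B" for x B
  proof (rule ex1I[where a = "x \<bullet> s"])
    have x: "x \<in> Ar C" "Cod C x = B" "Dom C x = Cod C f" using that by (auto simp: Hom_iff)
    then have "B \<in> Ob C" by auto
    have "x = x \<bullet> Add C (f \<bullet> t) (s \<bullet> g)" using x one by simp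
    also have "\<dots> = Add C ((x \<bullet> f) \<bullet> t) (x \<bullet> s \<bullet> g)" using x by simp
    also have "\<dots> = (x \<bullet> s) \<bullet> g" using x \<open>B \<in> Ob C\<close> unfolding that(2) by simp
    finally show "x \<bullet> s \<in> Hom C (Cod C g) B \<and> (x \<bullet> s) \<bullet> g = x" using x by (simp add: Hom_iff)
    fix h assume h: "h \<in> Hom C (Cod C g) B \<and> h \<bullet> g = x"
    then have "h = h \<bullet> (g \<bullet> s)" by (simp add: Hom_iff e(2))
    also have "\<dots> = (h \<bullet> g) \<bullet> s" using h by (intro Cmp_assoc_simp[symmetric]) (simp_all add: Hom_iff)
    finally show "h = x \<bullet> s" using h by simp
  qed
  ultimately show ?thesis
    using e(3) by (simp add: short_exact_def is_ker_def is_coker_def)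
qed

text \<open>\<open>m \<bullet> g\<close> is annihilated by \<open>f\<close>, so its factorisation
  through the kernel \<open>m\<close> is unique; \<open>g\<close> and \<open>h\<close> are two such
  factorisations.\<close>

lemma is_ker_mono: "is_ker C f m \<Longrightarrow> mono_ar C m"
  unfolding mono_ar_def
proof (intro conjI allI ballI impI)
  assume k: "is_ker C f m"
  then have fm [simp]: "f \<in> Ar C" "m \<in> Ar C" "Cod C m = Dom C f" "f \<bullet> m = Zero C (Dom C m) (Cod C f)"
    by (auto simp: is_ker_def)
  then show "m \<in> Ar C" by simp
  fix A g h assume gh: "g \<in> Hom C A (Dom C m)" "h \<in> Hom C A (Dom C m)" "m \<bullet> g = m \<bullet> h"
  have "(f \<bullet> m) \<bullet> g = Zero C A (Cod C f)" using gh(1) by (auto simp: Hom_iff)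
  moreover have "(f \<bullet> m) \<bullet> g = f \<bullet> (m \<bullet> g)"
    using gh(1) by (intro Cmp_assoc_simp) (simp_all add: Hom_iff)
  ultimately have "f \<bullet> (m \<bullet> g) = Zero C A (Cod C f)" by simp
  moreover have "m \<bullet> g \<in> Hom C A (Dom C f)" using gh(1) by (auto simp: Hom_iff)
  ultimately have "\<exists>!x. x \<in> Hom C A (Dom C m) \<and> m \<bullet> x = m \<bullet> g"
    using k unfolding is_ker_def by blast
  then show "g = h" using gh by metis
qed

end

lemma (in lin_functor) split_exact_image:
  assumes "split_exact C f g s t"
  shows "split_exact D (Far F f) (Far F g) (Far F s) (Far F t)"
    "Dom D (Far F f) = Fob F (Dom C f)" "Cod D (Far F f) = Fob F (Cod C f)" "Cod D (Far F g) = Fob F (Cod C g)"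
proof -
  have d [simp]: "f \<in> Ar C" "g \<in> Ar C" "s \<in> Ar C" "t \<in> Ar C" "Dom C g = Cod C f" "Dom C s = Cod C g"
    "Cod C s = Cod C f" "Dom C t = Cod C f" "Cod C t = Dom C f" and
    e: "t \<bullet> f = Id C (Dom C f)" "g \<bullet> s = Id C (Cod C g)" "g \<bullet> f = Zero C (Dom C f) (Cod C g)"
    and one: "Add C (f \<bullet> t) (s \<bullet> g) = Id C (Cod C f)"
    using assms by (auto simp: split_exact_def)
  have F: "Far F x \<in> Ar D" "Dom D (Far F x) = Fob F (Dom C x)" "Cod D (Far F x) = Fob F (Cod C x)"
    if "x \<in> Ar C" for x
    using Far_Hom[of x "Dom C x" "Cod C x"] that by (auto simp: Hom_iff)
  have FC: "Far F (y \<bullet> x) = Far F y \<bullet>\<^bsub>D\<^esub> Far F x" if "x \<in> Ar C" "y \<in> Ar C" "Dom C y = Cod C x" for x y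
    using Far_Cmp[of x "Dom C x" "Cod C x" y "Cod C y"] that by (auto simp: Hom_iff)
  have FZ: "Far F (Zero C A B) = Zero D (Fob F A) (Fob F B)" if "A \<in> Ob C" "B \<in> Ob C" for A B
    using Far_Scale[of "Zero C A B" A B 0] that F[of "Zero C A B"] by (auto simp: Hom_iff)
  have FA: "Far F (Add C x y) = Add D (Far F x) (Far F y)"
    if "x \<in> Ar C" "y \<in> Ar C" "Dom C x = Dom C y" "Cod C x = Cod C y" for x y
    using Far_Add[of x "Dom C x" "Cod C x" y] that by (auto simp: Hom_iff)
  have "Add D (Far F f \<bullet>\<^bsub>D\<^esub> Far F t) (Far F s \<bullet>\<^bsub>D\<^esub> Far F g) = Far F (Id C (Cod C f))"
    unfolding one[symmetric] by (subst FA) (simp_all add: FC)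
  then show "split_exact D (Far F f) (Far F g) (Far F s) (Far F t)"
    "Dom D (Far F f) = Fob F (Dom C f)" "Cod D (Far F f) = Fob F (Cod C f)" "Cod D (Far F g) = Fob F (Cod C g)"
    by (simp_all add: split_exact_def F FC[symmetric] e FZ Far_Id)
qed

section \<open>Semisimple categories\<close>

text \<open>The kernel of \<open>f\<close> is a subobject of the simple object \<open>S\<close>. It
  is not all of \<open>S\<close> because \<open>f\<close> is nonzero, so it is zero and
  \<open>f\<close> is mono; a mono from a nonzero object into the simple object \<open>T\<close> is
  invertible.\<close>

lemma (in abelian_category) schur_iso:
  assumes "simple_ob C S" "simple_ob C T" "f \<in> Hom C S T" "f \<noteq> Zero C S T"
  shows "iso_ar C f"
proof -
  have f [simp]: "f \<in> Ar C" "Dom C f = S" "Cod C f = T" "S \<in> Ob C" "T \<in> Ob C"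
    using assms(3) HomD[OF assms(3)] by (auto simp: Hom_iff)
  obtain m where m: "is_ker C f m" using kernels[of f] by auto
  then have m': "m \<in> Ar C" "Cod C m = S" "f \<bullet> m = Zero C (Dom C m) T" by (auto simp: is_ker_def)
  have "\<not> iso_ar C m"
  proof
    assume "iso_ar C m"
    then have "f = (f \<bullet> m) \<bullet> inv_ar C m" using m'(1,2) by simp
    also have "\<dots> = Zero C S T" unfolding m'(3) using m' \<open>iso_ar C m\<close> by simp
    finally show False using assms(4) by simp
  qed
  moreover have mS: "m \<in> Hom C (Dom C m) S" using m'(1,2) by (simp add: Hom_iff)
  ultimately have z: "zero_ob C (Dom C m)"
    using assms(1) mS is_ker_mono[OF m] unfolding simple_ob_def by blast
  have "mono_ar C f" unfolding mono_ar_def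
  proof (intro conjI allI ballI impI)
    fix A g h assume gh: "g \<in> Hom C A (Dom C f)" "h \<in> Hom C A (Dom C f)" "f \<bullet> g = f \<bullet> h"
    let ?d = "Add C g (Scale C (- 1) h)"
    have A: "A \<in> Ob C" using HomD(4)[OF gh(1)] .
    have "f \<bullet> ?d = Zero C A T" using gh by (auto simp: Hom_iff)
    moreover have d: "?d \<in> Hom C A (Dom C f)" using gh by (auto simp: Hom_iff)
    ultimately obtain x where x: "x \<in> Hom C A (Dom C m)" "m \<bullet> x = ?d"
      using m unfolding is_ker_def by (metis f(3))
    have "x = Zero C A (Dom C m)"
      using z x A m' unfolding zero_ob_def by (metis Hom_iff Dom_Cod_Ob(1) Zero_simps)
    then have "?d = Zero C A S" using x A m' by (auto simp: Hom_iff)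
    then show "g = h" using gh by (intro Add_neg_eqD[of g h A S]) (auto simp: Hom_iff)
  qed simp
  then show ?thesis using assms(1,2,3) unfolding simple_ob_def by blast
qed

context finite_semisimple_category
begin

text \<open>Decompose \<open>A\<close> into simple objects. Some component
  \<open>p r \<bullet> h\<close> is nonzero, hence invertible by Schur's lemma, and its inverse
  after \<open>p r\<close> retracts \<open>h\<close>.\<close>

lemma simple_retract:
  assumes "simple_ob C S" "h \<in> Hom C S A" "h \<noteq> Zero C S A"
  shows "\<exists>q \<in> Hom C A S. q \<bullet> h = Id C S"
proof -
  have A: "A \<in> Ob C" "S \<in> Ob C" using HomD[OF assms(2)] by auto
  obtain n T i p where T: "direct_sum C A n T i p" "\<And>r. r < n \<Longrightarrow> simple_ob C (T r)"
    using semisimple[OF A(1)] by auto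
  note d = direct_sumD[OF T(1)]
  have "\<exists>r<n. p r \<bullet> h \<noteq> Zero C S (T r)"
  proof (rule ccontr)
    assume *: "\<not> ?thesis"
    have "h = Zero C S A"
      by (rule direct_sum_eq_left[OF T(1)]) (use * d assms A in \<open>auto simp: Hom_iff\<close>)
    then show False using assms by simp
  qed
  then obtain r where r: "r < n" "p r \<bullet> h \<noteq> Zero C S (T r)" by auto
  have h: "h \<in> Ar C" "Dom C h = S" "Cod C h = A" using assms by (auto simp: Hom_iff)
  then have "iso_ar C (p r \<bullet> h)"
    using d r by (intro schur_iso[OF assms(1) T(2)[OF r(1)]]) (auto simp: Hom_iff)
  then show ?thesis
    using d(2-9)[OF r(1)] r(1) h by (intro bexI[where x = "inv_ar C (p r \<bullet> h) \<bullet> p r"]) (auto simp: Hom_iff)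
qed

text \<open>\<open>e\<close> acts as a projection onto the sum of the images of the
  \<open>h r\<close>: it fixes every \<open>h r\<close> and factors through them. It is enlarged by
  one simple object at a time, which avoids having to form images or complements.\<close>

lemma simples_cover_split:
  assumes "\<And>r. r < n \<Longrightarrow> simple_ob C (S r)" "\<And>r. r < n \<Longrightarrow> h r \<in> Hom C (S r) A" "A \<in> Ob C"
  shows "\<exists>e k. e \<in> Hom C A A \<and> (\<forall>r<n. e \<bullet> h r = h r \<and> k r \<in> Hom C A (S r)) \<and>
     e = hsum C A A (\<lambda>r. h r \<bullet> k r) n"
  using assms(1,2)
proof (induction n)
  case 0
  then show ?case using assms(3) by (auto simp: Hom_iff)
next
  case (Suc n)
  have "\<exists>e k. e \<in> Hom C A A \<and> (\<forall>r<n. e \<bullet> h r = h r \<and> k r \<in> Hom C A (S r)) \<and>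
     e = hsum C A A (\<lambda>r. h r \<bullet> k r) n"
    by (rule Suc.IH) (use Suc.prems in simp_all)
  then obtain e k where e: "e \<in> Hom C A A" "\<And>r. r < n \<Longrightarrow> e \<bullet> h r = h r" "\<And>r. r < n \<Longrightarrow> k r \<in> Hom C A (S r)"
     "e = hsum C A A (\<lambda>r. h r \<bullet> k r) n"
    by blast
  have [simp]: "e \<in> Ar C" "Dom C e = A" "Cod C e = A" "A \<in> Ob C" using e(1) assms(3) by (auto simp: Hom_iff)
  have hr: "h r \<in> Ar C" "Dom C (h r) = S r" "Cod C (h r) = A" if "r < Suc n" for r
    using Suc.prems(2)[OF that] by (auto simp: Hom_iff)
  note hn [simp] = hr[OF lessI]
  have Sn [simp]: "S n \<in> Ob C" using Suc.prems(1)[of n] by (simp add: simple_ob_def)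
  define d where "d = Add C (Id C A) (Scale C (- 1) e)"
  have d [simp]: "d \<in> Ar C" "Dom C d = A" "Cod C d = A" by (simp_all add: d_def)
  have dh: "d \<bullet> h r = Zero C (S r) A" if "r < n" for r
    using that hr[of r] e(2)[OF that] by (simp add: d_def)
  \<comment> \<open>If the complement \<open>d\<close> of \<open>e\<close> already kills
    \<open>h n\<close>, nothing has to be added and \<open>q\<close> is zero; otherwise
    \<open>d \<bullet> h n\<close> is a nonzero morphism out of a simple object and has a
    retraction.\<close>
  obtain q where q: "q \<in> Hom C A (S n)" and qd: "e \<bullet> h n = h n \<and> q = Zero C A (S n) \<or> q \<bullet> d \<bullet> h n = Id C (S n)"
  proof (cases "d \<bullet> h n = Zero C (S n) A")
    case True
    then have "Add C (h n) (Scale C (- 1) (e \<bullet> h n)) = Zero C (S n) A" by (simp add: d_def)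
    then have "h n = e \<bullet> h n" by (rule Add_neg_eqD) auto
    then show ?thesis using that[of "Zero C A (S n)"] by (auto simp: Hom_iff)
  next
    case False
    then show ?thesis using that simple_retract[OF Suc.prems(1)[of n], of "d \<bullet> h n" A]
      by (auto simp: Hom_iff)
  qed
  have q' [simp]: "q \<in> Ar C" "Dom C q = A" "Cod C q = S n" using q by (auto simp: Hom_iff)
  define w where "w = Add C (Id C A) (Scale C (- 1) (h n \<bullet> q \<bullet> d))"
  have w [simp]: "w \<in> Ar C" "Dom C w = A" "Cod C w = A" by (simp_all add: w_def)
  \<comment> \<open>The new term sends \<open>h n\<close> to itself and kills the earlier
    \<open>h r\<close>, because \<open>d\<close> does. Composing the old \<open>e\<close> with
    \<open>w\<close> prevents the part of \<open>h n\<close> already covered by \<open>e\<close>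
    from being counted twice.\<close>
  define e' where "e' = Add C (h n \<bullet> q \<bullet> d) (e \<bullet> w)"
  define k' where "k' = (\<lambda>r. if r = n then q \<bullet> d else k r \<bullet> w)"
  have kr: "k r \<in> Ar C" "Dom C (k r) = A" "Cod C (k r) = S r" if "r < n" for r
    using e(3)[OF that] by (auto simp: Hom_iff)
  have H: "h r \<bullet> k' r \<in> Hom C A A" if "r < Suc n" for r
    using that hr[OF that] kr[of r] by (cases "r = n") (auto simp: k'_def Hom_iff)
  have "e' = hsum C A A (\<lambda>r. h r \<bullet> k' r) (Suc n)"
  proof -
    have "e \<bullet> w = hsum C A A (\<lambda>r. (h r \<bullet> k r) \<bullet> w) n"
      unfolding e(4) using hr kr by (intro Cmp_hsum_left) (auto simp: Hom_iff)
    also have "\<dots> = hsum C A A (\<lambda>r. h r \<bullet> k' r) n"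
      using hr kr by (intro hsum_cong) (auto simp: k'_def Hom_iff)
    finally have "e' = Add C (h n \<bullet> k' n) (hsum C A A (\<lambda>r. h r \<bullet> k' r) n)"
      by (simp add: e'_def k'_def)
    also have "\<dots> = hsum C A A (\<lambda>r. h r \<bullet> k' r) (Suc n)"
      by (rule hsum_Suc[symmetric]) (rule H)
    finally show ?thesis .
  qed
  moreover have "e' \<bullet> h r = h r" if r: "r < Suc n" for r
  proof (cases "r = n")
    case True
    then show ?thesis using qd
      by (auto simp: e'_def w_def)
  next
    case False
    then have "r < n" using r by simp
    moreover have "S r \<in> Ob C" using Suc.prems(1)[OF r] by (simp add: simple_ob_def)
    ultimately show ?thesis using hr[OF r] dh[of r] e(2) by (simp add: e'_def w_def)
  qed
  moreover have "k' r \<in> Hom C A (S r)" if "r < Suc n" for r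
    using that kr[of r] by (auto simp: k'_def Hom_iff)
  moreover have "e' \<in> Hom C A A" by (simp add: e'_def Hom_iff)
  ultimately show ?case by blast
qed

text \<open>The simple summands of the domain, pushed forward along \<open>g\<close>, yield an
  endomorphism \<open>e\<close> of the codomain that factors through \<open>g\<close> and satisfies
  \<open>e \<bullet> g = g\<close>. As \<open>g\<close> is epi, \<open>e\<close> is the identity,
  and the factorisation is a section.\<close>

lemma epi_splits:
  assumes "epi_ar C g" shows "\<exists>s \<in> Hom C (Cod C g) (Dom C g). g \<bullet> s = Id C (Cod C g)"
proof -
  let ?A = "Dom C g" and ?B = "Cod C g"
  have g [simp]: "g \<in> Ar C" using assms by (simp add: epi_ar_def)
  obtain n S i p where T: "direct_sum C ?A n S i p" "\<And>r. r < n \<Longrightarrow> simple_ob C (S r)"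
    using semisimple[of ?A] by auto
  note d = direct_sumD[OF T(1)]
  obtain e k where e: "e \<in> Hom C ?B ?B" "\<And>r. r < n \<Longrightarrow> e \<bullet> (g \<bullet> i r) = g \<bullet> i r"
     "\<And>r. r < n \<Longrightarrow> k r \<in> Hom C ?B (S r)" "e = hsum C ?B ?B (\<lambda>r. (g \<bullet> i r) \<bullet> k r) n"
    using simples_cover_split[of n S "\<lambda>r. g \<bullet> i r" ?B] T(2) d by (auto simp: Hom_iff)
  have "e \<bullet> g = g"
    by (rule direct_sum_eq_right[OF T(1)]) (use e d in \<open>auto simp: Hom_iff\<close>)
  then have "e = Id C ?B"
    using assms e(1) unfolding epi_ar_def by (auto simp: Hom_iff)
  moreover have "e = g \<bullet> hsum C ?B ?A (\<lambda>r. i r \<bullet> k r) n"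
  proof -
    have "e = hsum C ?B ?B (\<lambda>r. g \<bullet> (i r \<bullet> k r)) n"
      unfolding e(4) by (rule hsum_cong) (use d e(3) in \<open>auto simp: Hom_iff\<close>)
    also have "\<dots> = g \<bullet> hsum C ?B ?A (\<lambda>r. i r \<bullet> k r) n"
      using d e(3) by (intro Cmp_hsum_right[symmetric]) (auto simp: Hom_iff)
    finally show ?thesis .
  qed
  moreover have "hsum C ?B ?A (\<lambda>r. i r \<bullet> k r) n \<in> Hom C ?B ?A"
    using d e(3) by (intro hsum_Hom) (auto simp: Hom_iff)
  ultimately show ?thesis by metis
qed

lemma short_exact_splits:
  assumes "short_exact C f g" shows "\<exists>s t. split_exact C f g s t"
proof -
  have k: "is_ker C g f" "is_coker C f g" using assms by (auto simp: short_exact_def)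
  then have d [simp]: "f \<in> Ar C" "g \<in> Ar C" "Dom C g = Cod C f" and gf: "g \<bullet> f = Zero C (Dom C f) (Cod C g)"
    by (auto simp: is_ker_def)
  have "epi_ar C g" unfolding epi_ar_def
  proof (intro conjI allI ballI impI)
    fix B x y assume xy: "x \<in> Hom C (Cod C g) B" "y \<in> Hom C (Cod C g) B" "x \<bullet> g = y \<bullet> g"
    have B: "B \<in> Ob C" using HomD[OF xy(1)] by simp
    have "(x \<bullet> g) \<bullet> f = Zero C (Dom C f) B" using xy gf B by (auto simp: Hom_iff)
    moreover have "x \<bullet> g \<in> Hom C (Cod C f) B" using xy by (auto simp: Hom_iff)
    ultimately have "\<exists>!h. h \<in> Hom C (Cod C g) B \<and> h \<bullet> g = x \<bullet> g"
      using k(2) unfolding is_coker_def by blast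
    then show "x = y" using xy by metis
  qed simp
  then obtain s where s: "s \<in> Ar C" "Dom C s = Cod C g" "Cod C s = Cod C f" and gs: "g \<bullet> s = Id C (Cod C g)"
    using epi_splits[of g] d(3) unfolding Hom_def by auto
  \<comment> \<open>The complement of the idempotent \<open>s \<bullet> g\<close>. It is annihilated
    by \<open>g\<close>, so it factors through the kernel \<open>f\<close>; the factor
    \<open>t\<close> is the retraction.\<close>
  let ?x = "Add C (Id C (Cod C f)) (Scale C (- 1) (s \<bullet> g))"
  have "g \<bullet> ?x = Add C g (Scale C (- 1) ((g \<bullet> s) \<bullet> g))" using s by simp
  then have "g \<bullet> ?x = Zero C (Cod C f) (Cod C g)" unfolding gs by simp
  moreover have "?x \<in> Hom C (Cod C f) (Dom C g)" using s by (simp add: Hom_iff)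
  ultimately obtain t where t: "t \<in> Hom C (Cod C f) (Dom C f)" "f \<bullet> t = ?x"
    using k(1) unfolding is_ker_def by blast
  have t' [simp]: "t \<in> Ar C" "Dom C t = Cod C f" "Cod C t = Dom C f" using t by (auto simp: Hom_iff)
  have one: "Add C (f \<bullet> t) (s \<bullet> g) = Id C (Cod C f)" unfolding t(2) using s by (simp add: Add_assoc)
  have "f \<bullet> (t \<bullet> f) = (f \<bullet> t) \<bullet> f" by simp
  also have "\<dots> = Add C f (Scale C (- 1) (s \<bullet> (g \<bullet> f)))" unfolding t(2) using s by simp
  also have "\<dots> = f \<bullet> Id C (Dom C f)" unfolding gf using s by simp
  finally have "t \<bullet> f = Id C (Dom C f)"
    using is_ker_mono[OF k(1)] unfolding mono_ar_def by (auto simp: Hom_iff)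
  then have "split_exact C f g s t" using s gs gf one by (simp add: split_exact_def)
  then show ?thesis by blast
qed

end

text \<open>For an induction on the number of summands, the sum of the first \<open>n\<close> of
  them must be available as an object. It is formed afresh, and \<open>f\<close> and
  \<open>t\<close> are the evident inclusion and projection.\<close>

lemma (in abelian_category) direct_sum_Suc_split:
  assumes "direct_sum C A (Suc n) S i p"
  shows "\<exists>A' i' p' f t. direct_sum C A' n S i' p' \<and> split_exact C f (p n) (i n) t \<and> Dom C f = A' \<and> Cod C f = A \<and> Cod C (p n) = S n"
proof -
  note d = direct_sumD[OF assms]
  obtain A' i' p' where A': "direct_sum C A' n S i' p'"
    using direct_sums[of n S] d(2) less_SucI by blast
  note d' = direct_sumD[OF A']
  note [simp] = d(1) d'(1)
  have dn [simp]: "i n \<in> Ar C" "p n \<in> Ar C" "Dom C (i n) = S n" "Cod C (i n) = A" "Dom C (p n) = A" "Cod C (p n) = S n"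
    "S n \<in> Ob C" using d by auto
  define f where "f = hsum C A' A (\<lambda>r. i r \<bullet> p' r) n"
  define t where "t = hsum C A A' (\<lambda>r. i' r \<bullet> p r) n"
  have "f \<in> Hom C A' A" "t \<in> Hom C A A'"
    unfolding f_def t_def using d d' by (intro hsum_Hom; auto simp: Hom_iff)+
  then have ft [simp]: "f \<in> Ar C" "t \<in> Ar C" "Dom C f = A'" "Cod C f = A" "Dom C t = A" "Cod C t = A'"
    by (auto simp: Hom_iff)
  have fi: "f \<bullet> i' r = i r" if r: "r < n" for r
  proof -
    have "f \<bullet> i' r = hsum C (S r) A (\<lambda>s. (i s \<bullet> p' s) \<bullet> i' r) n"
      unfolding f_def using r d d' by (intro Cmp_hsum_left) (auto simp: Hom_iff)
    also have "\<dots> = (i r \<bullet> p' r) \<bullet> i' r"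
      using r d d' by (intro hsum_single) (auto simp: Hom_iff)
    also have "\<dots> = i r" using r d d' by auto
    finally show ?thesis .
  qed
  have ti: "t \<bullet> i r = i' r" if r: "r < n" for r
  proof -
    have "t \<bullet> i r = hsum C (S r) A' (\<lambda>s. (i' s \<bullet> p s) \<bullet> i r) n"
      unfolding t_def using r d d' by (intro Cmp_hsum_left) (auto simp: Hom_iff)
    also have "\<dots> = (i' r \<bullet> p r) \<bullet> i r"
      using r d d' by (intro hsum_single) (auto simp: Hom_iff)
    also have "\<dots> = i' r" using r d d' by auto
    finally show ?thesis .
  qed
  have "t \<bullet> f = Id C A'"
  proof (rule direct_sum_eq_right[OF A'])
    fix r assume r: "r < n"
    have "(t \<bullet> f) \<bullet> i' r = t \<bullet> f \<bullet> i' r" using r d' by auto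
    then show "(t \<bullet> f) \<bullet> i' r = Id C A' \<bullet> i' r" using r d' fi ti by auto
  qed (auto simp: Hom_iff)
  moreover have "p n \<bullet> f = Zero C A' (S n)"
  proof (rule direct_sum_eq_right[OF A'])
    fix r assume r: "r < n"
    have "(p n \<bullet> f) \<bullet> i' r = p n \<bullet> f \<bullet> i' r" using r d' by auto
    then show "(p n \<bullet> f) \<bullet> i' r = Zero C A' (S n) \<bullet> i' r" using r d d' fi by auto
  qed (auto simp: Hom_iff)
  moreover have "Add C (f \<bullet> t) (i n \<bullet> p n) = Id C A"
  proof -
    have "f \<bullet> t = hsum C A A (\<lambda>r. f \<bullet> i' r \<bullet> p r) n"
      unfolding t_def using d d' by (intro Cmp_hsum_right) (auto simp: Hom_iff)
    also have "\<dots> = hsum C A A (\<lambda>r. i r \<bullet> p r) n"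
    proof (rule hsum_cong)
      fix r assume r: "r < n"
      have "f \<bullet> i' r \<bullet> p r = (f \<bullet> i' r) \<bullet> p r" using r d d' by simp
      then show "f \<bullet> i' r \<bullet> p r = i r \<bullet> p r" using fi r by simp
      show "i r \<bullet> p r \<in> Hom C A A" using r d by (auto simp: Hom_iff)
    qed auto
    finally have ft_sum: "f \<bullet> t = hsum C A A (\<lambda>r. i r \<bullet> p r) n" .
    have "Add C (f \<bullet> t) (i n \<bullet> p n) = Add C (i n \<bullet> p n) (f \<bullet> t)"
      by (rule Add_simps(4)) simp_all
    also have "\<dots> = Add C (i n \<bullet> p n) (hsum C A A (\<lambda>r. i r \<bullet> p r) n)"
      by (simp only: ft_sum)
    also have "\<dots> = hsum C A A (\<lambda>r. i r \<bullet> p r) (Suc n)"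
      using d by (intro hsum_Suc[symmetric]) (auto simp: Hom_iff)
    finally show ?thesis using d by simp
  qed
  ultimately have "split_exact C f (p n) (i n) t" using d(9)[of n] by (simp add: split_exact_def)
  with A' show ?thesis using ft dn by blast
qed

text \<open>Gaussian elimination, by induction on the set of equations. It provides a linear
  dependence between the powers of an endomorphism.\<close>

lemma homogeneous_system_nontrivial:
  fixes a :: "'j \<Rightarrow> 's \<Rightarrow> 'k :: field"
  assumes "finite Q" "finite J" "card Q < card J"
  shows "\<exists>c. (\<exists>j\<in>J. c j \<noteq> 0) \<and> (\<forall>s\<in>Q. (\<Sum>j\<in>J. c j * a j s) = 0)"
  using assms
proof (induction Q arbitrary: J a rule: finite_induct)
  case empty
  then have "J \<noteq> {}" by auto
  then show ?case by (auto intro!: exI[where x = "\<lambda>_. 1"])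
next
  case (insert s Q)
  show ?case
  proof (cases "\<exists>j\<in>J. a j s \<noteq> 0")
    case False
    have "\<exists>c. (\<exists>j\<in>J. c j \<noteq> 0) \<and> (\<forall>s\<in>Q. (\<Sum>j\<in>J. c j * a j s) = 0)"
      by (rule insert.IH) (use insert.prems insert.hyps in auto)
    then obtain c where "\<exists>j\<in>J. c j \<noteq> 0" "\<forall>s\<in>Q. (\<Sum>j\<in>J. c j * a j s) = 0"
      by blast
    then show ?thesis using False by (intro exI[where x = c]) auto
  next
    case True
    then obtain j0 where j0: "j0 \<in> J" "a j0 s \<noteq> 0" by auto
    define J' where "J' = J - {j0}"
    have J': "finite J'" "j0 \<notin> J'" "J = insert j0 J'" "card Q < card J'"
      using j0 insert by (auto simp: J'_def)
    define a' where "a' = (\<lambda>j t. a j t - a j s / a j0 s * a j0 t)"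
    have "\<exists>c. (\<exists>j\<in>J'. c j \<noteq> 0) \<and> (\<forall>t\<in>Q. (\<Sum>j\<in>J'. c j * a' j t) = 0)"
      by (rule insert.IH) (use J' in auto)
    then obtain c where c: "\<exists>j\<in>J'. c j \<noteq> 0" "\<forall>t\<in>Q. (\<Sum>j\<in>J'. c j * a' j t) = 0"
      by blast
    \<comment> \<open>The value of the eliminated unknown \<open>j0\<close>, obtained by solving
      equation \<open>s\<close> for it.\<close>
    define c0 where "c0 = - (\<Sum>j\<in>J'. c j * a j s) / a j0 s"
    define c' where "c' = c(j0 := c0)"
    have eq: "(\<Sum>j\<in>J. c' j * a j t) = (\<Sum>j\<in>J'. c j * a' j t)" for t
    proof -
      have "(\<Sum>j\<in>J. c' j * a j t) = c0 * a j0 t + (\<Sum>j\<in>J'. c' j * a j t)"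
        using J' by (simp add: c'_def)
      also have "(\<Sum>j\<in>J'. c' j * a j t) = (\<Sum>j\<in>J'. c j * a j t)"
        using J'(2) by (intro sum.cong) (auto simp: c'_def)
      also have "c0 * a j0 t = - (\<Sum>j\<in>J'. c j * (a j s / a j0 s * a j0 t))"
        unfolding c0_def using sum_distrib_right[of "\<lambda>j. c j * a j s" J' "a j0 t / a j0 s"]
        by (simp add: field_simps)
      finally show ?thesis by (simp add: a'_def algebra_simps sum_subtractf)
    qed
    have "a' j s = 0" for j using j0 by (simp add: a'_def)
    then have "\<forall>t\<in>insert s Q. (\<Sum>j\<in>J. c' j * a j t) = 0" using c(2) by (simp add: eq)
    moreover have "\<exists>j\<in>J. c' j \<noteq> 0" using c(1) J' by (auto simp: c'_def)
    ultimately show ?thesis by blast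
  qed
qed

section \<open>Presented abelian groups\<close>

lemma frag_diff_induct [consumes 1, case_names zero diff of]:
  assumes "Poly_Mapping.keys x \<subseteq> S" "P 0"
    "\<And>x y. \<lbrakk>Poly_Mapping.keys x \<subseteq> S; Poly_Mapping.keys y \<subseteq> S; P x; P y\<rbrakk> \<Longrightarrow> P (x - y)"
    "\<And>a. a \<in> S \<Longrightarrow> P (frag_of a)"
  shows "P x"
  using assms by (rule free_Abelian_group_induct)

locale presentation =
  fixes S :: "'a set" and R :: "('a \<Rightarrow>\<^sub>0 int) set"
  assumes rels_keys: "r \<in> R \<Longrightarrow> Poly_Mapping.keys r \<subseteq> S"
begin

abbreviation "H \<equiv> generate (free_Abelian_group S) R"
abbreviation "G \<equiv> presented_group S R"
abbreviation "cl \<equiv> coset_of S R"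

lemma subgroup_H: "subgroup H (free_Abelian_group S)"
  by (rule group.generate_is_subgroup) (use rels_keys in auto)

lemma normal_H: "H \<lhd> free_Abelian_group S"
  using subgroup_H by (simp add: comm_group.normal_iff_subgroup[OF abelian_free_Abelian_group])

lemma H_keys: "x \<in> H \<Longrightarrow> Poly_Mapping.keys x \<subseteq> S"
  using subgroup.mem_carrier[OF subgroup_H] by simp

lemma H_zero [simp]: "0 \<in> H"
  using subgroup.one_closed[OF subgroup_H] by simp

lemma H_add: "x \<in> H \<Longrightarrow> y \<in> H \<Longrightarrow> x + y \<in> H"
  using subgroup.m_closed[OF subgroup_H] by simp

lemma H_minus: "x \<in> H \<Longrightarrow> - x \<in> H"
  using subgroup.m_inv_closed[OF subgroup_H] H_keys by fastforce

lemma H_diff: "x \<in> H \<Longrightarrow> y \<in> H \<Longrightarrow> x - y \<in> H"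
  using H_add[of x "- y"] H_minus by simp

lemma H_rel: "r \<in> R \<Longrightarrow> r \<in> H"
  by (rule generate.incl)

lemma H_induct [consumes 1, case_names zero rel diff]:
  assumes "x \<in> H" "P 0" "\<And>r. r \<in> R \<Longrightarrow> P r" "\<And>x y. x \<in> H \<Longrightarrow> y \<in> H \<Longrightarrow> P x \<Longrightarrow> P y \<Longrightarrow> P (x - y)"
  shows "P x"
  using assms(1)
proof induction
  case one then show ?case using assms(2) by simp
next
  case (incl h) then show ?case using assms(3) by simp
next
  case (inv h)
  then show ?case using assms(4)[of 0 h] assms(2,3) rels_keys H_rel by simp
next
  case (eng h k)
  then have "P (h - (0 - k))" using assms(2,4) H_minus by (metis H_zero diff_0)
  then show ?case by simp
qed

lemma cl_def: "cl a = {h + a | h. h \<in> H}"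
  by (auto simp: coset_of_def r_coset_def)

lemma mem_cl_iff: "x \<in> cl a \<longleftrightarrow> x - a \<in> H"
proof
  assume "x - a \<in> H" then show "x \<in> cl a" unfolding cl_def by (intro CollectI exI[where x = "x - a"]) simp
qed (auto simp: cl_def)

lemma self_cl: "a \<in> cl a"
  by (simp add: mem_cl_iff)

lemma cl_keys: assumes "x \<in> cl a" "Poly_Mapping.keys a \<subseteq> S" shows "Poly_Mapping.keys x \<subseteq> S"
proof -
  have "Poly_Mapping.keys ((x - a) + a) \<subseteq> S"
    using H_keys[of "x - a"] assms keys_add[of "x - a" a] unfolding mem_cl_iff by blast
  then show ?thesis by simp
qed

lemma cl_eq_iff: "cl a = cl b \<longleftrightarrow> a - b \<in> H"
proof
  assume "cl a = cl b" then show "a - b \<in> H" using self_cl[of a] mem_cl_iff by simp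
next
  assume ab: "a - b \<in> H"
  then have "x - a \<in> H \<longleftrightarrow> x - b \<in> H" for x
    using H_add[of "x - a" "a - b"] H_diff[of "x - b" "a - b"] by auto
  then show "cl a = cl b" by (auto simp: mem_cl_iff)
qed

lemma carrier_G: "carrier G = cl ` {a. Poly_Mapping.keys a \<subseteq> S}"
  by (auto simp: presented_group_def FactGroup_def RCOSETS_def coset_of_def)

lemma cl_in_G [simp]: "Poly_Mapping.keys a \<subseteq> S \<Longrightarrow> cl a \<in> carrier G"
  by (auto simp: carrier_G)

lemma G_cases: assumes "U \<in> carrier G" obtains a where "Poly_Mapping.keys a \<subseteq> S" "U = cl a"
  using assms by (auto simp: carrier_G)

lemma mult_cl: "\<lbrakk>Poly_Mapping.keys a \<subseteq> S; Poly_Mapping.keys b \<subseteq> S\<rbrakk> \<Longrightarrow> cl a \<otimes>\<^bsub>G\<^esub> cl b = cl (a + b)"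
  using normal.rcos_sum[OF normal_H, of a b] by (simp add: presented_group_def FactGroup_def coset_of_def)

lemma one_G: "\<one>\<^bsub>G\<^esub> = cl 0"
  by (simp add: presented_group_def FactGroup_def cl_def)

lemma comm_group_G: "comm_group G"
proof -
  interpret group G unfolding presented_group_def by (rule normal.factorgroup_is_group[OF normal_H])
  show ?thesis
    by (rule group_comm_groupI) (auto simp: carrier_G mult_cl add.commute)
qed

lemma inv_cl: assumes "Poly_Mapping.keys a \<subseteq> S" shows "inv\<^bsub>G\<^esub> (cl a) = cl (- a)"
proof -
  interpret comm_group G by (rule comm_group_G)
  show ?thesis
    by (rule inv_equality) (use assms in \<open>simp_all add: mult_cl one_G\<close>)
qed

lemma subgroup_eq_G:
  assumes "subgroup K G" "\<And>x. x \<in> S \<Longrightarrow> cl (frag_of x) \<in> K" shows "K = carrier G"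
proof -
  have "cl a \<in> K" if "Poly_Mapping.keys a \<subseteq> S" for a
    using that
  proof (induction a rule: frag_diff_induct)
    case zero then show ?case using subgroup.one_closed[OF assms(1)] by (simp add: one_G)
  next
    case (diff x y)
    then have "cl x \<otimes>\<^bsub>G\<^esub> inv\<^bsub>G\<^esub> cl y \<in> K"
      using subgroup.m_closed[OF assms(1)] subgroup.m_inv_closed[OF assms(1)] by blast
    then show ?case using diff by (simp add: inv_cl mult_cl)
  qed (use assms(2) in auto)
  then show ?thesis using subgroup.subset[OF assms(1)] by (auto simp: carrier_G)
qed

end

text \<open>The additive extension of \<open>w\<close> from generators to the free abelian group,
  with values in the field.\<close>

definition ksum :: "('a \<Rightarrow> 'k :: field) \<Rightarrow> ('a \<Rightarrow>\<^sub>0 int) \<Rightarrow> 'k" where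
  "ksum w a = (\<Sum>x\<in>Poly_Mapping.keys a. of_int (Poly_Mapping.lookup a x) * w x)"

lemma ksum_superset: assumes "finite J" "Poly_Mapping.keys a \<subseteq> J"
  shows "ksum w a = (\<Sum>x\<in>J. of_int (Poly_Mapping.lookup a x) * w x)"
  unfolding ksum_def by (rule sum.mono_neutral_left) (use assms in \<open>auto simp: in_keys_iff\<close>)

lemma ksum_zero [simp]: "ksum w 0 = 0" by (simp add: ksum_def)

lemma ksum_frag_of [simp]: "ksum w (frag_of x) = w x" by (simp add: ksum_def)

lemma ksum_add: "ksum w (a + b) = ksum w a + ksum w b"
proof -
  let ?J = "Poly_Mapping.keys a \<union> Poly_Mapping.keys b"
  have "ksum w (a + b) = (\<Sum>x\<in>?J. of_int (Poly_Mapping.lookup (a + b) x) * w x)"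
    by (rule ksum_superset) (use keys_add[of a b] in auto)
  also have "\<dots> = ksum w a + ksum w b"
    by (simp add: ksum_superset[of ?J] lookup_add sum.distrib algebra_simps)
  finally show ?thesis .
qed

lemma ksum_minus [simp]: "ksum w (- a) = - ksum w a"
  using ksum_add[of w a "- a"] by (simp add: eq_neg_iff_add_eq_0 add.commute)

lemma ksum_diff [simp]: "ksum w (a - b) = ksum w a - ksum w b"
  using ksum_add[of w a "- b"] by simp

lemma ksum_fun_sum: "ksum (\<lambda>x. \<Sum>j\<in>J. w j x * c j) a = (\<Sum>j\<in>J. ksum (w j) a * c j)"
  unfolding ksum_def sum_distrib_left sum_distrib_right
  by (subst sum.swap) (simp add: mult.assoc)

text \<open>Independent of the chosen representative when \<open>ksum w\<close> vanishes on the relations.\<close>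

definition ksumq :: "('a \<Rightarrow> 'k :: field) \<Rightarrow> ('a \<Rightarrow>\<^sub>0 int) set \<Rightarrow> 'k" where
  "ksumq w U = ksum w (SOME a. a \<in> U)"

context presentation
begin

lemma ksum_H: assumes "\<And>r. r \<in> R \<Longrightarrow> ksum w r = 0" "x \<in> H" shows "ksum w x = 0"
  using assms(2) by (induction rule: H_induct) (use assms(1) in auto)

lemma ksum_cl: assumes "\<And>r. r \<in> R \<Longrightarrow> ksum w r = 0" "b \<in> cl a" shows "ksum w b = ksum w a"
  using ksum_H[of w "b - a", OF assms(1)] assms(2) by (simp add: mem_cl_iff)

lemma ksumq_cl: assumes "\<And>r. r \<in> R \<Longrightarrow> ksum w r = 0" shows "ksumq w (cl a) = ksum w a"
  unfolding ksumq_def by (rule ksum_cl[OF assms someI]) (auto intro: self_cl)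

lemma ksumq_mult: assumes "\<And>r. r \<in> R \<Longrightarrow> ksum w r = 0" "U \<in> carrier G" "V \<in> carrier G"
  shows "ksumq w (U \<otimes>\<^bsub>G\<^esub> V) = ksumq w U + ksumq w V"
  using assms(2,3) by (auto simp: carrier_G mult_cl ksumq_cl[OF assms(1)] ksum_add)

end

definition bilin_ext :: "('a \<Rightarrow> 'b \<Rightarrow> 'c) \<Rightarrow> ('a \<Rightarrow>\<^sub>0 int) \<Rightarrow> ('b \<Rightarrow>\<^sub>0 int) \<Rightarrow> ('c \<Rightarrow>\<^sub>0 int)" where
  "bilin_ext m a b = frag_extend (\<lambda>x. frag_extend (\<lambda>y. frag_of (m x y)) b) a"

lemma frag_cmul_diff: "frag_cmul c (x - y) = frag_cmul c x - frag_cmul c y"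
  by (rule poly_mapping_eqI) (simp add: lookup_minus right_diff_distrib)

lemma frag_extend_diff_fun: "frag_extend (\<lambda>x. f x - g x) a = frag_extend f a - frag_extend g a"
  by (simp add: frag_extend_def frag_cmul_diff sum_subtractf)

lemma bilin_ext_diff: "bilin_ext m (a - a') b = bilin_ext m a b - bilin_ext m a' b"
  "bilin_ext m a (b - b') = bilin_ext m a b - bilin_ext m a b'"
  by (simp_all add: bilin_ext_def frag_extend_diff frag_extend_diff_fun)

lemma bilin_ext_0 [simp]: "bilin_ext m 0 b = 0" "bilin_ext m a 0 = 0"
  by (simp_all add: bilin_ext_def frag_extend_eq_0)

lemma bilin_ext_of [simp]: "bilin_ext m (frag_of x) (frag_of y) = frag_of (m x y)"
  by (simp add: bilin_ext_def)

text \<open>The conditions on relations pair a relator in one variable with a single generator in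
  the other; biadditivity extends them to the whole subgroups generated by the relators.\<close>

locale bilinear_presentation =
  P1: presentation S1 R1 + P2: presentation S2 R2 + P: presentation S R
  for S1 :: "'a set" and R1 :: "('a \<Rightarrow>\<^sub>0 int) set" and S2 :: "'b set" and R2 :: "('b \<Rightarrow>\<^sub>0 int) set"
    and S :: "'c set" and R :: "('c \<Rightarrow>\<^sub>0 int) set" +
  fixes m :: "'a \<Rightarrow> 'b \<Rightarrow> 'c"
  assumes m_closed: "x \<in> S1 \<Longrightarrow> y \<in> S2 \<Longrightarrow> m x y \<in> S"
    and rel_left: "r \<in> R1 \<Longrightarrow> y \<in> S2 \<Longrightarrow> bilin_ext m r (frag_of y) \<in> P.H"
    and rel_right: "r' \<in> R2 \<Longrightarrow> x \<in> S1 \<Longrightarrow> bilin_ext m (frag_of x) r' \<in> P.H"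
begin

lemma ext_H_left: assumes "h \<in> P1.H" "Poly_Mapping.keys b \<subseteq> S2" shows "bilin_ext m h b \<in> P.H"
  using assms(2)
proof (induction b rule: frag_diff_induct)
  case (of y)
  show ?case using assms(1)
    by (induction rule: P1.H_induct) (use of rel_left in \<open>auto simp: bilin_ext_diff P.H_diff\<close>)
qed (auto simp: bilin_ext_diff P.H_diff)

lemma ext_H_right: assumes "h \<in> P2.H" "Poly_Mapping.keys a \<subseteq> S1" shows "bilin_ext m a h \<in> P.H"
  using assms(2)
proof (induction a rule: frag_diff_induct)
  case (of y)
  show ?case using assms(1)
    by (induction rule: P2.H_induct) (use of rel_right in \<open>auto simp: bilin_ext_diff P.H_diff\<close>)
qed (auto simp: bilin_ext_diff P.H_diff)

lemma ext_keys: assumes "Poly_Mapping.keys a \<subseteq> S1" "Poly_Mapping.keys b \<subseteq> S2"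
  shows "Poly_Mapping.keys (bilin_ext m a b) \<subseteq> S"
  using assms(1)
proof (induction a rule: frag_diff_induct)
  case (diff x y)
  then show ?case unfolding bilin_ext_diff
    using keys_diff[of "bilin_ext m x b" "bilin_ext m y b"] by blast
next
  case (of x)
  show ?case using assms(2)
  proof (induction b rule: frag_diff_induct)
    case (diff u v)
    then show ?case unfolding bilin_ext_diff
      using keys_diff[of "bilin_ext m (frag_of x) u" "bilin_ext m (frag_of x) v"] by blast
  qed (use of m_closed in auto)
qed simp

text \<open>\<open>quot_bilin\<close> is a union over all representatives. It is a single coset
  because the change of representatives splits into \<open>bilin_ext m (a' - a) b'\<close> and
  \<open>bilin_ext m a (b' - b)\<close>, both in the subgroup of relations.\<close>

lemma quot_bilin_cl:
  assumes "Poly_Mapping.keys a \<subseteq> S1" "Poly_Mapping.keys b \<subseteq> S2"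
  shows "quot_bilin S R m (P1.cl a) (P2.cl b) = P.cl (bilin_ext m a b)"
proof -
  have "P.cl (bilin_ext m a' b') = P.cl (bilin_ext m a b)" if "a' \<in> P1.cl a" "b' \<in> P2.cl b" for a' b'
  proof -
    have "bilin_ext m (a' - a) b' \<in> P.H" "bilin_ext m a (b' - b) \<in> P.H"
      using that assms ext_H_left[of "a' - a" b'] ext_H_right[of "b' - b" a] P2.cl_keys[OF that(2)]
      by (auto simp: P1.mem_cl_iff P2.mem_cl_iff)
    then have "bilin_ext m (a' - a) b' + bilin_ext m a (b' - b) \<in> P.H" by (rule P.H_add)
    then show ?thesis by (simp add: P.cl_eq_iff bilin_ext_diff)
  qed
  moreover have "P1.cl a \<noteq> {}" "P2.cl b \<noteq> {}" using P1.self_cl P2.self_cl by blast+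
  ultimately show ?thesis unfolding quot_bilin_def bilin_ext_def[symmetric] by auto
qed

lemma quot_bilin_closed:
  "U \<in> carrier P1.G \<Longrightarrow> V \<in> carrier P2.G \<Longrightarrow> quot_bilin S R m U V \<in> carrier P.G"
  by (auto simp: P1.carrier_G P2.carrier_G quot_bilin_cl ext_keys)

lemma bilin_ext_add: "bilin_ext m (a + a') b = bilin_ext m a b + bilin_ext m a' b"
  "bilin_ext m a (b + b') = bilin_ext m a b + bilin_ext m a b'"
  using bilin_ext_diff(1)[of m a "0 - a'" b] bilin_ext_diff(1)[of m 0 a' b]
    bilin_ext_diff(2)[of m a b "0 - b'"] bilin_ext_diff(2)[of m a 0 b'] by auto

lemma quot_bilin_mult_left:
  assumes "U \<in> carrier P1.G" "U' \<in> carrier P1.G" "V \<in> carrier P2.G"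
  shows "quot_bilin S R m (U \<otimes>\<^bsub>P1.G\<^esub> U') V = quot_bilin S R m U V \<otimes>\<^bsub>P.G\<^esub> quot_bilin S R m U' V"
proof -
  have "Poly_Mapping.keys (a + a') \<subseteq> S1" if "Poly_Mapping.keys a \<subseteq> S1" "Poly_Mapping.keys a' \<subseteq> S1" for a a' :: "'a \<Rightarrow>\<^sub>0 int"
    using that keys_add[of a a'] by blast
  moreover obtain a a' b where "Poly_Mapping.keys a \<subseteq> S1" "U = P1.cl a" "Poly_Mapping.keys a' \<subseteq> S1" "U' = P1.cl a'"
    "Poly_Mapping.keys b \<subseteq> S2" "V = P2.cl b"
    using assms P1.G_cases P2.G_cases by metis
  ultimately show ?thesis
    by (simp add: P1.mult_cl quot_bilin_cl bilin_ext_add P.mult_cl ext_keys)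
qed

lemma quot_bilin_mult_right:
  assumes "U \<in> carrier P1.G" "V \<in> carrier P2.G" "V' \<in> carrier P2.G"
  shows "quot_bilin S R m U (V \<otimes>\<^bsub>P2.G\<^esub> V') = quot_bilin S R m U V \<otimes>\<^bsub>P.G\<^esub> quot_bilin S R m U V'"
proof -
  have "Poly_Mapping.keys (a + a') \<subseteq> S2" if "Poly_Mapping.keys a \<subseteq> S2" "Poly_Mapping.keys a' \<subseteq> S2" for a a' :: "'b \<Rightarrow>\<^sub>0 int"
    using that keys_add[of a a'] by blast
  moreover obtain a b b' where "Poly_Mapping.keys a \<subseteq> S1" "U = P1.cl a" "Poly_Mapping.keys b \<subseteq> S2" "V = P2.cl b"
    "Poly_Mapping.keys b' \<subseteq> S2" "V' = P2.cl b'"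
    using assms P1.G_cases P2.G_cases by metis
  ultimately show ?thesis
    by (simp add: P2.mult_cl quot_bilin_cl bilin_ext_add P.mult_cl ext_keys)
qed

lemma ksum_bilin_ext:
  assumes "\<And>x y. x \<in> S1 \<Longrightarrow> y \<in> S2 \<Longrightarrow> w (m x y) = (\<Sum>j\<in>J. u j x * v j y)"
    "Poly_Mapping.keys a \<subseteq> S1" "Poly_Mapping.keys b \<subseteq> S2"
  shows "ksum w (bilin_ext m a b) = (\<Sum>j\<in>J. ksum (u j) a * ksum (v j) b)"
  using assms(2)
proof (induction a rule: frag_diff_induct)
  case (diff x y)
  then show ?case by (simp add: bilin_ext_diff sum_subtractf algebra_simps)
next
  case (of x)
  show ?case using assms(3)
  proof (induction b rule: frag_diff_induct)
    case (diff y z)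
    then show ?case by (simp add: bilin_ext_diff sum_subtractf algebra_simps)
  qed (use of assms(1) in auto)
qed simp

text \<open>An identity on generators in the shape of a matrix product passes to the induced map on
  quotients, as both sides are biadditive. Later \<open>J\<close> is a set of simple objects and the
  functionals are multiplicities.\<close>

lemma ksumq_quot_bilin:
  assumes "\<And>x y. x \<in> S1 \<Longrightarrow> y \<in> S2 \<Longrightarrow> w (m x y) = (\<Sum>j\<in>J. u j x * v j y)"
    and "\<And>r. r \<in> R \<Longrightarrow> ksum w r = 0" "\<And>r j. r \<in> R1 \<Longrightarrow> j \<in> J \<Longrightarrow> ksum (u j) r = 0"
    "\<And>r j. r \<in> R2 \<Longrightarrow> j \<in> J \<Longrightarrow> ksum (v j) r = 0"
    and "U \<in> carrier P1.G" "V \<in> carrier P2.G"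
  shows "ksumq w (quot_bilin S R m U V) = (\<Sum>j\<in>J. ksumq (u j) U * ksumq (v j) V)"
proof -
  obtain a b where ab: "Poly_Mapping.keys a \<subseteq> S1" "U = P1.cl a" "Poly_Mapping.keys b \<subseteq> S2" "V = P2.cl b"
    using assms(5,6) P1.G_cases P2.G_cases by metis
  have "ksumq w (quot_bilin S R m U V) = (\<Sum>j\<in>J. ksum (u j) a * ksum (v j) b)"
    using ab ksum_bilin_ext[where w = w and J = J and u = u and v = v, OF assms(1)] by (simp add: quot_bilin_cl P.ksumq_cl[OF assms(2)])
  also have "\<dots> = (\<Sum>j\<in>J. ksumq (u j) U * ksumq (v j) V)"
    unfolding ab(2,4) using P1.ksumq_cl[OF assms(3)] P2.ksumq_cl[OF assms(4)] by (intro sum.cong) auto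
  finally show ?thesis .
qed

end

section \<open>Extension of scalars\<close>

lemma (in comm_group) tensor_presentation: "presentation (tensor_gens G) (tensor_rels G :: ('a \<times> 'k :: field \<Rightarrow>\<^sub>0 int) set)"
proof
  fix r :: "'a \<times> 'k \<Rightarrow>\<^sub>0 int" assume r: "r \<in> tensor_rels G"
  have *: "Poly_Mapping.keys (frag_of x - frag_of y - frag_of z) \<subseteq> T" if "x \<in> T" "y \<in> T" "z \<in> T"
    for x y z :: "'a \<times> 'k" and T
    using that keys_diff[of "frag_of x - frag_of y" "frag_of z"] keys_diff[of "frag_of x" "frag_of y"] by auto
  show "Poly_Mapping.keys r \<subseteq> tensor_gens G"
    using r unfolding tensor_rels_def by (elim UnE CollectE exE conjE) (simp_all only:, (intro *; auto simp: tensor_gens_def)+)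
qed

text \<open>For additive \<open>w\<close>, the map that sends \<open>g \<otimes> k\<close> to
  \<open>k * w g\<close>.\<close>

definition tcoord :: "('g \<Rightarrow> 'k :: field) \<Rightarrow> ('g \<times> 'k \<Rightarrow>\<^sub>0 int) set \<Rightarrow> 'k" where
  "tcoord w = ksumq (\<lambda>(g, k). k * w g)"

context comm_group
begin

abbreviation tcl :: "('a \<times> 'k :: field \<Rightarrow>\<^sub>0 int) \<Rightarrow> _" where "tcl \<equiv> coset_of (tensor_gens G) (tensor_rels G)"

lemma comm_group_tensor: "comm_group (tensor_field G :: ('a \<times> 'k :: field \<Rightarrow>\<^sub>0 int) set monoid)"
  unfolding tensor_field_def using tensor_presentation by (rule presentation.comm_group_G)

lemma tcl_mult_left: assumes "g \<in> carrier G" "h \<in> carrier G"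
  shows "tcl (frag_of (g \<otimes> h, k)) = tcl (frag_of (g, k)) \<otimes>\<^bsub>tensor_field G\<^esub> tcl (frag_of (h, k :: 'k :: field))"
proof -
  interpret T: presentation "tensor_gens G" "tensor_rels G :: ('a \<times> 'k \<Rightarrow>\<^sub>0 int) set" by (rule tensor_presentation)
  have "frag_of (g \<otimes> h, k) - (frag_of (g, k) + frag_of (h, k)) \<in> T.H"
    by (rule T.H_rel) (use assms in \<open>auto simp: tensor_rels_def diff_diff_eq\<close>)
  moreover have "(g, k) \<in> tensor_gens G" "(h, k) \<in> tensor_gens G" using assms by (auto simp: tensor_gens_def)
  ultimately show ?thesis by (simp add: tensor_field_def T.mult_cl T.cl_eq_iff)
qed

lemma tcl_add_right: assumes "g \<in> carrier G"
  shows "tcl (frag_of (g, k + l)) = tcl (frag_of (g, k)) \<otimes>\<^bsub>tensor_field G\<^esub> tcl (frag_of (g, l :: 'k :: field))"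
proof -
  interpret T: presentation "tensor_gens G" "tensor_rels G :: ('a \<times> 'k \<Rightarrow>\<^sub>0 int) set" by (rule tensor_presentation)
  have "frag_of (g, k + l) - (frag_of (g, k) + frag_of (g, l)) \<in> T.H"
    by (rule T.H_rel) (use assms in \<open>auto simp: tensor_rels_def diff_diff_eq\<close>)
  moreover have "(g, k) \<in> tensor_gens G" "(g, l) \<in> tensor_gens G" using assms by (auto simp: tensor_gens_def)
  ultimately show ?thesis by (simp add: tensor_field_def T.mult_cl T.cl_eq_iff)
qed

lemma tcl_closed: "g \<in> carrier G \<Longrightarrow> tcl (frag_of (g, k :: 'k :: field)) \<in> carrier (tensor_field G)"
proof -
  interpret T: presentation "tensor_gens G" "tensor_rels G :: ('a \<times> 'k \<Rightarrow>\<^sub>0 int) set" by (rule tensor_presentation)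
  assume "g \<in> carrier G"
  then have "(g, k) \<in> tensor_gens G" by (simp add: tensor_gens_def)
  then show ?thesis by (simp add: tensor_field_def)
qed

lemma tcl_one: "tcl (frag_of (\<one>, k :: 'k :: field)) = \<one>\<^bsub>tensor_field G\<^esub>"
proof -
  interpret T: comm_group "tensor_field G :: ('a \<times> 'k \<Rightarrow>\<^sub>0 int) set monoid" by (rule comm_group_tensor)
  show ?thesis using tcl_mult_left[of \<one> \<one> k] tcl_closed[of \<one> k] by (metis T.r_cancel_one' one_closed r_one)
qed

lemma tcl_zero: "g \<in> carrier G \<Longrightarrow> tcl (frag_of (g, 0 :: 'k :: field)) = \<one>\<^bsub>tensor_field G\<^esub>"
proof -
  interpret T: comm_group "tensor_field G :: ('a \<times> 'k \<Rightarrow>\<^sub>0 int) set monoid" by (rule comm_group_tensor)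
  show "g \<in> carrier G \<Longrightarrow> ?thesis"
    using tcl_add_right[of g 0 0] tcl_closed[of g 0] by (metis T.r_cancel_one' add_0)
qed

lemma tcl_inv: assumes "g \<in> carrier G"
  shows "tcl (frag_of (inv g, k :: 'k :: field)) = inv\<^bsub>tensor_field G\<^esub> tcl (frag_of (g, k))"
    "tcl (frag_of (g, - k)) = inv\<^bsub>tensor_field G\<^esub> tcl (frag_of (g, k))"
proof -
  interpret T: comm_group "tensor_field G :: ('a \<times> 'k \<Rightarrow>\<^sub>0 int) set monoid" by (rule comm_group_tensor)
  show "tcl (frag_of (inv g, k :: 'k :: field)) = inv\<^bsub>tensor_field G\<^esub> tcl (frag_of (g, k))"
    using tcl_mult_left[of "inv g" g k] assms tcl_one[of k] tcl_closed
    by (intro T.inv_equality[symmetric]) auto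
  show "tcl (frag_of (g, - k)) = inv\<^bsub>tensor_field G\<^esub> tcl (frag_of (g, k))"
    using tcl_add_right[of g "- k" k] assms tcl_zero[of g] tcl_closed
    by (intro T.inv_equality[symmetric]) auto
qed

lemma tensor_rels_ksum:
  assumes "\<And>g h. g \<in> carrier G \<Longrightarrow> h \<in> carrier G \<Longrightarrow> w (g \<otimes> h) = w g + w h" "r \<in> tensor_rels G"
  shows "ksum (\<lambda>(g, k). k * w g) r = (0 :: 'k :: field)"
  using assms by (auto simp: tensor_rels_def distrib_left distrib_right)

lemma tcoord_mult:
  assumes "\<And>g h. g \<in> carrier G \<Longrightarrow> h \<in> carrier G \<Longrightarrow> w (g \<otimes> h) = w g + (w h :: 'k :: field)"
    "U \<in> carrier (tensor_field G)" "V \<in> carrier (tensor_field G)"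
  shows "tcoord w (U \<otimes>\<^bsub>tensor_field G\<^esub> V) = tcoord w U + tcoord w V"
proof -
  interpret T: presentation "tensor_gens G" "tensor_rels G :: ('a \<times> 'k \<Rightarrow>\<^sub>0 int) set" by (rule tensor_presentation)
  show ?thesis unfolding tcoord_def tensor_field_def
    by (rule T.ksumq_mult) (use assms tensor_rels_ksum in \<open>auto simp: tensor_field_def\<close>)
qed

lemma tcoord_tcl:
  assumes "\<And>g h. g \<in> carrier G \<Longrightarrow> h \<in> carrier G \<Longrightarrow> w (g \<otimes> h) = w g + (w h :: 'k :: field)"
  shows "tcoord w (tcl (frag_of (g, k))) = k * w g"
proof -
  interpret T: presentation "tensor_gens G" "tensor_rels G :: ('a \<times> 'k \<Rightarrow>\<^sub>0 int) set" by (rule tensor_presentation)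
  show ?thesis unfolding tcoord_def
    by (subst T.ksumq_cl) (use assms tensor_rels_ksum in auto)
qed

lemma tensor_subgroup_eq:
  assumes "subgroup K (tensor_field G :: ('a \<times> 'k :: field \<Rightarrow>\<^sub>0 int) set monoid)"
    "\<And>g k. g \<in> carrier G \<Longrightarrow> tcl (frag_of (g, k)) \<in> K"
  shows "K = carrier (tensor_field G)"
proof -
  interpret T: presentation "tensor_gens G" "tensor_rels G :: ('a \<times> 'k \<Rightarrow>\<^sub>0 int) set" by (rule tensor_presentation)
  show ?thesis using assms unfolding tensor_field_def
    by (intro T.subgroup_eq_G) (auto simp: tensor_gens_def)
qed

text \<open>The elements \<open>e i\<close> generate the group and the functionals
  \<open>w i\<close> are dual to them. Hence every tensor is a sum of the
  \<open>e i \<otimes> y i\<close>, written \<open>\<sigma> y\<close>, and the coefficients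
  \<open>y i\<close> are recovered by the functionals.\<close>

lemma tensor_coordinates:
  fixes w :: "'i \<Rightarrow> 'a \<Rightarrow> 'k :: field"
  assumes fin: "finite I" and e: "\<And>i. i \<in> I \<Longrightarrow> e i \<in> carrier G"
    and w: "\<And>i g h. i \<in> I \<Longrightarrow> g \<in> carrier G \<Longrightarrow> h \<in> carrier G \<Longrightarrow> w i (g \<otimes> h) = w i g + w i h"
    and we: "\<And>i j. i \<in> I \<Longrightarrow> j \<in> I \<Longrightarrow> w i (e j) = (if i = j then 1 else 0)"
    and gen: "\<And>K. subgroup K G \<Longrightarrow> e ` I \<subseteq> K \<Longrightarrow> K = carrier G"
  shows "\<exists>!U. U \<in> carrier (tensor_field G) \<and> (\<forall>i\<in>I. tcoord (w i) U = x i)"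
proof -
  interpret T: comm_group "tensor_field G :: ('a \<times> 'k \<Rightarrow>\<^sub>0 int) set monoid" by (rule comm_group_tensor)
  define \<sigma> where "\<sigma> = (\<lambda>y. finprod (tensor_field G) (\<lambda>i. tcl (frag_of (e i, y i :: 'k))) I)"
  have cl: "(\<lambda>i. tcl (frag_of (e i, y i :: 'k))) \<in> I \<rightarrow> carrier (tensor_field G)" for y
    using e tcl_closed by auto
  have tc: "tcl (frag_of (e i, k)) \<in> carrier (tensor_field G)"
    and tz: "tcl (frag_of (e i, 0 :: 'k)) = \<one>\<^bsub>tensor_field G\<^esub>" if "i \<in> I" for i and k :: 'k
    using e[OF that] tcl_closed tcl_zero by auto
  have t1: "tcl (frag_of (\<one>, k)) = \<one>\<^bsub>tensor_field G\<^esub>" for k :: 'k by (rule tcl_one)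
  have \<sigma>_closed: "\<sigma> y \<in> carrier (tensor_field G)" for y
    unfolding \<sigma>_def by (rule T.finprod_closed[OF cl])
  have \<sigma>_mult: "\<sigma> y \<otimes>\<^bsub>tensor_field G\<^esub> \<sigma> z = \<sigma> (\<lambda>i. y i + z i)" for y z
  proof -
    have "\<sigma> (\<lambda>i. y i + z i) = finprod (tensor_field G)
        (\<lambda>i. tcl (frag_of (e i, y i)) \<otimes>\<^bsub>tensor_field G\<^esub> tcl (frag_of (e i, z i))) I"
      unfolding \<sigma>_def using e tcl_closed by (intro T.finprod_cong') (auto simp: tcl_add_right)
    also have "\<dots> = \<sigma> y \<otimes>\<^bsub>tensor_field G\<^esub> \<sigma> z"
      unfolding \<sigma>_def by (rule T.finprod_multf[OF cl cl])
    finally show ?thesis by simp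
  qed
  have \<sigma>_zero: "\<sigma> (\<lambda>i. 0) = \<one>\<^bsub>tensor_field G\<^esub>"
    unfolding \<sigma>_def by (rule T.finprod_one_eqI) (use tz in auto)
  have \<sigma>_inv: "inv\<^bsub>tensor_field G\<^esub> \<sigma> y = \<sigma> (\<lambda>i. - y i)" for y
    by (rule T.inv_equality) (simp_all add: \<sigma>_mult \<sigma>_zero \<sigma>_closed)
  have \<sigma>_single: "\<sigma> (\<lambda>j. if j = i then k else 0) = tcl (frag_of (e i, k))" if i: "i \<in> I" for i and k :: 'k
  proof -
    have "\<sigma> (\<lambda>j. if j = i then k else 0) =
        finprod (tensor_field G) (\<lambda>j. if i = j then tcl (frag_of (e j, k)) else \<one>\<^bsub>tensor_field G\<^esub>) I"
      unfolding \<sigma>_def by (rule T.finprod_cong') (use tc tz in auto)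
    also have "\<dots> = tcl (frag_of (e i, k))"
      by (rule T.finprod_singleton[OF i fin]) (use tc in auto)
    finally show ?thesis .
  qed
  have "range \<sigma> = carrier (tensor_field G)"
  proof (rule tensor_subgroup_eq)
    show sub: "subgroup (range \<sigma>) (tensor_field G)"
      by (rule T.subgroupI) (use \<sigma>_closed \<sigma>_inv \<sigma>_mult in auto)
    \<comment> \<open>To reach all pure tensors, collect those \<open>g\<close> whose tensors with
      every scalar lie in the range of \<open>\<sigma>\<close>. They form a subgroup that contains
      the generators.\<close>
    define K where "K = {g \<in> carrier G. \<forall>k. tcl (frag_of (g, k :: 'k)) \<in> range \<sigma>}"
    have "subgroup K G"
    proof (rule subgroupI)
      have "\<one>\<^bsub>tensor_field G\<^esub> \<in> range \<sigma>" using \<sigma>_zero by (metis rangeI)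
      then have "\<one> \<in> K" unfolding K_def by (simp add: t1)
      then show "K \<noteq> {}" by blast
      fix a assume "a \<in> K" then show "inv a \<in> K"
        using subgroup.m_inv_closed[OF sub] by (auto simp: K_def tcl_inv(1))
    next
      fix a b assume "a \<in> K" "b \<in> K" then show "a \<otimes> b \<in> K"
        using subgroup.m_closed[OF sub] by (simp add: K_def tcl_mult_left)
    qed (auto simp: K_def)
    moreover have "e ` I \<subseteq> K" unfolding K_def using e \<sigma>_single by auto (metis rangeI)
    ultimately have "K = carrier G" by (rule gen)
    then show "tcl (frag_of (g, k)) \<in> range \<sigma>" if "g \<in> carrier G" for g k
      using that unfolding K_def by blast
  qed
  moreover have coord: "tcoord (w i) (\<sigma> y) = y i" if i: "i \<in> I" for i y
  proof -
    have add: "tcoord (w i) (U \<otimes>\<^bsub>tensor_field G\<^esub> V) = tcoord (w i) U + tcoord (w i) V"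
      if "U \<in> carrier (tensor_field G)" "V \<in> carrier (tensor_field G)" for U V
      using that w[OF i] by (intro tcoord_mult) auto
    have "tcoord (w i) (finprod (tensor_field G) (\<lambda>i. tcl (frag_of (e i, y i :: 'k))) J)
       = (\<Sum>j\<in>J. y j * w i (e j))" if "J \<subseteq> I" for J
      using finite_subset[OF that fin] that
    proof (induction J rule: finite_induct)
      case empty
      have "tcoord (w i) \<one>\<^bsub>tensor_field G\<^esub> = 0"
        using add[of "\<one>\<^bsub>tensor_field G\<^esub>" "\<one>\<^bsub>tensor_field G\<^esub>"]
        by (metis T.one_closed T.r_one add_cancel_right_right)
      then show ?case by simp
    next
      case (insert j J)
      then show ?case
        using cl[of y] by (subst T.finprod_insert) (auto simp: add Pi_def subset_iff T.finprod_closed tcoord_tcl[OF w[OF i]])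
    qed
    from this[of I] show ?thesis unfolding \<sigma>_def using i we fin by (simp add: if_distrib sum.delta cong: if_cong)
  qed
  have "U = \<sigma> x" if U: "U \<in> carrier (tensor_field G)" "\<forall>i\<in>I. tcoord (w i) U = x i" for U
  proof -
    obtain y where "U = \<sigma> y" using calculation U(1) by blast
    then have "\<forall>i\<in>I. x i = y i" using U(2) coord by auto
    then show ?thesis unfolding \<open>U = \<sigma> y\<close> \<sigma>_def by (intro T.finprod_cong') (use tc in auto)
  qed
  then show ?thesis
    by (intro ex1I[where a = "\<sigma> x"]) (simp_all add: \<sigma>_closed coord)
qed

end

text \<open>A relator in one variable paired with a pure tensor in the other is again a relator, by
  biadditivity of \<open>\<beta>\<close> for the first kind of relator and by distributivity in the
  field for the second.\<close>

lemma tensor_bilinear: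
  fixes G1 :: "'a monoid" and G2 :: "'b monoid" and G3 :: "'c monoid"
  assumes G: "comm_group G1" "comm_group G2" "comm_group G3"
    and closed: "\<And>g h. g \<in> carrier G1 \<Longrightarrow> h \<in> carrier G2 \<Longrightarrow> \<beta> g h \<in> carrier G3"
    and left: "\<And>g g' h. g \<in> carrier G1 \<Longrightarrow> g' \<in> carrier G1 \<Longrightarrow> h \<in> carrier G2 \<Longrightarrow> \<beta> (g \<otimes>\<^bsub>G1\<^esub> g') h = \<beta> g h \<otimes>\<^bsub>G3\<^esub> \<beta> g' h"
    and right: "\<And>g h h'. g \<in> carrier G1 \<Longrightarrow> h \<in> carrier G2 \<Longrightarrow> h' \<in> carrier G2 \<Longrightarrow> \<beta> g (h \<otimes>\<^bsub>G2\<^esub> h') = \<beta> g h \<otimes>\<^bsub>G3\<^esub> \<beta> g h'"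
  shows "bilinear_presentation (tensor_gens G1) (tensor_rels G1) (tensor_gens G2) (tensor_rels G2)
    (tensor_gens G3) (tensor_rels G3 :: ('c \<times> 'k :: field \<Rightarrow>\<^sub>0 int) set) (\<lambda>(g, k) (h, l). (\<beta> g h, k * l))"
proof -
  interpret T1: presentation "tensor_gens G1" "tensor_rels G1 :: ('a \<times> 'k \<Rightarrow>\<^sub>0 int) set" using G(1) by (rule comm_group.tensor_presentation)
  interpret T2: presentation "tensor_gens G2" "tensor_rels G2 :: ('b \<times> 'k \<Rightarrow>\<^sub>0 int) set" using G(2) by (rule comm_group.tensor_presentation)
  interpret T3: presentation "tensor_gens G3" "tensor_rels G3 :: ('c \<times> 'k \<Rightarrow>\<^sub>0 int) set" using G(3) by (rule comm_group.tensor_presentation)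
  let ?m = "\<lambda>(g, k) (h, l). (\<beta> g h, k * l :: 'k)"
  show ?thesis
  proof
    fix x :: "'a \<times> 'k" and y :: "'b \<times> 'k" assume "x \<in> tensor_gens G1" "y \<in> tensor_gens G2"
    then show "?m x y \<in> tensor_gens G3" by (auto simp: tensor_gens_def closed)
  next
    fix r :: "'a \<times> 'k \<Rightarrow>\<^sub>0 int" and y :: "'b \<times> 'k" assume r: "r \<in> tensor_rels G1" and y: "y \<in> tensor_gens G2"
    obtain h l where y': "y = (h, l)" "h \<in> carrier G2" using y by (auto simp: tensor_gens_def)
    have "bilin_ext ?m r (frag_of y) \<in> tensor_rels G3"
      using r unfolding tensor_rels_def
    proof (elim UnE CollectE exE conjE)
      fix g g' k assume g: "r = frag_of (g \<otimes>\<^bsub>G1\<^esub> g', k) - frag_of (g, k) - frag_of (g', k)" "g \<in> carrier G1" "g' \<in> carrier G1"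
      then have "bilin_ext ?m r (frag_of y) = frag_of (\<beta> g h \<otimes>\<^bsub>G3\<^esub> \<beta> g' h, k * l) - frag_of (\<beta> g h, k * l) - frag_of (\<beta> g' h, k * l)"
        using y' by (simp add: bilin_ext_diff left)
      then show "bilin_ext ?m r (frag_of y) \<in> {frag_of (g \<otimes>\<^bsub>G3\<^esub> h, k) - frag_of (g, k) - frag_of (h, k) | g h k. g \<in> carrier G3 \<and> h \<in> carrier G3} \<union>
         {frag_of (g, k + l) - frag_of (g, k) - frag_of (g, l) | g k l. g \<in> carrier G3}"
        using g y' closed by blast
    next
      fix g k k' assume g: "r = frag_of (g, k + k') - frag_of (g, k) - frag_of (g, k')" "g \<in> carrier G1"
      then have "bilin_ext ?m r (frag_of y) = frag_of (\<beta> g h, k * l + k' * l) - frag_of (\<beta> g h, k * l) - frag_of (\<beta> g h, k' * l)"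
        using y' by (simp add: bilin_ext_diff distrib_right)
      then show "bilin_ext ?m r (frag_of y) \<in> {frag_of (g \<otimes>\<^bsub>G3\<^esub> h, k) - frag_of (g, k) - frag_of (h, k) | g h k. g \<in> carrier G3 \<and> h \<in> carrier G3} \<union>
         {frag_of (g, k + l) - frag_of (g, k) - frag_of (g, l) | g k l. g \<in> carrier G3}"
        using g y' closed by blast
    qed
    then show "bilin_ext ?m r (frag_of y) \<in> T3.H" by (rule T3.H_rel)
  next
    fix r :: "'b \<times> 'k \<Rightarrow>\<^sub>0 int" and x :: "'a \<times> 'k" assume r: "r \<in> tensor_rels G2" and x: "x \<in> tensor_gens G1"
    obtain g k where x': "x = (g, k)" "g \<in> carrier G1" using x by (auto simp: tensor_gens_def)
    have "bilin_ext ?m (frag_of x) r \<in> tensor_rels G3"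
      using r unfolding tensor_rels_def
    proof (elim UnE CollectE exE conjE)
      fix h h' l assume h: "r = frag_of (h \<otimes>\<^bsub>G2\<^esub> h', l) - frag_of (h, l) - frag_of (h', l)" "h \<in> carrier G2" "h' \<in> carrier G2"
      then have "bilin_ext ?m (frag_of x) r = frag_of (\<beta> g h \<otimes>\<^bsub>G3\<^esub> \<beta> g h', k * l) - frag_of (\<beta> g h, k * l) - frag_of (\<beta> g h', k * l)"
        using x' by (simp add: bilin_ext_diff right)
      then show "bilin_ext ?m (frag_of x) r \<in> {frag_of (g \<otimes>\<^bsub>G3\<^esub> h, k) - frag_of (g, k) - frag_of (h, k) | g h k. g \<in> carrier G3 \<and> h \<in> carrier G3} \<union>
         {frag_of (g, k + l) - frag_of (g, k) - frag_of (g, l) | g k l. g \<in> carrier G3}"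
        using h x' closed by blast
    next
      fix h l l' assume h: "r = frag_of (h, l + l') - frag_of (h, l) - frag_of (h, l')" "h \<in> carrier G2"
      then have "bilin_ext ?m (frag_of x) r = frag_of (\<beta> g h, k * l + k * l') - frag_of (\<beta> g h, k * l) - frag_of (\<beta> g h, k * l')"
        using x' by (simp add: bilin_ext_diff distrib_left)
      then show "bilin_ext ?m (frag_of x) r \<in> {frag_of (g \<otimes>\<^bsub>G3\<^esub> h, k) - frag_of (g, k) - frag_of (h, k) | g h k. g \<in> carrier G3 \<and> h \<in> carrier G3} \<union>
         {frag_of (g, k + l) - frag_of (g, k) - frag_of (g, l) | g k l. g \<in> carrier G3}"
        using h x' closed by blast
    qed
    then show "bilin_ext ?m (frag_of x) r \<in> T3.H" by (rule T3.H_rel)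
  qed
qed

section \<open>Multiplicities in semisimple categories\<close>

locale semisimple_reps = finite_semisimple_category C
  for C :: "('o, 'm, 'k :: alg_closed_field, 'z) lincat_scheme" (structure) +
  fixes I :: "'o set"
  assumes finite_I: "finite I"
    and simple_I: "i \<in> I \<Longrightarrow> simple_ob C i"
    and I_unique: "\<lbrakk>i \<in> I; j \<in> I; iso_obs C i j\<rbrakk> \<Longrightarrow> i = j"
    and I_cover: "simple_ob C S \<Longrightarrow> \<exists>i \<in> I. iso_obs C S i"

text \<open>\<open>rep\<close> is chosen by a predicate that depends on the isomorphism class only,
  so isomorphic objects have equal representatives. Finiteness follows, since each representative is
  that of some element of \<open>T\<close>.\<close>

lemma (in finite_semisimple_category) simple_reps_exist:
  "\<exists>I. finite I \<and> (\<forall>i\<in>I. simple_ob C i) \<and> (\<forall>i\<in>I. \<forall>j\<in>I. iso_obs C i j \<longrightarrow> i = j) \<and>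
     (\<forall>S. simple_ob C S \<longrightarrow> (\<exists>i\<in>I. iso_obs C S i))"
proof -
  obtain T where T: "finite T" "\<And>S. simple_ob C S \<Longrightarrow> \<exists>S'\<in>T. iso_obs C S S'"
    using finitely_many_simples by auto
  define rep where "rep t = (SOME i. simple_ob C i \<and> iso_obs C i t)" for t
  have refl: "iso_obs C S S" if "simple_ob C S" for S
    using that by (auto simp: simple_ob_def Hom_iff intro!: iso_obsI[of "Id C S"])
  have rep: "simple_ob C (rep S)" "iso_obs C (rep S) S" if "simple_ob C S" for S
    using someI[of "\<lambda>i. simple_ob C i \<and> iso_obs C i S" S] refl[OF that] that unfolding rep_def by simp_all
  have cong: "rep S = rep S'" if "iso_obs C S S'" for S S'
  proof -
    have "iso_obs C i S \<longleftrightarrow> iso_obs C i S'" for i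
      using iso_obs_trans[OF _ that, of i] iso_obs_trans[OF _ iso_obs_sym[OF that], of i] by (rule iffI)
    then show ?thesis unfolding rep_def by simp
  qed
  show ?thesis
  proof (intro exI[where x = "rep ` {S. simple_ob C S}"] conjI ballI allI impI)
    have "rep S \<in> rep ` T" if S: "simple_ob C S" for S
    proof -
      obtain t where t: "t \<in> T" "iso_obs C S t" using T(2)[OF S] by blast
      from cong[OF t(2)] t(1) show ?thesis by simp
    qed
    then have "rep ` {S. simple_ob C S} \<subseteq> rep ` T" by (intro image_subsetI) simp
    then show "finite (rep ` {S. simple_ob C S})"
      by (rule finite_subset) (rule finite_imageI[OF T(1)])
  next
    fix i assume "i \<in> rep ` {S. simple_ob C S}"
    then show "simple_ob C i" using rep(1) by (elim imageE) simp
  next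
    fix i j assume "i \<in> rep ` {S. simple_ob C S}" "j \<in> rep ` {S. simple_ob C S}" and ij: "iso_obs C i j"
    then obtain S S' where S: "simple_ob C S" "i = rep S" "simple_ob C S'" "j = rep S'" by (elim imageE) simp
    have "iso_obs C S S'"
      using iso_obs_trans[OF iso_obs_sym[OF rep(2)[OF S(1)]] iso_obs_trans[OF _ rep(2)[OF S(3)]]] ij S by simp
    then show "i = j" using cong S by simp
  next
    fix S assume S: "simple_ob C S"
    show "\<exists>i\<in>rep ` {S. simple_ob C S}. iso_obs C S i"
      by (rule bexI[where x = "rep S"]) (use iso_obs_sym[OF rep(2)[OF S]] S in simp_all)
  qed
qed

lemma (in lin_category) Scale_eq_iff: assumes "f \<in> Ar C" "f \<noteq> Zero C (Dom C f) (Cod C f)"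
  shows "Scale C k f = Scale C l f \<longleftrightarrow> k = l"
proof
  assume eq: "Scale C k f = Scale C l f"
  show "k = l"
  proof (rule ccontr)
    assume "k \<noteq> l"
    have "Scale C (k - l) f = Add C (Scale C k f) (Scale C (- l) f)"
      using Scale_add[OF assms(1), of k "- l"] by simp
    also have "\<dots> = Add C (Scale C l f) (Scale C (- l) f)" by (simp only: eq)
    also have "\<dots> = Scale C (l + - l) f" by (rule Scale_add[OF assms(1), symmetric])
    finally have z: "Scale C (k - l) f = Zero C (Dom C f) (Cod C f)" using assms(1) by simp
    have "f = Scale C (inverse (k - l)) (Scale C (k - l) f)"
      using assms(1) \<open>k \<noteq> l\<close> by simp
    also have "\<dots> = Zero C (Dom C f) (Cod C f)"
      unfolding z using assms(1) by (intro Scale_Zero) auto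
    finally show False using assms(2) by simp
  qed
qed simp

section \<open>Polynomials in an endomorphism\<close>

context lin_category
begin

text \<open>The value of the polynomial \<open>p\<close> at the endomorphism \<open>f\<close>, by
  Horner's scheme.\<close>

definition end_poly :: "'m \<Rightarrow> 'k poly \<Rightarrow> 'm" where
  "end_poly f p = fold_coeffs (\<lambda>a g. Add C (Scale C a (Id C (Dom C f))) (f \<bullet> g)) p (Zero C (Dom C f) (Dom C f))"

context
  fixes f A assumes f: "f \<in> Hom C A A"
begin

private lemma fA: "f \<in> Ar C" "Dom C f = A" "Cod C f = A" "A \<in> Ob C"
  using f HomD(4)[OF f] by (auto simp: Hom_iff)

lemma end_poly_0: "end_poly f 0 = Zero C A A"
  by (simp add: end_poly_def fA)

lemma end_poly_pCons: "end_poly f (pCons a p) = Add C (Scale C a (Id C A)) (f \<bullet> end_poly f p)"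
  by (cases "p = 0 \<and> a = 0") (auto simp: end_poly_def fA)

lemma end_poly_simps: "end_poly f p \<in> Ar C" "Dom C (end_poly f p) = A" "Cod C (end_poly f p) = A"
  by (induction p) (auto simp: fA end_poly_0 end_poly_pCons)

lemma end_poly_smult: "end_poly f (smult c p) = Scale C c (end_poly f p)"
  by (induction p) (auto simp: Scale_Add fA end_poly_0 end_poly_pCons end_poly_simps)

lemma end_poly_add: "end_poly f (p + q) = Add C (end_poly f p) (end_poly f q)"
proof (induction p q rule: poly_induct2)
  case (pCons a p b q)
  note [simp] = fA end_poly_simps end_poly_pCons
  let ?a = "Scale C a (Id C A)" and ?b = "Scale C b (Id C A)" and ?p = "f \<bullet> end_poly f p" and ?q = "f \<bullet> end_poly f q"
  have "Add C (Add C ?a ?b) (Add C ?p ?q) = Add C ?a (Add C (Add C ?b ?p) ?q)"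
    by (simp add: Add_assoc)
  also have "Add C ?b ?p = Add C ?p ?b" by (rule Add_simps(4)) simp_all
  also have "Add C ?a (Add C (Add C ?p ?b) ?q) = Add C (Add C ?a ?p) (Add C ?b ?q)"
    by (simp add: Add_assoc)
  finally show ?case using pCons by (simp add: Scale_add)
qed (simp add: fA end_poly_0)

end

end

lemma (in lin_category) lincomb_simps:
  fixes Q :: "'m set" and c d :: "'m \<Rightarrow> 'k"
  assumes Q: "finite Q" "Q \<subseteq> Hom C A B" and AB: "A \<in> Ob C" "B \<in> Ob C"
  defines "L \<equiv> \<lambda>c. finsum (hom_space C A B) (\<lambda>s. Scale C (c s) s) Q"
  shows "L (\<lambda>s. c s + d s) = Add C (L c) (L d)" "L (\<lambda>s. k * c s) = Scale C k (L c)"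
    "L (\<lambda>s. 0) = Zero C A B" "(\<And>s. s \<in> Q \<Longrightarrow> c s = d s) \<Longrightarrow> L c = L d"
proof -
  have QH: "s \<in> Hom C A B" if "s \<in> Q" for s using subsetD[OF Q(2) that] .
  have QS: "Scale C k s \<in> Hom C A B" if "s \<in> Q" for s k
    using QH[OF that] by (simp add: Hom_iff)
  have QA: "Scale C (k + l) s = Add C (Scale C k s) (Scale C l s)" "Scale C k (Scale C l s) = Scale C (k * l) s"
     "Scale C 0 s = Zero C A B" if "s \<in> Q" for s k l
    using QH[OF that] by (simp_all add: Hom_iff Scale_add)
  interpret M: module "ring_of_type_algebra :: 'k ring" "hom_space C A B" by (rule hom_module) (fact AB)+
  have cl: "(\<lambda>s. Scale C (c s) s) \<in> Q \<rightarrow> carrier (hom_space C A B)" for c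
    using QS by (intro funcsetI) (simp only: hom_space_simps)
  have cong: "finsum (hom_space C A B) g Q = finsum (hom_space C A B) h Q"
    if "\<And>s. s \<in> Q \<Longrightarrow> g s = h s" "h \<in> Q \<rightarrow> carrier (hom_space C A B)" for g h
    by (rule M.finsum_cong'[OF refl that(2,1)])
  have cl': "(\<lambda>s. Scale C (c s) s \<oplus>\<^bsub>hom_space C A B\<^esub> Scale C (d s) s) \<in> Q \<rightarrow> carrier (hom_space C A B)"
    using cl[of c] cl[of d] by (intro funcsetI M.add.m_closed) (auto dest: funcset_mem)
  have "L (\<lambda>s. c s + d s) = finsum (hom_space C A B) (\<lambda>s. Scale C (c s) s \<oplus>\<^bsub>hom_space C A B\<^esub> Scale C (d s) s) Q"
    unfolding L_def by (rule cong[OF _ cl']) (simp only: QA hom_space_simps)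
  also have "\<dots> = Add C (L c) (L d)"
    unfolding L_def using M.finsum_addf[OF cl cl, of c d] by (simp only: hom_space_simps)
  finally show "L (\<lambda>s. c s + d s) = Add C (L c) (L d)" .
  have cl'': "(\<lambda>s. k \<odot>\<^bsub>hom_space C A B\<^esub> Scale C (c s) s) \<in> Q \<rightarrow> carrier (hom_space C A B)"
    using cl[of c] by (intro funcsetI M.smult_closed) (auto dest: funcset_mem)
  have "L (\<lambda>s. k * c s) = finsum (hom_space C A B) (\<lambda>s. k \<odot>\<^bsub>hom_space C A B\<^esub> Scale C (c s) s) Q"
    unfolding L_def by (rule cong[OF _ cl'']) (simp only: QA hom_space_simps)
  also have "\<dots> = Scale C k (L c)"
    unfolding L_def using M.finsum_smult_ldistr[OF Q(1) _ cl, of k c] by (simp only: hom_space_simps ring_of_type_algebra_simps UNIV_I)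
  finally show "L (\<lambda>s. k * c s) = Scale C k (L c)" .
  have "L (\<lambda>s. 0) = finsum (hom_space C A B) (\<lambda>s. \<zero>\<^bsub>hom_space C A B\<^esub>) Q"
    unfolding L_def by (rule cong) (simp_all only: QA hom_space_simps, simp add: Pi_def Hom_iff AB)
  then show "L (\<lambda>s. 0) = Zero C A B" using M.finsum_zero[of Q] by (simp only: hom_space_simps)
  show "L c = L d" if "\<And>s. s \<in> Q \<Longrightarrow> c s = d s"
    unfolding L_def by (rule cong[OF _ cl]) (simp only: that)
qed

text \<open>The endomorphisms of \<open>S\<close> are spanned by a finite set \<open>Q\<close>, so
  sufficiently many powers of \<open>f\<close> are linearly dependent; the coefficients of the
  dependence form the polynomial.\<close>

lemma (in finite_semisimple_category) end_poly_annihilator: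
  assumes f: "f \<in> Hom C S S"
  shows "\<exists>p. p \<noteq> 0 \<and> end_poly f p = Zero C S S"
proof -
  have S [simp]: "S \<in> Ob C" using HomD(4)[OF f] .
  obtain Q where "Q \<subseteq> Hom C S S \<and> finite Q \<and>
      (\<forall>f \<in> Hom C S S. \<exists>c. f = finsum (hom_space C S S) (\<lambda>s. Scale C (c s) s) Q)"
    using finite_dim[OF S S, unfolded fin_dim_hom_def] by (rule exE)
  then have Q: "Q \<subseteq> Hom C S S" "finite Q"
    "\<And>g. g \<in> Hom C S S \<Longrightarrow> \<exists>c. g = finsum (hom_space C S S) (\<lambda>s. Scale C (c s) s) Q"
    by simp_all
  let ?L = "\<lambda>c. finsum (hom_space C S S) (\<lambda>s. Scale C (c s) s) Q"
  note L = lincomb_simps[OF Q(2,1) S S]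
  have "\<forall>n. \<exists>c. end_poly f (monom 1 n) = ?L c"
    using Q(3) f end_poly_simps[OF f] by (simp add: Hom_iff)
  then obtain a where a: "\<And>n. end_poly f (monom 1 n) = ?L (a n)" by metis
  \<comment> \<open>The exponents \<open>{..card Q}\<close> are \<open>card Q + 1\<close> in number:
    one more unknown than there are equations.\<close>
  obtain c where c: "\<exists>j\<in>{..card Q}. c j \<noteq> 0" "\<forall>s\<in>Q. (\<Sum>j\<in>{..card Q}. c j * a j s) = 0"
    using homogeneous_system_nontrivial[OF Q(2), of "{..card Q}" a] by (metis card_atMost finite_atMost lessI)
  define p where "p = (\<Sum>j\<in>{..card Q}. monom (c j) j)"
  have "end_poly f (\<Sum>j\<in>J. monom (c j) j) = ?L (\<lambda>s. \<Sum>j\<in>J. c j * a j s)" if "finite J" for J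
    using that
  proof (induction J rule: finite_induct)
    case empty
    show ?case using L(3) end_poly_0[OF f] by simp
  next
    case (insert j J)
    have "monom (c j) j = smult (c j) (monom 1 j)" by (simp add: smult_monom)
    then have "end_poly f (monom (c j) j) = ?L (\<lambda>s. c j * a j s)"
      by (simp only: end_poly_smult[OF f] a L(2))
    then show ?case using insert by (simp add: end_poly_add[OF f] L(1))
  qed
  then have "end_poly f p = ?L (\<lambda>s. \<Sum>j\<in>{..card Q}. c j * a j s)" unfolding p_def by blast
  also have "\<dots> = ?L (\<lambda>s. 0)"
    by (rule L(4)) (use c(2) in simp)
  finally have "end_poly f p = Zero C S S" using L(3) by simp
  moreover have "p \<noteq> 0"
  proof
    assume "p = 0"
    obtain j where j: "j \<in> {..card Q}" "c j \<noteq> 0" using c(1) by blast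
    have "coeff p j = (\<Sum>i\<in>{..card Q}. if i = j then c i else 0)"
      unfolding p_def by (simp add: coeff_sum)
    also have "\<dots> = c j" using j by simp
    finally show False using j \<open>p = 0\<close> by simp
  qed
  ultimately show ?thesis by blast
qed

section \<open>Schur's lemma, decompositions and multiplicities\<close>

context semisimple_reps
begin

text \<open>Schur's lemma: a nonzero polynomial of minimal degree annihilating \<open>f\<close> has a root \<open>k\<close>, and
  then \<open>f - k\<close> is not invertible.\<close>

lemma schur_scalar:
  assumes S: "simple_ob C S" and f: "f \<in> Hom C S S"
  shows "\<exists>k. f = Scale C k (Id C S)"
proof -
  have f' [simp]: "f \<in> Ar C" "Dom C f = S" "Cod C f = S" "S \<in> Ob C" 
    using f HomD(4)[OF f] by (auto simp: Hom_iff)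
  obtain p where p: "p \<noteq> 0" "end_poly f p = Zero C S S"
     and min: "\<And>q. q \<noteq> 0 \<Longrightarrow> end_poly f q = Zero C S S \<Longrightarrow> degree p \<le> degree q"
    using ex_has_least_nat[of "\<lambda>p. p \<noteq> 0 \<and> end_poly f p = Zero C S S" _ degree] end_poly_annihilator[OF f]
    by blast
  have nz: "Id C S \<noteq> Zero C S S" using S zero_ob_iff unfolding simple_ob_def by auto
  have "degree p > 0"
  proof (rule ccontr)
    assume "\<not> 0 < degree p"
    then obtain c where c: "p = [:c:]" by (metis degree_eq_zeroE gr0I)
    then have "Scale C c (Id C S) = Scale C 0 (Id C S)" using p(2) end_poly_pCons[OF f, of c 0] end_poly_0[OF f] by simp
    then have "c = 0" using Scale_eq_iff[of "Id C S" c 0] nz by simp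
    then show False using c p(1) by simp
  qed
  then obtain k where "poly p k = 0" using alg_closed_imp_poly_has_root by blast
  then obtain q where q: "p = [:- k, 1:] * q" by (meson dvdE poly_eq_0_iff_dvd)
  have q0: "q \<noteq> 0" using p(1) q by auto
  let ?g = "Add C f (Scale C (- k) (Id C S))"
  have "degree p = Suc (degree q)" unfolding q using q0 by (subst degree_mult_eq) auto
  then have qn: "end_poly f q \<noteq> Zero C S S" using min[OF q0] by auto
  note es [simp] = end_poly_simps[OF f] 
  have "p = smult (- k) q + pCons 0 q" unfolding q by simp
  then have "end_poly f p = Add C (end_poly f (smult (- k) q)) (end_poly f (pCons 0 q))"
    by (simp only: end_poly_add[OF f])
  also have "\<dots> = Add C (Scale C (- k) (end_poly f q)) (f \<bullet> end_poly f q)"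
    by (simp only: end_poly_smult[OF f] end_poly_pCons[OF f]) simp
  also have "\<dots> = Add C (f \<bullet> end_poly f q) (Scale C (- k) (end_poly f q))"
    by (rule Add_simps(4)) simp_all
  also have "\<dots> = ?g \<bullet> end_poly f q" by simp
  finally have gq: "?g \<bullet> end_poly f q = Zero C S S" using p(2) by simp
  have "?g = Zero C S S"
  proof (rule ccontr)
    assume g: "?g \<noteq> Zero C S S"
    have "iso_ar C ?g" by (rule schur_iso[OF S S _ g]) (simp add: Hom_iff)
    then have "end_poly f q = Zero C S S"
      by (rule mono_cancel) (use gq in simp_all)
    then show False using qn by simp
  qed
  then have "Add C f (Scale C (- 1) (Scale C k (Id C S))) = Zero C S S" by simp
  then have "f = Scale C k (Id C S)" by (rule Add_neg_eqD) simp_all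
  then show ?thesis by blast
qed

definition scal :: "'o \<Rightarrow> 'm \<Rightarrow> 'k" where
  "scal i f = (THE k. f = Scale C k (Id C i))"

lemma I_Ob [simp]: "i \<in> I \<Longrightarrow> i \<in> Ob C"
  using simple_I unfolding simple_ob_def by blast

lemma Id_I_nonzero: "i \<in> I \<Longrightarrow> Id C i \<noteq> Zero C i i"
  using simple_I[of i] zero_ob_iff unfolding simple_ob_def by auto

lemma scal_Scale [simp]: "i \<in> I \<Longrightarrow> scal i (Scale C k (Id C i)) = k"
  unfolding scal_def using Scale_eq_iff[of "Id C i"] Id_I_nonzero[of i] by (intro the_equality) auto

lemma Scale_scal: "i \<in> I \<Longrightarrow> f \<in> Hom C i i \<Longrightarrow> Scale C (scal i f) (Id C i) = f"
  using schur_scalar[OF simple_I, of i f] by auto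

lemma scal_Id [simp]: "i \<in> I \<Longrightarrow> scal i (Id C i) = 1"
  using scal_Scale[of i 1] by simp

lemma scal_Zero [simp]: "i \<in> I \<Longrightarrow> scal i (Zero C i i) = 0"
  using scal_Scale[of i 0] by simp

lemma scal_Cmp: assumes "i \<in> I" "f \<in> Hom C i i" "g \<in> Hom C i i" shows "scal i (g \<bullet> f) = scal i g * scal i f"
proof -
  have "g \<bullet> f = Scale C (scal i g) (Id C i) \<bullet> Scale C (scal i f) (Id C i)"
    using assms by (simp add: Scale_scal)
  also have "\<dots> = Scale C (scal i g * scal i f) (Id C i)" using assms(1) by (simp add: mult.commute)
  finally show ?thesis using assms(1) by simp
qed

lemma scal_Add: assumes "i \<in> I" "f \<in> Hom C i i" "g \<in> Hom C i i" shows "scal i (Add C f g) = scal i f + scal i g"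
proof -
  have "Add C f g = Add C (Scale C (scal i f) (Id C i)) (Scale C (scal i g) (Id C i))"
    using assms by (simp add: Scale_scal)
  also have "\<dots> = Scale C (scal i f + scal i g) (Id C i)" using assms(1) by (intro Scale_add[symmetric]) simp
  finally show ?thesis using assms(1) by simp
qed

lemma scal_Sc: assumes "i \<in> I" "f \<in> Hom C i i" shows "scal i (Scale C k f) = k * scal i f"
proof -
  have "Scale C k f = Scale C k (Scale C (scal i f) (Id C i))"
    using assms by (simp add: Scale_scal)
  also have "\<dots> = Scale C (k * scal i f) (Id C i)" using assms(1) by simp
  finally show ?thesis using assms(1) by simp
qed

lemma scal_hsum: assumes "i \<in> I" "\<And>r. r < n \<Longrightarrow> f r \<in> Hom C i i"
  shows "scal i (hsum C i i f n) = (\<Sum>r<n. scal i (f r))"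
  by (rule hsum_additive) (use assms scal_Add in auto)

lemma orth: assumes "i \<in> I" "j \<in> I" "i \<noteq> j" "f \<in> Hom C i j" shows "f = Zero C i j"
  using schur_iso[OF simple_I simple_I] I_unique iso_obsI assms by metis

text \<open>The summands are elements of \<open>I\<close> and not merely isomorphic to such, so
  occurrences of a simple object are counted by equality.\<close>

definition is_dec :: "'o \<Rightarrow> nat \<Rightarrow> (nat \<Rightarrow> 'o) \<Rightarrow> (nat \<Rightarrow> 'm) \<Rightarrow> (nat \<Rightarrow> 'm) \<Rightarrow> bool" where
  "is_dec A n S i p \<longleftrightarrow> direct_sum C A n S i p \<and> (\<forall>r<n. S r \<in> I)"

text \<open>A decomposition into arbitrary simple objects is corrected summand by summand, by an
  isomorphism onto the representative.\<close>

lemma dec_exists: assumes "A \<in> Ob C" shows "\<exists>n S i p. is_dec A n S i p"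
proof -
  obtain n S i p where T: "direct_sum C A n S i p" "\<And>r. r < n \<Longrightarrow> simple_ob C (S r)"
    using semisimple[OF assms] by auto
  note d = direct_sumD[OF T(1)]
  have "\<forall>r. \<exists>e. r < n \<longrightarrow> iso_ar C e \<and> Dom C e = S r \<and> Cod C e \<in> I"
    using I_cover[OF T(2)] unfolding iso_obs_def Hom_def by blast
  then obtain e where e: "\<And>r. r < n \<Longrightarrow> iso_ar C (e r)" "\<And>r. r < n \<Longrightarrow> Dom C (e r) = S r" "\<And>r. r < n \<Longrightarrow> Cod C (e r) \<in> I"
    by metis
  have key: "p r \<bullet> i s = (if r = s then Id C (S r) else Zero C (S s) (S r))" if "r < n" "s < n" for r s
    using d(9,10) that by simp
  have inner: "(e r \<bullet> p r) \<bullet> (i s \<bullet> inv_ar C (e s)) = e r \<bullet> ((p r \<bullet> i s) \<bullet> inv_ar C (e s))"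
    if "r < n" "s < n" for r s
    using that d(1-8) e by simp
  have "hsum C A A (\<lambda>r. (i r \<bullet> inv_ar C (e r)) \<bullet> (e r \<bullet> p r)) n = hsum C A A (\<lambda>r. i r \<bullet> p r) n"
    using d e by (intro hsum_cong) (auto simp: Hom_iff)
  moreover have "(e r \<bullet> p r) \<bullet> (i s \<bullet> inv_ar C (e s)) = (if r = s then Id C (Cod C (e r)) else Zero C (Cod C (e s)) (Cod C (e r)))"
    if "r < n" "s < n" for r s
    unfolding inner[OF that] key[OF that] using that d(1-8) e by auto
  ultimately have "direct_sum C A n (\<lambda>r. Cod C (e r)) (\<lambda>r. i r \<bullet> inv_ar C (e r)) (\<lambda>r. e r \<bullet> p r)"
    using d e unfolding direct_sum_def hsum_def by (auto simp: Hom_iff)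
  then show ?thesis using e unfolding is_dec_def by blast
qed

lemma is_dec_simple: "j \<in> I \<Longrightarrow> is_dec j 1 (\<lambda>_. j) (\<lambda>_. Id C j) (\<lambda>_. Id C j)"
proof -
  assume j: "j \<in> I"
  then have "hsum C j j (\<lambda>_. Id C j \<bullet> Id C j) (Suc 0) = Id C j" by (subst hsum_Suc) (auto simp: Hom_iff)
  then show ?thesis using j by (simp add: is_dec_def direct_sum_def hsum_def Hom_iff)
qed

definition dec :: "'o \<Rightarrow> nat \<times> (nat \<Rightarrow> 'o) \<times> (nat \<Rightarrow> 'm) \<times> (nat \<Rightarrow> 'm)" where
  "dec A = (SOME (n, S, i, p). is_dec A n S i p)"

definition dn where "dn A = fst (dec A)"
definition dS where "dS A = fst (snd (dec A))"
definition di where "di A = fst (snd (snd (dec A)))"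
definition dp where "dp A = snd (snd (snd (dec A)))"

lemma dec: "A \<in> Ob C \<Longrightarrow> is_dec A (dn A) (dS A) (di A) (dp A)"
proof -
  assume "A \<in> Ob C"
  then have "\<exists>x. case x of (n, S, i, p) \<Rightarrow> is_dec A n S i p" using dec_exists[of A] by auto
  from someI_ex[OF this] show ?thesis unfolding dn_def dS_def di_def dp_def dec_def by (auto split: prod.splits)
qed

lemma dec_direct_sum: "A \<in> Ob C \<Longrightarrow> direct_sum C A (dn A) (dS A) (di A) (dp A)"
  using dec by (simp add: is_dec_def)

lemma dec_simps [simp]: assumes "A \<in> Ob C" "r < dn A"
  shows "dS A r \<in> I" "di A r \<in> Ar C" "Dom C (di A r) = dS A r" "Cod C (di A r) = A"
    "dp A r \<in> Ar C" "Dom C (dp A r) = A" "Cod C (dp A r) = dS A r"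
  using dec[OF assms(1)] direct_sumD[OF dec_direct_sum[OF assms(1)]] assms(2) by (auto simp: is_dec_def)

lemma dec_orth: assumes "A \<in> Ob C" "r < dn A" "s < dn A"
  shows "dp A r \<bullet> di A s = (if r = s then Id C (dS A r) else Zero C (dS A s) (dS A r))"
  using direct_sumD(9,10)[OF dec_direct_sum[OF assms(1)]] assms by auto

text \<open>The trace of \<open>f\<close> on the multiplicity space of \<open>j\<close>: each
  diagonal block at a summand equal to \<open>j\<close> is a scalar, and the others are
  ignored.\<close>

definition dtr :: "'o \<Rightarrow> nat \<Rightarrow> (nat \<Rightarrow> 'o) \<Rightarrow> (nat \<Rightarrow> 'm) \<Rightarrow> (nat \<Rightarrow> 'm) \<Rightarrow> 'm \<Rightarrow> 'k" where
  "dtr j n S i p f = (\<Sum>r<n. if S r = j then scal j (p r \<bullet> f \<bullet> i r) else 0)"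

text \<open>Applied to two decompositions of the same object and an identity, this shows that the trace
  does not depend on the decomposition.\<close>

lemma dtr_swap:
  assumes D: "is_dec A n S i p" and D': "is_dec B n' S' i' p'"
    and f: "f \<in> Hom C A B" and g: "g \<in> Hom C B A" and j: "j \<in> I"
  shows "dtr j n S i p (g \<bullet> f) = dtr j n' S' i' p' (f \<bullet> g)"
proof -
  have d: "direct_sum C A n S i p" "direct_sum C B n' S' i' p'"
     "\<And>r. r < n \<Longrightarrow> S r \<in> I" "\<And>r. r < n' \<Longrightarrow> S' r \<in> I"
    using D D' by (auto simp: is_dec_def)
  note e = direct_sumD[OF d(1)] note e' = direct_sumD[OF d(2)]
  have fg: "f \<in> Ar C" "Dom C f = A" "Cod C f = B" "g \<in> Ar C" "Dom C g = B" "Cod C g = A"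
    using f g by (auto simp: Hom_iff)
  \<comment> \<open>\<open>\<alpha>\<close> and \<open>\<beta>\<close> are the matrices of
    \<open>g\<close> and \<open>f\<close> between the summands equal to \<open>j\<close>. Blocks
    that pass through a different summand vanish by Schur's lemma, so both traces are the same
    double sum over entries of \<open>\<alpha>\<close> and \<open>\<beta>\<close>.\<close>
  define \<alpha> where "\<alpha> r s = (if S r = j \<and> S' s = j then scal j (p r \<bullet> g \<bullet> i' s) else 0)" for r s
  define \<beta> where "\<beta> s r = (if S r = j \<and> S' s = j then scal j (p' s \<bullet> f \<bullet> i r) else 0)" for s r
  have 1: "(if S r = j then scal j (p r \<bullet> (g \<bullet> f) \<bullet> i r) else 0) = (\<Sum>s<n'. \<alpha> r s * \<beta> s r)" if r: "r < n" for r
  proof (cases "S r = j")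
    case True
    have h: "p r \<bullet> g \<in> Hom C B j" "f \<bullet> i r \<in> Hom C j B" using e r fg True by (auto simp: Hom_iff)
    have "p r \<bullet> (g \<bullet> f) \<bullet> i r = (p r \<bullet> g) \<bullet> (f \<bullet> i r)" using e r fg by simp
    also have "\<dots> = (p r \<bullet> g) \<bullet> hsum C j B (\<lambda>s. i' s \<bullet> p' s \<bullet> (f \<bullet> i r)) n'"
      using direct_sum_expand_left[OF d(2) h(2)] by simp
    also have "\<dots> = hsum C j j (\<lambda>s. (p r \<bullet> g) \<bullet> (i' s \<bullet> p' s \<bullet> (f \<bullet> i r))) n'"
      using e' h j by (intro Cmp_hsum_right) (auto simp: Hom_iff)
    finally have "scal j (p r \<bullet> (g \<bullet> f) \<bullet> i r) = (\<Sum>s<n'. scal j ((p r \<bullet> g) \<bullet> (i' s \<bullet> p' s \<bullet> (f \<bullet> i r))))"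
      using e' h j by (simp add: scal_hsum Hom_iff)
    also have "\<dots> = (\<Sum>s<n'. \<alpha> r s * \<beta> s r)"
    proof (rule sum.cong[OF refl])
      fix s assume "s \<in> {..<n'}"
      then have s: "s < n'" by simp
      have eq: "(p r \<bullet> g) \<bullet> (i' s \<bullet> p' s \<bullet> (f \<bullet> i r)) = (p r \<bullet> g \<bullet> i' s) \<bullet> (p' s \<bullet> f \<bullet> i r)"
        using e e' fg r s by simp
      have H: "p r \<bullet> g \<bullet> i' s \<in> Hom C (S' s) j" "p' s \<bullet> f \<bullet> i r \<in> Hom C j (S' s)"
        using e e' fg r s True by (auto simp: Hom_iff)
      show "scal j ((p r \<bullet> g) \<bullet> (i' s \<bullet> p' s \<bullet> (f \<bullet> i r))) = \<alpha> r s * \<beta> s r"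
      proof (cases "S' s = j")
        case True
        then show ?thesis unfolding eq \<alpha>_def \<beta>_def using H j \<open>S r = j\<close> by (simp add: scal_Cmp)
      next
        case False
        have "p' s \<bullet> f \<bullet> i r = Zero C j (S' s)" by (rule orth) (use j d(4) s False H in auto)
        then show ?thesis unfolding eq \<alpha>_def \<beta>_def using H(1) j False by (simp add: Hom_iff)
      qed
    qed
    finally show ?thesis using True by simp
  qed (simp add: \<alpha>_def)
  have 2: "(if S' s = j then scal j (p' s \<bullet> (f \<bullet> g) \<bullet> i' s) else 0) = (\<Sum>r<n. \<beta> s r * \<alpha> r s)" if s: "s < n'" for s
  proof (cases "S' s = j")
    case True
    have h: "p' s \<bullet> f \<in> Hom C A j" "g \<bullet> i' s \<in> Hom C j A" using e' s fg True by (auto simp: Hom_iff)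
    have "p' s \<bullet> (f \<bullet> g) \<bullet> i' s = (p' s \<bullet> f) \<bullet> (g \<bullet> i' s)" using e' s fg by simp
    also have "\<dots> = (p' s \<bullet> f) \<bullet> hsum C j A (\<lambda>r. i r \<bullet> p r \<bullet> (g \<bullet> i' s)) n"
      using direct_sum_expand_left[OF d(1) h(2)] by simp
    also have "\<dots> = hsum C j j (\<lambda>r. (p' s \<bullet> f) \<bullet> (i r \<bullet> p r \<bullet> (g \<bullet> i' s))) n"
      using e h j by (intro Cmp_hsum_right) (auto simp: Hom_iff)
    finally have "scal j (p' s \<bullet> (f \<bullet> g) \<bullet> i' s) = (\<Sum>r<n. scal j ((p' s \<bullet> f) \<bullet> (i r \<bullet> p r \<bullet> (g \<bullet> i' s))))"
      using e h j by (simp add: scal_hsum Hom_iff)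
    also have "\<dots> = (\<Sum>r<n. \<beta> s r * \<alpha> r s)"
    proof (rule sum.cong[OF refl])
      fix r assume "r \<in> {..<n}"
      then have r: "r < n" by simp
      have eq: "(p' s \<bullet> f) \<bullet> (i r \<bullet> p r \<bullet> (g \<bullet> i' s)) = (p' s \<bullet> f \<bullet> i r) \<bullet> (p r \<bullet> g \<bullet> i' s)"
        using e e' fg r s by simp
      have H: "p' s \<bullet> f \<bullet> i r \<in> Hom C (S r) j" "p r \<bullet> g \<bullet> i' s \<in> Hom C j (S r)"
        using e e' fg r s True by (auto simp: Hom_iff)
      show "scal j ((p' s \<bullet> f) \<bullet> (i r \<bullet> p r \<bullet> (g \<bullet> i' s))) = \<beta> s r * \<alpha> r s"
      proof (cases "S r = j")
        case True
        then show ?thesis unfolding eq \<alpha>_def \<beta>_def using H j \<open>S' s = j\<close> by (simp add: scal_Cmp)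
      next
        case False
        have "p r \<bullet> g \<bullet> i' s = Zero C j (S r)" by (rule orth) (use j d(3) r False H in auto)
        then show ?thesis unfolding eq \<alpha>_def \<beta>_def using H(1) j False by (simp add: Hom_iff)
      qed
    qed
    finally show ?thesis using True by simp
  qed (simp add: \<beta>_def)
  have "dtr j n S i p (g \<bullet> f) = (\<Sum>r<n. \<Sum>s<n'. \<alpha> r s * \<beta> s r)"
    unfolding dtr_def using 1 by (intro sum.cong) auto
  also have "\<dots> = (\<Sum>s<n'. \<Sum>r<n. \<beta> s r * \<alpha> r s)" by (subst sum.swap) (simp add: mult.commute)
  also have "\<dots> = dtr j n' S' i' p' (f \<bullet> g)" unfolding dtr_def using 2 by (intro sum.cong) auto
  finally show ?thesis .
qed

definition mtr :: "'o \<Rightarrow> 'o \<Rightarrow> 'm \<Rightarrow> 'k" where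
  "mtr j A f = dtr j (dn A) (dS A) (di A) (dp A) f"

text \<open>A multiplicity, taken as an element of the field: as the trace of an identity it
  inherits additivity and invariance from cyclicity of the trace.\<close>

definition mult :: "'o \<Rightarrow> 'o \<Rightarrow> 'k" where
  "mult j A = mtr j A (Id C A)"

lemma mtr_swap: "\<lbrakk>f \<in> Hom C A B; g \<in> Hom C B A; j \<in> I\<rbrakk> \<Longrightarrow> mtr j A (g \<bullet> f) = mtr j B (f \<bullet> g)"
  unfolding mtr_def by (rule dtr_swap[OF dec dec]) (auto dest: HomD)

lemma dtr_count: assumes "is_dec A n S i p" "j \<in> I"
  shows "dtr j n S i p (Id C A) = (\<Sum>r<n. if S r = j then 1 else 0)"
proof -
  have d: "direct_sum C A n S i p" using assms by (simp add: is_dec_def)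
  have "p r \<bullet> Id C A \<bullet> i r = Id C (S r)" if "r < n" for r
    using that direct_sumD[OF d] by simp
  then show ?thesis unfolding dtr_def using assms(2) by (intro sum.cong) auto
qed

lemma mult_dec: assumes "is_dec A n S i p" "j \<in> I"
  shows "mult j A = (\<Sum>r<n. if S r = j then 1 else 0)"
proof -
  have A: "A \<in> Ob C" using assms by (auto simp: is_dec_def direct_sum_def)
  then have "mult j A = dtr j n S i p (Id C A)"
    unfolding mult_def mtr_def using dtr_swap[OF dec[OF A] assms(1), of "Id C A" "Id C A" j] assms by (simp add: Hom_iff)
  then show ?thesis using dtr_count[OF assms] by simp
qed

lemma mult_count: "A \<in> Ob C \<Longrightarrow> j \<in> I \<Longrightarrow> mult j A = (\<Sum>r<dn A. if dS A r = j then 1 else 0)"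
  by (rule mult_dec[OF dec])

lemma mult_simple: "i \<in> I \<Longrightarrow> j \<in> I \<Longrightarrow> mult i j = (if i = j then 1 else 0)"
  using mult_dec[OF is_dec_simple] by simp

lemma mult_iso: assumes "iso_obs C A B" "j \<in> I" shows "mult j A = mult j B"
proof -
  obtain f where f: "f \<in> Hom C A B" "iso_ar C f" using assms by (auto simp: iso_obs_def)
  then have "mtr j A (inv_ar C f \<bullet> f) = mtr j B (f \<bullet> inv_ar C f)"
    using assms(2) by (intro mtr_swap) (auto simp: Hom_iff)
  then show ?thesis using f by (auto simp: mult_def Hom_iff)
qed

lemma mtr_Add: assumes "f \<in> Hom C A A" "g \<in> Hom C A A" "j \<in> I"
  shows "mtr j A (Add C f g) = mtr j A f + mtr j A g"
proof -
  have A: "A \<in> Ob C" using HomD(4)[OF assms(1)] .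
  have "scal j (dp A r \<bullet> Add C f g \<bullet> di A r) = scal j (dp A r \<bullet> f \<bullet> di A r) + scal j (dp A r \<bullet> g \<bullet> di A r)"
    if "r < dn A" "dS A r = j" for r
    using that A assms scal_Add[of j "dp A r \<bullet> f \<bullet> di A r" "dp A r \<bullet> g \<bullet> di A r"] by (auto simp: Hom_iff)
  then show ?thesis unfolding mtr_def dtr_def sum.distrib[symmetric] by (intro sum.cong) auto
qed

text \<open>The identity of the middle object is \<open>f \<bullet> t\<close> plus
  \<open>s \<bullet> g\<close>. By cyclicity the traces of these are the traces of
  \<open>t \<bullet> f\<close> and \<open>g \<bullet> s\<close>, which are the identities of the
  outer objects.\<close>

lemma mult_split: assumes "split_exact C f g s t" "j \<in> I"
  shows "mult j (Cod C f) = mult j (Dom C f) + mult j (Cod C g)"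
proof -
  have d [simp]: "f \<in> Ar C" "g \<in> Ar C" "s \<in> Ar C" "t \<in> Ar C" "Dom C g = Cod C f" "Dom C s = Cod C g"
    "Cod C s = Cod C f" "Dom C t = Cod C f" "Cod C t = Dom C f" and
    e: "t \<bullet> f = Id C (Dom C f)" "g \<bullet> s = Id C (Cod C g)"
    and one: "Add C (f \<bullet> t) (s \<bullet> g) = Id C (Cod C f)"
    using assms by (auto simp: split_exact_def)
  have "mult j (Cod C f) = mtr j (Cod C f) (f \<bullet> t) + mtr j (Cod C f) (s \<bullet> g)"
    unfolding mult_def one[symmetric] using assms(2) by (intro mtr_Add) (auto simp: Hom_iff)
  also have "mtr j (Cod C f) (f \<bullet> t) = mtr j (Dom C f) (t \<bullet> f)"
    using assms(2) by (intro mtr_swap) (auto simp: Hom_iff)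
  also have "mtr j (Cod C f) (s \<bullet> g) = mtr j (Cod C g) (g \<bullet> s)"
    using assms(2) by (intro mtr_swap) (auto simp: Hom_iff)
  finally show ?thesis by (simp add: e mult_def)
qed

lemma mult_short_exact: "short_exact C f g \<Longrightarrow> j \<in> I \<Longrightarrow> mult j (Cod C f) = mult j (Dom C f) + mult j (Cod C g)"
  using short_exact_splits mult_split by blast

end

section \<open>Actions of monoidal categories\<close>

context mon_category
begin

lemma Tob_simp [simp]: "X \<in> Ob C \<Longrightarrow> Y \<in> Ob C \<Longrightarrow> X \<boxtimes> Y \<in> Ob C"
  by (rule Tob_Ob)

lemma Unit_simp [simp]: "Unit C \<in> Ob C"
  by (rule Unit_Ob)

lemma Tar_simps [simp]: assumes "f \<in> Ar C" "g \<in> Ar C"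
  shows "f \<boxdot> g \<in> Ar C" "Dom C (f \<boxdot> g) = Dom C f \<boxtimes> Dom C g" "Cod C (f \<boxdot> g) = Cod C f \<boxtimes> Cod C g"
  using Tar_Hom[of f "Dom C f" "Cod C f" g "Dom C g" "Cod C g"] assms by (auto simp: Hom_iff)

lemma Tar_Cmp_Hom: "\<lbrakk>f \<in> Ar C; f' \<in> Ar C; g \<in> Ar C; g' \<in> Ar C; Dom C f' = Cod C f; Dom C g' = Cod C g\<rbrakk> \<Longrightarrow>
    (f' \<boxdot> g') \<bullet> (f \<boxdot> g) = (f' \<bullet> f) \<boxdot> (g' \<bullet> g)"
  using Tar_Cmp[of f "Dom C f" "Cod C f" f' "Cod C f'" g "Dom C g" "Cod C g" g' "Cod C g'"] by (simp add: Hom_iff)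

lemma Tar_Id_simp [simp]: "X \<in> Ob C \<Longrightarrow> Y \<in> Ob C \<Longrightarrow> Id C X \<boxdot> Id C Y = Id C (X \<boxtimes> Y)"
  by (rule Tar_Id)

lemma coherence_simps [simp]: assumes "X \<in> Ob C" "Y \<in> Ob C" "Z \<in> Ob C"
  shows "Assoc C X Y Z \<in> Ar C" "Dom C (Assoc C X Y Z) = (X \<boxtimes> Y) \<boxtimes> Z" "Cod C (Assoc C X Y Z) = X \<boxtimes> (Y \<boxtimes> Z)"
    "iso_ar C (Assoc C X Y Z)"
  using Assoc_Hom[OF assms] Assoc_iso[OF assms] by (auto simp: Hom_iff)

lemma unitor_simps [simp]: assumes "X \<in> Ob C"
  shows "Lun C X \<in> Ar C" "Dom C (Lun C X) = Unit C \<boxtimes> X" "Cod C (Lun C X) = X" "iso_ar C (Lun C X)"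
    "Run C X \<in> Ar C" "Dom C (Run C X) = X \<boxtimes> Unit C" "Cod C (Run C X) = X" "iso_ar C (Run C X)"
  using Lun_Hom[OF assms] Lun_iso[OF assms] Run_Hom[OF assms] Run_iso[OF assms] by (auto simp: Hom_iff)

lemma Tar_iso [simp]: assumes "iso_ar C f" "iso_ar C g"
  shows "iso_ar C (f \<boxdot> g)" "inv_ar C (f \<boxdot> g) = inv_ar C f \<boxdot> inv_ar C g"
  using assms by (auto intro!: iso_arI[where g = "inv_ar C f \<boxdot> inv_ar C g"] inv_arI simp: Tar_Cmp_Hom)

lemma tensor_unit_left_cancel:
  assumes "Id C (Unit C) \<boxdot> f = Id C (Unit C) \<boxdot> g" "f \<in> Ar C" "g \<in> Ar C" "Dom C f = Dom C g" "Cod C f = Cod C g"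
  shows "f = g"
proof (rule epi_cancel[of "Lun C (Dom C f)"])
  show "f \<bullet> Lun C (Dom C f) = g \<bullet> Lun C (Dom C f)"
    using Lun_natural[of f "Dom C f" "Cod C f"] Lun_natural[of g "Dom C f" "Cod C f"] assms by (simp add: Hom_iff)
qed (use assms in auto)

text \<open>The right unitors conjugate \<open>f \<boxdot> Id C (Unit C)\<close> into
  \<open>f\<close>. This brings invertibility of a component at the unit object back to the morphism
  itself.\<close>

lemma tensor_unit_right_iso:
  assumes f: "f \<in> Ar C" and iso: "iso_ar C (f \<boxdot> Id C (Unit C))"
  shows "iso_ar C f"
proof -
  have "f \<bullet> Run C (Dom C f) = Run C (Cod C f) \<bullet> (f \<boxdot> Id C (Unit C))"
    using Run_natural[of f "Dom C f" "Cod C f"] f by (simp add: Hom_iff)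
  then have "f = (Run C (Cod C f) \<bullet> (f \<boxdot> Id C (Unit C))) \<bullet> inv_ar C (Run C (Dom C f))"
    using f by (intro iso_moveR) simp_all
  moreover have "iso_ar C ((Run C (Cod C f) \<bullet> (f \<boxdot> Id C (Unit C))) \<bullet> inv_ar C (Run C (Dom C f)))"
    using f iso by (intro iso_Cmp iso_inv) simp_all
  ultimately show ?thesis by simp
qed

text \<open>Kelly's lemma: the remaining triangle follows from the pentagon and the middle triangle after
  tensoring with the unit object.\<close>

lemma Lun_tensor:
  assumes X [simp]: "X \<in> Ob C" and Y [simp]: "Y \<in> Ob C"
  shows "Lun C (X \<boxtimes> Y) \<bullet> Assoc C (Unit C) X Y = Lun C X \<boxdot> Id C Y"
proof -
  let ?U = "Unit C"
  have p: "Assoc C ?U ?U (X \<boxtimes> Y) \<bullet> Assoc C (?U \<boxtimes> ?U) X Y =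
      (Id C ?U \<boxdot> Assoc C ?U X Y) \<bullet> Assoc C ?U (?U \<boxtimes> X) Y \<bullet> (Assoc C ?U ?U X \<boxdot> Id C Y)"
    by (rule pentagon) simp_all
  have t: "(Id C ?U \<boxdot> Lun C (X \<boxtimes> Y)) \<bullet> Assoc C ?U ?U (X \<boxtimes> Y) = Run C ?U \<boxdot> Id C (X \<boxtimes> Y)"
    by (rule triangle) simp_all
  have t': "(Id C ?U \<boxdot> Lun C X) \<bullet> Assoc C ?U ?U X = Run C ?U \<boxdot> Id C X"
    by (rule triangle) simp_all
  have n1: "Assoc C ?U X Y \<bullet> ((Run C ?U \<boxdot> Id C X) \<boxdot> Id C Y) = (Run C ?U \<boxdot> (Id C X \<boxdot> Id C Y)) \<bullet> Assoc C (?U \<boxtimes> ?U) X Y"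
    by (rule Assoc_natural) (simp_all add: Hom_iff)
  have n2: "Assoc C ?U X Y \<bullet> ((Id C ?U \<boxdot> Lun C X) \<boxdot> Id C Y) = (Id C ?U \<boxdot> (Lun C X \<boxdot> Id C Y)) \<bullet> Assoc C ?U (?U \<boxtimes> X) Y"
    by (rule Assoc_natural) (simp_all add: Hom_iff)
  let ?l = "(Id C ?U \<boxdot> Lun C (X \<boxtimes> Y)) \<bullet> (Id C ?U \<boxdot> Assoc C ?U X Y)" and ?r = "Id C ?U \<boxdot> (Lun C X \<boxdot> Id C Y)"
  \<comment> \<open>\<open>?e\<close> is invertible, so the claim, tensored with the unit on the
    left, may be checked after composing with \<open>?e\<close>; the right-hand side of the pentagon
    \<open>p\<close> then appears.\<close>
  let ?e = "Assoc C ?U (?U \<boxtimes> X) Y \<bullet> (Assoc C ?U ?U X \<boxdot> Id C Y)"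
  have "?l \<bullet> ?e = (Id C ?U \<boxdot> Lun C (X \<boxtimes> Y)) \<bullet>
     ((Id C ?U \<boxdot> Assoc C ?U X Y) \<bullet> Assoc C ?U (?U \<boxtimes> X) Y \<bullet> (Assoc C ?U ?U X \<boxdot> Id C Y))" by simp
  also have "\<dots> = (Id C ?U \<boxdot> Lun C (X \<boxtimes> Y)) \<bullet> (Assoc C ?U ?U (X \<boxtimes> Y) \<bullet> Assoc C (?U \<boxtimes> ?U) X Y)"
    by (simp only: p)
  also have "\<dots> = ((Id C ?U \<boxdot> Lun C (X \<boxtimes> Y)) \<bullet> Assoc C ?U ?U (X \<boxtimes> Y)) \<bullet> Assoc C (?U \<boxtimes> ?U) X Y"
    by (rule Cmp_assoc_simp[symmetric]) simp_all
  also have "\<dots> = (Run C ?U \<boxdot> (Id C X \<boxdot> Id C Y)) \<bullet> Assoc C (?U \<boxtimes> ?U) X Y"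
    by (simp only: t Tar_Id_simp X Y)
  also have "\<dots> = Assoc C ?U X Y \<bullet> ((Run C ?U \<boxdot> Id C X) \<boxdot> Id C Y)" by (simp only: n1)
  also have "\<dots> = Assoc C ?U X Y \<bullet> (((Id C ?U \<boxdot> Lun C X) \<bullet> Assoc C ?U ?U X) \<boxdot> (Id C Y \<bullet> Id C Y))"
    by (simp add: t')
  also have "\<dots> = Assoc C ?U X Y \<bullet> (((Id C ?U \<boxdot> Lun C X) \<boxdot> Id C Y) \<bullet> (Assoc C ?U ?U X \<boxdot> Id C Y))"
    by (subst Tar_Cmp_Hom) simp_all
  also have "\<dots> = (Assoc C ?U X Y \<bullet> ((Id C ?U \<boxdot> Lun C X) \<boxdot> Id C Y)) \<bullet> (Assoc C ?U ?U X \<boxdot> Id C Y)"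
    by (rule Cmp_assoc_simp[symmetric]) simp_all
  also have "\<dots> = (?r \<bullet> Assoc C ?U (?U \<boxtimes> X) Y) \<bullet> (Assoc C ?U ?U X \<boxdot> Id C Y)" by (simp only: n2)
  also have "\<dots> = ?r \<bullet> ?e" by simp
  finally have "?l = ?r" by (intro epi_cancel[of ?e ?l ?r]) simp_all
  then have "Id C ?U \<boxdot> (Lun C (X \<boxtimes> Y) \<bullet> Assoc C ?U X Y) = ?r"
    using Tar_Cmp_Hom[of "Id C ?U" "Id C ?U" "Assoc C ?U X Y" "Lun C (X \<boxtimes> Y)"] by simp
  then show ?thesis by (intro tensor_unit_left_cancel[of _ "Lun C X \<boxdot> Id C Y"]) simp_all
qed

end

text \<open>A module category in terms of components: \<open>A X\<close> is the endofunctor by which \<open>X\<close> acts, \<open>T f b\<close> the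
  component at \<open>b\<close> of the action of a morphism \<open>f\<close>.\<close>

locale action = C: mon_category C + B: lin_category B
  for C :: "('o, 'm, 'k :: field, 'z) moncat_scheme"
    and B :: "('p, 'n, 'k, 'y) lincat_scheme" (structure) +
  fixes A :: "'o \<Rightarrow> ('p, 'n, 'p, 'n) fct" and T :: "'m \<Rightarrow> 'p \<Rightarrow> 'n"
    and mu :: "'o \<Rightarrow> 'o \<Rightarrow> 'p \<Rightarrow> 'n" and ep :: "'p \<Rightarrow> 'n"
  assumes A_functor: "X \<in> Ob C \<Longrightarrow> lin_functor B B (A X)"
    and T_Hom: "\<lbrakk>f \<in> Hom C X Y; b \<in> Ob B\<rbrakk> \<Longrightarrow> T f b \<in> Hom B (Fob (A X) b) (Fob (A Y) b)"
    and T_natural: "\<lbrakk>f \<in> Hom C X Y; g \<in> Hom B b b'\<rbrakk> \<Longrightarrow> T f b' \<bullet> Far (A X) g = Far (A Y) g \<bullet> T f b"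
    and T_Id: "\<lbrakk>X \<in> Ob C; b \<in> Ob B\<rbrakk> \<Longrightarrow> T (Id C X) b = Id B (Fob (A X) b)"
    and T_Cmp: "\<lbrakk>f \<in> Hom C X Y; f' \<in> Hom C Y Z; b \<in> Ob B\<rbrakk> \<Longrightarrow> T (Cmp C f' f) b = T f' b \<bullet> T f b"
    and T_Add: "\<lbrakk>f \<in> Hom C X Y; f' \<in> Hom C X Y; b \<in> Ob B\<rbrakk> \<Longrightarrow> T (Add C f f') b = Add B (T f b) (T f' b)"
    and T_Scale: "\<lbrakk>f \<in> Hom C X Y; b \<in> Ob B\<rbrakk> \<Longrightarrow> T (Scale C k f) b = Scale B k (T f b)"
    and mu_Hom: "\<lbrakk>X \<in> Ob C; Y \<in> Ob C; b \<in> Ob B\<rbrakk> \<Longrightarrow> mu X Y b \<in> Hom B (Fob (A X) (Fob (A Y) b)) (Fob (A (Tob C X Y)) b)"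
    and mu_iso: "\<lbrakk>X \<in> Ob C; Y \<in> Ob C; b \<in> Ob B\<rbrakk> \<Longrightarrow> iso_ar B (mu X Y b)"
    and mu_natural: "\<lbrakk>X \<in> Ob C; Y \<in> Ob C; g \<in> Hom B b b'\<rbrakk> \<Longrightarrow>
      mu X Y b' \<bullet> Far (A X) (Far (A Y) g) = Far (A (Tob C X Y)) g \<bullet> mu X Y b"
    and mu_T: "\<lbrakk>f \<in> Hom C X X'; f' \<in> Hom C Y Y'; b \<in> Ob B\<rbrakk> \<Longrightarrow>
      T (Tar C f f') b \<bullet> mu X Y b = mu X' Y' b \<bullet> T f (Fob (A Y') b) \<bullet> Far (A X) (T f' b)"
    and ep_Hom: "b \<in> Ob B \<Longrightarrow> ep b \<in> Hom B b (Fob (A (Unit C)) b)"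
    and ep_iso: "b \<in> Ob B \<Longrightarrow> iso_ar B (ep b)"
    and ep_natural: "g \<in> Hom B b b' \<Longrightarrow> ep b' \<bullet> g = Far (A (Unit C)) g \<bullet> ep b"
    and T_Assoc: "\<lbrakk>X \<in> Ob C; Y \<in> Ob C; Z \<in> Ob C; b \<in> Ob B\<rbrakk> \<Longrightarrow>
      T (Assoc C X Y Z) b \<bullet> mu (Tob C X Y) Z b \<bullet> mu X Y (Fob (A Z) b) =
      mu X (Tob C Y Z) b \<bullet> Far (A X) (mu Y Z b)"
    and T_Lun: "\<lbrakk>X \<in> Ob C; b \<in> Ob B\<rbrakk> \<Longrightarrow>
      T (Lun C X) b \<bullet> mu (Unit C) X b \<bullet> ep (Fob (A X) b) = Id B (Fob (A X) b)"
    and T_Run: "\<lbrakk>X \<in> Ob C; b \<in> Ob B\<rbrakk> \<Longrightarrow>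
      T (Run C X) b \<bullet> mu X (Unit C) b \<bullet> Far (A X) (ep b) = Id B (Fob (A X) b)"
begin

abbreviation AO :: "'o \<Rightarrow> 'p \<Rightarrow> 'p" where "AO X b \<equiv> Fob (A X) b"
abbreviation F :: "'o \<Rightarrow> 'n \<Rightarrow> 'n" where "F X g \<equiv> Far (A X) g"

lemma O_Ob [simp]: "X \<in> Ob C \<Longrightarrow> b \<in> Ob B \<Longrightarrow> AO X b \<in> Ob B"
  by (rule lin_functor.Fob_Ob[OF A_functor])

lemma F_simps [simp]: assumes "X \<in> Ob C" "g \<in> Ar B"
  shows "F X g \<in> Ar B" "Dom B (F X g) = AO X (Dom B g)" "Cod B (F X g) = AO X (Cod B g)"
  using lin_functor.Far_Hom[OF A_functor[OF assms(1)], of g "Dom B g" "Cod B g"] assms by (auto simp: Hom_iff)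

lemma F_Id [simp]: "X \<in> Ob C \<Longrightarrow> b \<in> Ob B \<Longrightarrow> F X (Id B b) = Id B (AO X b)"
  by (rule lin_functor.Far_Id[OF A_functor])

lemma F_Cmp [simp]: "\<lbrakk>X \<in> Ob C; g \<in> Ar B; h \<in> Ar B; Dom B h = Cod B g\<rbrakk> \<Longrightarrow> F X (h \<bullet> g) = F X h \<bullet> F X g"
  by (rule lin_functor.Far_Cmp[OF A_functor]) (auto simp: Hom_iff)

lemma F_Scale [simp]: "\<lbrakk>X \<in> Ob C; g \<in> Ar B\<rbrakk> \<Longrightarrow> F X (Scale B k g) = Scale B k (F X g)"
  by (rule lin_functor.Far_Scale[OF A_functor]) (auto simp: Hom_iff)

lemma F_Zero [simp]: "\<lbrakk>X \<in> Ob C; b \<in> Ob B; b' \<in> Ob B\<rbrakk> \<Longrightarrow> F X (Zero B b b') = Zero B (AO X b) (AO X b')"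
  using F_Scale[of X "Zero B b b'" 0] by simp

lemma F_iso [simp]: assumes "X \<in> Ob C" "iso_ar B g"
  shows "iso_ar B (F X g)" "inv_ar B (F X g) = F X (inv_ar B g)"
proof -
  have "F X (inv_ar B g) \<bullet> F X g = Id B (AO X (Dom B g))" "F X g \<bullet> F X (inv_ar B g) = Id B (AO X (Cod B g))"
    using assms by (simp_all flip: F_Cmp)
  then show "iso_ar B (F X g)" "inv_ar B (F X g) = F X (inv_ar B g)"
    using assms by (auto intro!: B.iso_arI[where g = "F X (inv_ar B g)"] B.inv_arI)
qed

lemma F_inv_cancel [simp]: assumes "X \<in> Ob C" "iso_ar B g"
  shows "F X (inv_ar B g) \<bullet> F X g = Id B (AO X (Dom B g))" "F X g \<bullet> F X (inv_ar B g) = Id B (AO X (Cod B g))"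
    "\<lbrakk>h \<in> Ar B; Cod B h = AO X (Dom B g)\<rbrakk> \<Longrightarrow> F X (inv_ar B g) \<bullet> (F X g \<bullet> h) = h"
    "\<lbrakk>h \<in> Ar B; Cod B h = AO X (Cod B g)\<rbrakk> \<Longrightarrow> F X g \<bullet> (F X (inv_ar B g) \<bullet> h) = h"
  using assms B.iso_cancel_simps[OF F_iso(1)[OF assms], of h] B.iso_simps(5,6)[OF F_iso(1)[OF assms]]
  by (simp_all add: F_iso(2)[OF assms])

lemma T_simps [simp]: assumes "f \<in> Ar C" "b \<in> Ob B"
  shows "T f b \<in> Ar B" "Dom B (T f b) = AO (Dom C f) b" "Cod B (T f b) = AO (Cod C f) b"
  using T_Hom[of f "Dom C f" "Cod C f" b] assms by (auto simp: Hom_iff)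

lemma T_Id_simp [simp]: "\<lbrakk>X \<in> Ob C; b \<in> Ob B\<rbrakk> \<Longrightarrow> T (Id C X) b = Id B (AO X b)"
  by (rule T_Id)

lemma T_Cmp_simp [simp]: "\<lbrakk>f \<in> Ar C; f' \<in> Ar C; Dom C f' = Cod C f; b \<in> Ob B\<rbrakk> \<Longrightarrow> T (Cmp C f' f) b = T f' b \<bullet> T f b"
  by (rule T_Cmp) (auto simp: Hom_iff)

lemma T_iso [simp]: assumes "iso_ar C f" "b \<in> Ob B"
  shows "iso_ar B (T f b)" "T (inv_ar C f) b = inv_ar B (T f b)"
proof -
  have "T (inv_ar C f) b \<bullet> T f b = Id B (AO (Dom C f) b)" "T f b \<bullet> T (inv_ar C f) b = Id B (AO (Cod C f) b)"
    using assms by (simp_all flip: T_Cmp_simp)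
  then show "iso_ar B (T f b)" "T (inv_ar C f) b = inv_ar B (T f b)"
    using assms by (auto intro!: B.iso_arI[where g = "T (inv_ar C f) b"] B.inv_arI[symmetric])
qed

lemma mu_simps [simp]: assumes "X \<in> Ob C" "Y \<in> Ob C" "b \<in> Ob B"
  shows "mu X Y b \<in> Ar B" "Dom B (mu X Y b) = AO X (AO Y b)" "Cod B (mu X Y b) = AO (Tob C X Y) b" "iso_ar B (mu X Y b)"
  using mu_Hom[OF assms] mu_iso[OF assms] by (auto simp: Hom_iff)

lemma ep_simps [simp]: assumes "b \<in> Ob B"
  shows "ep b \<in> Ar B" "Dom B (ep b) = b" "Cod B (ep b) = AO (Unit C) b" "iso_ar B (ep b)"
  using ep_Hom[OF assms] ep_iso[OF assms] by (auto simp: Hom_iff)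

lemma T_nat: "\<lbrakk>f \<in> Ar C; g \<in> Ar B; Dom C f = X; Cod C f = Y; Dom B g = b; Cod B g = b'\<rbrakk> \<Longrightarrow>
    T f b' \<bullet> F X g = F Y g \<bullet> T f b"
  by (rule T_natural) (auto simp: Hom_iff)

lemma ep_nat: "\<lbrakk>g \<in> Ar B; Dom B g = b; Cod B g = b'\<rbrakk> \<Longrightarrow> ep b' \<bullet> g = F (Unit C) g \<bullet> ep b"
  by (rule ep_natural) (auto simp: Hom_iff)

lemma mu_nat: "\<lbrakk>X \<in> Ob C; Y \<in> Ob C; g \<in> Ar B; Dom B g = b; Cod B g = b'\<rbrakk> \<Longrightarrow>
    mu X Y b' \<bullet> F X (F Y g) = F (Tob C X Y) g \<bullet> mu X Y b"
  by (rule mu_natural) (auto simp: Hom_iff)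

lemma inv_ep_nat: assumes "g \<in> Ar B" "Dom B g = b" "Cod B g = b'"
  shows "g \<bullet> inv_ar B (ep b) = inv_ar B (ep b') \<bullet> F (Unit C) g"
proof -
  have "b \<in> Ob B" "b' \<in> Ob B" using assms by auto
  then have "g \<bullet> inv_ar B (ep b) = inv_ar B (ep b') \<bullet> (ep b' \<bullet> g) \<bullet> inv_ar B (ep b)" using assms by simp
  also have "\<dots> = inv_ar B (ep b') \<bullet> (F (Unit C) g \<bullet> ep b) \<bullet> inv_ar B (ep b)"
    by (simp only: ep_nat[OF assms])
  also have "\<dots> = inv_ar B (ep b') \<bullet> F (Unit C) g" using assms \<open>b \<in> Ob B\<close> \<open>b' \<in> Ob B\<close> by simp
  finally show ?thesis .
qed

lemma inv_mu_nat: assumes "X \<in> Ob C" "Y \<in> Ob C" "g \<in> Ar B" "Dom B g = b" "Cod B g = b'"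
  shows "inv_ar B (mu X Y b') \<bullet> F (Tob C X Y) g = F X (F Y g) \<bullet> inv_ar B (mu X Y b)"
proof -
  have b: "b \<in> Ob B" "b' \<in> Ob B" using assms by auto
  then have "F X (F Y g) \<bullet> inv_ar B (mu X Y b) = inv_ar B (mu X Y b') \<bullet> (mu X Y b' \<bullet> F X (F Y g)) \<bullet> inv_ar B (mu X Y b)" using assms by simp
  also have "\<dots> = inv_ar B (mu X Y b') \<bullet> (F (Tob C X Y) g \<bullet> mu X Y b) \<bullet> inv_ar B (mu X Y b)"
    by (simp only: mu_nat[OF assms])
  also have "\<dots> = inv_ar B (mu X Y b') \<bullet> F (Tob C X Y) g" using assms b by simp
  finally show ?thesis by simp
qed

text \<open>The transformation from the composite of the functors of \<open>W\<close> and
  \<open>X\<close> to the identity functor that is induced by a morphism \<open>e\<close> from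
  \<open>Tob C W X\<close> to the unit.\<close>

definition pairing :: "'m \<Rightarrow> 'o \<Rightarrow> 'o \<Rightarrow> 'p \<Rightarrow> 'n" where
  "pairing e W X b = inv_ar B (ep b) \<bullet> T e b \<bullet> mu W X b"

definition copairing :: "'m \<Rightarrow> 'o \<Rightarrow> 'o \<Rightarrow> 'p \<Rightarrow> 'n" where
  "copairing c X V b = inv_ar B (mu X V b) \<bullet> T c b \<bullet> ep b"

context
  fixes W X e
  assumes W: "W \<in> Ob C" and X: "X \<in> Ob C"
    and e: "e \<in> Ar C" "Dom C e = Tob C W X" "Cod C e = Unit C"
begin

lemma pairing_simps: assumes "b \<in> Ob B"
  shows "pairing e W X b \<in> Ar B" "Dom B (pairing e W X b) = AO W (AO X b)" "Cod B (pairing e W X b) = b"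
  using assms W X e by (simp_all add: pairing_def)

lemma pairing_nat: assumes g: "g \<in> Ar B" "Dom B g = b" "Cod B g = b'"
  shows "pairing e W X b' \<bullet> F W (F X g) = g \<bullet> pairing e W X b"
proof -
  have b: "b \<in> Ob B" "b' \<in> Ob B" using g by auto
  note [simp] = W X e g b
  have "T e b' \<bullet> F (Tob C W X) g = F (Unit C) g \<bullet> T e b" by (rule T_nat) simp_all
  note n = this mu_nat[OF W X g] inv_ep_nat[OF g, symmetric]
  note r = n(1)[THEN B.Cmp_reduce] n(2)[THEN B.Cmp_reduce] n(3)[THEN B.Cmp_reduce]
  show ?thesis unfolding pairing_def by (simp add: n r)
qed

end

context
  fixes X V c
  assumes X: "X \<in> Ob C" and V: "V \<in> Ob C"
    and c: "c \<in> Ar C" "Dom C c = Unit C" "Cod C c = Tob C X V"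
begin

lemma copairing_simps: assumes "b \<in> Ob B"
  shows "copairing c X V b \<in> Ar B" "Dom B (copairing c X V b) = b" "Cod B (copairing c X V b) = AO X (AO V b)"
  using assms V X c by (simp_all add: copairing_def)

lemma copairing_nat: assumes g: "g \<in> Ar B" "Dom B g = b" "Cod B g = b'"
  shows "copairing c X V b' \<bullet> g = F X (F V g) \<bullet> copairing c X V b"
proof -
  have b: "b \<in> Ob B" "b' \<in> Ob B" using g by auto
  note [simp] = V X c g b
  have "T c b' \<bullet> F (Unit C) g = F (Tob C X V) g \<bullet> T c b" by (rule T_nat) simp_all
  note n = this inv_mu_nat[OF X V g] ep_nat[OF g]
  note r = n(1)[THEN B.Cmp_reduce] n(2)[THEN B.Cmp_reduce] n(3)[THEN B.Cmp_reduce]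
  show ?thesis unfolding copairing_def by (simp add: n r)
qed

end

lemma T_Lun': assumes "X \<in> Ob C" "b \<in> Ob B"
  shows "T (Lun C X) b \<bullet> mu (Unit C) X b = inv_ar B (ep (AO X b))"
proof -
  have "(T (Lun C X) b \<bullet> mu (Unit C) X b) \<bullet> ep (AO X b) = Id B (AO X b)" using T_Lun[OF assms] assms by simp
  from B.iso_moveR[OF _ this] show ?thesis using assms by simp
qed

lemma T_Run': assumes "X \<in> Ob C" "b \<in> Ob B"
  shows "T (Run C X) b \<bullet> mu X (Unit C) b = F X (inv_ar B (ep b))"
proof -
  have "(T (Run C X) b \<bullet> mu X (Unit C) b) \<bullet> F X (ep b) = Id B (AO X b)" using T_Run[OF assms] assms by simp
  from B.iso_moveR[OF _ this] show ?thesis using assms by simp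
qed

lemma T_inv_Lun: assumes "X \<in> Ob C" "b \<in> Ob B"
  shows "inv_ar B (T (Lun C X) b) = mu (Unit C) X b \<bullet> ep (AO X b)"
  using B.iso_moveL[OF _ T_Lun[OF assms]] assms by simp

lemma T_inv_Run: assumes "X \<in> Ob C" "b \<in> Ob B"
  shows "inv_ar B (T (Run C X) b) = mu X (Unit C) b \<bullet> F X (ep b)"
  using B.iso_moveL[OF _ T_Run[OF assms]] assms by simp

text \<open>Composition of endofunctors is strictly associative, so an associator acts through
  \<open>mu\<close> alone. The right-hand side contains no \<open>T\<close>: rewriting in this
  direction removes the coherence morphisms of \<open>C\<close>.\<close>

lemma T_Assoc_mu: assumes "X \<in> Ob C" "Y \<in> Ob C" "Z \<in> Ob C" "b \<in> Ob B"
  shows "T (Assoc C X Y Z) b \<bullet> mu (Tob C X Y) Z b = mu X (Tob C Y Z) b \<bullet> F X (mu Y Z b) \<bullet> inv_ar B (mu X Y (AO Z b))"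
proof -
  have "(T (Assoc C X Y Z) b \<bullet> mu (Tob C X Y) Z b) \<bullet> mu X Y (AO Z b) = mu X (Tob C Y Z) b \<bullet> F X (mu Y Z b)"
    using T_Assoc[OF assms] assms by simp
  from B.iso_moveR[OF _ this] show ?thesis using assms by simp
qed

lemma T_inv_Assoc_mu: assumes "X \<in> Ob C" "Y \<in> Ob C" "Z \<in> Ob C" "b \<in> Ob B"
  shows "inv_ar B (T (Assoc C X Y Z) b) \<bullet> mu X (Tob C Y Z) b =
    mu (Tob C X Y) Z b \<bullet> mu X Y (AO Z b) \<bullet> inv_ar B (F X (mu Y Z b))"
proof -
  have "mu (Tob C X Y) Z b \<bullet> mu X Y (AO Z b) = inv_ar B (T (Assoc C X Y Z) b) \<bullet> mu X (Tob C Y Z) b \<bullet> F X (mu Y Z b)"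
    by (rule B.iso_moveL[OF _ T_Assoc[OF assms]]) (use assms in simp_all)
  then have "(inv_ar B (T (Assoc C X Y Z) b) \<bullet> mu X (Tob C Y Z) b) \<bullet> F X (mu Y Z b) = mu (Tob C X Y) Z b \<bullet> mu X Y (AO Z b)"
    using assms by simp
  from B.iso_moveR[OF _ this] show ?thesis using assms by simp
qed

lemma mu_T_left: assumes "f \<in> Ar C" "Dom C f = X" "Cod C f = X'" "Y \<in> Ob C" "b \<in> Ob B"
  shows "T (Tar C f (Id C Y)) b \<bullet> mu X Y b = mu X' Y b \<bullet> T f (AO Y b)"
proof -
  have "X \<in> Ob C" "X' \<in> Ob C" using assms by auto
  then show ?thesis using mu_T[of f X X' "Id C Y" Y Y b] assms by (simp add: Hom_iff)
qed

lemma mu_T_right: assumes "f \<in> Ar C" "Dom C f = Y" "Cod C f = Y'" "X \<in> Ob C" "b \<in> Ob B"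
  shows "T (Tar C (Id C X) f) b \<bullet> mu X Y b = mu X Y' b \<bullet> F X (T f b)"
proof -
  have "Y \<in> Ob C" "Y' \<in> Ob C" using assms by auto
  then show ?thesis using mu_T[of "Id C X" X X f Y Y' b] assms by (simp add: Hom_iff)
qed

text \<open>The unitors and the associator in \<open>mate\<close> are absorbed by \<open>mu\<close>
  and \<open>ep\<close>, which leaves the zigzag as it reads in a strict monoidal category.\<close>

lemma T_mate:
  assumes [simp]: "W \<in> Ob C" "X \<in> Ob C" "V \<in> Ob C" "b \<in> Ob B"
    and e [simp]: "e \<in> Ar C" "Dom C e = Tob C W X" "Cod C e = Unit C"
    and c [simp]: "c \<in> Ar C" "Dom C c = Unit C" "Cod C c = Tob C X V"
  shows "T (mate C X V c W e) b = pairing e W X (AO V b) \<bullet> F W (copairing c X V b)"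
proof -
  have "T (Tar C (Id C W) c) b \<bullet> mu W (Unit C) b = mu W (Tob C X V) b \<bullet> F W (T c b)"
    by (rule mu_T_right) simp_all
  moreover have "T (Tar C e (Id C V)) b \<bullet> mu (Tob C W X) V b = mu (Unit C) V b \<bullet> T e (AO V b)"
    by (rule mu_T_left) simp_all
  moreover have "inv_ar B (T (Assoc C W X V) b) \<bullet> mu W (Tob C X V) b =
      mu (Tob C W X) V b \<bullet> mu W X (AO V b) \<bullet> F W (inv_ar B (mu X V b))"
    using T_inv_Assoc_mu[of W X V b] by simp
  moreover have "T (Lun C V) b \<bullet> mu (Unit C) V b = inv_ar B (ep (AO V b))" by (rule T_Lun') simp_all
  moreover note n = calculation
  ultimately show ?thesis
    by (simp add: mate_def pairing_def copairing_def T_inv_Run n n[THEN B.Cmp_reduce])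
qed

text \<open>The other zigzag of \<open>left_dual\<close>, which is not an instance of
  \<open>mate\<close>; the coherence morphisms are absorbed in the same way.\<close>

lemma T_comate:
  assumes [simp]: "X \<in> Ob C" "V \<in> Ob C" "b \<in> Ob B"
    and a [simp]: "a \<in> Ar C" "Dom C a = Tob C V X" "Cod C a = Unit C"
    and c [simp]: "c \<in> Ar C" "Dom C c = Unit C" "Cod C c = Tob C X V"
  shows "T (Cmp C (Run C X) (Cmp C (Tar C (Id C X) a) (Cmp C (Assoc C X V X) (Cmp C (Tar C c (Id C X)) (inv_ar C (Lun C X)))))) b
    = F X (pairing a V X b) \<bullet> copairing c X V (AO X b)"
proof -
  have "T (Tar C c (Id C X)) b \<bullet> mu (Unit C) X b = mu (Tob C X V) X b \<bullet> T c (AO X b)"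
    by (rule mu_T_left) simp_all
  moreover have "T (Tar C (Id C X) a) b \<bullet> mu X (Tob C V X) b = mu X (Unit C) b \<bullet> F X (T a b)"
    by (rule mu_T_right) simp_all
  moreover have "T (Assoc C X V X) b \<bullet> mu (Tob C X V) X b = mu X (Tob C V X) b \<bullet> F X (mu V X b) \<bullet> inv_ar B (mu X V (AO X b))"
    by (rule T_Assoc_mu) simp_all
  moreover have "T (Run C X) b \<bullet> mu X (Unit C) b = F X (inv_ar B (ep b))" by (rule T_Run') simp_all
  moreover note n = calculation
  ultimately show ?thesis
    by (simp add: pairing_def copairing_def T_inv_Lun n n[THEN B.Cmp_reduce])
qed

text \<open>The two duality equations in \<open>C\<close>, seen through the action, are the triangle
  identities of an adjunction between the functors of \<open>V\<close> and \<open>X\<close>.\<close>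

lemma left_dual_zigzag:
  assumes d: "left_dual C X V a c" and b: "b \<in> Ob B"
  shows "F X (pairing a V X b) \<bullet> copairing c X V (AO X b) = Id B (AO X b)"
    and "pairing a V X (AO V b) \<bullet> F V (copairing c X V b) = Id B (AO V b)"
proof -
  have X [simp]: "X \<in> Ob C" "V \<in> Ob C" and a [simp]: "a \<in> Ar C" "Dom C a = Tob C V X" "Cod C a = Unit C"
    and c [simp]: "c \<in> Ar C" "Dom C c = Unit C" "Cod C c = Tob C X V"
    using d by (auto simp: left_dual_def Hom_iff)
  have "mate C X V c V a = Id C V" using d by (simp add: left_dual_def mate_def)
  then show "pairing a V X (AO V b) \<bullet> F V (copairing c X V b) = Id B (AO V b)"
    using T_mate[of V X V b a c] b by simp
  have "Cmp C (Run C X) (Cmp C (Tar C (Id C X) a) (Cmp C (Assoc C X V X) (Cmp C (Tar C c (Id C X)) (inv_ar C (Lun C X))))) = Id C X"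
    using d by (simp only: left_dual_def)
  from arg_cong[OF this, of "\<lambda>f. T f b"]
  show "F X (pairing a V X b) \<bullet> copairing c X V (AO X b) = Id B (AO X b)"
    unfolding T_comate[OF X b a c] using b by simp
qed

end

section \<open>Adjunctions and duals\<close>

text \<open>\<open>Q\<close> is left adjoint to \<open>P\<close>, with counit \<open>a\<close> and
  unit \<open>c\<close>. The functors are bare functions on objects and morphisms, so that
  composites fit without being packed into records.\<close>

locale endo_adjunction = category B for B :: "('p, 'n, 'y) cat_scheme" (structure) +
  fixes PO :: "'p \<Rightarrow> 'p" and P :: "'n \<Rightarrow> 'n" and QO :: "'p \<Rightarrow> 'p" and Q :: "'n \<Rightarrow> 'n"
    and a :: "'p \<Rightarrow> 'n" and c :: "'p \<Rightarrow> 'n"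
  assumes P: "\<And>g. g \<in> Ar B \<Longrightarrow> P g \<in> Ar B" "\<And>g. g \<in> Ar B \<Longrightarrow> Dom B (P g) = PO (Dom B g)"
      "\<And>g. g \<in> Ar B \<Longrightarrow> Cod B (P g) = PO (Cod B g)" "\<And>b. b \<in> Ob B \<Longrightarrow> PO b \<in> Ob B"
      "\<And>b. b \<in> Ob B \<Longrightarrow> P (Id B b) = Id B (PO b)"
      "\<And>g h. \<lbrakk>g \<in> Ar B; h \<in> Ar B; Dom B h = Cod B g\<rbrakk> \<Longrightarrow> P (h \<bullet> g) = P h \<bullet> P g"
    and Q: "\<And>g. g \<in> Ar B \<Longrightarrow> Q g \<in> Ar B" "\<And>g. g \<in> Ar B \<Longrightarrow> Dom B (Q g) = QO (Dom B g)"
      "\<And>g. g \<in> Ar B \<Longrightarrow> Cod B (Q g) = QO (Cod B g)" "\<And>b. b \<in> Ob B \<Longrightarrow> QO b \<in> Ob B"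
      "\<And>b. b \<in> Ob B \<Longrightarrow> Q (Id B b) = Id B (QO b)"
      "\<And>g h. \<lbrakk>g \<in> Ar B; h \<in> Ar B; Dom B h = Cod B g\<rbrakk> \<Longrightarrow> Q (h \<bullet> g) = Q h \<bullet> Q g"
    and a: "\<And>b. b \<in> Ob B \<Longrightarrow> a b \<in> Ar B" "\<And>b. b \<in> Ob B \<Longrightarrow> Dom B (a b) = QO (PO b)" "\<And>b. b \<in> Ob B \<Longrightarrow> Cod B (a b) = b"
    and a_nat: "\<And>g b b'. \<lbrakk>g \<in> Ar B; Dom B g = b; Cod B g = b'\<rbrakk> \<Longrightarrow> a b' \<bullet> Q (P g) = g \<bullet> a b"
    and c: "\<And>b. b \<in> Ob B \<Longrightarrow> c b \<in> Ar B" "\<And>b. b \<in> Ob B \<Longrightarrow> Dom B (c b) = b" "\<And>b. b \<in> Ob B \<Longrightarrow> Cod B (c b) = PO (QO b)"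
    and c_nat: "\<And>g b b'. \<lbrakk>g \<in> Ar B; Dom B g = b; Cod B g = b'\<rbrakk> \<Longrightarrow> c b' \<bullet> g = P (Q g) \<bullet> c b"
    and zig: "\<And>b. b \<in> Ob B \<Longrightarrow> P (a b) \<bullet> c (PO b) = Id B (PO b)"
    and zag: "\<And>b. b \<in> Ob B \<Longrightarrow> a (QO b) \<bullet> Q (c b) = Id B (QO b)"

text \<open>Two left adjoints of the same functor: \<open>w\<close> is the mate of the identity.\<close>

locale two_adjunctions = A1: endo_adjunction B PO P QO Q a c + A2: endo_adjunction B PO P QO' Q' a' c'
  for B :: "('p, 'n, 'y) cat_scheme" (structure) and PO P QO Q a c QO' Q' a' c'
begin

definition w :: "'p \<Rightarrow> 'n" where "w b = a (QO' b) \<bullet> Q (c' b)"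
definition w' :: "'p \<Rightarrow> 'n" where "w' b = a' (QO b) \<bullet> Q' (c b)"

lemma w_simps: assumes "b \<in> Ob B" shows "w b \<in> Ar B" "Dom B (w b) = QO b" "Cod B (w b) = QO' b"
  using assms by (simp_all add: w_def A1.Q A1.P A2.Q A1.a A2.c)

lemma w'_simps: assumes "b \<in> Ob B" shows "w' b \<in> Ar B" "Dom B (w' b) = QO' b" "Cod B (w' b) = QO b"
  using assms by (simp_all add: w'_def A1.Q A1.P A2.Q A2.a A1.c)

text \<open>Naturality of \<open>a\<close> and of \<open>c'\<close> brings the two comparison maps
  together; one triangle identity of each adjunction then finishes.\<close>

lemma w'_w: assumes b: "b \<in> Ob B" shows "w' b \<bullet> w b = Id B (QO b)"
proof -
  note [simp] = b A1.P A1.Q A2.Q A1.a A1.c A2.a A2.c w'_simps[OF b]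
  have n1: "a (QO b) \<bullet> Q (P (w' b)) = w' b \<bullet> a (QO' b)" by (rule A1.a_nat) simp_all
  have n2: "c' (PO (QO b)) \<bullet> c b = P (Q' (c b)) \<bullet> c' b" by (rule A2.c_nat) simp_all
  have z: "P (a' (QO b)) \<bullet> c' (PO (QO b)) = Id B (PO (QO b))" by (rule A2.zig) simp
  have "w' b \<bullet> w b = (w' b \<bullet> a (QO' b)) \<bullet> Q (c' b)" by (simp add: w_def)
  also have "\<dots> = (a (QO b) \<bullet> Q (P (w' b))) \<bullet> Q (c' b)" by (simp only: n1)
  also have "\<dots> = a (QO b) \<bullet> Q (P (w' b) \<bullet> c' b)" by simp
  also have "P (w' b) \<bullet> c' b = P (a' (QO b)) \<bullet> P (Q' (c b)) \<bullet> c' b" by (simp add: w'_def)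
  also have "\<dots> = P (a' (QO b)) \<bullet> c' (PO (QO b)) \<bullet> c b" by (simp only: n2)
  also have "\<dots> = c b" using A1.Cmp_reduce[OF z, of "c b"] by simp
  also have "a (QO b) \<bullet> Q (c b) = Id B (QO b)" by (rule A1.zag) simp
  finally show ?thesis .
qed

lemma a'_w: assumes b: "b \<in> Ob B" shows "a' b \<bullet> w (PO b) = a b"
proof -
  note [simp] = b A1.P A1.Q A2.Q A1.a A1.c A2.a A2.c
  have n: "a b \<bullet> Q (P (a' b)) = a' b \<bullet> a (QO' (PO b))" by (rule A1.a_nat) simp_all
  have "a' b \<bullet> w (PO b) = (a' b \<bullet> a (QO' (PO b))) \<bullet> Q (c' (PO b))" by (simp add: w_def)
  also have "\<dots> = (a b \<bullet> Q (P (a' b))) \<bullet> Q (c' (PO b))" by (simp only: n)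
  also have "\<dots> = a b \<bullet> Q (P (a' b) \<bullet> c' (PO b))" by simp
  also have "\<dots> = a b" by (simp add: A2.zig)
  finally show ?thesis .
qed

lemma P_w_c: assumes b: "b \<in> Ob B" shows "P (w b) \<bullet> c b = c' b"
proof -
  note [simp] = b A1.P A1.Q A2.Q A1.a A1.c A2.a A2.c
  have n: "c (PO (QO' b)) \<bullet> c' b = P (Q (c' b)) \<bullet> c b" by (rule A1.c_nat) simp_all
  have "P (w b) \<bullet> c b = P (a (QO' b)) \<bullet> (P (Q (c' b)) \<bullet> c b)" by (simp add: w_def)
  also have "\<dots> = P (a (QO' b)) \<bullet> (c (PO (QO' b)) \<bullet> c' b)" by (simp only: n)
  also have "\<dots> = c' b" using A1.Cmp_reduce[OF A1.zig, of "QO' b" "c' b"] by simp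
  finally show ?thesis .
qed

end

text \<open>Exchanging the two adjunctions exchanges \<open>w\<close> and \<open>w'\<close>, so the
  one-sided identity \<open>w'_w\<close> also gives the other one.\<close>

lemma (in two_adjunctions) w_iso: assumes b: "b \<in> Ob B" shows "iso_ar B (w b)"
proof -
  interpret S: two_adjunctions B PO P QO' Q' a' c' QO Q a c ..
  have "S.w = w'" "S.w' = w" by (auto simp: fun_eq_iff S.w_def w'_def w_def S.w'_def)
  then have "w b \<bullet> w' b = Id B (QO' b)" using S.w'_w[OF b] by simp
  then show ?thesis using w'_w[OF b] w_simps[OF b] w'_simps[OF b] by (intro A1.iso_arI[of "w b" "w' b"]) simp_all
qed

text \<open>Left adjoints compose in the opposite order. This is the reason why the dual of a
  product is compared with the product of the duals in reverse.\<close>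

lemma endo_adjunction_compose:
  assumes "endo_adjunction B PO P QO Q a c" "endo_adjunction B PO' P' QO' Q' a' c'"
  shows "endo_adjunction B (\<lambda>b. PO (PO' b)) (\<lambda>g. P (P' g)) (\<lambda>b. QO' (QO b)) (\<lambda>g. Q' (Q g))
    (\<lambda>b. Cmp B (a' b) (Q' (a (PO' b)))) (\<lambda>b. Cmp B (P (c' (QO b))) (c b))"
proof -
  interpret A1: endo_adjunction B PO P QO Q a c by fact
  interpret A2: endo_adjunction B PO' P' QO' Q' a' c' by fact
  note [simp] = A1.P A1.Q A2.P A2.Q A1.a A1.c A2.a A2.c
  have N: "a' (Cod B g) \<bullet>\<^bsub>B\<^esub> Q' (a (PO' (Cod B g))) \<bullet>\<^bsub>B\<^esub> Q' (Q (P (P' g))) = g \<bullet>\<^bsub>B\<^esub> a' (Dom B g) \<bullet>\<^bsub>B\<^esub> Q' (a (PO' (Dom B g)))" "P (c' (QO (Cod B g))) \<bullet>\<^bsub>B\<^esub> c (Cod B g) \<bullet>\<^bsub>B\<^esub> g = P (P' (Q' (Q g))) \<bullet>\<^bsub>B\<^esub> P (c' (QO (Dom B g))) \<bullet>\<^bsub>B\<^esub> c (Dom B g)" if g [simp]: "g \<in> Ar B" for g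
  proof -
    have "a (PO' (Cod B g)) \<bullet>\<^bsub>B\<^esub> Q (P (P' g)) = P' g \<bullet>\<^bsub>B\<^esub> a (PO' (Dom B g))" by (rule A1.a_nat) simp_all
    then have n: "Q' (a (PO' (Cod B g))) \<bullet>\<^bsub>B\<^esub> Q' (Q (P (P' g))) = Q' (P' g) \<bullet>\<^bsub>B\<^esub> Q' (a (PO' (Dom B g)))"
      by (simp flip: A2.Q(6))
    have n': "a' (Cod B g) \<bullet>\<^bsub>B\<^esub> Q' (P' g) = g \<bullet>\<^bsub>B\<^esub> a' (Dom B g)" by (rule A2.a_nat) simp_all
    show "a' (Cod B g) \<bullet>\<^bsub>B\<^esub> Q' (a (PO' (Cod B g))) \<bullet>\<^bsub>B\<^esub> Q' (Q (P (P' g))) = g \<bullet>\<^bsub>B\<^esub> a' (Dom B g) \<bullet>\<^bsub>B\<^esub> Q' (a (PO' (Dom B g)))"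
      unfolding n using A1.Cmp_reduce[OF n', of "Q' (a (PO' (Dom B g)))"] by simp
    have "c' (QO (Cod B g)) \<bullet>\<^bsub>B\<^esub> Q g = P' (Q' (Q g)) \<bullet>\<^bsub>B\<^esub> c' (QO (Dom B g))" by (rule A2.c_nat) simp_all
    then have n: "P (c' (QO (Cod B g))) \<bullet>\<^bsub>B\<^esub> P (Q g) = P (P' (Q' (Q g))) \<bullet>\<^bsub>B\<^esub> P (c' (QO (Dom B g)))"
      by (simp flip: A1.P(6))
    have n': "c (Cod B g) \<bullet>\<^bsub>B\<^esub> g = P (Q g) \<bullet>\<^bsub>B\<^esub> c (Dom B g)" by (rule A1.c_nat) simp_all
    show "P (c' (QO (Cod B g))) \<bullet>\<^bsub>B\<^esub> c (Cod B g) \<bullet>\<^bsub>B\<^esub> g = P (P' (Q' (Q g))) \<bullet>\<^bsub>B\<^esub> P (c' (QO (Dom B g))) \<bullet>\<^bsub>B\<^esub> c (Dom B g)"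
      unfolding n' using A1.Cmp_reduce[OF n, of "c (Dom B g)"] by simp
  qed
  have Z: "P (P' (a' b)) \<bullet>\<^bsub>B\<^esub> P (P' (Q' (a (PO' b)))) \<bullet>\<^bsub>B\<^esub> P (c' (QO (PO (PO' b)))) \<bullet>\<^bsub>B\<^esub> c (PO (PO' b)) = Id B (PO (PO' b))" "a' (QO' (QO b)) \<bullet>\<^bsub>B\<^esub> Q' (a (PO' (QO' (QO b)))) \<bullet>\<^bsub>B\<^esub> Q' (Q (P (c' (QO b)))) \<bullet>\<^bsub>B\<^esub> Q' (Q (c b)) = Id B (QO' (QO b))" if b [simp]: "b \<in> Ob B" for b
  proof -
    have n: "P' (Q' (a (PO' b))) \<bullet>\<^bsub>B\<^esub> c' (QO (PO (PO' b))) = c' (PO' b) \<bullet>\<^bsub>B\<^esub> a (PO' b)"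
      by (rule A2.c_nat[symmetric]) simp_all
    have "P (P' (a' b)) \<bullet>\<^bsub>B\<^esub> P (P' (Q' (a (PO' b)))) \<bullet>\<^bsub>B\<^esub> P (c' (QO (PO (PO' b)))) \<bullet>\<^bsub>B\<^esub> c (PO (PO' b))
      = P (P' (a' b)) \<bullet>\<^bsub>B\<^esub> P (P' (Q' (a (PO' b))) \<bullet>\<^bsub>B\<^esub> c' (QO (PO (PO' b)))) \<bullet>\<^bsub>B\<^esub> c (PO (PO' b))" by simp
    also have "\<dots> = P (P' (a' b) \<bullet>\<^bsub>B\<^esub> c' (PO' b)) \<bullet>\<^bsub>B\<^esub> P (a (PO' b)) \<bullet>\<^bsub>B\<^esub> c (PO (PO' b))"
      unfolding n by simp
    also have "\<dots> = Id B (PO (PO' b))" by (simp add: A1.zig A2.zig)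
    finally show "P (P' (a' b)) \<bullet>\<^bsub>B\<^esub> P (P' (Q' (a (PO' b)))) \<bullet>\<^bsub>B\<^esub> P (c' (QO (PO (PO' b)))) \<bullet>\<^bsub>B\<^esub> c (PO (PO' b)) = Id B (PO (PO' b))" .
    have n: "a (PO' (QO' (QO b))) \<bullet>\<^bsub>B\<^esub> Q (P (c' (QO b))) = c' (QO b) \<bullet>\<^bsub>B\<^esub> a (QO b)"
      by (rule A1.a_nat) simp_all
    have "a' (QO' (QO b)) \<bullet>\<^bsub>B\<^esub> Q' (a (PO' (QO' (QO b)))) \<bullet>\<^bsub>B\<^esub> Q' (Q (P (c' (QO b)))) \<bullet>\<^bsub>B\<^esub> Q' (Q (c b))
      = a' (QO' (QO b)) \<bullet>\<^bsub>B\<^esub> Q' (a (PO' (QO' (QO b))) \<bullet>\<^bsub>B\<^esub> Q (P (c' (QO b)))) \<bullet>\<^bsub>B\<^esub> Q' (Q (c b))" by simp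
    also have "\<dots> = (a' (QO' (QO b)) \<bullet>\<^bsub>B\<^esub> Q' (c' (QO b))) \<bullet>\<^bsub>B\<^esub> Q' (a (QO b) \<bullet>\<^bsub>B\<^esub> Q (c b))"
      unfolding n by simp
    also have "\<dots> = Id B (QO' (QO b))" by (simp add: A1.zag A2.zag)
    finally show "a' (QO' (QO b)) \<bullet>\<^bsub>B\<^esub> Q' (a (PO' (QO' (QO b)))) \<bullet>\<^bsub>B\<^esub> Q' (Q (P (c' (QO b)))) \<bullet>\<^bsub>B\<^esub> Q' (Q (c b)) = Id B (QO' (QO b))" .
  qed
  show ?thesis by unfold_locales (auto simp: N Z)
qed

section \<open>Actions of rigid categories\<close>

context rigid_category
begin

lemma dual_simps [simp]: assumes "X \<in> Ob C"
  shows "Dual C X \<in> Ob C" "Ann C X \<in> Ar C" "Dom C (Ann C X) = Dual C X \<boxtimes> X" "Cod C (Ann C X) = Unit C"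
    "Cre C X \<in> Ar C" "Dom C (Cre C X) = Unit C" "Cod C (Cre C X) = X \<boxtimes> Dual C X"
  using left_duals[OF assms] by (auto simp: left_dual_def Hom_iff)

lemma mate_simps: assumes "X \<in> Ob C" "V \<in> Ob C" "W \<in> Ob C" "c \<in> Ar C" "Dom C c = Unit C" "Cod C c = X \<boxtimes> V"
    "e \<in> Ar C" "Dom C e = W \<boxtimes> X" "Cod C e = Unit C"
  shows "mate C X V c W e \<in> Ar C" "Dom C (mate C X V c W e) = W" "Cod C (mate C X V c W e) = V"
  using assms by (simp_all add: mate_def)

lemma Dar_simps [simp]: assumes "f \<in> Ar C"
  shows "Dar C f \<in> Ar C" "Dom C (Dar C f) = Dual C (Cod C f)" "Cod C (Dar C f) = Dual C (Dom C f)"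
  using assms by (simp_all add: Dar_def dual_ar_def mate_simps)

lemma Dmu_simps [simp]: assumes "X \<in> Ob C" "Y \<in> Ob C"
  shows "Dmu C X Y \<in> Ar C" "Dom C (Dmu C X Y) = Dual C Y \<boxtimes> Dual C X" "Cod C (Dmu C X Y) = Dual C (X \<boxtimes> Y)"
  using assms by (simp_all add: Dmu_def mate_simps)

lemma Deps_simps [simp]: "Deps C \<in> Ar C" "Dom C (Deps C) = Unit C" "Cod C (Deps C) = Dual C (Unit C)"
  by (simp_all add: Deps_def mate_simps)

end

locale rigid_action = action C B A T mu ep + C: rigid_category C
  for C :: "('o, 'm, 'k :: field, 'z) pivcat_scheme"
    and B :: "('p, 'n, 'k, 'y) lincat_scheme" (structure) and A T mu ep
begin

text \<open>\<open>an X\<close> and \<open>cr X\<close> are the counit and unit by which the functor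
  of \<open>Dual C X\<close> is left adjoint to that of \<open>X\<close>.\<close>

definition an :: "'o \<Rightarrow> 'p \<Rightarrow> 'n" where "an X b = pairing (Ann C X) (Dual C X) X b"
definition cr :: "'o \<Rightarrow> 'p \<Rightarrow> 'n" where "cr X b = copairing (Cre C X) X (Dual C X) b"

lemma an_simps [simp]: assumes "X \<in> Ob C" "b \<in> Ob B"
  shows "an X b \<in> Ar B" "Dom B (an X b) = AO (Dual C X) (AO X b)" "Cod B (an X b) = b"
  using assms by (simp_all add: an_def pairing_simps)

lemma cr_simps [simp]: assumes "X \<in> Ob C" "b \<in> Ob B"
  shows "cr X b \<in> Ar B" "Dom B (cr X b) = b" "Cod B (cr X b) = AO X (AO (Dual C X) b)"
  using assms by (simp_all add: cr_def copairing_simps)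

lemma dual_adjunction: assumes "X \<in> Ob C"
  shows "endo_adjunction B (AO X) (F X) (AO (Dual C X)) (F (Dual C X)) (an X) (cr X)"
proof (unfold_locales)
  fix g b b' assume "g \<in> Ar B" "Dom B g = b" "Cod B g = b'"
  then show "an X b' \<bullet> F (Dual C X) (F X g) = g \<bullet> an X b" "cr X b' \<bullet> g = F X (F (Dual C X) g) \<bullet> cr X b"
    unfolding an_def cr_def using assms by (auto intro!: pairing_nat copairing_nat)
next
  fix b assume "b \<in> Ob B"
  then show "F X (an X b) \<bullet> cr X (AO X b) = Id B (AO X b)" "an X (AO (Dual C X) b) \<bullet> F (Dual C X) (cr X b) = Id B (AO (Dual C X) b)"
    unfolding an_def cr_def by (auto intro!: left_dual_zigzag C.left_duals assms)
qed (use assms in simp_all)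

lemmas an_nat = endo_adjunction.a_nat[OF dual_adjunction]
lemmas cr_nat = endo_adjunction.c_nat[OF dual_adjunction]
lemmas zig = endo_adjunction.zig[OF dual_adjunction]
lemmas zag = endo_adjunction.zag[OF dual_adjunction]

lemma T_Dar: assumes f: "f \<in> Ar C" "Dom C f = X" "Cod C f = Y" and b: "b \<in> Ob B"
  shows "T (Dar C f) b = an Y (AO (Dual C X) b) \<bullet> F (Dual C Y) (T f (AO (Dual C X) b)) \<bullet> F (Dual C Y) (cr X b)"
proof -
  have [simp]: "X \<in> Ob C" "Y \<in> Ob C" using f by auto
  note [simp] = f b
  let ?e = "Cmp C (Ann C Y) (Tar C (Id C (Dual C Y)) f)"
  have "T (Tar C (Id C (Dual C Y)) f) b' \<bullet> mu (Dual C Y) X b' = mu (Dual C Y) Y b' \<bullet> F (Dual C Y) (T f b')" if "b' \<in> Ob B" for b'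
    by (rule mu_T_right) (use that in simp_all)
  then have "pairing ?e (Dual C Y) X b' = an Y b' \<bullet> F (Dual C Y) (T f b')" if "b' \<in> Ob B" for b'
    using that by (simp add: pairing_def an_def)
  moreover have "T (Dar C f) b = pairing ?e (Dual C Y) X (AO (Dual C X) b) \<bullet> F (Dual C Y) (copairing (Cre C X) X (Dual C X) b)"
    unfolding Dar_def dual_ar_def f by (rule T_mate) simp_all
  ultimately show ?thesis by (simp add: cr_def[symmetric])
qed

text \<open>The property that characterises the dual of \<open>f\<close>: next to an annihilation,
  \<open>f\<close> on one leg may be traded for its dual on the other. It follows from naturality
  and one zigzag.\<close>

lemma an_Dar: assumes f: "f \<in> Ar C" "Dom C f = X" "Cod C f = Y" and b: "b \<in> Ob B"
  shows "an X b \<bullet> T (Dar C f) (AO X b) = an Y b \<bullet> F (Dual C Y) (T f b)"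
proof -
  have [simp]: "X \<in> Ob C" "Y \<in> Ob C" using f by auto
  note [simp] = f b
  have n: "an Y b \<bullet> F (Dual C Y) (F Y (an X b)) = an X b \<bullet> an Y (AO (Dual C X) (AO X b))"
    by (rule an_nat) simp_all
  have t: "T f b \<bullet> F X (an X b) = F Y (an X b) \<bullet> T f (AO (Dual C X) (AO X b))" by (rule T_nat) simp_all
  have "an X b \<bullet> T (Dar C f) (AO X b) = (an X b \<bullet> an Y (AO (Dual C X) (AO X b))) \<bullet>
      F (Dual C Y) (T f (AO (Dual C X) (AO X b))) \<bullet> F (Dual C Y) (cr X (AO X b))"
    by (subst T_Dar[OF f]) simp_all
  also have "\<dots> = an Y b \<bullet> F (Dual C Y) ((F Y (an X b) \<bullet> T f (AO (Dual C X) (AO X b))) \<bullet> cr X (AO X b))"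
    unfolding n[symmetric] by simp
  also have "\<dots> = an Y b \<bullet> F (Dual C Y) (T f b \<bullet> (F X (an X b) \<bullet> cr X (AO X b)))"
    unfolding t[symmetric] by simp
  also have "\<dots> = an Y b \<bullet> F (Dual C Y) (T f b)" by (simp add: zig)
  finally show ?thesis .
qed

lemma T_Deps: assumes b: "b \<in> Ob B"
  shows "T (Deps C) b = inv_ar B (ep (AO (Dual C (Unit C)) b)) \<bullet> cr (Unit C) b \<bullet> inv_ar B (ep b)"
proof -
  let ?U = "Unit C" and ?V = "Dual C (Unit C)"
  note [simp] = b
  have "T (Deps C) b = pairing (Lun C ?U) ?U ?U (AO ?V b) \<bullet> F ?U (cr ?U b)"
    unfolding Deps_def cr_def by (rule T_mate) simp_all
  also have "pairing (Lun C ?U) ?U ?U (AO ?V b) = inv_ar B (ep (AO ?V b)) \<bullet> inv_ar B (ep (AO ?U (AO ?V b)))"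
    unfolding pairing_def by (simp add: T_Lun')
  also have "(inv_ar B (ep (AO ?V b)) \<bullet> inv_ar B (ep (AO ?U (AO ?V b)))) \<bullet> F ?U (cr ?U b)
      = inv_ar B (ep (AO ?V b)) \<bullet> (inv_ar B (ep (AO ?U (AO ?V b))) \<bullet> F ?U (cr ?U b))" by simp
  also have "inv_ar B (ep (AO ?U (AO ?V b))) \<bullet> F ?U (cr ?U b) = cr ?U b \<bullet> inv_ar B (ep b)"
    by (rule inv_ep_nat[symmetric]) simp_all
  finally show ?thesis .
qed

text \<open>The unit object acts as the identity functor up to \<open>ep\<close>, so its left dual
  does as well: \<open>z\<close> is the comparison obtained from the creation, and \<open>k\<close>,
  obtained from the annihilation, is its inverse.\<close>

lemma T_Deps_iso: assumes b: "b \<in> Ob B" shows "iso_ar B (T (Deps C) b)"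
proof -
  let ?U = "Unit C" and ?V = "Dual C (Unit C)"
  define z where "z b = inv_ar B (ep (AO ?V b)) \<bullet> cr ?U b" for b
  define k where "k b = an ?U b \<bullet> F ?V (ep b)" for b
  have zk [simp]: "z b \<in> Ar B" "Dom B (z b) = b" "Cod B (z b) = AO ?V b"
    "k b \<in> Ar B" "Dom B (k b) = AO ?V b" "Cod B (k b) = b" if "b \<in> Ob B" for b
    using that by (simp_all add: z_def k_def)
  have k_nat: "k (Cod B g) \<bullet> F ?V g = g \<bullet> k (Dom B g)" if g [simp]: "g \<in> Ar B" for g
  proof -
    have n: "ep (Cod B g) \<bullet> g = F ?U g \<bullet> ep (Dom B g)" by (rule ep_nat) simp_all
    have m: "an ?U (Cod B g) \<bullet> F ?V (F ?U g) = g \<bullet> an ?U (Dom B g)" by (rule an_nat) simp_all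
    have "k (Cod B g) \<bullet> F ?V g = an ?U (Cod B g) \<bullet> F ?V (ep (Cod B g) \<bullet> g)" by (simp add: k_def)
    also have "\<dots> = (an ?U (Cod B g) \<bullet> F ?V (F ?U g)) \<bullet> F ?V (ep (Dom B g))" unfolding n by simp
    also have "\<dots> = g \<bullet> k (Dom B g)" unfolding m by (simp add: k_def)
    finally show ?thesis .
  qed
  have kz: "k b \<bullet> z b = Id B b" if b [simp]: "b \<in> Ob B" for b
  proof -
    have n: "an ?U b \<bullet> inv_ar B (ep (AO ?V (AO ?U b))) = inv_ar B (ep b) \<bullet> F ?U (an ?U b)"
      by (rule inv_ep_nat) simp_all
    have n2: "F ?V (ep b) \<bullet> inv_ar B (ep (AO ?V b)) = inv_ar B (ep (AO ?V (AO ?U b))) \<bullet> F ?U (F ?V (ep b))"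
      by (rule inv_ep_nat) simp_all
    have m: "cr ?U (AO ?U b) \<bullet> ep b = F ?U (F ?V (ep b)) \<bullet> cr ?U b" by (rule cr_nat) simp_all
    have "k b \<bullet> z b = an ?U b \<bullet> (F ?V (ep b) \<bullet> inv_ar B (ep (AO ?V b))) \<bullet> cr ?U b" by (simp add: k_def z_def)
    also have "\<dots> = (an ?U b \<bullet> inv_ar B (ep (AO ?V (AO ?U b)))) \<bullet> (F ?U (F ?V (ep b)) \<bullet> cr ?U b)" unfolding n2 by simp
    also have "\<dots> = inv_ar B (ep b) \<bullet> (F ?U (an ?U b) \<bullet> cr ?U (AO ?U b)) \<bullet> ep b" unfolding n m[symmetric] by simp
    also have "\<dots> = Id B b" by (simp add: zig)
    finally show ?thesis .
  qed
  \<comment> \<open>Naturality of \<open>k\<close> at the morphism \<open>z b\<close> moves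
    \<open>z b\<close> inside the functor of the dual, where the second zigzag applies.\<close>
  have "z b \<bullet> k b = Id B (AO ?V b)"
  proof -
    have "z b \<bullet> k b = k (AO ?V b) \<bullet> F ?V (z b)" using k_nat[of "z b"] b by simp
    also have "\<dots> = an ?U (AO ?V b) \<bullet> F ?V (ep (AO ?V b) \<bullet> z b)" using b by (simp add: k_def)
    also have "ep (AO ?V b) \<bullet> z b = cr ?U b" using b by (simp add: z_def)
    finally show ?thesis using b by (simp add: zag)
  qed
  then have "iso_ar B (z b)" using kz[OF b] b by (intro B.iso_arI[where g = "k b"]) simp_all
  moreover have "T (Deps C) b = z b \<bullet> inv_ar B (ep b)" using b by (simp add: T_Deps z_def)
  ultimately show ?thesis using b by simp
qed

text \<open>\<open>n\<close> is the pairing whose mate is \<open>Dmu\<close>. Once associators and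
  unitors are stripped, it annihilates the inner pair \<open>X'\<close>, \<open>X\<close> and then
  the outer pair \<open>Y'\<close>, \<open>Y\<close>.\<close>

lemma nested_pairing:
  assumes [simp]: "X \<in> Ob C" "Y \<in> Ob C" "b \<in> Ob B"
  defines "X' \<equiv> Dual C X" and "Y' \<equiv> Dual C Y"
  defines "n \<equiv> Cmp C (Ann C Y) (Cmp C (Tar C (Id C Y') (Lun C Y)) (Cmp C (Tar C (Id C Y') (Tar C (Ann C X) (Id C Y)))
       (Cmp C (Tar C (Id C Y') (inv_ar C (Assoc C X' X Y))) (Assoc C Y' X' (Tob C X Y)))))"
  shows "n \<in> Ar C" "Dom C n = Tob C (Tob C Y' X') (Tob C X Y)" "Cod C n = Unit C"
    "pairing n (Tob C Y' X') (Tob C X Y) b \<bullet> mu Y' X' (AO (Tob C X Y) b) \<bullet> F Y' (F X' (mu X Y b))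
      = an Y b \<bullet> F Y' (an X (AO Y b))"
proof -
  have [simp]: "X' \<in> Ob C" "Y' \<in> Ob C" by (simp_all add: X'_def Y'_def)
  have [simp]: "Dom C (Ann C X) = Tob C X' X" "Dom C (Ann C Y) = Tob C Y' Y"
     by (simp_all add: X'_def Y'_def)
  show n [simp]: "n \<in> Ar C" "Dom C n = Tob C (Tob C Y' X') (Tob C X Y)" "Cod C n = Unit C"
    by (simp_all add: n_def)
  have r1: "T (Assoc C Y' X' (Tob C X Y)) b \<bullet> mu (Tob C Y' X') (Tob C X Y) b =
      mu Y' (Tob C X' (Tob C X Y)) b \<bullet> F Y' (mu X' (Tob C X Y) b) \<bullet> inv_ar B (mu Y' X' (AO (Tob C X Y) b))"
    by (rule T_Assoc_mu) simp_all
  have r2: "T (Tar C (Id C Y') (inv_ar C (Assoc C X' X Y))) b \<bullet> mu Y' (Tob C X' (Tob C X Y)) b =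
      mu Y' (Tob C (Tob C X' X) Y) b \<bullet> F Y' (T (inv_ar C (Assoc C X' X Y)) b)"
    by (rule mu_T_right) simp_all
  have r3: "T (Tar C (Id C Y') (Tar C (Ann C X) (Id C Y))) b \<bullet> mu Y' (Tob C (Tob C X' X) Y) b =
      mu Y' (Tob C (Unit C) Y) b \<bullet> F Y' (T (Tar C (Ann C X) (Id C Y)) b)"
    by (rule mu_T_right) simp_all
  have r4: "T (Tar C (Id C Y') (Lun C Y)) b \<bullet> mu Y' (Tob C (Unit C) Y) b = mu Y' Y b \<bullet> F Y' (T (Lun C Y) b)"
    by (rule mu_T_right) simp_all
  have s1: "inv_ar B (T (Assoc C X' X Y) b) \<bullet> mu X' (Tob C X Y) b = mu (Tob C X' X) Y b \<bullet> mu X' X (AO Y b) \<bullet> inv_ar B (F X' (mu X Y b))"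
    by (rule T_inv_Assoc_mu) simp_all
  have s2: "T (Tar C (Ann C X) (Id C Y)) b \<bullet> mu (Tob C X' X) Y b = mu (Unit C) Y b \<bullet> T (Ann C X) (AO Y b)"
    by (rule mu_T_left) simp_all
  have s3: "T (Lun C Y) b \<bullet> mu (Unit C) Y b = inv_ar B (ep (AO Y b))" by (rule T_Lun') simp_all
  note s = s1 s2 s3 s1[THEN B.Cmp_reduce] s2[THEN B.Cmp_reduce] s3[THEN B.Cmp_reduce]
  let ?in = "T (Lun C Y) b \<bullet> T (Tar C (Ann C X) (Id C Y)) b \<bullet> T (inv_ar C (Assoc C X' X Y)) b \<bullet> mu X' (Tob C X Y) b \<bullet> F X' (mu X Y b)"
  have inner: "?in = an X (AO Y b)"
    by (simp add: s an_def pairing_def X'_def[symmetric])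
  note r = r1 r2 r3 r4 r1[THEN B.Cmp_reduce] r2[THEN B.Cmp_reduce] r3[THEN B.Cmp_reduce] r4[THEN B.Cmp_reduce]
  have "pairing n (Tob C Y' X') (Tob C X Y) b \<bullet> mu Y' X' (AO (Tob C X Y) b) \<bullet> F Y' (F X' (mu X Y b))
      = inv_ar B (ep b) \<bullet> T (Ann C Y) b \<bullet> mu Y' Y b \<bullet> F Y' ?in"
    unfolding pairing_def n_def by (simp add: r)
  also have "\<dots> = an Y b \<bullet> F Y' (an X (AO Y b))"
    unfolding inner by (simp add: an_def pairing_def Y'_def[symmetric] X'_def[symmetric])
  finally show "pairing n (Tob C Y' X') (Tob C X Y) b \<bullet> mu Y' X' (AO (Tob C X Y) b) \<bullet> F Y' (F X' (mu X Y b))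
      = an Y b \<bullet> F Y' (an X (AO Y b))" .
qed

text \<open>The functor of \<open>Dual C (Tob C X Y)\<close> is left adjoint to that of
  \<open>Tob C X Y\<close>, and \<open>mu\<close> transports this to the composite of the functors
  of \<open>X\<close> and \<open>Y\<close>. That composite has a second left adjoint, built from the
  individual duals.\<close>

lemma tensor_adjunction: assumes [simp]: "X \<in> Ob C" "Y \<in> Ob C"
  shows "endo_adjunction B (\<lambda>b. AO X (AO Y b)) (\<lambda>g. F X (F Y g)) (AO (Dual C (Tob C X Y))) (F (Dual C (Tob C X Y)))
    (\<lambda>b. an (Tob C X Y) b \<bullet> F (Dual C (Tob C X Y)) (mu X Y b)) (\<lambda>b. inv_ar B (mu X Y (AO (Dual C (Tob C X Y)) b)) \<bullet> cr (Tob C X Y) b)"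
proof -
  let ?V = "Dual C (Tob C X Y)"
  interpret D: endo_adjunction B "AO (Tob C X Y)" "F (Tob C X Y)" "AO ?V" "F ?V" "an (Tob C X Y)" "cr (Tob C X Y)"
    by (rule dual_adjunction) simp
  have N: "an (Tob C X Y) (Cod B g) \<bullet> F ?V (mu X Y (Cod B g)) \<bullet> F ?V (F X (F Y g)) = g \<bullet> an (Tob C X Y) (Dom B g) \<bullet> F ?V (mu X Y (Dom B g))" "inv_ar B (mu X Y (AO ?V (Cod B g))) \<bullet> cr (Tob C X Y) (Cod B g) \<bullet> g = F X (F Y (F ?V g)) \<bullet> inv_ar B (mu X Y (AO ?V (Dom B g))) \<bullet> cr (Tob C X Y) (Dom B g)" if g [simp]: "g \<in> Ar B" for g
  proof -
    have m: "mu X Y (Cod B g) \<bullet> F X (F Y g) = F (Tob C X Y) g \<bullet> mu X Y (Dom B g)" by (rule mu_nat) simp_all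
    have n: "an (Tob C X Y) (Cod B g) \<bullet> F ?V (F (Tob C X Y) g) = g \<bullet> an (Tob C X Y) (Dom B g)" by (rule D.a_nat) simp_all
    have "an (Tob C X Y) (Cod B g) \<bullet> F ?V (mu X Y (Cod B g)) \<bullet> F ?V (F X (F Y g)) = an (Tob C X Y) (Cod B g) \<bullet> F ?V (mu X Y (Cod B g) \<bullet> F X (F Y g))" by simp
    also have "\<dots> = (an (Tob C X Y) (Cod B g) \<bullet> F ?V (F (Tob C X Y) g)) \<bullet> F ?V (mu X Y (Dom B g))" unfolding m by simp
    also have "\<dots> = g \<bullet> an (Tob C X Y) (Dom B g) \<bullet> F ?V (mu X Y (Dom B g))" unfolding n by simp
    finally show "an (Tob C X Y) (Cod B g) \<bullet> F ?V (mu X Y (Cod B g)) \<bullet> F ?V (F X (F Y g)) = g \<bullet> an (Tob C X Y) (Dom B g) \<bullet> F ?V (mu X Y (Dom B g))" .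
    have c: "cr (Tob C X Y) (Cod B g) \<bullet> g = F (Tob C X Y) (F ?V g) \<bullet> cr (Tob C X Y) (Dom B g)" by (rule D.c_nat) simp_all
    have i: "inv_ar B (mu X Y (AO ?V (Cod B g))) \<bullet> F (Tob C X Y) (F ?V g) = F X (F Y (F ?V g)) \<bullet> inv_ar B (mu X Y (AO ?V (Dom B g)))"
      by (rule inv_mu_nat) simp_all
    show "inv_ar B (mu X Y (AO ?V (Cod B g))) \<bullet> cr (Tob C X Y) (Cod B g) \<bullet> g = F X (F Y (F ?V g)) \<bullet> inv_ar B (mu X Y (AO ?V (Dom B g))) \<bullet> cr (Tob C X Y) (Dom B g)"
      unfolding c using B.Cmp_reduce[OF i] by simp
  qed
  have Z: "F X (F Y (an (Tob C X Y) b)) \<bullet> F X (F Y (F ?V (mu X Y b))) \<bullet> inv_ar B (mu X Y (AO ?V (AO X (AO Y b)))) \<bullet> cr (Tob C X Y) (AO X (AO Y b)) = Id B (AO X (AO Y b))" "an (Tob C X Y) (AO ?V b) \<bullet> F ?V (cr (Tob C X Y) b) = Id B (AO ?V b)" if b [simp]: "b \<in> Ob B" for b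
  proof -
    have i: "inv_ar B (mu X Y b) \<bullet> F (Tob C X Y) (an (Tob C X Y) b \<bullet> F ?V (mu X Y b)) = F X (F Y (an (Tob C X Y) b \<bullet> F ?V (mu X Y b))) \<bullet> inv_ar B (mu X Y (AO ?V (AO X (AO Y b))))"
      by (rule inv_mu_nat) simp_all
    have c: "cr (Tob C X Y) (AO (Tob C X Y) b) \<bullet> mu X Y b = F (Tob C X Y) (F ?V (mu X Y b)) \<bullet> cr (Tob C X Y) (AO X (AO Y b))" by (rule D.c_nat) simp_all
    have "F X (F Y (an (Tob C X Y) b)) \<bullet> F X (F Y (F ?V (mu X Y b))) \<bullet> inv_ar B (mu X Y (AO ?V (AO X (AO Y b)))) \<bullet> cr (Tob C X Y) (AO X (AO Y b))
      = (F X (F Y (an (Tob C X Y) b \<bullet> F ?V (mu X Y b))) \<bullet> inv_ar B (mu X Y (AO ?V (AO X (AO Y b))))) \<bullet> cr (Tob C X Y) (AO X (AO Y b))" by simp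
    also have "\<dots> = inv_ar B (mu X Y b) \<bullet> F (Tob C X Y) (an (Tob C X Y) b) \<bullet> (F (Tob C X Y) (F ?V (mu X Y b)) \<bullet> cr (Tob C X Y) (AO X (AO Y b)))"
      unfolding i[symmetric] by simp
    also have "\<dots> = inv_ar B (mu X Y b) \<bullet> (F (Tob C X Y) (an (Tob C X Y) b) \<bullet> cr (Tob C X Y) (AO (Tob C X Y) b)) \<bullet> mu X Y b"
      unfolding c[symmetric] by simp
    also have "\<dots> = Id B (AO X (AO Y b))" by (simp add: D.zig)
    finally show "F X (F Y (an (Tob C X Y) b)) \<bullet> F X (F Y (F ?V (mu X Y b))) \<bullet> inv_ar B (mu X Y (AO ?V (AO X (AO Y b)))) \<bullet> cr (Tob C X Y) (AO X (AO Y b)) = Id B (AO X (AO Y b))" .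
    show "an (Tob C X Y) (AO ?V b) \<bullet> F ?V (cr (Tob C X Y) b) = Id B (AO ?V b)"
      by (rule D.zag) simp
  qed
  show ?thesis by unfold_locales (auto simp: N Z)
qed

text \<open>The right-hand side is the canonical comparison between two left adjoints of the
  composite functor, so \<open>Dmu\<close> inherits the properties of such comparisons.\<close>

lemma T_Dmu:
  assumes [simp]: "X \<in> Ob C" "Y \<in> Ob C" "b \<in> Ob B"
  defines "V \<equiv> Dual C (Tob C X Y)"
  shows "T (Dmu C X Y) b \<bullet> mu (Dual C Y) (Dual C X) b =
     (an Y (AO V b) \<bullet> F (Dual C Y) (an X (AO Y (AO V b)))) \<bullet>
     F (Dual C Y) (F (Dual C X) (inv_ar B (mu X Y (AO V b)) \<bullet> cr (Tob C X Y) b))"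
proof -
  let ?X = "Dual C X" and ?Y = "Dual C Y" and ?XY = "Tob C X Y"
  have V [simp]: "V \<in> Ob C" by (simp add: V_def)
  define n where "n = Cmp C (Ann C Y) (Cmp C (Tar C (Id C ?Y) (Lun C Y)) (Cmp C (Tar C (Id C ?Y) (Tar C (Ann C X) (Id C Y)))
       (Cmp C (Tar C (Id C ?Y) (inv_ar C (Assoc C ?X X Y))) (Assoc C ?Y ?X ?XY))))"
  note np = nested_pairing[OF assms(1,2), folded n_def]
  have c [simp]: "cr ?XY b \<in> Ar B" "Dom B (cr ?XY b) = b" "Cod B (cr ?XY b) = AO ?XY (AO V b)" by (simp_all add: V_def)
  have p [simp]: "pairing n (Tob C ?Y ?X) ?XY b' \<in> Ar B" "Dom B (pairing n (Tob C ?Y ?X) ?XY b') = AO (Tob C ?Y ?X) (AO ?XY b')"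
    "Cod B (pairing n (Tob C ?Y ?X) ?XY b') = b'" if "b' \<in> Ob B" for b'
    using that np(1-3)[OF that] by (simp_all add: pairing_simps)
  have "Dmu C X Y = mate C ?XY V (Cre C ?XY) (Tob C ?Y ?X) n"
    by (simp only: Dmu_def n_def V_def)
  then have "T (Dmu C X Y) b = pairing n (Tob C ?Y ?X) ?XY (AO V b) \<bullet> F (Tob C ?Y ?X) (cr ?XY b)"
    using T_mate[of "Tob C ?Y ?X" ?XY V b n "Cre C ?XY"] np(1-3)[of b] by (simp add: cr_def V_def)
  then have "T (Dmu C X Y) b \<bullet> mu ?Y ?X b = pairing n (Tob C ?Y ?X) ?XY (AO V b) \<bullet> (F (Tob C ?Y ?X) (cr ?XY b) \<bullet> mu ?Y ?X b)"
    by simp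
  also have "F (Tob C ?Y ?X) (cr ?XY b) \<bullet> mu ?Y ?X b = mu ?Y ?X (AO ?XY (AO V b)) \<bullet> F ?Y (F ?X (cr ?XY b))"
    by (rule mu_nat[symmetric]) simp_all
  also have "pairing n (Tob C ?Y ?X) ?XY (AO V b) \<bullet> mu ?Y ?X (AO ?XY (AO V b)) \<bullet> F ?Y (F ?X (cr ?XY b)) =
     (pairing n (Tob C ?Y ?X) ?XY (AO V b) \<bullet> mu ?Y ?X (AO ?XY (AO V b)) \<bullet> F ?Y (F ?X (mu X Y (AO V b)))) \<bullet>
       F ?Y (F ?X (inv_ar B (mu X Y (AO V b)) \<bullet> cr ?XY b))"
  proof -
    have "F ?Y (F ?X (mu X Y (AO V b))) \<bullet> F ?Y (F ?X (inv_ar B (mu X Y (AO V b)) \<bullet> cr ?XY b)) =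
       F ?Y (F ?X (mu X Y (AO V b) \<bullet> (inv_ar B (mu X Y (AO V b)) \<bullet> cr ?XY b)))"
      by (simp del: B.iso_cancel_simps F_inv_cancel)
    also have "\<dots> = F ?Y (F ?X (cr ?XY b))" by (subst B.iso_cancel_simps) simp_all
    finally have e: "F ?Y (F ?X (mu X Y (AO V b))) \<bullet> F ?Y (F ?X (inv_ar B (mu X Y (AO V b)) \<bullet> cr ?XY b)) =
       F ?Y (F ?X (cr ?XY b))" .
    have "(pairing n (Tob C ?Y ?X) ?XY (AO V b) \<bullet> mu ?Y ?X (AO ?XY (AO V b)) \<bullet> F ?Y (F ?X (mu X Y (AO V b)))) \<bullet>
       F ?Y (F ?X (inv_ar B (mu X Y (AO V b)) \<bullet> cr ?XY b)) =
     pairing n (Tob C ?Y ?X) ?XY (AO V b) \<bullet> mu ?Y ?X (AO ?XY (AO V b)) \<bullet> (F ?Y (F ?X (mu X Y (AO V b))) \<bullet>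
       F ?Y (F ?X (inv_ar B (mu X Y (AO V b)) \<bullet> cr ?XY b)))" by simp
    then show ?thesis unfolding e by simp
  qed
  also have "pairing n (Tob C ?Y ?X) ?XY (AO V b) \<bullet> mu ?Y ?X (AO ?XY (AO V b)) \<bullet> F ?Y (F ?X (mu X Y (AO V b))) =
     an Y (AO V b) \<bullet> F ?Y (an X (AO Y (AO V b)))"
    by (rule np(4)) simp
  finally show ?thesis .
qed

text \<open>By uniqueness of left adjoints, \<open>d\<close> is invertible and compatible with the
  counits and units of the two adjunctions.\<close>

lemma Dmu_mate:
  assumes X [simp]: "X \<in> Ob C" and Y [simp]: "Y \<in> Ob C"
  defines "d \<equiv> \<lambda>b. T (Dmu C X Y) b \<bullet> mu (Dual C Y) (Dual C X) b"
  shows "b \<in> Ob B \<Longrightarrow> iso_ar B (d b)"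
    and "b \<in> Ob B \<Longrightarrow> an (Tob C X Y) b \<bullet> F (Dual C (Tob C X Y)) (mu X Y b) \<bullet> d (AO X (AO Y b)) = an Y b \<bullet> F (Dual C Y) (an X (AO Y b))"
    and "b \<in> Ob B \<Longrightarrow> mu X Y (AO (Dual C (Tob C X Y)) b) \<bullet> F X (F Y (d b)) \<bullet> F X (cr Y (AO (Dual C X) b)) \<bullet> cr X b = cr (Tob C X Y) b"
proof -
  let ?V = "Dual C (Tob C X Y)"
  interpret W: two_adjunctions B "\<lambda>b. AO X (AO Y b)" "\<lambda>g. F X (F Y g)"
    "\<lambda>b. AO (Dual C Y) (AO (Dual C X) b)" "\<lambda>g. F (Dual C Y) (F (Dual C X) g)"
    "\<lambda>b. an Y b \<bullet> F (Dual C Y) (an X (AO Y b))" "\<lambda>b. F X (cr Y (AO (Dual C X) b)) \<bullet> cr X b"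
    "AO ?V" "F ?V" "\<lambda>b. an (Tob C X Y) b \<bullet> F ?V (mu X Y b)" "\<lambda>b. inv_ar B (mu X Y (AO ?V b)) \<bullet> cr (Tob C X Y) b"
    using endo_adjunction_compose[OF dual_adjunction[OF X] dual_adjunction[OF Y]] tensor_adjunction[OF X Y]
    by (rule two_adjunctions.intro)
  have wd: "W.w b = d b" if "b \<in> Ob B" for b
    using T_Dmu[OF X Y that] by (simp only: W.w_def d_def)
  show "iso_ar B (d b)" if "b \<in> Ob B" using W.w_iso[OF that] wd[OF that] by simp
  have d [simp]: "d b \<in> Ar B" "Dom B (d b) = AO (Dual C Y) (AO (Dual C X) b)" "Cod B (d b) = AO ?V b" if "b \<in> Ob B" for b
    using that by (simp_all add: d_def)
  show "an (Tob C X Y) b \<bullet> F ?V (mu X Y b) \<bullet> d (AO X (AO Y b)) = an Y b \<bullet> F (Dual C Y) (an X (AO Y b))" if "b \<in> Ob B"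
    using W.a'_w[OF that] that by (simp add: wd)
  show "mu X Y (AO ?V b) \<bullet> F X (F Y (d b)) \<bullet> F X (cr Y (AO (Dual C X) b)) \<bullet> cr X b = cr (Tob C X Y) b" if "b \<in> Ob B"
  proof -
    have "mu X Y (AO ?V b) \<bullet> F X (F Y (d b)) \<bullet> F X (cr Y (AO (Dual C X) b)) \<bullet> cr X b = mu X Y (AO ?V b) \<bullet> (inv_ar B (mu X Y (AO ?V b)) \<bullet> cr (Tob C X Y) b)"
      using W.P_w_c[OF that] by (simp add: wd[OF that])
    then show ?thesis using that by simp
  qed
qed

end

text \<open>Applied to the action of a category on itself, the pointwise statements above show that \<open>Dmu\<close> and
  \<open>Deps\<close> are invertible.\<close>

definition self_action :: "('o, 'm, 'k, 'z) moncat_scheme \<Rightarrow> 'o \<Rightarrow> ('o, 'm, 'o, 'm) fct" where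
  "self_action C X = \<lparr>Fob = Tob C X, Far = Tar C (Id C X)\<rparr>"

lemma (in mon_category) tensor_left_functor: "X \<in> Ob C \<Longrightarrow> lin_functor C C \<lparr>Fob = Tob C X, Far = Tar C (Id C X)\<rparr>"
proof
  fix f g A B E assume X [simp]: "X \<in> Ob C"
  assume fg: "f \<in> Hom C A B" "g \<in> Hom C B E"
  show "Far \<lparr>Fob = Tob C X, Far = Tar C (Id C X)\<rparr> (g \<bullet> f) =
    Far \<lparr>Fob = Tob C X, Far = Tar C (Id C X)\<rparr> g \<bullet> Far \<lparr>Fob = Tob C X, Far = Tar C (Id C X)\<rparr> f"
    using Tar_Cmp_Hom[of "Id C X" "Id C X" f g] fg by (simp add: Hom_iff)
qed (auto simp: Hom_iff Tar_Add_right[unfolded Hom_iff] Tar_Scale_right[unfolded Hom_iff])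

text \<open>The structure isomorphisms are the inverse associators and left unitors. The laws of an
  action then amount to the pentagon, to Kelly's triangle for the left unitor, and to the middle
  triangle for the right one.\<close>

lemma (in mon_category) self_action:
  "action C C (self_action C) (\<lambda>f Y. f \<boxdot> Id C Y) (\<lambda>X Y Z. inv_ar C (Assoc C X Y Z)) (\<lambda>X. inv_ar C (Lun C X))"
proof (intro action.intro action_axioms.intro mon_category_axioms lin_category_axioms)
  show "X \<in> Ob C \<Longrightarrow> lin_functor C C (self_action C X)" for X
    unfolding self_action_def by (rule tensor_left_functor)
next
  fix f g X Y b b' assume "f \<in> Hom C X Y" "g \<in> Hom C b b'"
  then show "(f \<boxdot> Id C b') \<bullet> Far (self_action C X) g = Far (self_action C Y) g \<bullet> (f \<boxdot> Id C b)"
    by (auto simp: self_action_def Hom_iff Tar_Cmp_Hom)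
next
  fix f f' X Y Z b assume "f \<in> Hom C X Y" "f' \<in> Hom C Y Z" "b \<in> Ob C"
  then show "(f' \<bullet> f) \<boxdot> Id C b = (f' \<boxdot> Id C b) \<bullet> (f \<boxdot> Id C b)"
    by (auto simp: Hom_iff Tar_Cmp_Hom)
next
  fix f f' X Y b assume "f \<in> Hom C X Y" "f' \<in> Hom C X Y" "b \<in> Ob C"
  then show "Add C f f' \<boxdot> Id C b = Add C (f \<boxdot> Id C b) (f' \<boxdot> Id C b)" by (rule Tar_Add_left[OF _ _ Id_Hom])
next
  fix f X Y b k assume "f \<in> Hom C X Y" "b \<in> Ob C"
  then show "Scale C k f \<boxdot> Id C b = Scale C k (f \<boxdot> Id C b)" by (rule Tar_Scale_left[OF _ Id_Hom])
next
  fix X Y g b b' assume [simp]: "X \<in> Ob C" "Y \<in> Ob C" and g: "g \<in> Hom C b b'"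
  have [simp]: "b \<in> Ob C" "b' \<in> Ob C" and [simp]: "g \<in> Ar C" "Dom C g = b" "Cod C g = b'"
    using HomD(4,5)[OF g] g by (auto simp: Hom_iff)
  have n: "Assoc C X Y b' \<bullet> ((Id C X \<boxdot> Id C Y) \<boxdot> g) = (Id C X \<boxdot> (Id C Y \<boxdot> g)) \<bullet> Assoc C X Y b"
    by (rule Assoc_natural) (simp_all add: Hom_iff)
  have "inv_ar C (Assoc C X Y b') \<bullet> ((Id C X \<boxdot> (Id C Y \<boxdot> g)) \<bullet> Assoc C X Y b) \<bullet> inv_ar C (Assoc C X Y b) =
    inv_ar C (Assoc C X Y b') \<bullet> (Assoc C X Y b' \<bullet> ((Id C X \<boxdot> Id C Y) \<boxdot> g)) \<bullet> inv_ar C (Assoc C X Y b)"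
    by (simp only: n)
  then show "inv_ar C (Assoc C X Y b') \<bullet> Far (self_action C X) (Far (self_action C Y) g) = Far (self_action C (X \<boxtimes> Y)) g \<bullet> inv_ar C (Assoc C X Y b)"
    by (simp add: self_action_def)
next
  fix f f' X X' Y Y' b assume f: "f \<in> Hom C X X'" and f': "f' \<in> Hom C Y Y'" and b [simp]: "b \<in> Ob C"
  have [simp]: "X \<in> Ob C" "X' \<in> Ob C" "Y \<in> Ob C" "Y' \<in> Ob C" "f \<in> Ar C" "Dom C f = X" "Cod C f = X'"
    "f' \<in> Ar C" "Dom C f' = Y" "Cod C f' = Y'"
    using HomD(4,5)[OF f] HomD(4,5)[OF f'] f f' by (auto simp: Hom_iff)
  have n: "Assoc C X' Y' b \<bullet> ((f \<boxdot> f') \<boxdot> Id C b) = (f \<boxdot> (f' \<boxdot> Id C b)) \<bullet> Assoc C X Y b"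
    by (rule Assoc_natural) (simp_all add: Hom_iff)
  have "inv_ar C (Assoc C X' Y' b) \<bullet> ((f \<boxdot> (f' \<boxdot> Id C b)) \<bullet> Assoc C X Y b) \<bullet> inv_ar C (Assoc C X Y b) =
    inv_ar C (Assoc C X' Y' b) \<bullet> (Assoc C X' Y' b \<bullet> ((f \<boxdot> f') \<boxdot> Id C b)) \<bullet> inv_ar C (Assoc C X Y b)"
    by (simp only: n)
  then show "((f \<boxdot> f') \<boxdot> Id C b) \<bullet> inv_ar C (Assoc C X Y b) =
       inv_ar C (Assoc C X' Y' b) \<bullet> (f \<boxdot> Id C (Fob (self_action C Y') b)) \<bullet> Far (self_action C X) (f' \<boxdot> Id C b)"
    by (simp add: self_action_def Tar_Cmp_Hom)
next
  fix g b b' assume g: "g \<in> Hom C b b'"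
  have [simp]: "b \<in> Ob C" "b' \<in> Ob C" and [simp]: "g \<in> Ar C" "Dom C g = b" "Cod C g = b'"
    using HomD(4,5)[OF g] g by (auto simp: Hom_iff)
  have "inv_ar C (Lun C b') \<bullet> (g \<bullet> Lun C b) \<bullet> inv_ar C (Lun C b) = inv_ar C (Lun C b') \<bullet> (Lun C b' \<bullet> (Id C (Unit C) \<boxdot> g)) \<bullet> inv_ar C (Lun C b)"
    by (simp only: Lun_natural[OF g])
  then show "inv_ar C (Lun C b') \<bullet> g = Far (self_action C (Unit C)) g \<bullet> inv_ar C (Lun C b)"
    by (simp add: self_action_def)
next
  fix X Y Z b assume [simp]: "X \<in> Ob C" "Y \<in> Ob C" "Z \<in> Ob C" "b \<in> Ob C"
  let ?u = "Assoc C X Y (Z \<boxtimes> b)" and ?v = "Assoc C (X \<boxtimes> Y) Z b"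
    and ?x = "Id C X \<boxdot> Assoc C Y Z b" and ?y = "Assoc C X (Y \<boxtimes> Z) b" and ?z = "Assoc C X Y Z \<boxdot> Id C b"
  have p: "?u \<bullet> ?v = ?x \<bullet> ?y \<bullet> ?z" by (rule pentagon) simp_all
  have "?z \<bullet> inv_ar C (?u \<bullet> ?v) = inv_ar C ?y \<bullet> inv_ar C ?x"
  proof -
    have zc: "?z \<bullet> (inv_ar C (Assoc C X Y Z) \<boxdot> Id C b) = Id C ((X \<boxtimes> (Y \<boxtimes> Z)) \<boxtimes> b)"
      by (simp add: Tar_Cmp_Hom)
    show ?thesis
      unfolding p using Cmp_reduce[OF zc, of "inv_ar C ?y \<bullet> inv_ar C ?x"] by simp
  qed
  then show "(Assoc C X Y Z \<boxdot> Id C b) \<bullet> inv_ar C (Assoc C (X \<boxtimes> Y) Z b) \<bullet> inv_ar C (Assoc C X Y (Fob (self_action C Z) b)) =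
       inv_ar C (Assoc C X (Y \<boxtimes> Z) b) \<bullet> Far (self_action C X) (inv_ar C (Assoc C Y Z b))"
    by (simp add: self_action_def)
next
  fix X b assume [simp]: "X \<in> Ob C" "b \<in> Ob C"
  have "(Lun C X \<boxdot> Id C b) \<bullet> inv_ar C (Assoc C (Unit C) X b) \<bullet> inv_ar C (Lun C (X \<boxtimes> b)) = Id C (X \<boxtimes> b)"
    unfolding Lun_tensor[of X b, symmetric, simplified] by simp
  then show "(Lun C X \<boxdot> Id C b) \<bullet> inv_ar C (Assoc C (Unit C) X b) \<bullet> inv_ar C (Lun C (Fob (self_action C X) b)) = Id C (Fob (self_action C X) b)"
    by (simp add: self_action_def)
  have t: "(Id C X \<boxdot> Lun C b) \<bullet> Assoc C X (Unit C) b = Run C X \<boxdot> Id C b" by (rule triangle) simp_all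
  have "(Run C X \<boxdot> Id C b) \<bullet> inv_ar C (Assoc C X (Unit C) b) \<bullet> (Id C X \<boxdot> inv_ar C (Lun C b)) = Id C (X \<boxtimes> b)"
    unfolding t[symmetric] by (simp add: Tar_Cmp_Hom)
  then show "(Run C X \<boxdot> Id C b) \<bullet> inv_ar C (Assoc C X (Unit C) b) \<bullet> Far (self_action C X) (inv_ar C (Lun C b)) = Id C (Fob (self_action C X) b)"
    by (simp add: self_action_def)
qed (auto simp: self_action_def Hom_iff)

text \<open>Comparison of adjoints makes \<open>Dmu\<close> tensored with the unit object
  invertible, and tensoring with the unit loses nothing. Through this \<open>DDmu\<close>, which
  contains an inverse of \<open>Dmu\<close>, becomes usable.\<close>

lemma (in rigid_category) Dmu_iso: assumes [simp]: "X \<in> Ob C" "Y \<in> Ob C" shows "iso_ar C (Dmu C X Y)"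
proof -
  interpret S: rigid_action C C "self_action C" "\<lambda>f Y. f \<boxdot> Id C Y" "\<lambda>X Y Z. inv_ar C (Assoc C X Y Z)" "\<lambda>X. inv_ar C (Lun C X)"
    by (intro rigid_action.intro self_action rigid_category_axioms)
  have iso: "iso_ar C ((Dmu C X Y \<boxdot> Id C (Unit C)) \<bullet> inv_ar C (Assoc C (Dual C Y) (Dual C X) (Unit C)))"
    by (rule S.Dmu_mate) simp_all
  have "iso_ar C (((Dmu C X Y \<boxdot> Id C (Unit C)) \<bullet> inv_ar C (Assoc C (Dual C Y) (Dual C X) (Unit C))) \<bullet> Assoc C (Dual C Y) (Dual C X) (Unit C))"
    by (rule iso_Cmp(1)[OF _ iso]) simp_all
  then have "iso_ar C (Dmu C X Y \<boxdot> Id C (Unit C))" by simp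
  then show ?thesis by (rule tensor_unit_right_iso[rotated]) simp
qed

lemma (in rigid_category) Deps_iso: "iso_ar C (Deps C)"
proof -
  interpret S: rigid_action C C "self_action C" "\<lambda>f Y. f \<boxdot> Id C Y" "\<lambda>X Y Z. inv_ar C (Assoc C X Y Z)" "\<lambda>X. inv_ar C (Lun C X)"
    by (intro rigid_action.intro self_action rigid_category_axioms)
  have "iso_ar C (Deps C \<boxdot> Id C (Unit C))" by (rule S.T_Deps_iso) simp
  then show ?thesis by (rule tensor_unit_right_iso[rotated]) simp
qed

section \<open>Pivotal actions\<close>

locale pivotal_action = rigid_action C B A T mu ep + C: pivotal_category C
  for C :: "('o, 'm, 'k :: field, 'z) pivcat_scheme"
    and B :: "('p, 'n, 'k, 'y) lincat_scheme" (structure) and A T mu ep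
begin

lemma Piv_simps [simp]: assumes "X \<in> Ob C"
  shows "Piv C X \<in> Ar C" "Dom C (Piv C X) = X" "Cod C (Piv C X) = DD C X"
  using C.Piv_Hom[OF assms] by (auto simp: Hom_iff)

text \<open>The pivotal structure turns the left dual \<open>Dual C X\<close> of \<open>X\<close> into a right dual, with evaluation \<open>ev X\<close>.\<close>

definition ev :: "'o \<Rightarrow> 'p \<Rightarrow> 'n" where
  "ev X b = an (Dual C X) b \<bullet> T (Piv C X) (AO (Dual C X) b)"

lemma ev_simps [simp]: assumes "X \<in> Ob C" "b \<in> Ob B"
  shows "ev X b \<in> Ar B" "Dom B (ev X b) = AO X (AO (Dual C X) b)" "Cod B (ev X b) = b"
  using assms by (simp_all add: ev_def)

lemma ev_nat: assumes X: "X \<in> Ob C" and g: "g \<in> Ar B" "Dom B g = b" "Cod B g = b'"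
  shows "ev X b' \<bullet> F X (F (Dual C X) g) = g \<bullet> ev X b"
proof -
  have [simp]: "b \<in> Ob B" "b' \<in> Ob B" using g by auto
  note [simp] = X g
  have n: "T (Piv C X) (AO (Dual C X) b') \<bullet> F X (F (Dual C X) g) = F (DD C X) (F (Dual C X) g) \<bullet> T (Piv C X) (AO (Dual C X) b)"
    by (rule T_nat) simp_all
  have m: "an (Dual C X) b' \<bullet> F (DD C X) (F (Dual C X) g) = g \<bullet> an (Dual C X) b"
    by (rule an_nat) simp_all
  have "ev X b' \<bullet> F X (F (Dual C X) g) = (an (Dual C X) b' \<bullet> F (DD C X) (F (Dual C X) g)) \<bullet> T (Piv C X) (AO (Dual C X) b)"
    by (simp add: ev_def n)
  also have "\<dots> = g \<bullet> ev X b" unfolding m by (simp add: ev_def)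
  finally show ?thesis .
qed

text \<open>Monoidality of the pivotal structure enters here. \<open>Piv\<close> of the product is
  \<open>DDmu\<close> after the product of the two \<open>Piv\<close>, and \<open>DDmu\<close> has
  two factors: the dual of the inverse of \<open>Dmu\<close> cancels against \<open>d\<close>, and
  \<open>Dmu\<close> for the duals turns the annihilation of a product of duals into two nested
  annihilations.\<close>

lemma ev_tensor:
  assumes X [simp]: "X \<in> Ob C" and Y [simp]: "Y \<in> Ob C" and b [simp]: "b \<in> Ob B"
  defines "d \<equiv> \<lambda>b. T (Dmu C X Y) b \<bullet> mu (Dual C Y) (Dual C X) b"
  shows "ev (Tob C X Y) b \<bullet> F (Tob C X Y) (d b) \<bullet> mu X Y (AO (Dual C Y) (AO (Dual C X) b))
    = ev X b \<bullet> F X (ev Y (AO (Dual C X) b))"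
proof -
  let ?X = "Dual C X" and ?Y = "Dual C Y" and ?XX = "DD C X" and ?YY = "DD C Y" and ?XY = "Tob C X Y"
  let ?V = "Dual C (Tob C X Y)" and ?VV = "DD C (Tob C X Y)" and ?W = "Tob C ?Y ?X" and ?WW = "Dual C (Tob C ?Y ?X)"
  let ?b = "AO ?X b" and ?G = "AO ?Y (AO ?X b)"
  define f where "f = inv_ar C (Dmu C X Y)"
  have f [simp]: "f \<in> Ar C" "Dom C f = ?V" "Cod C f = ?W" using C.Dmu_iso[OF X Y] by (simp_all add: f_def)
  have fD: "T f b \<bullet> T (Dmu C X Y) b = Id B (AO ?W b)"
    using C.Dmu_iso[OF X Y] by (simp add: f_def)
  define d' where "d' = (\<lambda>b. T (Dmu C ?Y ?X) b \<bullet> mu ?XX ?YY b)"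
  have d [simp]: "d b \<in> Ar B" "Dom B (d b) = AO ?Y (AO ?X b)" "Cod B (d b) = AO ?V b" by (simp_all add: d_def)
  have d' [simp]: "d' b \<in> Ar B" "Dom B (d' b) = AO ?XX (AO ?YY b)" "Cod B (d' b) = AO ?WW b" if "b \<in> Ob B" for b
    using that by (simp_all add: d'_def)
  have 1: "T (Piv C ?XY) (AO ?V b) \<bullet> F ?XY (d b) = F ?VV (d b) \<bullet> T (Piv C ?XY) ?G"
    by (rule T_nat) simp_all
  have 2: "T (Piv C ?XY) ?G = T (Dar C f) ?G \<bullet> T (Dmu C ?Y ?X) ?G \<bullet> T (Tar C (Piv C X) (Piv C Y)) ?G"
    by (simp add: C.Piv_tensor DDmu_def f_def[symmetric])
  have 3: "T (Tar C (Piv C X) (Piv C Y)) ?G \<bullet> mu X Y ?G = mu ?XX ?YY ?G \<bullet> T (Piv C X) (AO ?YY ?G) \<bullet> F X (T (Piv C Y) ?G)"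
    by (rule mu_T) (simp_all add: Hom_iff)
  have 4: "an ?W b \<bullet> F ?WW (mu ?Y ?X b) \<bullet> d' ?G = an ?X b \<bullet> F ?XX (an ?Y ?b)"
    unfolding d'_def by (rule Dmu_mate(2)) simp_all
  \<comment> \<open>The dual of \<open>f\<close> is slid across the annihilation, where it becomes
    \<open>f\<close> itself and meets \<open>d\<close>; as \<open>f\<close> inverts
    \<open>Dmu\<close>, only \<open>mu\<close> is left.\<close>
  have 5: "an ?V b \<bullet> F ?VV (d b) \<bullet> T (Dar C f) ?G = an ?W b \<bullet> F ?WW (mu ?Y ?X b)"
  proof -
    have a: "F ?VV (d b) \<bullet> T (Dar C f) ?G = T (Dar C f) (AO ?V b) \<bullet> F ?WW (d b)"
      by (rule T_nat[symmetric]) simp_all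
    have c: "an ?V b \<bullet> T (Dar C f) (AO ?V b) = an ?W b \<bullet> F ?WW (T f b)" by (rule an_Dar) simp_all
    have "T f b \<bullet> d b = mu ?Y ?X b" using B.Cmp_reduce[OF fD, of "mu ?Y ?X b"] by (simp add: d_def)
    then have e: "F ?WW (T f b) \<bullet> F ?WW (d b) = F ?WW (mu ?Y ?X b)" by (simp flip: F_Cmp)
    have "an ?V b \<bullet> F ?VV (d b) \<bullet> T (Dar C f) ?G = (an ?V b \<bullet> T (Dar C f) (AO ?V b)) \<bullet> F ?WW (d b)"
      unfolding a by simp
    also have "\<dots> = an ?W b \<bullet> (F ?WW (T f b) \<bullet> F ?WW (d b))" unfolding c by simp
    finally show ?thesis unfolding e .
  qed
  have 6: "F ?XX (an ?Y ?b) \<bullet> T (Piv C X) (AO ?YY ?G) = T (Piv C X) ?b \<bullet> F X (an ?Y ?b)"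
    by (rule T_nat[symmetric]) simp_all
  have "ev ?XY b \<bullet> F ?XY (d b) \<bullet> mu X Y ?G = an ?V b \<bullet> (T (Piv C ?XY) (AO ?V b) \<bullet> F ?XY (d b)) \<bullet> mu X Y ?G"
    by (simp add: ev_def)
  also have "\<dots> = (an ?V b \<bullet> F ?VV (d b) \<bullet> T (Dar C f) ?G) \<bullet> T (Dmu C ?Y ?X) ?G \<bullet> (T (Tar C (Piv C X) (Piv C Y)) ?G \<bullet> mu X Y ?G)"
    unfolding 1 2 by simp
  also have "\<dots> = (an ?W b \<bullet> F ?WW (mu ?Y ?X b) \<bullet> d' ?G) \<bullet> T (Piv C X) (AO ?YY ?G) \<bullet> F X (T (Piv C Y) ?G)"
    unfolding 3 5 by (simp add: d'_def)
  also have "\<dots> = an ?X b \<bullet> (F ?XX (an ?Y ?b) \<bullet> T (Piv C X) (AO ?YY ?G)) \<bullet> F X (T (Piv C Y) ?G)"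
    unfolding 4 by simp
  also have "\<dots> = ev X b \<bullet> F X (ev Y ?b)" unfolding 6 by (simp add: ev_def)
  finally show ?thesis .
qed

text \<open>\<open>Piv\<close> at the unit object is \<open>DDeps\<close>. Sliding its first factor
  across the annihilation leaves the inverse of \<open>Deps\<close>, which cancels against the
  \<open>Deps\<close> that \<open>T_Deps\<close> finds in the creation.\<close>

lemma ev_unit: assumes b [simp]: "b \<in> Ob B" shows "ev (Unit C) b \<bullet> cr (Unit C) b = Id B b"
proof -
  let ?U = "Unit C" and ?V = "Dual C (Unit C)"
  define f where "f = inv_ar C (Deps C)"
  have f [simp]: "f \<in> Ar C" "Dom C f = ?V" "Cod C f = ?U" using C.Deps_iso by (simp_all add: f_def)
  have fD: "T f b \<bullet> T (Deps C) b = Id B (AO ?U b)" using C.Deps_iso by (simp add: f_def)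
  have 1: "T (Piv C ?U) (AO ?V b) = T (Dar C f) (AO ?V b) \<bullet> T (Deps C) (AO ?V b)"
    by (simp add: C.Piv_unit DDeps_def f_def[symmetric])
  have 2: "an ?V b \<bullet> T (Dar C f) (AO ?V b) = an ?U b \<bullet> F ?V (T f b)" by (rule an_Dar) simp_all
  have 3: "F ?V (T f b) \<bullet> T (Deps C) (AO ?V b) = T (Deps C) (AO ?U b) \<bullet> F ?U (T f b)"
    by (rule T_nat[symmetric]) simp_all
  have 4: "an ?U b \<bullet> inv_ar B (ep (AO ?V (AO ?U b))) = inv_ar B (ep b) \<bullet> F ?U (an ?U b)"
    by (rule inv_ep_nat) simp_all
  have 5: "inv_ar B (ep (AO ?U b)) \<bullet> F ?U (T f b) = T f b \<bullet> inv_ar B (ep (AO ?V b))"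
    by (rule inv_ep_nat[symmetric]) simp_all
  have 6: "inv_ar B (ep (AO ?V b)) \<bullet> cr ?U b = T (Deps C) b \<bullet> ep b" by (simp add: T_Deps)
  have "ev ?U b = (an ?V b \<bullet> T (Dar C f) (AO ?V b)) \<bullet> T (Deps C) (AO ?V b)" by (simp add: ev_def 1)
  also have "\<dots> = an ?U b \<bullet> T (Deps C) (AO ?U b) \<bullet> F ?U (T f b)" unfolding 2 using 3 by simp
  also have "\<dots> = (an ?U b \<bullet> inv_ar B (ep (AO ?V (AO ?U b)))) \<bullet> cr ?U (AO ?U b) \<bullet> (inv_ar B (ep (AO ?U b)) \<bullet> F ?U (T f b))"
    by (simp add: T_Deps)
  also have "\<dots> = inv_ar B (ep b) \<bullet> (F ?U (an ?U b) \<bullet> cr ?U (AO ?U b)) \<bullet> T f b \<bullet> inv_ar B (ep (AO ?V b))"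
    unfolding 4 5 by simp
  also have "\<dots> = inv_ar B (ep b) \<bullet> T f b \<bullet> inv_ar B (ep (AO ?V b))" by (simp add: zig)
  finally have "ev ?U b \<bullet> cr ?U b = inv_ar B (ep b) \<bullet> T f b \<bullet> (inv_ar B (ep (AO ?V b)) \<bullet> cr ?U b)" by simp
  also have "\<dots> = inv_ar B (ep b) \<bullet> (T f b \<bullet> T (Deps C) b) \<bullet> ep b" unfolding 6 by simp
  also have "\<dots> = Id B b" unfolding fD by simp
  finally show ?thesis .
qed

section \<open>Natural transformations between the acting functors and their partial traces\<close>

definition nt :: "'o \<Rightarrow> 'o \<Rightarrow> ('p \<Rightarrow> 'n) \<Rightarrow> bool" where
  "nt X Y \<alpha> \<longleftrightarrow> (\<forall>b\<in>Ob B. \<alpha> b \<in> Hom B (AO X b) (AO Y b)) \<and>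
     (\<forall>g\<in>Ar B. \<alpha> (Cod B g) \<bullet> F X g = F Y g \<bullet> \<alpha> (Dom B g))"

lemma nt_simps: assumes "nt X Y \<alpha>" "b \<in> Ob B"
  shows "\<alpha> b \<in> Ar B" "Dom B (\<alpha> b) = AO X b" "Cod B (\<alpha> b) = AO Y b"
  using assms by (auto simp: nt_def Hom_iff)

lemma nt_nat: "\<lbrakk>nt X Y \<alpha>; g \<in> Ar B; Dom B g = b; Cod B g = b'\<rbrakk> \<Longrightarrow> \<alpha> b' \<bullet> F X g = F Y g \<bullet> \<alpha> b"
  by (auto simp: nt_def)

text \<open>\<^const>\<open>DarM\<close> in terms of components.\<close>

definition ntdual :: "'o \<Rightarrow> 'o \<Rightarrow> ('p \<Rightarrow> 'n) \<Rightarrow> 'p \<Rightarrow> 'n" where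
  "ntdual X Y \<alpha> b = an Y (AO (Dual C X) b) \<bullet> F (Dual C Y) (\<alpha> (AO (Dual C X) b)) \<bullet> F (Dual C Y) (cr X b)"

context
  fixes X Y \<alpha>
  assumes X: "X \<in> Ob C" and Y: "Y \<in> Ob C" and \<alpha>: "nt X Y \<alpha>"
begin

lemma ntdual_simps: assumes "b \<in> Ob B"
  shows "ntdual X Y \<alpha> b \<in> Ar B" "Dom B (ntdual X Y \<alpha> b) = AO (Dual C Y) b" "Cod B (ntdual X Y \<alpha> b) = AO (Dual C X) b"
  using assms X Y nt_simps[OF \<alpha>] by (simp_all add: ntdual_def)

lemma an_ntdual: assumes b: "b \<in> Ob B"
  shows "an X b \<bullet> ntdual X Y \<alpha> (AO X b) = an Y b \<bullet> F (Dual C Y) (\<alpha> b)"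
proof -
  note [simp] = X Y b nt_simps[OF \<alpha>]
  let ?b = "AO (Dual C X) (AO X b)"
  have n: "an Y b \<bullet> F (Dual C Y) (F Y (an X b)) = an X b \<bullet> an Y ?b" by (rule an_nat) simp_all
  have t: "\<alpha> b \<bullet> F X (an X b) = F Y (an X b) \<bullet> \<alpha> ?b" by (rule nt_nat[OF \<alpha>]) simp_all
  have "an X b \<bullet> ntdual X Y \<alpha> (AO X b) = (an X b \<bullet> an Y ?b) \<bullet> F (Dual C Y) (\<alpha> ?b) \<bullet> F (Dual C Y) (cr X (AO X b))"
    by (simp add: ntdual_def)
  also have "\<dots> = an Y b \<bullet> F (Dual C Y) ((F Y (an X b) \<bullet> \<alpha> ?b) \<bullet> cr X (AO X b))"
    unfolding n[symmetric] by simp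
  also have "\<dots> = an Y b \<bullet> F (Dual C Y) (\<alpha> b \<bullet> (F X (an X b) \<bullet> cr X (AO X b)))"
    unfolding t[symmetric] by simp
  also have "\<dots> = an Y b \<bullet> F (Dual C Y) (\<alpha> b)" by (simp add: zig)
  finally show ?thesis .
qed

text \<open>A transformation next to a creation may be moved to the other leg, where it becomes its
  dual; this is the first half of moving it around a loop.\<close>

lemma cr_ntdual: assumes b: "b \<in> Ob B"
  shows "F Y (ntdual X Y \<alpha> b) \<bullet> cr Y b = \<alpha> (AO (Dual C X) b) \<bullet> cr X b"
proof -
  note [simp] = X Y b nt_simps[OF \<alpha>]
  let ?b = "AO (Dual C X) b" and ?g = "\<alpha> (AO (Dual C X) b) \<bullet> cr X b"
  have n: "cr Y (AO Y ?b) \<bullet> ?g = F Y (F (Dual C Y) ?g) \<bullet> cr Y b" by (rule cr_nat) simp_all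
  have "F Y (ntdual X Y \<alpha> b) \<bullet> cr Y b = F Y (an Y ?b) \<bullet> (F Y (F (Dual C Y) ?g) \<bullet> cr Y b)"
    by (simp add: ntdual_def)
  also have "\<dots> = (F Y (an Y ?b) \<bullet> cr Y (AO Y ?b)) \<bullet> ?g" unfolding n[symmetric] by simp
  also have "\<dots> = ?g" by (simp add: zig)
  finally show ?thesis .
qed

end

text \<open>The partial trace: the strand of \<open>X\<close> is closed into a loop by
  \<open>cr\<close> and \<open>ev\<close>. The result is an endomorphism of every object
  \<open>b\<close>, natural in \<open>b\<close>, and not yet a scalar.\<close>

definition tr :: "'o \<Rightarrow> ('p \<Rightarrow> 'n) \<Rightarrow> 'p \<Rightarrow> 'n" where
  "tr X \<eta> b = ev X b \<bullet> \<eta> (AO (Dual C X) b) \<bullet> cr X b"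

lemma tr_simps: assumes "nt X X \<eta>" "X \<in> Ob C" "b \<in> Ob B"
  shows "tr X \<eta> b \<in> Ar B" "Dom B (tr X \<eta> b) = b" "Cod B (tr X \<eta> b) = b"
  using assms nt_simps[OF assms(1)] by (simp_all add: tr_def)

lemma tr_nat: assumes \<eta>: "nt X X \<eta>" and X: "X \<in> Ob C" and g: "g \<in> Ar B" "Dom B g = b" "Cod B g = b'"
  shows "tr X \<eta> b' \<bullet> g = g \<bullet> tr X \<eta> b"
proof -
  have [simp]: "b \<in> Ob B" "b' \<in> Ob B" using g by auto
  note [simp] = X g nt_simps[OF \<eta>]
  let ?X = "Dual C X"
  have 1: "cr X b' \<bullet> g = F X (F ?X g) \<bullet> cr X b" by (rule cr_nat) simp_all
  have 2: "\<eta> (AO ?X b') \<bullet> F X (F ?X g) = F X (F ?X g) \<bullet> \<eta> (AO ?X b)" by (rule nt_nat[OF \<eta>]) simp_all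
  have 3: "ev X b' \<bullet> F X (F ?X g) = g \<bullet> ev X b" by (rule ev_nat) simp_all
  have "tr X \<eta> b' \<bullet> g = ev X b' \<bullet> (\<eta> (AO ?X b') \<bullet> F X (F ?X g)) \<bullet> cr X b" by (simp add: tr_def 1)
  also have "\<dots> = (ev X b' \<bullet> F X (F ?X g)) \<bullet> \<eta> (AO ?X b) \<bullet> cr X b" unfolding 2 by simp
  also have "\<dots> = g \<bullet> tr X \<eta> b" unfolding 3 by (simp add: tr_def)
  finally show ?thesis .
qed

text \<open>A loop labelled by a product is a pair of nested loops, and the trace over
  \<open>Y\<close> sits inside the loop of \<open>X\<close>. Creation and evaluation of the product
  are taken apart by \<open>Dmu_mate\<close> and \<open>ev_tensor\<close>.\<close>

lemma tr_tensor:
  assumes X [simp]: "X \<in> Ob C" and Y [simp]: "Y \<in> Ob C" and b [simp]: "b \<in> Ob B"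
    and \<alpha>: "nt X X \<alpha>" and \<beta>: "nt Y Y \<beta>"
  defines "\<zeta> \<equiv> \<lambda>b. mu X Y b \<bullet> \<alpha> (AO Y b) \<bullet> F X (\<beta> b) \<bullet> inv_ar B (mu X Y b)"
  shows "nt (Tob C X Y) (Tob C X Y) \<zeta>"
    and "tr (Tob C X Y) \<zeta> b = ev X b \<bullet> \<alpha> (AO (Dual C X) b) \<bullet> F X (tr Y \<beta> (AO (Dual C X) b)) \<bullet> cr X b"
proof -
  let ?X = "Dual C X" and ?Y = "Dual C Y" and ?XY = "Tob C X Y"
  note [simp] = nt_simps[OF \<alpha>] nt_simps[OF \<beta>]
  show "nt ?XY ?XY \<zeta>" unfolding nt_def
  proof (intro conjI ballI)
    fix b assume [simp]: "b \<in> Ob B"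
    show "\<zeta> b \<in> Hom B (AO ?XY b) (AO ?XY b)" by (simp add: \<zeta>_def Hom_iff)
  next
    fix g assume [simp]: "g \<in> Ar B"
    let ?a = "Dom B g" and ?c = "Cod B g"
    have 1: "inv_ar B (mu X Y ?c) \<bullet> F ?XY g = F X (F Y g) \<bullet> inv_ar B (mu X Y ?a)" by (rule inv_mu_nat) simp_all
    have "\<beta> ?c \<bullet> F Y g = F Y g \<bullet> \<beta> ?a" by (rule nt_nat[OF \<beta>]) simp_all
    then have 2: "F X (\<beta> ?c) \<bullet> F X (F Y g) = F X (F Y g) \<bullet> F X (\<beta> ?a)" by (simp flip: F_Cmp)
    have 3: "\<alpha> (AO Y ?c) \<bullet> F X (F Y g) = F X (F Y g) \<bullet> \<alpha> (AO Y ?a)" by (rule nt_nat[OF \<alpha>]) simp_all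
    have 4: "mu X Y ?c \<bullet> F X (F Y g) = F ?XY g \<bullet> mu X Y ?a" by (rule mu_nat) simp_all
    have "\<zeta> ?c \<bullet> F ?XY g = mu X Y ?c \<bullet> \<alpha> (AO Y ?c) \<bullet> (F X (\<beta> ?c) \<bullet> F X (F Y g)) \<bullet> inv_ar B (mu X Y ?a)"
      by (simp add: \<zeta>_def 1)
    also have "\<dots> = mu X Y ?c \<bullet> (\<alpha> (AO Y ?c) \<bullet> F X (F Y g)) \<bullet> F X (\<beta> ?a) \<bullet> inv_ar B (mu X Y ?a)" unfolding 2 by simp
    also have "\<dots> = (mu X Y ?c \<bullet> F X (F Y g)) \<bullet> \<alpha> (AO Y ?a) \<bullet> F X (\<beta> ?a) \<bullet> inv_ar B (mu X Y ?a)" unfolding 3 by simp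
    also have "\<dots> = F ?XY g \<bullet> \<zeta> ?a" unfolding 4 by (simp add: \<zeta>_def)
    finally show "\<zeta> ?c \<bullet> F ?XY g = F ?XY g \<bullet> \<zeta> ?a" .
  qed
  let ?V = "Dual C ?XY" and ?b = "AO ?X b" and ?G = "AO ?Y (AO ?X b)"
  define d where "d = (\<lambda>b. T (Dmu C X Y) b \<bullet> mu ?Y ?X b)"
  have d [simp]: "d b \<in> Ar B" "Dom B (d b) = ?G" "Cod B (d b) = AO ?V b" by (simp_all add: d_def)
  have c: "mu X Y (AO ?V b) \<bullet> F X (F Y (d b)) \<bullet> F X (cr Y ?b) \<bullet> cr X b = cr ?XY b"
    unfolding d_def by (rule Dmu_mate(3)) simp_all
  have e: "ev ?XY b \<bullet> F ?XY (d b) \<bullet> mu X Y ?G = ev X b \<bullet> F X (ev Y ?b)"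
    unfolding d_def by (rule ev_tensor) simp_all
  have "\<beta> (AO ?V b) \<bullet> F Y (d b) = F Y (d b) \<bullet> \<beta> ?G" by (rule nt_nat[OF \<beta>]) simp_all
  then have 1: "F X (\<beta> (AO ?V b)) \<bullet> F X (F Y (d b)) = F X (F Y (d b)) \<bullet> F X (\<beta> ?G)" by (simp flip: F_Cmp)
  have 2: "\<alpha> (AO Y (AO ?V b)) \<bullet> F X (F Y (d b)) = F X (F Y (d b)) \<bullet> \<alpha> (AO Y ?G)" by (rule nt_nat[OF \<alpha>]) simp_all
  have 3: "mu X Y (AO ?V b) \<bullet> F X (F Y (d b)) = F ?XY (d b) \<bullet> mu X Y ?G" by (rule mu_nat) simp_all
  have 4: "F X (ev Y ?b) \<bullet> \<alpha> (AO Y ?G) = \<alpha> ?b \<bullet> F X (ev Y ?b)" by (rule nt_nat[OF \<alpha>, symmetric]) simp_all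
  have "tr ?XY \<zeta> b = ev ?XY b \<bullet> \<zeta> (AO ?V b) \<bullet> (mu X Y (AO ?V b) \<bullet> F X (F Y (d b)) \<bullet> F X (cr Y ?b) \<bullet> cr X b)"
    unfolding tr_def c ..
  also have "\<dots> = ev ?XY b \<bullet> mu X Y (AO ?V b) \<bullet> \<alpha> (AO Y (AO ?V b)) \<bullet> (F X (\<beta> (AO ?V b)) \<bullet> F X (F Y (d b))) \<bullet> F X (cr Y ?b) \<bullet> cr X b"
    by (simp add: \<zeta>_def)
  also have "\<dots> = ev ?XY b \<bullet> mu X Y (AO ?V b) \<bullet> (\<alpha> (AO Y (AO ?V b)) \<bullet> F X (F Y (d b))) \<bullet> F X (\<beta> ?G) \<bullet> F X (cr Y ?b) \<bullet> cr X b"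
    unfolding 1 by simp
  also have "\<dots> = ev ?XY b \<bullet> (mu X Y (AO ?V b) \<bullet> F X (F Y (d b))) \<bullet> \<alpha> (AO Y ?G) \<bullet> F X (\<beta> ?G) \<bullet> F X (cr Y ?b) \<bullet> cr X b"
    unfolding 2 by simp
  also have "\<dots> = (ev ?XY b \<bullet> F ?XY (d b) \<bullet> mu X Y ?G) \<bullet> \<alpha> (AO Y ?G) \<bullet> F X (\<beta> ?G) \<bullet> F X (cr Y ?b) \<bullet> cr X b"
    unfolding 3 by simp
  also have "\<dots> = ev X b \<bullet> (F X (ev Y ?b) \<bullet> \<alpha> (AO Y ?G)) \<bullet> F X (\<beta> ?G) \<bullet> F X (cr Y ?b) \<bullet> cr X b"
    unfolding e by simp
  also have "\<dots> = ev X b \<bullet> \<alpha> ?b \<bullet> F X (tr Y \<beta> ?b) \<bullet> cr X b"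
    unfolding 4 by (simp add: tr_def)
  finally show "tr ?XY \<zeta> b = ev X b \<bullet> \<alpha> ?b \<bullet> F X (tr Y \<beta> ?b) \<bullet> cr X b" .
qed

end

locale pivotal_module_action = pivotal_action +
  assumes pivotal: "\<lbrakk>X \<in> Ob C; Y \<in> Ob C; nt X Y \<alpha>; b \<in> Ob B\<rbrakk> \<Longrightarrow>
    T (Piv C Y) b \<bullet> \<alpha> b = ntdual (Dual C Y) (Dual C X) (ntdual X Y \<alpha>) b \<bullet> T (Piv C X) b"
begin

lemma ntdual_nt: assumes X: "X \<in> Ob C" and Y: "Y \<in> Ob C" and \<alpha>: "nt X Y \<alpha>"
  shows "nt (Dual C Y) (Dual C X) (ntdual X Y \<alpha>)"
  unfolding nt_def
proof (intro conjI ballI)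
  fix b assume "b \<in> Ob B"
  then show "ntdual X Y \<alpha> b \<in> Hom B (AO (Dual C Y) b) (AO (Dual C X) b)"
    using ntdual_simps[OF X Y \<alpha>] by (simp add: Hom_iff)
next
  fix g assume g [simp]: "g \<in> Ar B"
  let ?X = "Dual C X" and ?Y = "Dual C Y" and ?a = "Dom B g" and ?c = "Cod B g"
  note [simp] = X Y nt_simps[OF \<alpha>]
  have "cr X ?c \<bullet> g = F X (F ?X g) \<bullet> cr X ?a" by (rule cr_nat) simp_all
  then have 1: "F ?Y (cr X ?c) \<bullet> F ?Y g = F ?Y (F X (F ?X g)) \<bullet> F ?Y (cr X ?a)" by (simp flip: F_Cmp)
  have "\<alpha> (AO ?X ?c) \<bullet> F X (F ?X g) = F Y (F ?X g) \<bullet> \<alpha> (AO ?X ?a)" by (rule nt_nat[OF \<alpha>]) simp_all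
  then have 2: "F ?Y (\<alpha> (AO ?X ?c)) \<bullet> F ?Y (F X (F ?X g)) = F ?Y (F Y (F ?X g)) \<bullet> F ?Y (\<alpha> (AO ?X ?a))" by (simp flip: F_Cmp)
  have 3: "an Y (AO ?X ?c) \<bullet> F ?Y (F Y (F ?X g)) = F ?X g \<bullet> an Y (AO ?X ?a)" by (rule an_nat) simp_all
  have "ntdual X Y \<alpha> ?c \<bullet> F ?Y g = an Y (AO ?X ?c) \<bullet> (F ?Y (\<alpha> (AO ?X ?c)) \<bullet> F ?Y (F X (F ?X g))) \<bullet> F ?Y (cr X ?a)"
    by (simp add: ntdual_def 1)
  also have "\<dots> = (an Y (AO ?X ?c) \<bullet> F ?Y (F Y (F ?X g))) \<bullet> F ?Y (\<alpha> (AO ?X ?a)) \<bullet> F ?Y (cr X ?a)" unfolding 2 by simp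
  also have "\<dots> = F ?X g \<bullet> ntdual X Y \<alpha> ?a" unfolding 3 by (simp add: ntdual_def)
  finally show "ntdual X Y \<alpha> ?c \<bullet> F ?Y g = F ?X g \<bullet> ntdual X Y \<alpha> ?a" .
qed

text \<open>The counterpart of \<open>cr_ntdual\<close> for \<open>ev\<close>. It requires the
  double dual of \<open>\<alpha>\<close> to agree with \<open>\<alpha>\<close> up to the pivotal
  structure, which pivotality of the module category grants also to transformations outside the
  image of \<open>C\<close>.\<close>

lemma ev_ntdual: assumes X [simp]: "X \<in> Ob C" and Y [simp]: "Y \<in> Ob C" and \<alpha>: "nt X Y \<alpha>" and b [simp]: "b \<in> Ob B"
  shows "ev Y b \<bullet> \<alpha> (AO (Dual C Y) b) = ev X b \<bullet> F X (ntdual X Y \<alpha> b)"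
proof -
  let ?X = "Dual C X" and ?Y = "Dual C Y" and ?\<alpha> = "ntdual X Y \<alpha>"
  have \<alpha>': "nt ?Y ?X ?\<alpha>" by (rule ntdual_nt) fact+
  have YX: "?Y \<in> Ob C" "?X \<in> Ob C" by simp_all
  note [simp] = nt_simps[OF \<alpha>] nt_simps[OF \<alpha>'] ntdual_simps[OF YX \<alpha>']
  have 1: "T (Piv C Y) (AO ?Y b) \<bullet> \<alpha> (AO ?Y b) = ntdual ?Y ?X ?\<alpha> (AO ?Y b) \<bullet> T (Piv C X) (AO ?Y b)"
    by (rule pivotal[OF X Y \<alpha>]) simp
  have 2: "an ?Y b \<bullet> ntdual ?Y ?X ?\<alpha> (AO ?Y b) = an ?X b \<bullet> F (DD C X) (?\<alpha> b)" by (rule an_ntdual[OF YX \<alpha>' b])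
  have 3: "F (DD C X) (?\<alpha> b) \<bullet> T (Piv C X) (AO ?Y b) = T (Piv C X) (AO ?X b) \<bullet> F X (?\<alpha> b)"
    by (rule T_nat[symmetric]) simp_all
  have "ev Y b \<bullet> \<alpha> (AO ?Y b) = an ?Y b \<bullet> (T (Piv C Y) (AO ?Y b) \<bullet> \<alpha> (AO ?Y b))" by (simp add: ev_def)
  also have "\<dots> = (an ?Y b \<bullet> ntdual ?Y ?X ?\<alpha> (AO ?Y b)) \<bullet> T (Piv C X) (AO ?Y b)" unfolding 1 by simp
  also have "\<dots> = an ?X b \<bullet> (F (DD C X) (?\<alpha> b) \<bullet> T (Piv C X) (AO ?Y b))" unfolding 2 by simp
  also have "\<dots> = ev X b \<bullet> F X (?\<alpha> b)" unfolding 3 by (simp add: ev_def)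
  finally show ?thesis .
qed

text \<open>\<open>\<alpha>\<close> travels around the loop: past the creation it becomes its dual,
  naturality of \<open>\<gamma>\<close> lets the two pass each other, and the evaluation turns the
  dual back into \<open>\<alpha>\<close> on the other side of \<open>\<gamma>\<close>.\<close>

lemma tr_swap: assumes X [simp]: "X \<in> Ob C" and Y [simp]: "Y \<in> Ob C" and \<alpha>: "nt X Y \<alpha>" and \<gamma>: "nt Y X \<gamma>" and b [simp]: "b \<in> Ob B"
  shows "tr X (\<lambda>b. \<gamma> b \<bullet> \<alpha> b) b = tr Y (\<lambda>b. \<alpha> b \<bullet> \<gamma> b) b"
proof -
  let ?X = "Dual C X" and ?Y = "Dual C Y" and ?\<alpha> = "ntdual X Y \<alpha>"
  note [simp] = nt_simps[OF \<alpha>] nt_simps[OF \<gamma>] ntdual_simps[OF X Y \<alpha>]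
  have 1: "\<alpha> (AO ?X b) \<bullet> cr X b = F Y (?\<alpha> b) \<bullet> cr Y b" by (rule cr_ntdual[OF X Y \<alpha> b, symmetric])
  have 2: "\<gamma> (AO ?X b) \<bullet> F Y (?\<alpha> b) = F X (?\<alpha> b) \<bullet> \<gamma> (AO ?Y b)" by (rule nt_nat[OF \<gamma>]) simp_all
  have 3: "ev X b \<bullet> F X (?\<alpha> b) = ev Y b \<bullet> \<alpha> (AO ?Y b)" by (rule ev_ntdual[OF X Y \<alpha> b, symmetric])
  have "tr X (\<lambda>b. \<gamma> b \<bullet> \<alpha> b) b = ev X b \<bullet> \<gamma> (AO ?X b) \<bullet> (\<alpha> (AO ?X b) \<bullet> cr X b)" by (simp add: tr_def)
  also have "\<dots> = ev X b \<bullet> (\<gamma> (AO ?X b) \<bullet> F Y (?\<alpha> b)) \<bullet> cr Y b" unfolding 1 by simp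
  also have "\<dots> = (ev X b \<bullet> F X (?\<alpha> b)) \<bullet> \<gamma> (AO ?Y b) \<bullet> cr Y b" unfolding 2 by simp
  also have "\<dots> = tr Y (\<lambda>b. \<alpha> b \<bullet> \<gamma> b) b" unfolding 3 by (simp add: tr_def)
  finally show ?thesis .
qed

end

section \<open>Natural transformations on semisimple categories\<close>

lemma (in lin_functor) direct_sum_image:
  assumes "direct_sum C A n S i p"
  shows "direct_sum D (Fob F A) n (\<lambda>r. Fob F (S r)) (\<lambda>r. Far F (i r)) (\<lambda>r. Far F (p r))"
proof -
  note d = direct_sumD[OF assms]
  have F: "Far F x \<in> Ar D" "Dom D (Far F x) = Fob F (Dom C x)" "Cod D (Far F x) = Fob F (Cod C x)"
    if "x \<in> Ar C" for x
    using Far_Hom[of x "Dom C x" "Cod C x"] that by (auto simp: Hom_iff)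
  have FC: "Far F y \<bullet>\<^bsub>D\<^esub> Far F x = Far F (y \<bullet> x)" if "x \<in> Ar C" "y \<in> Ar C" "Dom C y = Cod C x" for x y
    using Far_Cmp[of x "Dom C x" "Cod C x" y "Cod C y"] that by (auto simp: Hom_iff)
  have FZ: "Far F (Zero C A B) = Zero D (Fob F A) (Fob F B)" if "A \<in> Ob C" "B \<in> Ob C" for A B
    using Far_Scale[of "Zero C A B" A B 0] that F[of "Zero C A B"] by (auto simp: Hom_iff)
  have "hsum D (Fob F A) (Fob F A) (\<lambda>r. Far F (i r \<bullet> p r)) n = Far F (hsum C A A (\<lambda>r. i r \<bullet> p r) n)"
    by (rule hsum_map[symmetric]) (use d in \<open>auto simp: Hom_iff F Far_Add FZ D.lin_category_axioms\<close>)
  also have "\<dots> = Id D (Fob F A)" using d by (simp add: Far_Id)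
  finally have "hsum D (Fob F A) (Fob F A) (\<lambda>r. Far F (i r) \<bullet>\<^bsub>D\<^esub> Far F (p r)) n = Id D (Fob F A)"
    using d by (subst D.hsum_cong[where g = "\<lambda>r. Far F (i r \<bullet> p r)"]) (auto simp: FC F Hom_iff Fob_Ob)
  then show ?thesis using d unfolding direct_sum_def hsum_def by (auto simp: Hom_iff F FC FZ Far_Id Fob_Ob)
qed

lemma (in lin_functor) Far_simps: assumes "x \<in> Ar C"
  shows "Far F x \<in> Ar D" "Dom D (Far F x) = Fob F (Dom C x)" "Cod D (Far F x) = Fob F (Cod C x)"
    "Far F (Scale C k x) = Scale D k (Far F x)"
  using Far_Hom[of x "Dom C x" "Cod C x"] Far_Scale[of x "Dom C x" "Cod C x"] assms by (auto simp: Hom_iff)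

lemma (in lin_functor) Far_Cmp_simp: assumes "x \<in> Ar C" "y \<in> Ar C" "Dom C y = Cod C x"
  shows "Far F (y \<bullet> x) = Far F y \<bullet>\<^bsub>D\<^esub> Far F x"
  using Far_Cmp[of x "Dom C x" "Cod C x" y "Cod C y"] assms by (auto simp: Hom_iff)

lemma (in lin_functor) Far_Zero: assumes "A \<in> Ob C" "B \<in> Ob C"
  shows "Far F (Zero C A B) = Zero D (Fob F A) (Fob F B)"
  using Far_simps(4)[of "Zero C A B" 0] Far_simps(1-3)[of "Zero C A B"] assms by simp

definition nat_family :: "('o, 'm, 'z) cat_scheme \<Rightarrow> ('o, 'm, 'o, 'm) fct \<Rightarrow> ('o, 'm, 'o, 'm) fct \<Rightarrow> ('o \<Rightarrow> 'm) \<Rightarrow> bool" where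
  "nat_family C P Q \<eta> \<longleftrightarrow> (\<forall>b\<in>Ob C. \<eta> b \<in> Hom C (Fob P b) (Fob Q b)) \<and>
     (\<forall>g\<in>Ar C. Cmp C (\<eta> (Cod C g)) (Far P g) = Cmp C (Far Q g) (\<eta> (Dom C g)))"

context semisimple_reps
begin

text \<open>Extends an arbitrary choice of morphisms on \<open>I\<close> to all objects through the
  chosen decompositions. Every natural transformation between linear functors arises in this way,
  and every choice is allowed.\<close>

definition nat_ext :: "('o, 'm, 'o, 'm) fct \<Rightarrow> ('o, 'm, 'o, 'm) fct \<Rightarrow> ('o \<Rightarrow> 'm) \<Rightarrow> 'o \<Rightarrow> 'm" where
  "nat_ext P Q h b = hsum C (Fob P b) (Fob Q b) (\<lambda>r. Far Q (di b r) \<bullet> h (dS b r) \<bullet> Far P (dp b r)) (dn b)"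

context
  fixes P Q :: "('o, 'm, 'o, 'm) fct" assumes P: "lin_functor C C P" and Q: "lin_functor C C Q"
begin

interpretation P: lin_functor C C P by (rule P)
interpretation Q: lin_functor C C Q by (rule Q)

lemma nat_family_expand:
  assumes \<eta>: "nat_family C P Q \<eta>" and b: "b \<in> Ob C"
  shows "\<eta> b = nat_ext P Q \<eta> b"
proof -
  have \<eta>b: "\<eta> b \<in> Hom C (Fob P b) (Fob Q b)" if "b \<in> Ob C" for b using \<eta> that by (simp add: nat_family_def)
  have "\<eta> b = hsum C (Fob P b) (Fob Q b) (\<lambda>r. \<eta> b \<bullet> Far P (di b r) \<bullet> Far P (dp b r)) (dn b)"
    by (rule direct_sum_expand_right[OF P.direct_sum_image[OF dec_direct_sum[OF b]] \<eta>b[OF b]])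
  also have "\<dots> = nat_ext P Q \<eta> b"
    unfolding nat_ext_def
  proof (rule hsum_cong)
    fix r assume r: "r < dn b"
    have e: "\<eta> b \<bullet> Far P (di b r) = Far Q (di b r) \<bullet> \<eta> (dS b r)"
      using \<eta> dec_simps[OF b r] unfolding nat_family_def by auto
    have h: "\<eta> b \<in> Ar C" "Dom C (\<eta> b) = Fob P b" "Cod C (\<eta> b) = Fob Q b"
      "\<eta> (dS b r) \<in> Ar C" "Dom C (\<eta> (dS b r)) = Fob P (dS b r)" "Cod C (\<eta> (dS b r)) = Fob Q (dS b r)"
      using \<eta>b[OF b] \<eta>b[of "dS b r"] b r by (auto simp: Hom_iff)
    have "\<eta> b \<bullet> Far P (di b r) \<bullet> Far P (dp b r) = (\<eta> b \<bullet> Far P (di b r)) \<bullet> Far P (dp b r)"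
      using b r h by (simp add: P.Far_simps)
    then show "\<eta> b \<bullet> Far P (di b r) \<bullet> Far P (dp b r) = Far Q (di b r) \<bullet> \<eta> (dS b r) \<bullet> Far P (dp b r)"
      unfolding e using b r h by (simp add: P.Far_simps Q.Far_simps)
    show "Far Q (di b r) \<bullet> \<eta> (dS b r) \<bullet> Far P (dp b r) \<in> Hom C (Fob P b) (Fob Q b)"
      using b r h by (simp add: P.Far_simps Q.Far_simps Hom_iff)
  qed (use b in \<open>simp_all add: P.Fob_Ob Q.Fob_Ob\<close>)
  finally show ?thesis .
qed

lemma nat_ext_cong: "(\<And>i. i \<in> I \<Longrightarrow> h i = h' i) \<Longrightarrow> (\<And>i. i \<in> I \<Longrightarrow> h' i \<in> Hom C (Fob P i) (Fob Q i)) \<Longrightarrow> b \<in> Ob C \<Longrightarrow> nat_ext P Q h b = nat_ext P Q h' b"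
  unfolding nat_ext_def by (rule hsum_cong) (auto simp: P.Fob_Ob Q.Fob_Ob P.Far_simps Q.Far_simps Hom_iff)

lemma nat_family_eqI:
  assumes "nat_family C P Q \<eta>" "nat_family C P Q \<eta>'" "\<And>i. i \<in> I \<Longrightarrow> \<eta> i = \<eta>' i" "b \<in> Ob C"
  shows "\<eta> b = \<eta>' b"
proof -
  have "nat_ext P Q \<eta> b = nat_ext P Q \<eta>' b"
    using assms by (intro nat_ext_cong) (auto simp: nat_family_def)
  then show ?thesis using nat_family_expand assms by simp
qed

context
  fixes h assumes h: "\<And>i. i \<in> I \<Longrightarrow> h i \<in> Hom C (Fob P i) (Fob Q i)"
begin

lemma nat_ext_Hom: "b \<in> Ob C \<Longrightarrow> nat_ext P Q h b \<in> Hom C (Fob P b) (Fob Q b)"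
  unfolding nat_ext_def using h by (intro hsum_Hom) (auto simp: P.Fob_Ob Q.Fob_Ob P.Far_simps Q.Far_simps Hom_iff)

lemma nat_ext_di: assumes b: "b \<in> Ob C" and s: "s < dn b"
  shows "nat_ext P Q h b \<bullet> Far P (di b s) = Far Q (di b s) \<bullet> h (dS b s)"
proof -
  have hH: "h (dS b r) \<in> Ar C" "Dom C (h (dS b r)) = Fob P (dS b r)" "Cod C (h (dS b r)) = Fob Q (dS b r)" if "r < dn b" for r
    using h[of "dS b r"] b that by (auto simp: Hom_iff)
  have PP: "Far P (dp b r) \<bullet> Far P (di b s) = (if r = s then Id C (Fob P (dS b r)) else Zero C (Fob P (dS b s)) (Fob P (dS b r)))" if "r < dn b" for r
    using that b s by (simp add: P.Far_Cmp_simp[symmetric] dec_orth P.Far_Id P.Far_Zero)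
  have eq: "(Far Q (di b r) \<bullet> h (dS b r) \<bullet> Far P (dp b r)) \<bullet> Far P (di b s) =
      Far Q (di b r) \<bullet> h (dS b r) \<bullet> (Far P (dp b r) \<bullet> Far P (di b s))" if "r < dn b" for r
    using that b s hH by (simp add: P.Far_simps Q.Far_simps)
  have "nat_ext P Q h b \<bullet> Far P (di b s) = hsum C (Fob P (dS b s)) (Fob Q b) (\<lambda>r. (Far Q (di b r) \<bullet> h (dS b r) \<bullet> Far P (dp b r)) \<bullet> Far P (di b s)) (dn b)"
    unfolding nat_ext_def using b s hH by (intro Cmp_hsum_left) (auto simp: P.Fob_Ob Q.Fob_Ob P.Far_simps Q.Far_simps Hom_iff)
  also have "\<dots> = (Far Q (di b s) \<bullet> h (dS b s) \<bullet> Far P (dp b s)) \<bullet> Far P (di b s)"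
    by (rule hsum_single) (use b s hH in \<open>auto simp: eq PP P.Fob_Ob Q.Fob_Ob P.Far_simps Q.Far_simps Hom_iff\<close>)
  also have "\<dots> = Far Q (di b s) \<bullet> h (dS b s)"
    unfolding eq[OF s] using b s hH[OF s] by (simp add: PP P.Far_simps Q.Far_simps)
  finally show ?thesis .
qed

lemma nat_ext_dp: assumes b: "b \<in> Ob C" and s: "s < dn b"
  shows "Far Q (dp b s) \<bullet> nat_ext P Q h b = h (dS b s) \<bullet> Far P (dp b s)"
proof -
  have hH: "h (dS b r) \<in> Ar C" "Dom C (h (dS b r)) = Fob P (dS b r)" "Cod C (h (dS b r)) = Fob Q (dS b r)" if "r < dn b" for r
    using h[of "dS b r"] b that by (auto simp: Hom_iff)
  have QQ: "Far Q (dp b s) \<bullet> Far Q (di b r) = (if s = r then Id C (Fob Q (dS b s)) else Zero C (Fob Q (dS b r)) (Fob Q (dS b s)))" if "r < dn b" for r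
    using that b s by (simp add: Q.Far_Cmp_simp[symmetric] dec_orth Q.Far_Id Q.Far_Zero)
  have eq: "Far Q (dp b s) \<bullet> (Far Q (di b r) \<bullet> h (dS b r) \<bullet> Far P (dp b r)) =
      (Far Q (dp b s) \<bullet> Far Q (di b r)) \<bullet> h (dS b r) \<bullet> Far P (dp b r)" if "r < dn b" for r
    using that b s hH by (simp add: P.Far_simps Q.Far_simps)
  have "Far Q (dp b s) \<bullet> nat_ext P Q h b = hsum C (Fob P b) (Fob Q (dS b s)) (\<lambda>r. Far Q (dp b s) \<bullet> (Far Q (di b r) \<bullet> h (dS b r) \<bullet> Far P (dp b r))) (dn b)"
    unfolding nat_ext_def using b s hH by (intro Cmp_hsum_right) (auto simp: P.Fob_Ob Q.Fob_Ob P.Far_simps Q.Far_simps Hom_iff)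
  also have "\<dots> = Far Q (dp b s) \<bullet> (Far Q (di b s) \<bullet> h (dS b s) \<bullet> Far P (dp b s))"
    by (rule hsum_single) (use b s hH in \<open>auto simp: eq QQ P.Fob_Ob Q.Fob_Ob P.Far_simps Q.Far_simps Hom_iff\<close>)
  also have "\<dots> = h (dS b s) \<bullet> Far P (dp b s)"
    unfolding eq[OF s] using b s hH[OF s] by (simp add: QQ P.Far_simps Q.Far_simps)
  finally show ?thesis .
qed

text \<open>By Schur's lemma a morphism between representatives is zero or a multiple of an
  identity, so naturality on \<open>I\<close> imposes no condition on \<open>h\<close>.\<close>

lemma scalar_natural: assumes i: "i \<in> I" and j: "j \<in> I" and f: "f \<in> Hom C i j"
  shows "h j \<bullet> Far P f = Far Q f \<bullet> h i"
proof (cases "i = j")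
  case True
  have "f = Scale C (scal j f) (Id C j)" using Scale_scal[OF j, of f] f True by simp
  then obtain k where k: "f = Scale C k (Id C j)" by blast
  then show ?thesis using h[OF j] True j by (simp add: P.Fob_Ob Q.Fob_Ob P.Far_simps Q.Far_simps P.Far_Id Q.Far_Id Hom_iff)
next
  case False
  then have "f = Zero C i j" using orth[OF i j _ f] by simp
  then show ?thesis using h[OF i] h[OF j] i j by (simp add: P.Far_Zero Q.Far_Zero Hom_iff P.Fob_Ob Q.Fob_Ob)
qed

text \<open>Naturality at \<open>g\<close> is tested on blocks: after projecting onto a summand of
  the codomain and restricting to a summand of the domain, only a morphism between representatives
  is left.\<close>

lemma nat_ext_nat_family: "nat_family C P Q (nat_ext P Q h)"
  unfolding nat_family_def
proof (intro conjI ballI)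
  fix g assume g: "g \<in> Ar C"
  let ?a = "Dom C g" and ?c = "Cod C g"
  note ab = Dom_Ob[OF g] Cod_Ob[OF g]
  have eH: "nat_ext P Q h b \<in> Ar C" "Dom C (nat_ext P Q h b) = Fob P b" "Cod C (nat_ext P Q h b) = Fob Q b" if "b \<in> Ob C" for b
    using nat_ext_Hom[OF that] by (auto simp: Hom_iff)
  have hH: "h i \<in> Ar C" "Dom C (h i) = Fob P i" "Cod C (h i) = Fob Q i" if "i \<in> I" for i
    using h[OF that] by (auto simp: Hom_iff)
  let ?l = "nat_ext P Q h ?c \<bullet> Far P g" and ?r = "Far Q g \<bullet> nat_ext P Q h ?a"
  have lr: "?l \<in> Hom C (Fob P ?a) (Fob Q ?c)" "?r \<in> Hom C (Fob P ?a) (Fob Q ?c)"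
    using g ab eH by (auto simp: Hom_iff P.Far_simps Q.Far_simps)
  show "?l = ?r"
  proof (rule direct_sum_eq_left[OF Q.direct_sum_image[OF dec_direct_sum[OF ab(2)]] lr])
    fix s assume s: "s < dn ?c"
    have lr': "Far Q (dp ?c s) \<bullet> ?l \<in> Hom C (Fob P ?a) (Fob Q (dS ?c s))" "Far Q (dp ?c s) \<bullet> ?r \<in> Hom C (Fob P ?a) (Fob Q (dS ?c s))"
      using lr s ab by (auto simp: Hom_iff Q.Far_simps)
    show "Far Q (dp ?c s) \<bullet> ?l = Far Q (dp ?c s) \<bullet> ?r"
    proof (rule direct_sum_eq_right[OF P.direct_sum_image[OF dec_direct_sum[OF ab(1)]] lr'])
      fix r assume r: "r < dn ?a"
      let ?f = "dp ?c s \<bullet> g \<bullet> di ?a r"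
      have "(Far Q (dp ?c s) \<bullet> ?l) \<bullet> Far P (di ?a r) = (Far Q (dp ?c s) \<bullet> nat_ext P Q h ?c) \<bullet> Far P (g \<bullet> di ?a r)"
        using g ab eH r s by (simp add: P.Far_simps Q.Far_simps P.Far_Cmp_simp)
      also have "\<dots> = h (dS ?c s) \<bullet> Far P ?f"
        unfolding nat_ext_dp[OF ab(2) s] using g ab hH r s by (simp add: P.Far_simps Q.Far_simps P.Far_Cmp_simp)
      also have "\<dots> = Far Q ?f \<bullet> h (dS ?a r)"
        using g ab r s by (intro scalar_natural) (auto simp: Hom_iff)
      also have "\<dots> = Far Q (dp ?c s \<bullet> g) \<bullet> (Far Q (di ?a r) \<bullet> h (dS ?a r))"
        using g ab hH r s by (simp add: P.Far_simps Q.Far_simps Q.Far_Cmp_simp)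
      also have "\<dots> = (Far Q (dp ?c s) \<bullet> ?r) \<bullet> Far P (di ?a r)"
        unfolding nat_ext_di[OF ab(1) r, symmetric] using g ab eH r s by (simp add: P.Far_simps Q.Far_simps Q.Far_Cmp_simp)
      finally show "(Far Q (dp ?c s) \<bullet> ?l) \<bullet> Far P (di ?a r) = (Far Q (dp ?c s) \<bullet> ?r) \<bullet> Far P (di ?a r)" .
    qed
  qed
qed (rule nat_ext_Hom)

text \<open>The decomposition chosen for \<open>j\<close> need not be the identity. The value at
  \<open>j\<close> is still \<open>h j\<close>, because \<open>h\<close> is natural with respect to
  the inclusions \<open>di j r\<close>.\<close>

lemma nat_ext_simple: assumes j: "j \<in> I" shows "nat_ext P Q h j = h j"
proof -
  note jO = I_Ob[OF j]
  have eH: "nat_ext P Q h j \<in> Hom C (Fob P j) (Fob Q j)" by (rule nat_ext_Hom[OF jO])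
  show ?thesis
  proof (rule direct_sum_eq_right[OF P.direct_sum_image[OF dec_direct_sum[OF jO]] eH h[OF j]])
    fix r assume r: "r < dn j"
    show "nat_ext P Q h j \<bullet> Far P (di j r) = h j \<bullet> Far P (di j r)"
      unfolding nat_ext_di[OF jO r] using r jO j by (intro scalar_natural[symmetric]) (auto simp: Hom_iff)
  qed
qed

end

end

end

section \<open>Traces of natural transformations on simple objects\<close>

locale pivotal_semisimple_action = pivotal_module_action C B A T mu ep + B: semisimple_reps B I
  for C :: "('o, 'm, 'k :: alg_closed_field, 'z) pivcat_scheme"
    and B :: "('p, 'n, 'k, 'y) lincat_scheme" (structure) and A T mu ep and I :: "'p set"
begin

lemma nt_iff: "nt X Y \<alpha> \<longleftrightarrow> nat_family B (A X) (A Y) \<alpha>"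
  by (simp add: nt_def nat_family_def)

lemma nt_eqI: "\<lbrakk>X \<in> Ob C; Y \<in> Ob C; nt X Y \<eta>; nt X Y \<eta>'; \<And>i. i \<in> I \<Longrightarrow> \<eta> i = \<eta>' i; b \<in> Ob B\<rbrakk> \<Longrightarrow> \<eta> b = \<eta>' b"
  unfolding nt_iff using B.nat_family_eqI[OF A_functor A_functor] by blast

lemma nt_Cmp: assumes "nt X Y \<alpha>" "nt Y Z \<gamma>" "X \<in> Ob C" "Y \<in> Ob C" "Z \<in> Ob C"
  shows "nt X Z (\<lambda>b. \<gamma> b \<bullet> \<alpha> b)"
  unfolding nt_def
proof (intro conjI ballI)
  note [simp] = nt_simps[OF assms(1)] nt_simps[OF assms(2)] assms(3-5)
  show "\<gamma> b \<bullet> \<alpha> b \<in> Hom B (AO X b) (AO Z b)" if "b \<in> Ob B" for b using that by (simp add: Hom_iff)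
  fix g assume g [simp]: "g \<in> Ar B"
  let ?a = "Dom B g" and ?c = "Cod B g"
  have 1: "\<alpha> ?c \<bullet> F X g = F Y g \<bullet> \<alpha> ?a" by (rule nt_nat[OF assms(1)]) simp_all
  have 2: "\<gamma> ?c \<bullet> F Y g = F Z g \<bullet> \<gamma> ?a" by (rule nt_nat[OF assms(2)]) simp_all
  have "(\<gamma> ?c \<bullet> \<alpha> ?c) \<bullet> F X g = (\<gamma> ?c \<bullet> F Y g) \<bullet> \<alpha> ?a" by (simp add: 1)
  also have "\<dots> = F Z g \<bullet> \<gamma> ?a \<bullet> \<alpha> ?a" unfolding 2 by simp
  finally show "(\<gamma> ?c \<bullet> \<alpha> ?c) \<bullet> F X g = F Z g \<bullet> \<gamma> ?a \<bullet> \<alpha> ?a" .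
qed

lemma nt_F: assumes X: "X \<in> Ob C" and \<alpha>: "\<And>b. b \<in> Ob B \<Longrightarrow> \<alpha> b \<in> Hom B b b"
    "\<And>g. g \<in> Ar B \<Longrightarrow> \<alpha> (Cod B g) \<bullet> g = g \<bullet> \<alpha> (Dom B g)"
  shows "nt X X (\<lambda>b. F X (\<alpha> b))"
  unfolding nt_def
proof (intro conjI ballI)
  have a: "\<alpha> b \<in> Ar B" "Dom B (\<alpha> b) = b" "Cod B (\<alpha> b) = b" if "b \<in> Ob B" for b using \<alpha>(1)[OF that] by (auto simp: Hom_iff)
  show "F X (\<alpha> b) \<in> Hom B (AO X b) (AO X b)" if "b \<in> Ob B" for b using that a X by (simp add: Hom_iff)
  fix g assume g: "g \<in> Ar B"
  have "F X (\<alpha> (Cod B g) \<bullet> g) = F X (g \<bullet> \<alpha> (Dom B g))" using \<alpha>(2)[OF g] by simp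
  then show "F X (\<alpha> (Cod B g)) \<bullet> F X g = F X g \<bullet> F X (\<alpha> (Dom B g))" using g a X by simp
qed

lemma nt_Scale: assumes "nt X Y \<alpha>" "X \<in> Ob C" "Y \<in> Ob C" shows "nt X Y (\<lambda>b. Scale B k (\<alpha> b))"
  using assms nt_simps[OF assms(1)] by (auto simp: nt_def Hom_iff)

text \<open>The transformation with value \<open>h\<close> at \<open>j\<close> and zero at the other
  representatives. It need not come from a morphism of \<open>C\<close>.\<close>

definition supp :: "'o \<Rightarrow> 'o \<Rightarrow> 'p \<Rightarrow> 'n \<Rightarrow> 'p \<Rightarrow> 'n" where
  "supp X Y j h = B.nat_ext (A X) (A Y) (\<lambda>i. if i = j then h else Zero B (AO X i) (AO Y i))"

context
  fixes X Y j h assumes X: "X \<in> Ob C" and Y: "Y \<in> Ob C" and j: "j \<in> I" and h: "h \<in> Hom B (AO X j) (AO Y j)"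
begin

private lemma hH: "i \<in> I \<Longrightarrow> (if i = j then h else Zero B (AO X i) (AO Y i)) \<in> Hom B (AO X i) (AO Y i)"
  using h X Y by (auto simp: Hom_iff)

lemma supp_nt: "nt X Y (supp X Y j h)"
  unfolding nt_iff supp_def by (rule B.nat_ext_nat_family[OF A_functor[OF X] A_functor[OF Y] hH])

lemma supp_simple: "i \<in> I \<Longrightarrow> supp X Y j h i = (if i = j then h else Zero B (AO X i) (AO Y i))"
  unfolding supp_def by (rule B.nat_ext_simple[OF A_functor[OF X] A_functor[OF Y] hH])

end

definition tau :: "'o \<Rightarrow> 'p \<Rightarrow> 'p \<Rightarrow> 'n \<Rightarrow> 'k" where
  "tau X i j h = B.scal i (tr X (supp X X j h) i)"

lemma tr_cong: "\<eta> (AO (Dual C X) b) = \<eta>' (AO (Dual C X) b) \<Longrightarrow> tr X \<eta> b = tr X \<eta>' b"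
  by (simp add: tr_def)

text \<open>\<open>u\<close> and \<open>v\<close> exhibit \<open>i\<close> as a retract of
  \<open>X\<close> applied to \<open>j\<close>; \<open>u \<bullet> v\<close> is the idempotent onto
  this copy of \<open>i\<close>.\<close>

definition wit :: "'o \<Rightarrow> 'p \<Rightarrow> 'p \<Rightarrow> 'n \<Rightarrow> 'n \<Rightarrow> bool" where
  "wit X i j u v \<longleftrightarrow> X \<in> Ob C \<and> i \<in> I \<and> j \<in> I \<and> u \<in> Hom B i (AO X j) \<and> v \<in> Hom B (AO X j) i \<and> v \<bullet> u = Id B i"

lemma witD: assumes "wit X i j u v"
  shows "X \<in> Ob C" "i \<in> I" "j \<in> I" "u \<in> Ar B" "Dom B u = i" "Cod B u = AO X j" "v \<in> Ar B" "Dom B v = AO X j" "Cod B v = i"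
    "v \<bullet> u = Id B i"
  using assms by (auto simp: wit_def Hom_iff)

text \<open>Pivotality enters here: by cyclicity of the trace, \<open>tau\<close> does not depend on the witness.\<close>

lemma tau_unique: assumes w: "wit X i j u v" and w': "wit Y i j u' v'"
  shows "tau X i j (u \<bullet> v) = tau Y i j (u' \<bullet> v')"
proof -
  note d [simp] = witD(1-9)[OF w] witD(1-9)[OF w']
  have h: "u \<bullet> v \<in> Hom B (AO X j) (AO X j)" "u' \<bullet> v \<in> Hom B (AO X j) (AO Y j)"
    "u \<bullet> v' \<in> Hom B (AO Y j) (AO X j)" "u' \<bullet> v' \<in> Hom B (AO Y j) (AO Y j)"
    by (simp_all add: Hom_iff)
  note X = d(1) and Y = d(10) and j = d(3)
  note s = supp_nt[OF X X j h(1)] supp_nt[OF X Y j h(2)] supp_nt[OF Y X j h(3)] supp_nt[OF Y Y j h(4)]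
  note ss = supp_simple[OF X X j h(1)] supp_simple[OF X Y j h(2)] supp_simple[OF Y X j h(3)] supp_simple[OF Y Y j h(4)]
  \<comment> \<open>The two idempotents are linked through the common object \<open>i\<close>:
    concentrated at \<open>j\<close>, the mixed products compose to \<open>u \<bullet> v\<close> in
    one order and to \<open>u' \<bullet> v'\<close> in the other, so cyclicity equates the
    traces.\<close>
  let ?\<alpha> = "supp X Y j (u' \<bullet> v)" and ?\<gamma> = "supp Y X j (u \<bullet> v')"
  have 1: "?\<gamma> b \<bullet> ?\<alpha> b = supp X X j (u \<bullet> v) b" if b: "b \<in> Ob B" for b
  proof (rule nt_eqI[OF X X nt_Cmp[OF s(2,3) X Y X] s(1) _ b])
    fix i' assume i': "i' \<in> I"
    have "(u \<bullet> v') \<bullet> (u' \<bullet> v) = u \<bullet> (v' \<bullet> u') \<bullet> v" by simp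
    also have "\<dots> = u \<bullet> v" unfolding witD(10)[OF w'] by simp
    finally have e: "(u \<bullet> v') \<bullet> (u' \<bullet> v) = u \<bullet> v" .
    show "?\<gamma> i' \<bullet> ?\<alpha> i' = supp X X j (u \<bullet> v) i'"
      unfolding ss[OF i'] using e i' by (cases "i' = j") simp_all
  qed
  have 2: "?\<alpha> b \<bullet> ?\<gamma> b = supp Y Y j (u' \<bullet> v') b" if b: "b \<in> Ob B" for b
  proof (rule nt_eqI[OF Y Y nt_Cmp[OF s(3,2) Y X Y] s(4) _ b])
    fix i' assume i': "i' \<in> I"
    have "(u' \<bullet> v) \<bullet> (u \<bullet> v') = u' \<bullet> (v \<bullet> u) \<bullet> v'" by simp
    also have "\<dots> = u' \<bullet> v'" unfolding witD(10)[OF w] by simp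
    finally have e: "(u' \<bullet> v) \<bullet> (u \<bullet> v') = u' \<bullet> v'" .
    show "?\<alpha> i' \<bullet> ?\<gamma> i' = supp Y Y j (u' \<bullet> v') i'"
      unfolding ss[OF i'] using e i' by (cases "i' = j") simp_all
  qed
  have "tr X (\<lambda>b. ?\<gamma> b \<bullet> ?\<alpha> b) i = tr Y (\<lambda>b. ?\<alpha> b \<bullet> ?\<gamma> b) i"
    by (rule tr_swap[OF X Y s(2,3)]) simp
  moreover have "tr X (\<lambda>b. ?\<gamma> b \<bullet> ?\<alpha> b) i = tr X (supp X X j (u \<bullet> v)) i" by (rule tr_cong) (simp add: 1)
  moreover have "tr Y (\<lambda>b. ?\<alpha> b \<bullet> ?\<gamma> b) i = tr Y (supp Y Y j (u' \<bullet> v')) i" by (rule tr_cong) (simp add: 2)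
  ultimately show ?thesis by (simp add: tau_def)
qed

definition rel :: "'p \<Rightarrow> 'p \<Rightarrow> bool" where "rel i j \<longleftrightarrow> (\<exists>X u v. wit X i j u v)"

text \<open>The choice is immaterial when a witness exists, by \<open>tau_unique\<close>. Otherwise
  the value is arbitrary, and it is only ever multiplied by a multiplicity that vanishes.\<close>

definition lam :: "'p \<Rightarrow> 'p \<Rightarrow> 'k" where
  "lam i j = (SOME t. \<exists>X u v. wit X i j u v \<and> t = tau X i j (u \<bullet> v))"

lemma tau_wit: assumes "wit X i j u v" shows "tau X i j (u \<bullet> v) = lam i j"
proof -
  have "\<exists>X u v. wit X i j u v \<and> lam i j = tau X i j (u \<bullet> v)"
    unfolding lam_def by (rule someI_ex) (use assms in blast)
  then show ?thesis using tau_unique[OF assms] by auto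
qed

text \<open>A copy of \<open>i\<close> in \<open>X j\<close> and a copy of \<open>j\<close> in
  \<open>Y k\<close> compose to a copy of \<open>i\<close> in the product applied to
  \<open>k\<close>, whose idempotent is the tensor product of the two. Its trace is nested, and the
  inner loop contributes the scalar \<open>lam j k\<close>.\<close>

lemma lam_Cmp: assumes w: "wit X i j u v" and w': "wit Y j k u' v'"
  shows "rel i k" "lam i k = lam i j * lam j k"
proof -
  note d [simp] = witD(1-9)[OF w] witD(1-9)[OF w']
  note X = d(1) and Y = d(10) and i = d(2) and j = d(3) and k = d(12)
  let ?XY = "Tob C X Y"
  define u'' where "u'' = mu X Y k \<bullet> F X u' \<bullet> u"
  define v'' where "v'' = v \<bullet> F X v' \<bullet> inv_ar B (mu X Y k)"
  have XY: "?XY \<in> Ob C" by simp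
  have uv'' [simp]: "u'' \<in> Ar B" "Dom B u'' = i" "Cod B u'' = AO ?XY k" "v'' \<in> Ar B" "Dom B v'' = AO ?XY k" "Cod B v'' = i"
    by (simp_all add: u''_def v''_def)
  have "F X (v' \<bullet> u') = Id B (AO X j)" unfolding witD(10)[OF w'] by simp
  then have FF: "F X v' \<bullet> F X u' = Id B (AO X j)" by simp
  have "v'' \<bullet> u'' = v \<bullet> (F X v' \<bullet> F X u') \<bullet> u" by (simp add: u''_def v''_def)
  also have "\<dots> = Id B i" unfolding FF using witD(10)[OF w] by simp
  finally have w'': "wit ?XY i k u'' v''" by (simp add: wit_def Hom_iff)
  then show "rel i k" by (auto simp: rel_def)
  have h: "u \<bullet> v \<in> Hom B (AO X j) (AO X j)" "u' \<bullet> v' \<in> Hom B (AO Y k) (AO Y k)" "u'' \<bullet> v'' \<in> Hom B (AO ?XY k) (AO ?XY k)"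
    by (simp_all add: Hom_iff)
  let ?\<alpha> = "supp X X j (u \<bullet> v)" and ?\<beta> = "supp Y Y k (u' \<bullet> v')"
  note s = supp_nt[OF X X j h(1)] supp_nt[OF Y Y k h(2)] supp_nt[OF XY XY k h(3)]
  note ss = supp_simple[OF X X j h(1)] supp_simple[OF Y Y k h(2)] supp_simple[OF XY XY k h(3)]
  note [simp] = nt_simps[OF s(1)] nt_simps[OF s(2)]
  define \<zeta> where "\<zeta> = (\<lambda>b. mu X Y b \<bullet> ?\<alpha> (AO Y b) \<bullet> F X (?\<beta> b) \<bullet> inv_ar B (mu X Y b))"
  have \<zeta>: "nt ?XY ?XY \<zeta>" unfolding \<zeta>_def by (rule tr_tensor(1)[OF X Y _ s(1,2)]) (rule B.I_Ob[OF i])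
  have 1: "\<zeta> b = supp ?XY ?XY k (u'' \<bullet> v'') b" if b: "b \<in> Ob B" for b
  proof (rule nt_eqI[OF XY XY \<zeta> s(3) _ b])
    fix l assume l: "l \<in> I"
    show "\<zeta> l = supp ?XY ?XY k (u'' \<bullet> v'') l"
    proof (cases "l = k")
      case True
      have "?\<alpha> (AO Y k) \<bullet> F X u' = F X u' \<bullet> ?\<alpha> j" by (rule nt_nat[OF s(1)]) simp_all
      then have n: "?\<alpha> (AO Y k) \<bullet> F X u' = F X u' \<bullet> u \<bullet> v" using ss(1)[OF j] by simp
      have "\<zeta> k = mu X Y k \<bullet> (?\<alpha> (AO Y k) \<bullet> F X u') \<bullet> F X v' \<bullet> inv_ar B (mu X Y k)"
        unfolding \<zeta>_def ss(2)[OF k] by simp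
      also have "\<dots> = u'' \<bullet> v''" unfolding n by (simp add: u''_def v''_def)
      finally show ?thesis using True ss(3)[OF l] by simp
    next
      case False
      then have "?\<beta> l = Zero B (AO Y l) (AO Y l)" using ss(2)[OF l] by simp
      then have "\<zeta> l = Zero B (AO ?XY l) (AO ?XY l)" using l by (simp add: \<zeta>_def)
      then show ?thesis using False ss(3)[OF l] by simp
    qed
  qed
  have \<beta>': "tr Y ?\<beta> b \<in> Hom B b b" if "b \<in> Ob B" for b
    using tr_simps[OF s(2) Y that] by (simp add: Hom_iff)
  have F\<beta>: "nt X X (\<lambda>b. F X (tr Y ?\<beta> b))"
    by (rule nt_F[OF X \<beta>']) (use tr_nat[OF s(2) Y] in simp_all)
  \<comment> \<open>The inner trace may act by different scalars on different simple objects, but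
    \<open>?\<alpha>\<close> is concentrated at \<open>j\<close> and sees only the scalar
    there.\<close>
  have 2: "?\<alpha> b \<bullet> F X (tr Y ?\<beta> b) = Scale B (lam j k) (?\<alpha> b)" if b: "b \<in> Ob B" for b
  proof (rule nt_eqI[OF X X nt_Cmp[OF F\<beta> s(1) X X X] nt_Scale[OF s(1) X X] _ b])
    fix l assume l: "l \<in> I"
    show "?\<alpha> l \<bullet> F X (tr Y ?\<beta> l) = Scale B (lam j k) (?\<alpha> l)"
    proof (cases "l = j")
      case True
      have "tr Y ?\<beta> j = Scale B (lam j k) (Id B j)"
        using B.Scale_scal[OF j \<beta>'[OF B.I_Ob[OF j]]] tau_wit[OF w'] by (simp add: tau_def)
      then show ?thesis unfolding True by simp
    next
      case False
      then have z: "?\<alpha> l = Zero B (AO X l) (AO X l)" using ss(1)[OF l] by simp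
      show ?thesis unfolding z using l tr_simps[OF s(2) Y, of l] by simp
    qed
  qed
  have G: "AO (Dual C X) i \<in> Ob B" by simp
  have "lam i k = B.scal i (tr ?XY \<zeta> i)"
    using tau_wit[OF w''] tr_cong[of \<zeta> ?XY i] 1 by (simp add: tau_def)
  also have "tr ?XY \<zeta> i = ev X i \<bullet> (?\<alpha> (AO (Dual C X) i) \<bullet> F X (tr Y ?\<beta> (AO (Dual C X) i))) \<bullet> cr X i"
    unfolding \<zeta>_def using tr_tensor(2)[OF X Y B.I_Ob[OF i] s(1,2)] tr_simps[OF s(2) Y] by simp
  also have "\<dots> = Scale B (lam j k) (tr X ?\<alpha> i)"
    unfolding 2[OF G] by (simp add: tr_def)
  also have "B.scal i \<dots> = lam j k * lam i j"
    using tau_wit[OF w] tr_simps[OF s(1) X, of i] by (simp add: tau_def B.scal_Sc Hom_iff)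
  finally show "lam i k = lam i j * lam j k" by (simp add: mult.commute)
qed

text \<open>The inclusion \<open>u\<close> of \<open>i\<close> into \<open>X j\<close> corresponds
  by adjunction to a morphism \<open>f\<close> from the dual of \<open>X\<close> applied to
  \<open>i\<close> into \<open>j\<close>. It is nonzero since \<open>u\<close> can be recovered from
  it, so some simple summand of its domain maps isomorphically onto \<open>j\<close>.\<close>

lemma rel_sym: assumes "rel i j" shows "rel j i"
proof -
  obtain X u v where w: "wit X i j u v" using assms by (auto simp: rel_def)
  note d [simp] = witD(1-9)[OF w]
  let ?X = "Dual C X"
  define f where "f = an X j \<bullet> F ?X u"
  have f [simp]: "f \<in> Ar B" "Dom B f = AO ?X i" "Cod B f = j" by (simp_all add: f_def)
  have n: "cr X (AO X j) \<bullet> u = F X (F ?X u) \<bullet> cr X i" by (rule cr_nat) simp_all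
  have "F X f \<bullet> cr X i = F X (an X j) \<bullet> (F X (F ?X u) \<bullet> cr X i)" by (simp add: f_def)
  also have "\<dots> = (F X (an X j) \<bullet> cr X (AO X j)) \<bullet> u" unfolding n[symmetric] by simp
  also have "\<dots> = u" by (simp add: zig)
  finally have fu: "F X f \<bullet> cr X i = u" .
  have "f \<noteq> Zero B (AO ?X i) j"
  proof
    assume "f = Zero B (AO ?X i) j"
    then have "u = Zero B i (AO X j)" using fu by simp
    then have "v \<bullet> u = Zero B i i" by simp
    then show False using witD(10)[OF w] B.Id_I_nonzero[OF d(2)] by simp
  qed
  have G: "AO ?X i \<in> Ob B" by simp
  have "\<exists>r<B.dn (AO ?X i). f \<bullet> B.di (AO ?X i) r \<noteq> Zero B (B.dS (AO ?X i) r) j"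
  proof (rule ccontr)
    assume *: "\<not> ?thesis"
    have "f = Zero B (AO ?X i) j"
      by (rule B.direct_sum_eq_right[OF B.dec_direct_sum[OF G]]) (use * in \<open>auto simp: Hom_iff\<close>)
    then show False using \<open>f \<noteq> _\<close> by simp
  qed
  then obtain r where r: "r < B.dn (AO ?X i)" "f \<bullet> B.di (AO ?X i) r \<noteq> Zero B (B.dS (AO ?X i) r) j" by auto
  have g: "f \<bullet> B.di (AO ?X i) r \<in> Hom B (B.dS (AO ?X i) r) j" using r by (simp add: Hom_iff)
  have iso: "iso_ar B (f \<bullet> B.di (AO ?X i) r)"
    by (rule B.schur_iso[OF B.simple_I B.simple_I g r(2)]) (use r in simp_all)
  have "f \<bullet> B.di (AO ?X i) r \<bullet> inv_ar B (f \<bullet> B.di (AO ?X i) r) = (f \<bullet> B.di (AO ?X i) r) \<bullet> inv_ar B (f \<bullet> B.di (AO ?X i) r)"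
    using r iso by (intro B.Cmp_assoc_simp[symmetric]) simp_all
  also have "\<dots> = Id B j" unfolding B.iso_simps(6)[OF iso] using r by simp
  finally have e: "f \<bullet> B.di (AO ?X i) r \<bullet> inv_ar B (f \<bullet> B.di (AO ?X i) r) = Id B j" .
  have "wit ?X j i (B.di (AO ?X i) r \<bullet> inv_ar B (f \<bullet> B.di (AO ?X i) r)) f"
    unfolding wit_def using r iso e by (simp add: Hom_iff)
  then show ?thesis by (auto simp: rel_def)
qed

lemma mult_rel: assumes "B.mult i (AO X j) \<noteq> 0" "X \<in> Ob C" "i \<in> I" "j \<in> I" shows "rel i j"
proof -
  have G: "AO X j \<in> Ob B" using assms by simp
  have "\<exists>r<B.dn (AO X j). B.dS (AO X j) r = i"
  proof (rule ccontr)
    assume "\<not> ?thesis"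
    then have "B.mult i (AO X j) = 0" unfolding B.mult_count[OF G assms(3)] by (intro sum.neutral) auto
    then show False using assms(1) by simp
  qed
  then obtain r where r: "r < B.dn (AO X j)" "B.dS (AO X j) r = i" by blast
  then have "wit X i j (B.di (AO X j) r) (B.dp (AO X j) r)"
    unfolding wit_def using assms B.dec_simps[OF G r(1)] B.dec_orth[OF G r(1) r(1)] by (simp add: Hom_iff)
  then show ?thesis by (auto simp: rel_def)
qed

text \<open>What the \<open>r\<close>-th summand of the dual of \<open>X\<close> applied to
  \<open>i\<close> contributes to the trace at \<open>i\<close> when \<open>x\<close> acts on
  it.\<close>

definition comp :: "'o \<Rightarrow> 'p \<Rightarrow> nat \<Rightarrow> 'n \<Rightarrow> 'k" where
  "comp X i r x = B.scal i (ev X i \<bullet> F X (B.di (AO (Dual C X) i) r) \<bullet> x \<bullet> F X (B.dp (AO (Dual C X) i) r) \<bullet> cr X i)"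

context
  fixes X i assumes X: "X \<in> Ob C" and i: "i \<in> I"
begin

private abbreviation "G \<equiv> AO (Dual C X) i"

private lemma G [simp]: "G \<in> Ob B" using X i by simp

lemma comp_Add: assumes r: "r < B.dn G" and "x \<in> Hom B (AO X (B.dS G r)) (AO X (B.dS G r))" "y \<in> Hom B (AO X (B.dS G r)) (AO X (B.dS G r))"
  shows "comp X i r (Add B x y) = comp X i r x + comp X i r y"
proof -
  have [simp]: "x \<in> Ar B" "Dom B x = AO X (B.dS G r)" "Cod B x = AO X (B.dS G r)" "y \<in> Ar B" "Dom B y = AO X (B.dS G r)" "Cod B y = AO X (B.dS G r)"
    using assms by (auto simp: Hom_iff)
  note [simp] = X i r
  show ?thesis unfolding comp_def by (simp add: B.scal_Add Hom_iff)
qed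

lemma comp_Scale: assumes r: "r < B.dn G" and "x \<in> Hom B (AO X (B.dS G r)) (AO X (B.dS G r))"
  shows "comp X i r (Scale B k x) = k * comp X i r x"
proof -
  have [simp]: "x \<in> Ar B" "Dom B x = AO X (B.dS G r)" "Cod B x = AO X (B.dS G r)"
    using assms by (auto simp: Hom_iff)
  note [simp] = X i r
  show ?thesis unfolding comp_def by (simp add: B.scal_Sc Hom_iff)
qed

lemma comp_Zero: assumes r: "r < B.dn G"
  shows "comp X i r (Zero B (AO X (B.dS G r)) (AO X (B.dS G r))) = 0"
  unfolding comp_def using X i r by simp

lemma scal_tr: assumes \<eta>: "nt X X \<eta>"
  shows "B.scal i (tr X \<eta> i) = (\<Sum>r<B.dn G. comp X i r (\<eta> (B.dS G r)))"
proof -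
  note [simp] = X i nt_simps[OF \<eta>]
  let ?L = "\<lambda>x. B.scal i (ev X i \<bullet> x \<bullet> cr X i)"
  have "\<eta> G = B.nat_ext (A X) (A X) \<eta> G"
    by (rule B.nat_family_expand[OF A_functor[OF X] A_functor[OF X] _ G]) (use \<eta> nt_iff in blast)
  then have "B.scal i (tr X \<eta> i) = ?L (hsum B (AO X G) (AO X G) (\<lambda>r. F X (B.di G r) \<bullet> \<eta> (B.dS G r) \<bullet> F X (B.dp G r)) (B.dn G))"
    unfolding tr_def B.nat_ext_def by simp
  also have "\<dots> = (\<Sum>r<B.dn G. ?L (F X (B.di G r) \<bullet> \<eta> (B.dS G r) \<bullet> F X (B.dp G r)))"
  proof (rule B.hsum_additive)
    fix x y assume "x \<in> Hom B (AO X G) (AO X G)" "y \<in> Hom B (AO X G) (AO X G)"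
    then have [simp]: "x \<in> Ar B" "Dom B x = AO X G" "Cod B x = AO X G" "y \<in> Ar B" "Dom B y = AO X G" "Cod B y = AO X G"
      by (auto simp: Hom_iff)
    show "?L (Add B x y) = ?L x + ?L y" by (simp add: B.scal_Add Hom_iff)
  qed (auto simp: Hom_iff)
  also have "\<dots> = (\<Sum>r<B.dn G. comp X i r (\<eta> (B.dS G r)))"
    unfolding comp_def by (intro sum.cong) auto
  finally show ?thesis .
qed

text \<open>The identity is the sum of the idempotents onto the summands. An idempotent onto a
  summand other than \<open>i\<close> meets a morphism out of \<open>i\<close>, and contributes zero
  by Schur's lemma.\<close>

lemma comp_split: assumes r: "r < B.dn G"
  shows "comp X i r (Id B (AO X (B.dS G r))) =
    (\<Sum>s<B.dn (AO X (B.dS G r)). if B.dS (AO X (B.dS G r)) s = i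
       then comp X i r (B.di (AO X (B.dS G r)) s \<bullet> B.dp (AO X (B.dS G r)) s) else 0)"
proof -
  note [simp] = X i r
  let ?K = "AO X (B.dS G r)"
  have K [simp]: "?K \<in> Ob B" by simp
  have "comp X i r (Id B ?K) = comp X i r (hsum B ?K ?K (\<lambda>s. B.di ?K s \<bullet> B.dp ?K s) (B.dn ?K))"
    using B.direct_sumD(11)[OF B.dec_direct_sum[OF K]] by simp
  also have "\<dots> = (\<Sum>s<B.dn ?K. comp X i r (B.di ?K s \<bullet> B.dp ?K s))"
    by (rule B.hsum_additive) (use comp_Add[OF r] in \<open>auto simp: Hom_iff\<close>)
  also have "\<dots> = (\<Sum>s<B.dn ?K. if B.dS ?K s = i then comp X i r (B.di ?K s \<bullet> B.dp ?K s) else 0)"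
  proof (rule sum.cong[OF refl])
    fix s assume "s \<in> {..<B.dn ?K}"
    then have s [simp]: "s < B.dn ?K" by simp
    have "comp X i r (B.di ?K s \<bullet> B.dp ?K s) = 0" if ne: "B.dS ?K s \<noteq> i"
    proof -
      have z: "B.dp ?K s \<bullet> F X (B.dp G r) \<bullet> cr X i = Zero B i (B.dS ?K s)"
        by (rule B.orth) (use ne in \<open>auto simp: Hom_iff\<close>)
      have "(B.di ?K s \<bullet> B.dp ?K s) \<bullet> F X (B.dp G r) \<bullet> cr X i = B.di ?K s \<bullet> (B.dp ?K s \<bullet> F X (B.dp G r) \<bullet> cr X i)" by simp
      also have "\<dots> = Zero B i ?K" unfolding z by simp
      finally have z': "(B.di ?K s \<bullet> B.dp ?K s) \<bullet> F X (B.dp G r) \<bullet> cr X i = Zero B i ?K" .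
      show ?thesis unfolding comp_def z' by simp
    qed
    then show "comp X i r (B.di ?K s \<bullet> B.dp ?K s) = (if B.dS ?K s = i then comp X i r (B.di ?K s \<bullet> B.dp ?K s) else 0)" by simp
  qed
  finally show ?thesis .
qed

text \<open>For a fixed copy of \<open>i\<close> in \<open>X j\<close>, the terms add up to the full
  trace of the transformation concentrated at \<open>j\<close> whose value there is the idempotent
  onto that copy.\<close>

lemma comp_tau: assumes j: "j \<in> I" and s: "s < B.dn (AO X j)" and si: "B.dS (AO X j) s = i"
  shows "(\<Sum>r<B.dn G. if B.dS G r = j then comp X i r (B.di (AO X j) s \<bullet> B.dp (AO X j) s) else 0) = lam i j"
proof -
  note [simp] = X i j s
  have K [simp]: "AO X j \<in> Ob B" by simp
  let ?h = "B.di (AO X j) s \<bullet> B.dp (AO X j) s"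
  have h: "?h \<in> Hom B (AO X j) (AO X j)" by (simp add: Hom_iff)
  have w: "wit X i j (B.di (AO X j) s) (B.dp (AO X j) s)"
    unfolding wit_def using B.dec_simps[OF K s] B.dec_orth[OF K s s] si by (simp add: Hom_iff)
  have "lam i j = B.scal i (tr X (supp X X j ?h) i)" using tau_wit[OF w] by (simp add: tau_def)
  also have "\<dots> = (\<Sum>r<B.dn G. comp X i r (supp X X j ?h (B.dS G r)))" by (rule scal_tr[OF supp_nt[OF X X j h]])
  also have "\<dots> = (\<Sum>r<B.dn G. if B.dS G r = j then comp X i r ?h else 0)"
    by (intro sum.cong) (auto simp: supp_simple[OF X X j h] comp_Zero)
  finally show ?thesis by simp
qed

text \<open>The trace is a double sum, over copies of \<open>j\<close> in the dual of
  \<open>X\<close> applied to \<open>i\<close> and over copies of \<open>i\<close> in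
  \<open>X j\<close>. Summing over the former first, each of the latter yields
  \<open>lam i j\<close>, so their number, the multiplicity, becomes a factor.\<close>

lemma scal_encircle:
  assumes \<alpha>: "\<And>b. b \<in> Ob B \<Longrightarrow> \<alpha> b \<in> Hom B b b" "\<And>g. g \<in> Ar B \<Longrightarrow> \<alpha> (Cod B g) \<bullet> g = g \<bullet> \<alpha> (Dom B g)"
  shows "B.scal i (tr X (\<lambda>b. F X (\<alpha> b)) i) = (\<Sum>j\<in>I. B.scal j (\<alpha> j) * (lam i j * B.mult i (AO X j)))"
proof -
  note [simp] = X i
  let ?a = "\<lambda>j. B.scal j (\<alpha> j)"
  let ?c = "\<lambda>r j s. comp X i r (B.di (AO X j) s \<bullet> B.dp (AO X j) s)"
  have "B.scal i (tr X (\<lambda>b. F X (\<alpha> b)) i) = (\<Sum>r<B.dn G. comp X i r (F X (\<alpha> (B.dS G r))))"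
    by (rule scal_tr[OF nt_F[OF X \<alpha>]])
  \<comment> \<open>The representative that occurs as the \<open>r\<close>-th summand is turned into
    a summation index \<open>j\<close>, so that the sums can be interchanged.\<close>
  also have "\<dots> = (\<Sum>r<B.dn G. \<Sum>j\<in>I. if B.dS G r = j then ?a j * (\<Sum>s<B.dn (AO X j). if B.dS (AO X j) s = i then ?c r j s else 0) else 0)"
  proof (rule sum.cong[OF refl])
    fix r assume "r \<in> {..<B.dn G}"
    then have r [simp]: "r < B.dn G" by simp
    let ?k = "B.dS G r"
    have k: "?k \<in> I" by simp
    have "F X (\<alpha> ?k) = F X (Scale B (?a ?k) (Id B ?k))"
      using B.Scale_scal[OF k \<alpha>(1)[OF B.I_Ob[OF k]]] by simp
    also have "\<dots> = Scale B (?a ?k) (Id B (AO X ?k))" by simp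
    finally have "comp X i r (F X (\<alpha> ?k)) = ?a ?k * comp X i r (Id B (AO X ?k))"
      using comp_Scale[OF r, of "Id B (AO X ?k)"] by (simp add: Hom_iff)
    also have "\<dots> = ?a ?k * (\<Sum>s<B.dn (AO X ?k). if B.dS (AO X ?k) s = i then ?c r ?k s else 0)"
      unfolding comp_split[OF r] ..
    also have "\<dots> = (\<Sum>j\<in>I. if ?k = j then ?a j * (\<Sum>s<B.dn (AO X j). if B.dS (AO X j) s = i then ?c r j s else 0) else 0)"
      using k B.finite_I by simp
    finally show "comp X i r (F X (\<alpha> ?k)) = (\<Sum>j\<in>I. if ?k = j then ?a j * (\<Sum>s<B.dn (AO X j). if B.dS (AO X j) s = i then ?c r j s else 0) else 0)" .
  qed
  also have "\<dots> = (\<Sum>j\<in>I. \<Sum>r<B.dn G. if B.dS G r = j then ?a j * (\<Sum>s<B.dn (AO X j). if B.dS (AO X j) s = i then ?c r j s else 0) else 0)"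
    by (rule sum.swap)
  also have "\<dots> = (\<Sum>j\<in>I. ?a j * (lam i j * B.mult i (AO X j)))"
  proof (rule sum.cong[OF refl])
    fix j assume j [simp]: "j \<in> I"
    have "(\<Sum>r<B.dn G. if B.dS G r = j then ?a j * (\<Sum>s<B.dn (AO X j). if B.dS (AO X j) s = i then ?c r j s else 0) else 0)
      = (\<Sum>r<B.dn G. \<Sum>s<B.dn (AO X j). ?a j * (if B.dS (AO X j) s = i then (if B.dS G r = j then ?c r j s else 0) else 0))"
      by (intro sum.cong) (auto simp: sum_distrib_left intro!: sum.cong cong: if_cong)
    also have "\<dots> = (\<Sum>s<B.dn (AO X j). \<Sum>r<B.dn G. ?a j * (if B.dS (AO X j) s = i then (if B.dS G r = j then ?c r j s else 0) else 0))"
      by (rule sum.swap)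
    also have "\<dots> = (\<Sum>s<B.dn (AO X j). ?a j * (if B.dS (AO X j) s = i then lam i j else 0))"
    proof (rule sum.cong[OF refl])
      fix s assume "s \<in> {..<B.dn (AO X j)}"
      then have s: "s < B.dn (AO X j)" by simp
      show "(\<Sum>r<B.dn G. ?a j * (if B.dS (AO X j) s = i then (if B.dS G r = j then ?c r j s else 0) else 0)) = ?a j * (if B.dS (AO X j) s = i then lam i j else 0)"
        using comp_tau[OF j s] by (simp add: sum_distrib_left[symmetric])
    qed
    also have "\<dots> = ?a j * (lam i j * B.mult i (AO X j))"
      by (simp add: B.mult_count sum_distrib_left if_distrib cong: if_cong)
    finally show "(\<Sum>r<B.dn G. if B.dS G r = j then ?a j * (\<Sum>s<B.dn (AO X j). if B.dS (AO X j) s = i then ?c r j s else 0) else 0)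
      = ?a j * (lam i j * B.mult i (AO X j))" .
  qed
  finally show ?thesis .
qed

end

text \<open>The unit object acts as the identity functor up to isomorphism, so in
  \<open>scal_encircle\<close> for the unit and the identity transformation only the term
  \<open>lam i i\<close> survives; the left-hand side is 1 by \<open>ev_unit\<close>.\<close>

lemma lam_refl: assumes i: "i \<in> I" shows "rel i i" "lam i i = 1"
proof -
  let ?U = "Unit C"
  note [simp] = i
  have w: "wit ?U i i (ep i) (inv_ar B (ep i))" by (simp add: wit_def Hom_iff)
  then show "rel i i" by (auto simp: rel_def)
  have mult: "B.mult i (AO ?U j) = (if i = j then 1 else 0)" if j: "j \<in> I" for j
  proof -
    have "iso_obs B j (AO ?U j)" by (rule B.iso_obsI[of "ep j"]) (use j in \<open>simp_all add: Hom_iff\<close>)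
    then have "B.mult i j = B.mult i (AO ?U j)" by (rule B.mult_iso) simp
    then show ?thesis using B.mult_simple[OF i j] by simp
  qed
  have "tr ?U (\<lambda>b. F ?U (Id B b)) i = Id B i" by (simp add: tr_def ev_unit)
  then have "1 = B.scal i (tr ?U (\<lambda>b. F ?U (Id B b)) i)" by simp
  also have "\<dots> = (\<Sum>j\<in>I. B.scal j (Id B j) * (lam i j * B.mult i (AO ?U j)))"
    by (rule scal_encircle) (simp_all add: Hom_iff)
  also have "\<dots> = (\<Sum>j\<in>I. if i = j then lam i j else 0)"
    by (intro sum.cong) (auto simp: mult)
  also have "\<dots> = lam i i" using B.finite_I by simp
  finally show "lam i i = 1" by simp
qed

text \<open>The multiplicative cocycle \<open>lam\<close> is a coboundary: \<open>lam i j = d j / d i\<close>, with \<open>d\<close> normalised by a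
  representative of each class of \<open>rel\<close>.\<close>

lemma module_trace:
  "\<exists>d. (\<forall>i\<in>I. d i \<noteq> 0) \<and> (\<forall>X\<in>Ob C. \<forall>i\<in>I. \<forall>\<alpha>. (\<forall>b\<in>Ob B. \<alpha> b \<in> Hom B b b) \<longrightarrow>
     (\<forall>g\<in>Ar B. \<alpha> (Cod B g) \<bullet> g = g \<bullet> \<alpha> (Dom B g)) \<longrightarrow>
     d i * B.scal i (tr X (\<lambda>b. F X (\<alpha> b)) i) = (\<Sum>j\<in>I. B.mult i (AO X j) * (d j * B.scal j (\<alpha> j))))"
proof -
  have relI: "i \<in> I" "j \<in> I" if "rel i j" for i j using that by (auto simp: rel_def wit_def)
  have trans: "rel i k" "lam i k = lam i j * lam j k" if "rel i j" "rel j k" for i j k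
    using that lam_Cmp unfolding rel_def by blast+
  define \<rho> where "\<rho> j = (SOME i. rel i j)" for j
  have \<rho>: "rel (\<rho> j) j" if "j \<in> I" for j unfolding \<rho>_def by (rule someI[of _ j]) (rule lam_refl(1)[OF that])
  have \<rho>_eq: "\<rho> i = \<rho> j" if "rel i j" for i j
  proof -
    have "rel k i \<longleftrightarrow> rel k j" for k using that rel_sym trans(1) by blast
    then show ?thesis by (simp add: \<rho>_def)
  qed
  define d where "d j = lam (\<rho> j) j" for j
  \<comment> \<open>Symmetry of \<open>rel\<close> gives \<open>lam (\<rho> i) i * lam i (\<rho> i)
    = lam (\<rho> i) (\<rho> i) = 1\<close>.\<close>
  have nz: "d i \<noteq> 0" if i: "i \<in> I" for i
  proof
    assume "d i = 0"
    then have "lam (\<rho> i) (\<rho> i) = 0" using trans(2)[OF \<rho>[OF i] rel_sym[OF \<rho>[OF i]]] by (simp add: d_def)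
    then show False using lam_refl(2)[OF relI(1)[OF \<rho>[OF i]]] by simp
  qed
  have dl: "d i * lam i j = d j" if "rel i j" for i j
    using trans(2)[OF \<rho>[OF relI(1)[OF that]] that] \<rho>_eq[OF that] by (simp add: d_def)
  have "d i * B.scal i (tr X (\<lambda>b. F X (\<alpha> b)) i) = (\<Sum>j\<in>I. B.mult i (AO X j) * (d j * B.scal j (\<alpha> j)))"
    if X: "X \<in> Ob C" and i: "i \<in> I" and \<alpha>: "\<forall>b\<in>Ob B. \<alpha> b \<in> Hom B b b" "\<forall>g\<in>Ar B. \<alpha> (Cod B g) \<bullet> g = g \<bullet> \<alpha> (Dom B g)" for X i \<alpha>
  proof -
    have "d i * B.scal i (tr X (\<lambda>b. F X (\<alpha> b)) i) = (\<Sum>j\<in>I. d i * (B.scal j (\<alpha> j) * (lam i j * B.mult i (AO X j))))"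
      using scal_encircle[OF X i, of \<alpha>] \<alpha> by (simp add: sum_distrib_left)
    also have "\<dots> = (\<Sum>j\<in>I. B.mult i (AO X j) * (d j * B.scal j (\<alpha> j)))"
    proof (rule sum.cong[OF refl])
      fix j assume j: "j \<in> I"
      show "d i * (B.scal j (\<alpha> j) * (lam i j * B.mult i (AO X j))) = B.mult i (AO X j) * (d j * B.scal j (\<alpha> j))"
      proof (cases "B.mult i (AO X j) = 0")
        case False
        then have "d i * lam i j = d j" using dl mult_rel[OF _ X i j] by blast
        then show ?thesis by (metis mult.assoc mult.commute)
      qed simp
    qed
    finally show ?thesis .
  qed
  then show ?thesis using nz by blast
qed

end

section \<open>Grothendieck groups of semisimple categories\<close>

lemma (in presentation) ksumq_cong:
  assumes "\<And>x. x \<in> S \<Longrightarrow> w x = w' x" "\<And>r. r \<in> R \<Longrightarrow> ksum w r = 0" "U \<in> carrier G"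
  shows "ksumq w U = ksumq w' U"
proof -
  have e: "ksum w a = ksum w' a" if "Poly_Mapping.keys a \<subseteq> S" for a
    unfolding ksum_def using assms(1) that by (intro sum.cong) auto
  obtain a where a: "Poly_Mapping.keys a \<subseteq> S" "U = cl a" using assms(3) by (rule G_cases)
  then have "ksumq w' U = ksum w' a"
    unfolding a(2) using assms(2) e rels_keys by (intro ksumq_cl) metis
  then show ?thesis using a e assms(2) by (simp add: ksumq_cl)
qed

lemma (in comm_group) tcoord_cong:
  assumes "\<And>g. g \<in> carrier G \<Longrightarrow> w g = w' g"
    "\<And>g h. g \<in> carrier G \<Longrightarrow> h \<in> carrier G \<Longrightarrow> w (g \<otimes> h) = w g + (w h :: 'k :: field)"
    "U \<in> carrier (tensor_field G)"
  shows "tcoord w U = tcoord w' U"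
proof -
  interpret T: presentation "tensor_gens G" "tensor_rels G :: ('a \<times> 'k \<Rightarrow>\<^sub>0 int) set" by (rule tensor_presentation)
  show ?thesis unfolding tcoord_def
    by (rule T.ksumq_cong) (use assms tensor_rels_ksum[OF assms(2)] in \<open>auto simp: tensor_gens_def tensor_field_def\<close>)
qed

text \<open>Carries a formula of matrix type from groups to their extensions of scalars: once for
  the product of the fusion algebra and once for its action.\<close>

lemma tcoord_quot_bilin:
  fixes G1 :: "'a monoid" and G2 :: "'b monoid" and G3 :: "'c monoid" and w :: "'c \<Rightarrow> 'k :: field"
  assumes G: "comm_group G1" "comm_group G2" "comm_group G3"
    and closed: "\<And>g h. g \<in> carrier G1 \<Longrightarrow> h \<in> carrier G2 \<Longrightarrow> \<beta> g h \<in> carrier G3"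
    and left: "\<And>g g' h. g \<in> carrier G1 \<Longrightarrow> g' \<in> carrier G1 \<Longrightarrow> h \<in> carrier G2 \<Longrightarrow> \<beta> (g \<otimes>\<^bsub>G1\<^esub> g') h = \<beta> g h \<otimes>\<^bsub>G3\<^esub> \<beta> g' h"
    and right: "\<And>g h h'. g \<in> carrier G1 \<Longrightarrow> h \<in> carrier G2 \<Longrightarrow> h' \<in> carrier G2 \<Longrightarrow> \<beta> g (h \<otimes>\<^bsub>G2\<^esub> h') = \<beta> g h \<otimes>\<^bsub>G3\<^esub> \<beta> g h'"
    and w: "\<And>g h. g \<in> carrier G3 \<Longrightarrow> h \<in> carrier G3 \<Longrightarrow> w (g \<otimes>\<^bsub>G3\<^esub> h) = w g + w h"
    and u: "\<And>j g h. j \<in> J \<Longrightarrow> g \<in> carrier G1 \<Longrightarrow> h \<in> carrier G1 \<Longrightarrow> u j (g \<otimes>\<^bsub>G1\<^esub> h) = u j g + u j h"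
    and v: "\<And>j g h. j \<in> J \<Longrightarrow> g \<in> carrier G2 \<Longrightarrow> h \<in> carrier G2 \<Longrightarrow> v j (g \<otimes>\<^bsub>G2\<^esub> h) = v j g + v j h"
    and wuv: "\<And>g h. g \<in> carrier G1 \<Longrightarrow> h \<in> carrier G2 \<Longrightarrow> w (\<beta> g h) = (\<Sum>j\<in>J. u j g * v j h)"
    and U: "U \<in> carrier (tensor_field G1)" and V: "V \<in> carrier (tensor_field G2)"
  shows "quot_bilin (tensor_gens G3) (tensor_rels G3) (\<lambda>(g, k) (h, l). (\<beta> g h, k * l :: 'k)) U V \<in> carrier (tensor_field G3)"
    "tcoord w (quot_bilin (tensor_gens G3) (tensor_rels G3) (\<lambda>(g, k) (h, l). (\<beta> g h, k * l)) U V) =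
      (\<Sum>j\<in>J. tcoord (u j) U * tcoord (v j) V)"
proof -
  interpret bilinear_presentation "tensor_gens G1" "tensor_rels G1" "tensor_gens G2" "tensor_rels G2"
    "tensor_gens G3" "tensor_rels G3 :: ('c \<times> 'k \<Rightarrow>\<^sub>0 int) set" "\<lambda>(g, k) (h, l). (\<beta> g h, k * l)"
    by (rule tensor_bilinear[OF G closed left right])
  show "quot_bilin (tensor_gens G3) (tensor_rels G3) (\<lambda>(g, k) (h, l). (\<beta> g h, k * l :: 'k)) U V \<in> carrier (tensor_field G3)"
    using U V unfolding tensor_field_def by (rule quot_bilin_closed)
  show "tcoord w (quot_bilin (tensor_gens G3) (tensor_rels G3) (\<lambda>(g, k) (h, l). (\<beta> g h, k * l)) U V) =
      (\<Sum>j\<in>J. tcoord (u j) U * tcoord (v j) V)"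
    unfolding tcoord_def
  proof (rule ksumq_quot_bilin)
    fix x :: "'a \<times> 'k" and y :: "'b \<times> 'k" assume "x \<in> tensor_gens G1" "y \<in> tensor_gens G2"
    then show "(case (case x of (g, k) \<Rightarrow> \<lambda>(h, l). (\<beta> g h, k * l)) y of (g, k) \<Rightarrow> k * w g) =
       (\<Sum>j\<in>J. (case x of (g, k) \<Rightarrow> k * u j g) * (case y of (g, k) \<Rightarrow> k * v j g))"
      by (auto simp: tensor_gens_def wuv sum_distrib_left intro!: sum.cong)
  next
    show "ksum (\<lambda>(g, k). k * w g) r = 0" if "r \<in> tensor_rels G3" for r
      using comm_group.tensor_rels_ksum[OF G(3), of w r] w that by blast
    show "ksum (\<lambda>(g, k). k * u j g) r = 0" if "r \<in> tensor_rels G1" "j \<in> J" for r j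
      using comm_group.tensor_rels_ksum[OF G(1), of "u j" r] u that by blast
    show "ksum (\<lambda>(g, k). k * v j g) r = 0" if "r \<in> tensor_rels G2" "j \<in> J" for r j
      using comm_group.tensor_rels_ksum[OF G(2), of "v j" r] v that by blast
  qed (use U V in \<open>simp_all add: tensor_field_def\<close>)
qed

section \<open>Classes of objects in the Grothendieck group\<close>

context lin_category
begin

lemma K0_relI: assumes "split_exact C f g s t"
  shows "frag_of (Cod C f) - frag_of (Dom C f) - frag_of (Cod C g) \<in> K0_rels C"
  unfolding K0_rels_def using split_exact_short_exact[OF assms] by blast

lemma K0_presentation: "presentation (Ob C) (K0_rels C)"
proof
  fix r assume "r \<in> K0_rels C"
  then obtain f g where r: "r = frag_of (Cod C f) - frag_of (Dom C f) - frag_of (Cod C g)" and s: "short_exact C f g"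
    by (auto simp: K0_rels_def)
  then have fg: "f \<in> Ar C" "g \<in> Ar C" by (auto simp: short_exact_def is_ker_def)
  have "Poly_Mapping.keys r \<subseteq> {Cod C f, Dom C f, Cod C g}"
    unfolding r using keys_diff[of "frag_of (Cod C f) - frag_of (Dom C f)" "frag_of (Cod C g)"]
      keys_diff[of "frag_of (Cod C f)" "frag_of (Dom C f)"] by simp blast
  with fg show "Poly_Mapping.keys r \<subseteq> Ob C" by auto
qed

lemma comm_group_K0: "comm_group (K0 C)"
  unfolding K0_def by (rule presentation.comm_group_G[OF K0_presentation])

lemma K0_class_closed: "X \<in> Ob C \<Longrightarrow> K0_class C X \<in> carrier (K0 C)"
  unfolding K0_def K0_class_def by (rule presentation.cl_in_G[OF K0_presentation]) simp

lemma K0_class_split: assumes "split_exact C f g s t"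
  shows "K0_class C (Cod C f) = K0_class C (Dom C f) \<otimes>\<^bsub>K0 C\<^esub> K0_class C (Cod C g)"
proof -
  interpret P: presentation "Ob C" "K0_rels C" by (rule K0_presentation)
  have fg: "f \<in> Ar C" "g \<in> Ar C" using assms by (auto simp: split_exact_def)
  have "frag_of (Cod C f) - (frag_of (Dom C f) + frag_of (Cod C g)) \<in> P.H"
    using P.H_rel[OF K0_relI[OF assms]] by (simp add: diff_diff_eq)
  then show ?thesis unfolding K0_class_def K0_def using fg by (simp add: P.mult_cl P.cl_eq_iff)
qed

lemma split_exact_zero: assumes "Z \<in> Ob C" "Id C Z = Zero C Z Z"
  shows "split_exact C (Id C Z) (Id C Z) (Id C Z) (Id C Z)"
  using assms(1) unfolding split_exact_def by (simp add: assms(2)[symmetric]) (simp add: assms(2))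

end

context semisimple_reps
begin

text \<open>Splitting off one summand of a decomposition at a time leaves zero objects and split
  extensions by a representative. Additive invariants are compared in this way.\<close>

lemma ob_induct [consumes 1, case_names zero split]:
  assumes A: "A \<in> Ob C" and zero: "\<And>Z. Z \<in> Ob C \<Longrightarrow> Id C Z = Zero C Z Z \<Longrightarrow> P Z"
    and split: "\<And>f g s t. split_exact C f g s t \<Longrightarrow> P (Dom C f) \<Longrightarrow> Cod C g \<in> I \<Longrightarrow> P (Cod C f)"
  shows "P A"
proof -
  have "P A" if "direct_sum C A n S i p" "\<forall>r<n. S r \<in> I" for n A S i p
    using that
  proof (induction n arbitrary: A i p)
    case 0
    then show ?case using direct_sumD(1,11)[OF 0(1)] by (intro zero) simp_all
  next
    case (Suc n)
    obtain A' i' p' f t where s: "direct_sum C A' n S i' p'" "split_exact C f (p n) (i n) t" "Dom C f = A'" "Cod C f = A" "Cod C (p n) = S n"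
      using direct_sum_Suc_split[OF Suc.prems(1)] by blast
    have "P (Cod C f)" by (rule split[OF s(2)]) (use Suc.IH[OF s(1)] Suc.prems(2) s in auto)
    then show ?case using s by simp
  qed
  then show ?thesis using dec[OF A] by (auto simp: is_dec_def)
qed

lemma mult_rels: "\<lbrakk>i \<in> I; r \<in> K0_rels C\<rbrakk> \<Longrightarrow> ksum (mult i) r = 0"
  unfolding K0_rels_def using mult_short_exact by auto

lemma K0_gen: assumes K: "subgroup K (K0 C)" "K0_class C ` I \<subseteq> K" shows "K = carrier (K0 C)"
proof -
  interpret P: presentation "Ob C" "K0_rels C" by (rule K0_presentation)
  interpret G: comm_group "K0 C" by (rule comm_group_K0)
  have "K0_class C X \<in> K" if "X \<in> Ob C" for X
    using that
  proof (induction rule: ob_induct)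
    case (zero Z)
    \<comment> \<open>A zero object is an extension of itself by itself, so its class equals its own
      square and is trivial.\<close>
    have "K0_class C Z = K0_class C Z \<otimes>\<^bsub>K0 C\<^esub> K0_class C Z"
      using K0_class_split[OF split_exact_zero[OF zero]] zero(1) by simp
    then have "K0_class C Z = \<one>\<^bsub>K0 C\<^esub>" using K0_class_closed[OF zero(1)] G.l_cancel_one by metis
    then show ?case using subgroup.one_closed[OF K(1)] by simp
  next
    case (split f g s t)
    then show ?case using K0_class_split[OF split(1)] subgroup.m_closed[OF K(1)] K(2) by auto
  qed
  then show ?thesis
    using K(1) unfolding K0_def K0_class_def by (intro P.subgroup_eq_G) auto
qed

definition kc :: "'o \<Rightarrow> ('o \<Rightarrow>\<^sub>0 int) set \<Rightarrow> 'k" where "kc i = ksumq (mult i)"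

lemma kc_mult: "\<lbrakk>i \<in> I; g \<in> carrier (K0 C); h \<in> carrier (K0 C)\<rbrakk> \<Longrightarrow> kc i (g \<otimes>\<^bsub>K0 C\<^esub> h) = kc i g + kc i h"
  unfolding kc_def K0_def using mult_rels by (intro presentation.ksumq_mult[OF K0_presentation])

lemma kc_class: "i \<in> I \<Longrightarrow> kc i (K0_class C X) = mult i X"
  unfolding kc_def K0_class_def using mult_rels by (simp add: presentation.ksumq_cl[OF K0_presentation])

lemma K0_field_coordinates:
  "\<exists>!U. U \<in> carrier (tensor_field (K0 C)) \<and> (\<forall>i\<in>I. tcoord (kc i) U = v i)"
  by (rule comm_group.tensor_coordinates[OF comm_group_K0 finite_I, where e = "K0_class C"])
    (simp_all add: K0_class_closed kc_mult kc_class mult_simple K0_gen)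

lemma tcoord_kc_mult: "\<lbrakk>i \<in> I; U \<in> carrier (tensor_field (K0 C)); V \<in> carrier (tensor_field (K0 C))\<rbrakk> \<Longrightarrow>
    tcoord (kc i) (U \<otimes>\<^bsub>tensor_field (K0 C)\<^esub> V) = tcoord (kc i) U + tcoord (kc i) V"
  by (rule comm_group.tcoord_mult[OF comm_group_K0]) (auto intro: kc_mult)

lemma tcoord_kc_tcl: "i \<in> I \<Longrightarrow> tcoord (kc i) (coset_of (tensor_gens (K0 C)) (tensor_rels (K0 C)) (frag_of (g, k))) = k * kc i g"
  by (rule comm_group.tcoord_tcl[OF comm_group_K0]) (rule kc_mult)

end

section \<open>Modules given by matrices\<close>

text \<open>A module presented by coordinates \<open>c\<close> on which \<open>R\<close> acts
  through matrices \<open>r\<close>. The operations of \<open>R\<close> are only required to be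
  closed and compatible with the matrices, because the locale also serves to prove that the fusion
  algebra is a ring.\<close>

locale matrix_module = abelian_group M
  for M :: "('a, 'b, 's) module_scheme" +
  fixes R :: "('a, 'r) ring_scheme" and I :: "'i set" and r :: "'i \<Rightarrow> 'i \<Rightarrow> 'a \<Rightarrow> 'k :: field" and c :: "'i \<Rightarrow> 'b \<Rightarrow> 'k"
  assumes fin: "finite I"
    and coords: "\<exists>!x. x \<in> carrier M \<and> (\<forall>i\<in>I. c i x = v i)"
    and c_add: "\<lbrakk>i \<in> I; x \<in> carrier M; y \<in> carrier M\<rbrakk> \<Longrightarrow> c i (x \<oplus>\<^bsub>M\<^esub> y) = c i x + c i y"
    and smult_closed: "\<lbrakk>a \<in> carrier R; x \<in> carrier M\<rbrakk> \<Longrightarrow> a \<odot>\<^bsub>M\<^esub> x \<in> carrier M"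
    and c_smult: "\<lbrakk>i \<in> I; a \<in> carrier R; x \<in> carrier M\<rbrakk> \<Longrightarrow> c i (a \<odot>\<^bsub>M\<^esub> x) = (\<Sum>j\<in>I. r i j a * c j x)"
    and R_closed: "\<lbrakk>a \<in> carrier R; b \<in> carrier R\<rbrakk> \<Longrightarrow> a \<oplus>\<^bsub>R\<^esub> b \<in> carrier R"
      "\<lbrakk>a \<in> carrier R; b \<in> carrier R\<rbrakk> \<Longrightarrow> a \<otimes>\<^bsub>R\<^esub> b \<in> carrier R" "\<one>\<^bsub>R\<^esub> \<in> carrier R"
    and r_add: "\<lbrakk>i \<in> I; j \<in> I; a \<in> carrier R; b \<in> carrier R\<rbrakk> \<Longrightarrow> r i j (a \<oplus>\<^bsub>R\<^esub> b) = r i j a + r i j b"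
    and r_mult: "\<lbrakk>i \<in> I; j \<in> I; a \<in> carrier R; b \<in> carrier R\<rbrakk> \<Longrightarrow> r i j (a \<otimes>\<^bsub>R\<^esub> b) = (\<Sum>l\<in>I. r i l a * r l j b)"
    and r_one: "\<lbrakk>i \<in> I; j \<in> I\<rbrakk> \<Longrightarrow> r i j \<one>\<^bsub>R\<^esub> = (if i = j then 1 else 0)"
begin

lemma coord_eqI: "\<lbrakk>x \<in> carrier M; y \<in> carrier M; \<And>i. i \<in> I \<Longrightarrow> c i x = c i y\<rbrakk> \<Longrightarrow> x = y"
  using coords[of "\<lambda>i. c i x"] by metis

lemma smult_l_distr: "\<lbrakk>a \<in> carrier R; b \<in> carrier R; x \<in> carrier M\<rbrakk> \<Longrightarrow> (a \<oplus>\<^bsub>R\<^esub> b) \<odot>\<^bsub>M\<^esub> x = a \<odot>\<^bsub>M\<^esub> x \<oplus>\<^bsub>M\<^esub> b \<odot>\<^bsub>M\<^esub> x"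
  by (rule coord_eqI) (simp_all add: smult_closed R_closed c_add c_smult r_add distrib_right sum.distrib)

lemma smult_r_distr: "\<lbrakk>a \<in> carrier R; x \<in> carrier M; y \<in> carrier M\<rbrakk> \<Longrightarrow> a \<odot>\<^bsub>M\<^esub> (x \<oplus>\<^bsub>M\<^esub> y) = a \<odot>\<^bsub>M\<^esub> x \<oplus>\<^bsub>M\<^esub> a \<odot>\<^bsub>M\<^esub> y"
  by (rule coord_eqI) (simp_all add: smult_closed c_add c_smult distrib_left sum.distrib)

lemma smult_assoc: assumes "a \<in> carrier R" "b \<in> carrier R" "x \<in> carrier M"
  shows "(a \<otimes>\<^bsub>R\<^esub> b) \<odot>\<^bsub>M\<^esub> x = a \<odot>\<^bsub>M\<^esub> (b \<odot>\<^bsub>M\<^esub> x)"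
proof (rule coord_eqI)
  fix i assume i: "i \<in> I"
  have "c i ((a \<otimes>\<^bsub>R\<^esub> b) \<odot>\<^bsub>M\<^esub> x) = (\<Sum>j\<in>I. \<Sum>l\<in>I. r i l a * r l j b * c j x)"
    using i assms by (simp add: R_closed c_smult r_mult sum_distrib_right)
  also have "\<dots> = (\<Sum>l\<in>I. \<Sum>j\<in>I. r i l a * r l j b * c j x)" by (rule sum.swap)
  also have "\<dots> = c i (a \<odot>\<^bsub>M\<^esub> (b \<odot>\<^bsub>M\<^esub> x))"
    using i assms by (simp add: smult_closed c_smult sum_distrib_left mult.assoc)
  finally show "c i ((a \<otimes>\<^bsub>R\<^esub> b) \<odot>\<^bsub>M\<^esub> x) = c i (a \<odot>\<^bsub>M\<^esub> (b \<odot>\<^bsub>M\<^esub> x))" .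
qed (use assms in \<open>simp_all add: smult_closed R_closed\<close>)

lemma smult_one: "x \<in> carrier M \<Longrightarrow> \<one>\<^bsub>R\<^esub> \<odot>\<^bsub>M\<^esub> x = x"
  by (rule coord_eqI) (simp_all add: smult_closed R_closed c_smult r_one if_distrib[of "\<lambda>t. t * _"] fin cong: if_cong)

lemma left_module: "ring R \<Longrightarrow> left_module R M"
  using smult_closed smult_l_distr smult_r_distr smult_assoc smult_one
  by (intro left_module.intro left_module_axioms.intro abelian_group_axioms)

end

text \<open>The matrices are the same for both modules, so the bijection that preserves coordinates
  is linear.\<close>

lemma matrix_modules_iso:
  assumes R: "ring R" and M: "matrix_module M R I r c" and N: "matrix_module N R I r d"
  shows "left_modules_iso R M N"
proof -
  interpret M: matrix_module M R I r c by (rule M)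
  interpret N: matrix_module N R I r d by (rule N)
  define \<phi> where "\<phi> x = (THE y. y \<in> carrier N \<and> (\<forall>i\<in>I. d i y = c i x))" for x
  have \<phi>: "\<phi> x \<in> carrier N" "i \<in> I \<Longrightarrow> d i (\<phi> x) = c i x" for x i
    using theI'[OF N.coords[of "\<lambda>i. c i x"]] unfolding \<phi>_def by auto
  have "bij_betw \<phi> (carrier M) (carrier N)"
  proof (rule bij_betwI')
    show "\<phi> x = \<phi> y \<longleftrightarrow> x = y" if "x \<in> carrier M" "y \<in> carrier M" for x y
      using M.coord_eqI[OF that] \<phi>(2) by metis
    show "\<exists>x\<in>carrier M. y = \<phi> x" if y: "y \<in> carrier N" for y
    proof -
      obtain x where "x \<in> carrier M" "\<forall>i\<in>I. c i x = d i y" using M.coords[of "\<lambda>i. d i y"] by blast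
      then show ?thesis using N.coord_eqI[OF y \<phi>(1)] \<phi>(2) by metis
    qed
  qed (rule \<phi>)
  moreover have "\<phi> (x \<oplus>\<^bsub>M\<^esub> y) = \<phi> x \<oplus>\<^bsub>N\<^esub> \<phi> y" if "x \<in> carrier M" "y \<in> carrier M" for x y
    by (rule N.coord_eqI) (use that in \<open>simp_all add: \<phi> M.c_add N.c_add\<close>)
  moreover have "\<phi> (a \<odot>\<^bsub>M\<^esub> x) = a \<odot>\<^bsub>N\<^esub> \<phi> x" if "a \<in> carrier R" "x \<in> carrier M" for a x
    by (rule N.coord_eqI) (use that in \<open>simp_all add: \<phi> M.c_smult N.c_smult N.smult_closed\<close>)
  ultimately show ?thesis
    unfolding left_modules_iso_def using M.left_module[OF R] N.left_module[OF R] by blast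
qed

text \<open>\<open>R\<close> is regarded as a left module over itself. The module laws are then
  associativity, distributivity on both sides and the left unit law; the right unit law is not among
  them and is a separate premise.\<close>

lemma matrix_ring:
  assumes ab: "abelian_group R"
    and M: "matrix_module \<lparr>carrier = carrier R, monoid.mult = undefined, monoid.one = undefined,
      ring.zero = \<zero>\<^bsub>R\<^esub>, ring.add = ring.add R, module.smult = monoid.mult R\<rparr> R I r c"
    and one: "\<And>a. a \<in> carrier R \<Longrightarrow> a \<otimes>\<^bsub>R\<^esub> \<one>\<^bsub>R\<^esub> = a"
  shows "ring R"
proof -
  interpret M: matrix_module "\<lparr>carrier = carrier R, monoid.mult = undefined, monoid.one = undefined,
      ring.zero = \<zero>\<^bsub>R\<^esub>, ring.add = ring.add R, module.smult = monoid.mult R\<rparr>" R I r c by (rule M)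
  note M' = M.smult_closed M.smult_l_distr M.smult_r_distr M.smult_assoc M.smult_one M.R_closed
  show ?thesis
    using M'[simplified] one by (intro ringI ab monoidI) simp_all
qed

section \<open>The action on Grothendieck groups\<close>

locale semisimple_action = action C B A T mu ep + C: finite_semisimple_category C + B: semisimple_reps B I
  for C :: "('o, 'm, 'k :: alg_closed_field, 'z) moncat_scheme"
    and B :: "('p, 'n, 'k, 'y) lincat_scheme" (structure) and A T mu ep and I :: "'p set"
begin

lemma eval_functor: assumes b [simp]: "b \<in> Ob B"
  shows "lin_functor C B \<lparr>Fob = \<lambda>X. AO X b, Far = \<lambda>f. T f b\<rparr>"
  using T_Hom[OF _ b] T_Id[OF _ b] T_Cmp[OF _ _ b] T_Add[OF _ _ b] T_Scale[OF _ b]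
  by (intro lin_functor.intro lin_functor_axioms.intro C.lin_category_axioms B.lin_category_axioms) simp_all

lemma split_eval: assumes "split_exact C f g s t" "b \<in> Ob B"
  shows "split_exact B (T f b) (T g b) (T s b) (T t b)"
    "Dom B (T f b) = AO (Dom C f) b" "Cod B (T f b) = AO (Cod C f) b" "Cod B (T g b) = AO (Cod C g) b"
  using lin_functor.split_exact_image[OF eval_functor[OF assms(2)] assms(1)] by simp_all

lemma split_F: assumes "split_exact B f g s t" "X \<in> Ob C"
  shows "split_exact B (F X f) (F X g) (F X s) (F X t)"
    "Dom B (F X f) = AO X (Dom B f)" "Cod B (F X f) = AO X (Cod B f)" "Cod B (F X g) = AO X (Cod B g)"
  by (rule lin_functor.split_exact_image[OF A_functor[OF assms(2)] assms(1)])+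

text \<open>Short exact sequences split in \<open>C\<close> and in \<open>B\<close>, and both acting
  by \<open>X\<close> and evaluating at \<open>b\<close> are linear functors, which preserve split
  sequences. So relators go to relators in each variable.\<close>

lemma K0_bilinear: "bilinear_presentation (Ob C) (K0_rels C) (Ob B) (K0_rels B) (Ob B) (K0_rels B) (\<lambda>X b. AO X b)"
proof -
  interpret P: presentation "Ob B" "K0_rels B" by (rule B.K0_presentation)
  show ?thesis
  proof (intro bilinear_presentation.intro bilinear_presentation_axioms.intro C.K0_presentation B.K0_presentation)
    fix r b assume r: "r \<in> K0_rels C" and b: "b \<in> Ob B"
    obtain f g where fg: "r = frag_of (Cod C f) - frag_of (Dom C f) - frag_of (Cod C g)" "short_exact C f g"
      using r by (auto simp: K0_rels_def)
    obtain s t where s: "split_exact C f g s t" using C.short_exact_splits[OF fg(2)] by blast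
    have "bilin_ext (\<lambda>X b. AO X b) r (frag_of b) \<in> K0_rels B"
      unfolding fg(1) using B.K0_relI[OF split_eval(1)[OF s b]] split_eval(2-4)[OF s b] by (simp add: bilin_ext_diff)
    then show "bilin_ext (\<lambda>X b. AO X b) r (frag_of b) \<in> P.H" by (rule P.H_rel)
  next
    fix r X assume r: "r \<in> K0_rels B" and X: "X \<in> Ob C"
    obtain f g where fg: "r = frag_of (Cod B f) - frag_of (Dom B f) - frag_of (Cod B g)" "short_exact B f g"
      using r by (auto simp: K0_rels_def)
    obtain s t where s: "split_exact B f g s t" using B.short_exact_splits[OF fg(2)] by blast
    have "bilin_ext (\<lambda>X b. AO X b) (frag_of X) r \<in> K0_rels B"
      unfolding fg(1) using B.K0_relI[OF split_F(1)[OF s X]] split_F(2-4)[OF s X] by (simp add: bilin_ext_diff)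
    then show "bilin_ext (\<lambda>X b. AO X b) (frag_of X) r \<in> P.H" by (rule P.H_rel)
  qed (rule O_Ob)
qed

abbreviation "k0act \<equiv> quot_bilin (Ob B) (K0_rels B) (\<lambda>X b. AO X b)"

interpretation K: bilinear_presentation "Ob C" "K0_rels C" "Ob B" "K0_rels B" "Ob B" "K0_rels B" "\<lambda>X b. AO X b"
  by (rule K0_bilinear)

lemmas k0act_closed = K.quot_bilin_closed[folded K0_def]
lemmas k0act_left = K.quot_bilin_mult_left[folded K0_def]
lemmas k0act_right = K.quot_bilin_mult_right[folded K0_def]

text \<open>Both sides are additive along split sequences in \<open>b\<close> and agree on
  representatives, where a single term of the sum survives.\<close>

lemma mult_act: assumes X: "X \<in> Ob C" and b: "b \<in> Ob B" and i: "i \<in> I"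
  shows "B.mult i (AO X b) = (\<Sum>j\<in>I. B.mult i (AO X j) * B.mult j b)"
  using b
proof (induction rule: B.ob_induct)
  case (zero Z)
  note s = B.split_exact_zero[OF zero]
  have z: "B.mult j Z = 0" if "j \<in> I" for j using B.mult_split[OF s that] zero(1) by (metis add_cancel_right_right B.Id_simps(2,3))
  have "B.mult i (AO X Z) = B.mult i (AO X Z) + B.mult i (AO X Z)"
    using B.mult_split[OF split_F(1)[OF s X] i] split_F(2-4)[OF s X] zero(1) X by (simp del: one_add_one)
  then have "B.mult i (AO X Z) = 0" by (metis add_cancel_right_right)
  then show ?case using z by simp
next
  case (split f g s t)
  have "B.mult i (AO X (Cod B f)) = B.mult i (AO X (Dom B f)) + B.mult i (AO X (Cod B g))"
    using B.mult_split[OF split_F(1)[OF split(1) X] i] split_F(2-4)[OF split(1) X] by simp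
  also have "\<dots> = (\<Sum>j\<in>I. B.mult i (AO X j) * B.mult j (Dom B f)) + (\<Sum>j\<in>I. B.mult i (AO X j) * B.mult j (Cod B g))"
    using split(2,3) by (simp add: B.mult_simple if_distrib B.finite_I cong: if_cong)
  also have "\<dots> = (\<Sum>j\<in>I. B.mult i (AO X j) * B.mult j (Cod B f))"
    using B.mult_split[OF split(1)] by (simp add: distrib_left sum.distrib)
  finally show ?case .
qed

lemma mult_act_rels: assumes "i \<in> I" "j \<in> I" "r \<in> K0_rels C" shows "ksum (\<lambda>X. B.mult i (AO X j)) r = 0"
proof -
  obtain f g where fg: "r = frag_of (Cod C f) - frag_of (Dom C f) - frag_of (Cod C g)" "short_exact C f g"
    using assms(3) by (auto simp: K0_rels_def)
  obtain s t where s: "split_exact C f g s t" using C.short_exact_splits[OF fg(2)] by blast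
  show ?thesis unfolding fg(1)
    using B.mult_split[OF split_eval(1)[OF s B.I_Ob[OF assms(2)]] assms(1)] split_eval(2-4)[OF s B.I_Ob[OF assms(2)]] by simp
qed

definition rho :: "'p \<Rightarrow> 'p \<Rightarrow> ('o \<Rightarrow>\<^sub>0 int) set \<Rightarrow> 'k" where "rho i j = ksumq (\<lambda>X. B.mult i (AO X j))"

lemma rho_mult: "\<lbrakk>i \<in> I; j \<in> I; g \<in> carrier (K0 C); h \<in> carrier (K0 C)\<rbrakk> \<Longrightarrow> rho i j (g \<otimes>\<^bsub>K0 C\<^esub> h) = rho i j g + rho i j h"
  unfolding rho_def K0_def using mult_act_rels by (intro K.P1.ksumq_mult)

lemma rho_class: "\<lbrakk>i \<in> I; j \<in> I\<rbrakk> \<Longrightarrow> rho i j (K0_class C X) = B.mult i (AO X j)"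
  unfolding rho_def K0_class_def using mult_act_rels by (simp add: K.P1.ksumq_cl)

lemma kc_act: assumes "i \<in> I" "g \<in> carrier (K0 C)" "n \<in> carrier (K0 B)"
  shows "B.kc i (k0act g n) = (\<Sum>j\<in>I. rho i j g * B.kc j n)"
  unfolding B.kc_def rho_def
  by (rule K.ksumq_quot_bilin) (use assms mult_act B.mult_rels mult_act_rels in \<open>auto simp: K0_def\<close>)

definition R where "R i j = (tcoord (rho i j) :: ('o, 'k) K0_field \<Rightarrow> 'k)"

lemma tact: assumes "U \<in> carrier (tensor_field (K0 C))" "V \<in> carrier (tensor_field (K0 B))"
  shows "quot_bilin (tensor_gens (K0 B)) (tensor_rels (K0 B)) (\<lambda>(g, k) (h, l). (k0act g h, k * l :: 'k)) U V \<in> carrier (tensor_field (K0 B))"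
    "i \<in> I \<Longrightarrow> tcoord (B.kc i) (quot_bilin (tensor_gens (K0 B)) (tensor_rels (K0 B)) (\<lambda>(g, k) (h, l). (k0act g h, k * l)) U V) =
      (\<Sum>j\<in>I. R i j U * tcoord (B.kc j) V)"
proof -
  note * = C.comm_group_K0 B.comm_group_K0 B.comm_group_K0 k0act_closed k0act_left k0act_right
  show "i \<in> I \<Longrightarrow> tcoord (B.kc i) (quot_bilin (tensor_gens (K0 B)) (tensor_rels (K0 B)) (\<lambda>(g, k) (h, l). (k0act g h, k * l)) U V) =
      (\<Sum>j\<in>I. R i j U * tcoord (B.kc j) V)"
    unfolding R_def
    by (rule tcoord_quot_bilin(2)[where \<beta> = k0act and w = "B.kc i" and u = "rho i" and v = B.kc and J = I, OF * _ _ _ _ assms])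
      (simp_all add: B.kc_mult rho_mult kc_act)
  show "quot_bilin (tensor_gens (K0 B)) (tensor_rels (K0 B)) (\<lambda>(g, k) (h, l). (k0act g h, k * l :: 'k)) U V \<in> carrier (tensor_field (K0 B))"
    \<comment> \<open>Closure does not involve coordinates, so the zero functional and an empty
      index set meet the remaining premises.\<close>
    by (rule tcoord_quot_bilin(1)[where \<beta> = k0act and w = "\<lambda>_. 0" and J = "{}", OF * _ _ _ _ assms]) simp_all
qed

lemma R_tcl: "\<lbrakk>i \<in> I; j \<in> I\<rbrakk> \<Longrightarrow> R i j (coset_of (tensor_gens (K0 C)) (tensor_rels (K0 C)) (frag_of (g, k))) = k * rho i j g"
  unfolding R_def by (rule comm_group.tcoord_tcl[OF C.comm_group_K0]) (rule rho_mult)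

lemma R_mult: "\<lbrakk>i \<in> I; j \<in> I; U \<in> carrier (tensor_field (K0 C)); V \<in> carrier (tensor_field (K0 C))\<rbrakk> \<Longrightarrow>
    R i j (U \<otimes>\<^bsub>tensor_field (K0 C)\<^esub> V) = R i j U + R i j V"
  unfolding R_def by (rule comm_group.tcoord_mult[OF C.comm_group_K0]) (auto intro: rho_mult)

lemma R_one: assumes i: "i \<in> I" and j: "j \<in> I"
  shows "R i j (coset_of (tensor_gens (K0 C)) (tensor_rels (K0 C)) (frag_of (K0_class C (Unit C), 1))) = (if i = j then 1 else 0)"
proof -
  have "iso_obs B j (AO (Unit C) j)" by (rule B.iso_obsI[of "ep j"]) (use j in \<open>simp_all add: Hom_iff\<close>)
  then have "B.mult i j = B.mult i (AO (Unit C) j)" using i by (rule B.mult_iso)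
  then show ?thesis using B.mult_simple[OF i j] i j by (simp add: R_tcl rho_class)
qed

lemma mult_tensor: assumes "X \<in> Ob C" "Y \<in> Ob C" and i: "i \<in> I" and j: "j \<in> I"
  shows "B.mult i (AO (Tob C X Y) j) = (\<Sum>l\<in>I. B.mult i (AO X l) * B.mult l (AO Y j))"
proof -
  have "iso_obs B (AO X (AO Y j)) (AO (Tob C X Y) j)"
    by (rule B.iso_obsI[of "mu X Y j"]) (use assms in \<open>simp_all add: Hom_iff\<close>)
  then have "B.mult i (AO X (AO Y j)) = B.mult i (AO (Tob C X Y) j)" using i by (rule B.mult_iso)
  then show ?thesis using mult_act[OF assms(1) _ i, of "AO Y j"] assms by simp
qed

end

section \<open>The fusion algebra and the NIM-rep\<close>

lemma semisimple_self_action: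
  assumes "mon_category C" "semisimple_reps C J"
  shows "semisimple_action C C (self_action C) (\<lambda>f Y. Tar C f (Id C Y)) (\<lambda>X Y Z. inv_ar C (Assoc C X Y Z)) (\<lambda>X. inv_ar C (Lun C X)) J"
  using assms semisimple_reps.axioms(1)[OF assms(2)] mon_category.self_action[OF assms(1)]
  by (intro semisimple_action.intro)

locale fusion_action = semisimple_action C B A T mu ep I + C: semisimple_reps C J
  for C :: "('o, 'm, 'k :: alg_closed_field, 'z) moncat_scheme"
    and B :: "('p, 'n, 'k, 'y) lincat_scheme" (structure) and A T mu ep and I :: "'p set" and J :: "'o set"
begin

text \<open>\<open>C\<close> acting on itself. Its action on the Grothendieck group is the product
  \<open>K0_mult\<close>, so statements about actions also cover the product.\<close>

sublocale S: semisimple_action C C "self_action C" "\<lambda>f Y. Tar C f (Id C Y)" "\<lambda>X Y Z. inv_ar C (Assoc C X Y Z)" "\<lambda>X. inv_ar C (Lun C X)" J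
  by (rule semisimple_self_action) unfold_locales

lemma k0act_self: "S.k0act = K0_mult C"
  by (simp add: K0_mult_def self_action_def)

lemma rho_tensor: assumes i: "i \<in> I" and j: "j \<in> I" and g: "g \<in> carrier (K0 C)" "h \<in> carrier (K0 C)"
  shows "rho i j (K0_mult C g h) = (\<Sum>l\<in>I. rho i l g * rho l j h)"
proof -
  interpret K: bilinear_presentation "Ob C" "K0_rels C" "Ob C" "K0_rels C" "Ob C" "K0_rels C" "\<lambda>X Y. Tob C X Y"
    using S.K0_bilinear by (simp add: self_action_def)
  show ?thesis unfolding rho_def K0_mult_def
    by (rule K.ksumq_quot_bilin) (use assms mult_tensor mult_act_rels in \<open>auto simp: K0_def\<close>)
qed

lemma fusion_mult:
  assumes "U \<in> carrier (tensor_field (K0 C))" "V \<in> carrier (tensor_field (K0 C))" "i \<in> I" "j \<in> I"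
  shows "R i j (quot_bilin (tensor_gens (K0 C)) (tensor_rels (K0 C)) (\<lambda>(g, k) (h, l). (K0_mult C g h, k * l)) U V) = (\<Sum>l\<in>I. R i l U * R l j V)"
  unfolding R_def
  by (rule tcoord_quot_bilin(2)[where \<beta> = "K0_mult C" and w = "rho i j" and u = "rho i" and v = "\<lambda>l. rho l j" and J = I,
        OF C.comm_group_K0 C.comm_group_K0 C.comm_group_K0 _ _ _ _ _ _ _ assms(1,2)])
    (use assms S.k0act_closed S.k0act_left S.k0act_right in \<open>simp_all add: rho_mult rho_tensor k0act_self\<close>)

text \<open>The conditions that concern only the fusion algebra and the matrices \<open>R\<close> do
  not depend on the module and are discharged here once.\<close>

lemma matrix_moduleI:
  assumes "abelian_group M" "\<And>v. \<exists>!x. x \<in> carrier M \<and> (\<forall>i\<in>I. c i x = v i)"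
    "\<And>i x y. \<lbrakk>i \<in> I; x \<in> carrier M; y \<in> carrier M\<rbrakk> \<Longrightarrow> c i (x \<oplus>\<^bsub>M\<^esub> y) = c i x + c i y"
    "\<And>a x. \<lbrakk>a \<in> carrier (tensor_field (K0 C)); x \<in> carrier M\<rbrakk> \<Longrightarrow> a \<odot>\<^bsub>M\<^esub> x \<in> carrier M"
    "\<And>i a x. \<lbrakk>i \<in> I; a \<in> carrier (tensor_field (K0 C)); x \<in> carrier M\<rbrakk> \<Longrightarrow> c i (a \<odot>\<^bsub>M\<^esub> x) = (\<Sum>j\<in>I. R i j a * c j x)"
  shows "matrix_module M (fusion_algebra C) I R c"
proof -
  interpret K: comm_group "K0 C" by (rule C.comm_group_K0)
  interpret G: comm_group "tensor_field (K0 C) :: ('o, 'k) K0_field monoid" by (rule K.comm_group_tensor)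
  show ?thesis
    using assms S.tact(1)
    by (intro matrix_module.intro matrix_module_axioms.intro B.finite_I)
      (simp_all add: fusion_algebra_def R_mult fusion_mult R_one k0act_self K.tcl_closed C.K0_class_closed)
qed

end

lemma tensor_module_abelian_group:
  assumes "comm_group G"
  shows "abelian_group \<lparr>carrier = carrier (tensor_field G :: ('g \<times> 'k :: field \<Rightarrow>\<^sub>0 int) set monoid), monoid.mult = m, monoid.one = e,
     ring.zero = \<one>\<^bsub>tensor_field G\<^esub>, ring.add = monoid.mult (tensor_field G), \<dots> = s\<rparr>"
proof -
  interpret G: comm_group "tensor_field G :: ('g \<times> 'k \<Rightarrow>\<^sub>0 int) set monoid" by (rule comm_group.comm_group_tensor[OF assms])
  show ?thesis
    by (rule abelian_groupI) (use G.m_assoc G.m_comm G.l_inv_ex in auto)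
qed

context fusion_action
begin

lemma NIM_matrix_module:
  fixes M :: "('o, 'm, 'p, 'n) module_functor"
  assumes M: "Fob M = A"
  shows "matrix_module (NIM_rep B M) (fusion_algebra C) I R (\<lambda>i. tcoord (B.kc i))"
proof (rule matrix_moduleI)
  show "abelian_group (NIM_rep B M :: (('o, 'k) K0_field, ('p, 'k) K0_field) module)"
    unfolding NIM_rep_def by (rule tensor_module_abelian_group[OF B.comm_group_K0])
qed (use tact B.K0_field_coordinates B.tcoord_kc_mult in
    \<open>simp_all add: NIM_rep_def K0_action_def M\<close>)

end

text \<open>The regular action makes the fusion algebra a matrix module over itself, which yields
  every law except the right unit law. The unit object is simple and has a representative
  \<open>u\<close>; column \<open>u\<close> of the matrix of an element lists the coordinates of
  that element, and this is the missing law.\<close>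

lemma fusion_ring:
  fixes C :: "('o, 'm, 'k :: alg_closed_field, 'z) moncat_scheme"
  assumes C: "mon_category C" "semisimple_reps C J" and unit: "simple_ob C (Unit C)"
  shows "ring (fusion_algebra C)"
proof -
  interpret C: mon_category C by (rule C)
  interpret J: semisimple_reps C J by (rule C)
  interpret F: fusion_action C C "self_action C" "\<lambda>f Y. Tar C f (Id C Y)" "\<lambda>X Y Z. inv_ar C (Assoc C X Y Z)" "\<lambda>X. inv_ar C (Lun C X)" J J
    by (intro fusion_action.intro semisimple_self_action C)
  note tc = J.tcoord_kc_mult J.tcoord_kc_tcl
  let ?c = "\<lambda>i. tcoord (J.kc i) :: ('o, 'k) K0_field \<Rightarrow> 'k"
  have ab: "abelian_group (fusion_algebra C)"
    unfolding fusion_algebra_def by (rule tensor_module_abelian_group[OF C.comm_group_K0])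
  have mult_closed: "a \<otimes>\<^bsub>fusion_algebra C\<^esub> b \<in> carrier (fusion_algebra C)"
    and mult_coord: "i \<in> J \<Longrightarrow> ?c i (a \<otimes>\<^bsub>fusion_algebra C\<^esub> b) = (\<Sum>j\<in>J. F.R i j a * ?c j b)"
    if "a \<in> carrier (fusion_algebra C)" "b \<in> carrier (fusion_algebra C)" for a b i
    using F.tact(1)[of a b] F.tact(2)[of a b i] that by (simp_all add: fusion_algebra_def F.k0act_self)
  have M: "matrix_module \<lparr>carrier = carrier (fusion_algebra C), monoid.mult = undefined, monoid.one = undefined,
      ring.zero = \<zero>\<^bsub>fusion_algebra C\<^esub>, ring.add = ring.add (fusion_algebra C), module.smult = monoid.mult (fusion_algebra C)\<rparr>
      (fusion_algebra C) J F.R ?c"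
  proof (rule F.matrix_moduleI)
    show "abelian_group \<lparr>carrier = carrier (fusion_algebra C), monoid.mult = undefined, monoid.one = undefined,
      ring.zero = \<zero>\<^bsub>fusion_algebra C\<^esub>, ring.add = ring.add (fusion_algebra C), module.smult = monoid.mult (fusion_algebra C)\<rparr>"
      unfolding fusion_algebra_def ring.simps monoid.simps partial_object.simps
      by (rule tensor_module_abelian_group[OF C.comm_group_K0])
  qed (use mult_closed mult_coord J.K0_field_coordinates tc in \<open>simp_all add: fusion_algebra_def\<close>)
  interpret M: matrix_module "\<lparr>carrier = carrier (fusion_algebra C), monoid.mult = undefined, monoid.one = undefined,
      ring.zero = \<zero>\<^bsub>fusion_algebra C\<^esub>, ring.add = ring.add (fusion_algebra C), module.smult = monoid.mult (fusion_algebra C)\<rparr>"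
      "fusion_algebra C" J F.R ?c by (rule M)
  have one: "a \<otimes>\<^bsub>fusion_algebra C\<^esub> \<one>\<^bsub>fusion_algebra C\<^esub> = a" if a: "a \<in> carrier (fusion_algebra C)" for a
  proof (rule M.coord_eqI)
    fix i assume i: "i \<in> J"
    obtain u where u: "u \<in> J" "iso_obs C (Unit C) u" using J.I_cover[OF unit] by blast
    have mu: "J.mult j (Unit C) = (if j = u then 1 else 0)" if "j \<in> J" for j
      using J.mult_iso[OF u(2) that] J.mult_simple[OF that u(1)] by simp
    have cu: "?c j \<one>\<^bsub>fusion_algebra C\<^esub> = (if j = u then 1 else 0)" if "j \<in> J" for j
      using tc(2)[OF that] J.kc_class[OF that] mu[OF that] by (simp add: fusion_algebra_def)
    \<comment> \<open>\<open>mult_act\<close> is applied at the unit object, whose only nonzero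
      multiplicity is at \<open>u\<close>. This avoids transporting the isomorphism between the unit
      and \<open>u\<close> through the tensor product.\<close>
    have mX: "J.mult i (Tob C X u) = J.mult i X" if X: "X \<in> Ob C" for X
    proof -
      have "iso_obs C (Tob C X (Unit C)) X" by (rule C.iso_obsI[of "Run C X"]) (use X in \<open>simp_all add: Hom_iff\<close>)
      then have "J.mult i X = J.mult i (Tob C X (Unit C))" using J.mult_iso i by metis
      also have "\<dots> = (\<Sum>j\<in>J. J.mult i (Tob C X j) * J.mult j (Unit C))"
        using F.mult_act[OF X C.Unit_Ob i] by (simp add: self_action_def)
      also have "\<dots> = J.mult i (Tob C X u)" using u(1) by (simp add: mu J.finite_I if_distrib cong: if_cong)
      finally show ?thesis by simp
    qed
    have "F.rho i u g = J.kc i g" if "g \<in> carrier (K0 C)" for g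
      unfolding F.rho_def J.kc_def
      by (rule presentation.ksumq_cong[OF C.K0_presentation])
        (use mX F.mult_act_rels[OF i u(1)] that in \<open>simp_all add: self_action_def K0_def\<close>)
    then have Ru: "F.R i u a = ?c i a"
      unfolding F.R_def using a F.rho_mult[OF i u(1)]
      by (intro comm_group.tcoord_cong[OF C.comm_group_K0]) (simp_all add: fusion_algebra_def)
    have "?c i (a \<otimes>\<^bsub>fusion_algebra C\<^esub> \<one>\<^bsub>fusion_algebra C\<^esub>) = (\<Sum>j\<in>J. F.R i j a * ?c j \<one>\<^bsub>fusion_algebra C\<^esub>)"
      by (rule mult_coord[OF a M.R_closed(3) i])
    also have "\<dots> = F.R i u a" using u(1) by (simp add: cu J.finite_I if_distrib cong: if_cong)
    finally show "?c i (a \<otimes>\<^bsub>fusion_algebra C\<^esub> \<one>\<^bsub>fusion_algebra C\<^esub>) = ?c i a" unfolding Ru .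
  qed (use a mult_closed M.R_closed(3) in simp_all)
  show ?thesis by (rule matrix_ring[OF ab M one])
qed

section \<open>Module categories as actions\<close>

lemma End_sel [simp]:
  "Ob (End_cat B) = {G. endofunctor B G}" "Dom (End_cat B) = Src" "Cod (End_cat B) = Tgt"
  "Src (id_nat B G) = G" "Tgt (id_nat B G) = G"
  "Unit (End_cat B) = id_fct B" "Tob (End_cat B) = comp_fct B" "Id (End_cat B) = id_nat B"
  "Lun (End_cat B) = id_nat B" "Run (End_cat B) = id_nat B"
  "Assoc (End_cat B) G H K = id_nat B (comp_fct B G (comp_fct B H K))"
  "Src (Cmp (End_cat B) \<eta> \<theta>) = Src \<theta>" "Tgt (Cmp (End_cat B) \<eta> \<theta>) = Tgt \<eta>"
  "Src (Tar (End_cat B) \<eta> \<theta>) = comp_fct B (Src \<eta>) (Src \<theta>)" "Tgt (Tar (End_cat B) \<eta> \<theta>) = comp_fct B (Tgt \<eta>) (Tgt \<theta>)"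
  by (simp_all add: End_cat_def id_nat_def)

lemma End_Cpt [simp]:
  assumes "b \<in> Ob B"
  shows "Cpt (id_nat B G) b = Id B (Fob G b)"
    "Cpt (Cmp (End_cat B) \<eta> \<theta>) b = Cpt \<eta> b \<bullet>\<^bsub>B\<^esub> Cpt \<theta> b"
    "Cpt (Tar (End_cat B) \<eta> \<theta>) b = Cpt \<eta> (Fob (Tgt \<theta>) b) \<bullet>\<^bsub>B\<^esub> Far (Src \<eta>) (Cpt \<theta> b)"
    "Cpt (Add (End_cat B) \<eta> \<theta>) b = Add B (Cpt \<eta> b) (Cpt \<theta> b)"
    "Cpt (Scale (End_cat B) k \<eta>) b = Scale B k (Cpt \<eta> b)"
    "Fob (comp_fct B G H) b = Fob G (Fob H b)" "Fob (id_fct B) b = b"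
  using assms by (simp_all add: End_cat_def id_nat_def comp_fct_def id_fct_def)

lemma Far_comp_fct [simp]: assumes "g \<in> Ar B"
  shows "Far (comp_fct B G H) g = Far G (Far H g)" "Far (id_fct B) g = g"
  using assms by (simp_all add: comp_fct_def id_fct_def)

lemma End_Ar: "\<eta> \<in> Ar (End_cat B) \<longleftrightarrow> endofunctor B (Src \<eta>) \<and> endofunctor B (Tgt \<eta>) \<and> natural_family B B \<eta> \<and>
    Cpt \<eta> \<in> extensional (Ob B)"
  by (simp add: End_cat_def)

lemma End_Cpt_Hom: "\<eta> \<in> Hom (End_cat B) G H \<Longrightarrow> b \<in> Ob B \<Longrightarrow> Cpt \<eta> b \<in> Hom B (Fob G b) (Fob H b)"
  by (auto simp: Hom_iff End_Ar natural_family_def)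

lemma End_Cpt_nat: "\<lbrakk>\<eta> \<in> Hom (End_cat B) G H; g \<in> Hom B b b'\<rbrakk> \<Longrightarrow> Cpt \<eta> b' \<bullet>\<^bsub>B\<^esub> Far G g = Far H g \<bullet>\<^bsub>B\<^esub> Cpt \<eta> b"
  by (auto simp: Hom_iff End_Ar natural_family_def)

section \<open>Evaluation of module functors at objects\<close>

context module_category
begin

abbreviation "MO X \<equiv> Fob (Fob M X)"
abbreviation "MA f \<equiv> Cpt (Far M f)"
abbreviation "Mm X Y \<equiv> Cpt (Mu M X Y)"
abbreviation "Me \<equiv> Cpt (Eps M)"

lemma endo_M: "X \<in> Ob C \<Longrightarrow> endofunctor B (Fob M X)"
  using Fob_Ob[of X] by simp

lemma M_functor: "X \<in> Ob C \<Longrightarrow> lin_functor B B (Fob M X)"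
  using endo_M by (simp add: endofunctor_def)

lemma M_Ob [simp]: "X \<in> Ob C \<Longrightarrow> b \<in> Ob B \<Longrightarrow> MO X b \<in> Ob B"
  by (rule lin_functor.Fob_Ob[OF M_functor])

lemma M_Far [simp]: assumes "X \<in> Ob C" "g \<in> Ar B"
  shows "Far (Fob M X) g \<in> Ar B" "Dom B (Far (Fob M X) g) = MO X (Dom B g)" "Cod B (Far (Fob M X) g) = MO X (Cod B g)"
  using lin_functor.Far_simps[OF M_functor] assms by simp_all

lemma M_Far_Id [simp]: "X \<in> Ob C \<Longrightarrow> b \<in> Ob B \<Longrightarrow> Far (Fob M X) (Id B b) = Id B (MO X b)"
  by (rule lin_functor.Far_Id[OF M_functor])

lemma MA_simps [simp]: assumes "f \<in> Ar C"
  shows "Far M f \<in> Ar (End_cat B)" "Src (Far M f) = Fob M (Dom C f)" "Tgt (Far M f) = Fob M (Cod C f)"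
    "b \<in> Ob B \<Longrightarrow> MA f b \<in> Ar B" "b \<in> Ob B \<Longrightarrow> Dom B (MA f b) = MO (Dom C f) b" "b \<in> Ob B \<Longrightarrow> Cod B (MA f b) = MO (Cod C f) b"
proof -
  have h: "Far M f \<in> Hom (End_cat B) (Fob M (Dom C f)) (Fob M (Cod C f))" using assms by (intro Far_Hom) (simp add: Hom_iff)
  then show "Far M f \<in> Ar (End_cat B)" "Src (Far M f) = Fob M (Dom C f)" "Tgt (Far M f) = Fob M (Cod C f)" by (auto simp: Hom_iff)
  show "b \<in> Ob B \<Longrightarrow> MA f b \<in> Ar B" "b \<in> Ob B \<Longrightarrow> Dom B (MA f b) = MO (Dom C f) b" "b \<in> Ob B \<Longrightarrow> Cod B (MA f b) = MO (Cod C f) b"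
    using End_Cpt_Hom[OF h, of b] by (auto simp: Hom_iff)
qed

lemma Mm_simps [simp]: assumes "X \<in> Ob C" "Y \<in> Ob C"
  shows "Mu M X Y \<in> Ar (End_cat B)" "Src (Mu M X Y) = comp_fct B (Fob M X) (Fob M Y)" "Tgt (Mu M X Y) = Fob M (Tob C X Y)"
    "b \<in> Ob B \<Longrightarrow> Mm X Y b \<in> Ar B" "b \<in> Ob B \<Longrightarrow> Dom B (Mm X Y b) = MO X (MO Y b)" "b \<in> Ob B \<Longrightarrow> Cod B (Mm X Y b) = MO (Tob C X Y) b"
proof -
  have h: "Mu M X Y \<in> Hom (End_cat B) (comp_fct B (Fob M X) (Fob M Y)) (Fob M (Tob C X Y))" using Mu_Hom[OF assms] by simp
  then show "Mu M X Y \<in> Ar (End_cat B)" "Src (Mu M X Y) = comp_fct B (Fob M X) (Fob M Y)" "Tgt (Mu M X Y) = Fob M (Tob C X Y)" by (auto simp: Hom_iff)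
  show "b \<in> Ob B \<Longrightarrow> Mm X Y b \<in> Ar B" "b \<in> Ob B \<Longrightarrow> Dom B (Mm X Y b) = MO X (MO Y b)" "b \<in> Ob B \<Longrightarrow> Cod B (Mm X Y b) = MO (Tob C X Y) b"
    using End_Cpt_Hom[OF h, of b] by (auto simp: Hom_iff)
qed

lemma Me_simps [simp]:
  shows "Eps M \<in> Ar (End_cat B)" "Src (Eps M) = id_fct B" "Tgt (Eps M) = Fob M (Unit C)"
    "b \<in> Ob B \<Longrightarrow> Me b \<in> Ar B" "b \<in> Ob B \<Longrightarrow> Dom B (Me b) = b" "b \<in> Ob B \<Longrightarrow> Cod B (Me b) = MO (Unit C) b"
proof -
  have h: "Eps M \<in> Hom (End_cat B) (id_fct B) (Fob M (Unit C))" using Eps_Hom by simp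
  then show "Eps M \<in> Ar (End_cat B)" "Src (Eps M) = id_fct B" "Tgt (Eps M) = Fob M (Unit C)" by (auto simp: Hom_iff)
  show "b \<in> Ob B \<Longrightarrow> Me b \<in> Ar B" "b \<in> Ob B \<Longrightarrow> Dom B (Me b) = b" "b \<in> Ob B \<Longrightarrow> Cod B (Me b) = MO (Unit C) b"
    using End_Cpt_Hom[OF h, of b] by (auto simp: Hom_iff)
qed

lemma inv_sel [simp]: assumes "iso_ar (End_cat B) \<eta>"
  shows "Src (inv_ar (End_cat B) \<eta>) = Tgt \<eta>" "Tgt (inv_ar (End_cat B) \<eta>) = Src \<eta>"
  using D.iso_simps(2-4)[OF assms] by simp_all

lemma Cpt_inv: assumes iso: "iso_ar (End_cat B) \<eta>" and b: "b \<in> Ob B"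
  shows "Cpt (inv_ar (End_cat B) \<eta>) b = inv_ar B (Cpt \<eta> b)" "iso_ar B (Cpt \<eta> b)"
proof -
  let ?i = "inv_ar (End_cat B) \<eta>"
  have i: "inverse_ars (End_cat B) \<eta> ?i" by (rule D.inverse_inv_ar[OF iso])
  then have h: "\<eta> \<in> Hom (End_cat B) (Src \<eta>) (Tgt \<eta>)" "?i \<in> Hom (End_cat B) (Tgt \<eta>) (Src \<eta>)"
    and e: "Cmp (End_cat B) ?i \<eta> = id_nat B (Src \<eta>)" "Cmp (End_cat B) \<eta> ?i = id_nat B (Tgt \<eta>)"
    by (auto simp: inverse_ars_def Hom_iff)
  have c: "Cpt ?i b \<bullet>\<^bsub>B\<^esub> Cpt \<eta> b = Id B (Fob (Src \<eta>) b)" "Cpt \<eta> b \<bullet>\<^bsub>B\<^esub> Cpt ?i b = Id B (Fob (Tgt \<eta>) b)"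
    using arg_cong[OF e(1), of "\<lambda>\<theta>. Cpt \<theta> b"] arg_cong[OF e(2), of "\<lambda>\<theta>. Cpt \<theta> b"] b by simp_all
  have t: "Cpt \<eta> b \<in> Ar B" "Dom B (Cpt \<eta> b) = Fob (Src \<eta>) b" "Cod B (Cpt \<eta> b) = Fob (Tgt \<eta>) b"
    "Cpt ?i b \<in> Ar B" "Dom B (Cpt ?i b) = Fob (Tgt \<eta>) b" "Cod B (Cpt ?i b) = Fob (Src \<eta>) b"
    using End_Cpt_Hom[OF h(1) b] End_Cpt_Hom[OF h(2) b] by (auto simp: Hom_iff)
  show "Cpt ?i b = inv_ar B (Cpt \<eta> b)" by (rule B.inv_arI[symmetric]) (simp_all add: t c)
  show "iso_ar B (Cpt \<eta> b)" by (rule B.iso_arI[of _ "Cpt ?i b"]) (simp_all add: t c)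
qed

text \<open>The equations between natural transformations are evaluated at objects of
  \<open>B\<close>; as \<open>End_cat\<close> is strict, its associators and unitors contribute
  identities.\<close>

lemma module_action: "action C B (Fob M) (\<lambda>f. MA f) (\<lambda>X Y. Mm X Y) Me"
proof (intro action.intro action_axioms.intro C.mon_category_axioms B.lin_category_axioms)
  fix f f' X Y Z b assume f: "f \<in> Hom C X Y" and b: "b \<in> Ob B"
  show "f' \<in> Hom C Y Z \<Longrightarrow> MA (Cmp C f' f) b = MA f' b \<bullet>\<^bsub>B\<^esub> MA f b" using Far_Cmp[OF f] b by simp
  show "f' \<in> Hom C X Y \<Longrightarrow> MA (Add C f f') b = Add B (MA f b) (MA f' b)" using Far_Add[OF f] b by simp
  show "MA (Scale C k f) b = Scale B k (MA f b)" for k using Far_Scale[OF f] b by simp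
next
  fix f f' X X' Y Y' b assume f: "f \<in> Hom C X X'" and f': "f' \<in> Hom C Y Y'" and b: "b \<in> Ob B"
  show "MA (Tar C f f') b \<bullet>\<^bsub>B\<^esub> Mm X Y b = Mm X' Y' b \<bullet>\<^bsub>B\<^esub> MA f (MO Y' b) \<bullet>\<^bsub>B\<^esub> Far (Fob M X) (MA f' b)"
    using arg_cong[OF Mu_natural[OF f f'], of "\<lambda>\<theta>. Cpt \<theta> b"] f f' b by (simp add: Hom_iff)
next
  fix X Y Z b assume X: "X \<in> Ob C" "Y \<in> Ob C" "Z \<in> Ob C" and b: "b \<in> Ob B"
  show "MA (Assoc C X Y Z) b \<bullet>\<^bsub>B\<^esub> Mm (Tob C X Y) Z b \<bullet>\<^bsub>B\<^esub> Mm X Y (MO Z b) = Mm X (Tob C Y Z) b \<bullet>\<^bsub>B\<^esub> Far (Fob M X) (Mm Y Z b)"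
    using arg_cong[OF Mu_Assoc[OF X], of "\<lambda>\<theta>. Cpt \<theta> b"] X b by simp
next
  fix X b assume X: "X \<in> Ob C" and b: "b \<in> Ob B"
  show "MA (Lun C X) b \<bullet>\<^bsub>B\<^esub> Mm (Unit C) X b \<bullet>\<^bsub>B\<^esub> Me (MO X b) = Id B (MO X b)"
    using arg_cong[OF Mu_Lun[OF X], of "\<lambda>\<theta>. Cpt \<theta> b"] X b by simp
  show "MA (Run C X) b \<bullet>\<^bsub>B\<^esub> Mm X (Unit C) b \<bullet>\<^bsub>B\<^esub> Far (Fob M X) (Me b) = Id B (MO X b)"
    using arg_cong[OF Mu_Run[OF X], of "\<lambda>\<theta>. Cpt \<theta> b"] X b by simp
next
  fix X Y g b b' assume X: "X \<in> Ob C" "Y \<in> Ob C" and g: "g \<in> Hom B b b'"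
  show "Mm X Y b' \<bullet>\<^bsub>B\<^esub> Far (Fob M X) (Far (Fob M Y) g) = Far (Fob M (Tob C X Y)) g \<bullet>\<^bsub>B\<^esub> Mm X Y b"
    using End_Cpt_nat[OF Mu_Hom[OF X] g] g by (simp add: Hom_iff)
next
  fix g b b' assume g: "g \<in> Hom B b b'"
  show "Me b' \<bullet>\<^bsub>B\<^esub> g = Far (Fob M (Unit C)) g \<bullet>\<^bsub>B\<^esub> Me b"
    using End_Cpt_nat[OF Eps_Hom g] g by (simp add: Hom_iff)
qed (use Cpt_inv(2)[OF Mu_iso] Cpt_inv(2)[OF Eps_iso] End_Cpt_nat[OF Far_Hom] in \<open>auto simp: M_functor Far_Id Hom_iff\<close>)

end

lemma id_fct_functor: "module_category C B M \<Longrightarrow> lin_functor B B (id_fct B)"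
  using mon_category.Unit_Ob[OF mon_functor.axioms(3)[OF module_category.axioms(3)], of C B M]
  by (simp add: endofunctor_def)

context finite_pivotal_module_category
begin

interpretation A: pivotal_action C B "Fob M" "\<lambda>f. MA f" "\<lambda>X Y. Mm X Y" Me
  by (intro pivotal_action.intro rigid_action.intro module_action C.rigid_category_axioms C.pivotal_category_axioms)

lemma Cpt_AnnM: "\<lbrakk>X \<in> Ob C; b \<in> Ob B\<rbrakk> \<Longrightarrow> Cpt (AnnM C (End_cat B) M X) b = A.an X b"
  by (simp add: AnnM_def A.an_def A.pairing_def Cpt_inv Eps_iso)

lemma Cpt_CreM: "\<lbrakk>X \<in> Ob C; b \<in> Ob B\<rbrakk> \<Longrightarrow> Cpt (CreM C (End_cat B) M X) b = A.cr X b"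
  by (simp add: CreM_def A.cr_def A.copairing_def Cpt_inv Mu_iso)

lemma Src_AnnM: "X \<in> Ob C \<Longrightarrow> Src (AnnM C (End_cat B) M X) = comp_fct B (Fob M (Dual C X)) (Fob M X)"
  "Tgt (AnnM C (End_cat B) M X) = id_fct B"
  by (simp_all add: AnnM_def Eps_iso)

lemma Src_CreM: "Src (CreM C (End_cat B) M X) = id_fct B"
  "X \<in> Ob C \<Longrightarrow> Tgt (CreM C (End_cat B) M X) = comp_fct B (Fob M X) (Fob M (Dual C X))"
  by (simp_all add: CreM_def Mu_iso)

lemma inv_id_nat: "endofunctor B G \<Longrightarrow> inv_ar (End_cat B) (id_nat B G) = id_nat B G"
  using D.iso_Id(2)[of G] by simp

lemma DarM_sel: assumes "X \<in> Ob C" "Y \<in> Ob C"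
  shows "Src (DarM C (End_cat B) M X Y \<alpha>) = Fob M (Dual C Y)" "Tgt (DarM C (End_cat B) M X Y \<alpha>) = Fob M (Dual C X)"
  using assms by (simp_all add: DarM_def dual_ar_def mate_def inv_id_nat endo_M)

lemma Cpt_DarM:
  assumes X: "X \<in> Ob C" and Y: "Y \<in> Ob C" and \<alpha>: "Src \<alpha> = Fob M X" "Tgt \<alpha> = Fob M Y"
    "\<And>b. b \<in> Ob B \<Longrightarrow> Cpt \<alpha> b \<in> Hom B (MO X b) (MO Y b)" and b: "b \<in> Ob B"
  shows "Cpt (DarM C (End_cat B) M X Y \<alpha>) b = A.ntdual X Y (Cpt \<alpha>) b"
proof -
  have c: "endofunctor B (comp_fct B G H)" if "endofunctor B G" "endofunctor B H" for G H
    using D.Tob_Ob[of G H] that by simp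
  have [simp]: "Cpt \<alpha> b \<in> Ar B" "Dom B (Cpt \<alpha> b) = MO X b" "Cod B (Cpt \<alpha> b) = MO Y b" if "b \<in> Ob B" for b
    using \<alpha>(3)[OF that] by (auto simp: Hom_iff)
  show ?thesis
    using X Y b by (simp add: DarM_def dual_ar_def mate_def inv_id_nat endo_M c \<alpha>(1,2) Cpt_AnnM Cpt_CreM Src_AnnM Src_CreM A.ntdual_def)
qed

text \<open>Pivotality is assumed for morphisms of \<open>End_cat\<close>, while actions use bare
  families of components. \<open>?\<alpha>\<close> packs a family into such a morphism, restricting
  it to the objects of \<open>B\<close> to make it extensional.\<close>

lemma module_pivotal_action: "pivotal_module_action C B (Fob M) (\<lambda>f. MA f) (\<lambda>X Y. Mm X Y) Me"
proof (intro pivotal_module_action.intro pivotal_module_action_axioms.intro A.pivotal_action_axioms)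
  fix X Y \<alpha> b assume X: "X \<in> Ob C" and Y: "Y \<in> Ob C" and \<alpha>: "A.nt X Y \<alpha>" and b: "b \<in> Ob B"
  let ?\<alpha> = "\<lparr>Src = Fob M X, Tgt = Fob M Y, Cpt = restrict \<alpha> (Ob B)\<rparr>"
  let ?\<beta> = "DarM C (End_cat B) M X Y ?\<alpha>"
  have "?\<alpha> \<in> Hom (End_cat B) (Fob M X) (Fob M Y)"
    using X Y \<alpha> B.Dom_Ob B.Cod_Ob by (auto simp: Hom_iff End_Ar endo_M natural_family_def A.nt_def)
  from arg_cong[OF pivotal[OF X Y this], of "\<lambda>\<theta>. Cpt \<theta> b"]
  have e: "MA (Piv C Y) b \<bullet>\<^bsub>B\<^esub> \<alpha> b = Cpt (DarM C (End_cat B) M (Dual C Y) (Dual C X) ?\<beta>) b \<bullet>\<^bsub>B\<^esub> MA (Piv C X) b"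
    using b by simp
  have nt_cong: "A.ntdual X' Y' \<eta> c = A.ntdual X' Y' \<eta>' c"
    if "\<And>b. b \<in> Ob B \<Longrightarrow> \<eta> b = \<eta>' b" "X' \<in> Ob C" "c \<in> Ob B" for X' Y' \<eta> \<eta>' c
    using that by (simp add: A.ntdual_def)
  have \<beta>: "Cpt ?\<beta> c = A.ntdual X Y \<alpha> c" if c: "c \<in> Ob B" for c
    using Cpt_DarM[OF X Y, of ?\<alpha> c] \<alpha> c nt_cong[of "restrict \<alpha> (Ob B)" \<alpha> X c Y] X by (simp add: A.nt_def)
  have "Cpt (DarM C (End_cat B) M (Dual C Y) (Dual C X) ?\<beta>) b = A.ntdual (Dual C Y) (Dual C X) (Cpt ?\<beta>) b"
    by (rule Cpt_DarM) (use X Y \<alpha> b \<beta> A.ntdual_simps[OF X Y \<alpha>] in \<open>simp_all add: DarM_sel Hom_iff\<close>)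
  also have "\<dots> = A.ntdual (Dual C Y) (Dual C X) (A.ntdual X Y \<alpha>) b"
    by (rule nt_cong) (use Y b \<beta> in simp_all)
  finally show "MA (Piv C Y) b \<bullet>\<^bsub>B\<^esub> \<alpha> b = A.ntdual (Dual C Y) (Dual C X) (A.ntdual X Y \<alpha>) b \<bullet>\<^bsub>B\<^esub> MA (Piv C X) b"
    using e by simp
qed

text \<open>The pivotal structure is absorbed into \<open>ev\<close>, and what remains on the loop
  is \<open>\<alpha>\<close> with the functor of \<open>X\<close> applied to it. Encircling is thus
  a partial trace.\<close>

lemma Cpt_encircle:
  assumes X: "X \<in> Ob C" and \<alpha>: "\<alpha> \<in> Hom (End_cat B) (id_fct B) (id_fct B)" and b: "b \<in> Ob B"
  shows "Cpt (encircle C B M X \<alpha>) b = A.tr X (\<lambda>b. Far (Fob M X) (Cpt \<alpha> b)) b"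
proof -
  have [simp]: "Src \<alpha> = id_fct B" "Tgt \<alpha> = id_fct B" using \<alpha> by (auto simp: Hom_iff)
  have [simp]: "Cpt \<alpha> c \<in> Ar B" "Dom B (Cpt \<alpha> c) = c" "Cod B (Cpt \<alpha> c) = c" if "c \<in> Ob B" for c
    using End_Cpt_Hom[OF \<alpha> that] that by (auto simp: Hom_iff)
  show ?thesis
    using X b by (simp add: encircle_def Let_def Cpt_AnnM Cpt_CreM Src_AnnM Src_CreM A.tr_def A.ev_def)
qed

lemma End_id_iff:
  "\<alpha> \<in> Hom (End_cat B) (id_fct B) (id_fct B) \<longleftrightarrow> Src \<alpha> = id_fct B \<and> Tgt \<alpha> = id_fct B \<and> Cpt \<alpha> \<in> extensional (Ob B) \<and>
     (\<forall>b\<in>Ob B. Cpt \<alpha> b \<in> Hom B b b) \<and> (\<forall>g\<in>Ar B. Cpt \<alpha> (Cod B g) \<bullet>\<^bsub>B\<^esub> g = g \<bullet>\<^bsub>B\<^esub> Cpt \<alpha> (Dom B g))"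
  using D.Unit_Ob by (auto simp: Hom_iff End_Ar natural_family_def)

lemma encircle_sel: "Src (encircle C B M X \<alpha>) = id_fct B" "Tgt (encircle C B M X \<alpha>) = id_fct B" "Cpt (encircle C B M X \<alpha>) \<in> extensional (Ob B)"
  by (simp_all add: encircle_def Let_def Src_AnnM Src_CreM) (simp add: End_cat_def)

end

section \<open>The encircling module\<close>

text \<open>\<open>quot_lin\<close> takes the only element of the image of a coset, so the values at
  all representatives must coincide. They are compared by coordinates: each is a
  \<open>ksum\<close>, constant on the coset because it vanishes on the relators.\<close>

lemma (in presentation) quot_lin_coord:
  fixes V :: "('k :: field, 'v) module" and c :: "'i \<Rightarrow> 'v \<Rightarrow> 'k"
  assumes V: "module (ring_of_type_algebra :: 'k ring) V" and f: "\<And>x. x \<in> S \<Longrightarrow> f x \<in> carrier V"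
    and c_add: "\<And>i x y. \<lbrakk>i \<in> I; x \<in> carrier V; y \<in> carrier V\<rbrakk> \<Longrightarrow> c i (x \<oplus>\<^bsub>V\<^esub> y) = c i x + c i y"
    and c_smult: "\<And>i k x. \<lbrakk>i \<in> I; x \<in> carrier V\<rbrakk> \<Longrightarrow> c i (k \<odot>\<^bsub>V\<^esub> x) = k * c i x"
    and c_inj: "\<And>x y. \<lbrakk>x \<in> carrier V; y \<in> carrier V; \<And>i. i \<in> I \<Longrightarrow> c i x = c i y\<rbrakk> \<Longrightarrow> x = y"
    and w: "\<And>i x. \<lbrakk>i \<in> I; x \<in> S\<rbrakk> \<Longrightarrow> c i (f x) = w i x"
    and rels: "\<And>i r. \<lbrakk>i \<in> I; r \<in> R\<rbrakk> \<Longrightarrow> ksum (w i) r = 0" and U: "U \<in> carrier G"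
  shows "quot_lin V f U \<in> carrier V" "i \<in> I \<Longrightarrow> c i (quot_lin V f U) = ksumq (w i) U"
proof -
  interpret V: module "ring_of_type_algebra :: 'k ring" V by (rule V)
  define g where "g a = finsum V (\<lambda>x. of_int (Poly_Mapping.lookup a x) \<odot>\<^bsub>V\<^esub> f x) (Poly_Mapping.keys a)" for a
  obtain a where a: "Poly_Mapping.keys a \<subseteq> S" "U = cl a" using U by (rule G_cases)
  have c_zero: "c i \<zero>\<^bsub>V\<^esub> = 0" if "i \<in> I" for i using c_add[OF that V.zero_closed V.zero_closed] by (metis V.l_zero V.zero_closed add_cancel_right_right)
  have fin: "finsum V h K \<in> carrier V \<and> c i (finsum V h K) = (\<Sum>x\<in>K. c i (h x))"
    if "finite K" "h \<in> K \<rightarrow> carrier V" "i \<in> I" for h K i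
    using that by (induction K rule: finite_induct) (simp_all add: c_zero c_add Pi_iff V.finsum_insert V.finsum_closed)
  have cl: "(\<lambda>x. of_int (Poly_Mapping.lookup b x) \<odot>\<^bsub>V\<^esub> f x) \<in> Poly_Mapping.keys b \<rightarrow> carrier V" if "b \<in> U" for b
    using cl_keys[of b a] that a f by (auto intro!: V.smult_closed)
  have gV: "g b \<in> carrier V" if "b \<in> U" for b
    unfolding g_def by (rule V.finsum_closed[OF cl[OF that]])
  have gc: "c i (g b) = ksumq (w i) U" if b: "b \<in> U" and i: "i \<in> I" for b i
  proof -
    have "c i (g b) = (\<Sum>x\<in>Poly_Mapping.keys b. c i (of_int (Poly_Mapping.lookup b x) \<odot>\<^bsub>V\<^esub> f x))"
      unfolding g_def using fin[OF finite_keys cl[OF b] i] by simp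
    also have "\<dots> = ksum (w i) b"
      unfolding ksum_def using cl_keys[of b a] b a f i by (intro sum.cong) (auto simp: c_smult w)
    also have "\<dots> = ksum (w i) a" using ksum_cl[of "w i" b a] rels i b a by blast
    also have "\<dots> = ksumq (w i) U" unfolding a(2) using ksumq_cl[of "w i" a] rels i by simp
    finally show ?thesis .
  qed
  have aU: "a \<in> U" unfolding a(2) by (rule self_cl)
  have ga: "g b = g a" if "b \<in> U" for b
    by (rule c_inj) (use gV gc that aU in simp_all)
  have "g ` U = {g a}" using ga aU by blast
  then have "quot_lin V f U = g a" unfolding quot_lin_def g_def by simp
  then show "quot_lin V f U \<in> carrier V" "i \<in> I \<Longrightarrow> c i (quot_lin V f U) = ksumq (w i) U"
    using gV[OF aU] gc[OF aU] by simp_all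
qed

locale fusion_module_category = finite_pivotal_module_category C B M + C: fusion_category C +
    C: semisimple_reps C J + B: semisimple_reps B I
  for C :: "('o, 'm, 'k :: alg_closed_field, 'z) pivcat_scheme" and B :: "('p, 'n, 'k, 'y) lincat_scheme"
    and M :: "('o, 'm, 'p, 'n) module_functor" and J :: "'o set" and I :: "'p set"
begin

interpretation P: pivotal_semisimple_action C B "Fob M" "\<lambda>f. MA f" "\<lambda>X Y. Mm X Y" Me I
  by (intro pivotal_semisimple_action.intro module_pivotal_action B.semisimple_reps_axioms)

interpretation Q: fusion_action C B "Fob M" "\<lambda>f. MA f" "\<lambda>X Y. Mm X Y" Me I J
  by (intro fusion_action.intro semisimple_action.intro module_action C.finite_semisimple_category_axioms
      B.semisimple_reps_axioms C.semisimple_reps_axioms)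

abbreviation "E \<equiv> hom_space (End_cat B) (id_fct B) (id_fct B)"

lemma E_module: "module (ring_of_type_algebra :: 'k ring) E"
  by (rule D.hom_module) (use D.Unit_Ob in simp_all)

lemma encircle_closed:
  assumes X: "X \<in> Ob C" and \<alpha>: "\<alpha> \<in> carrier E" shows "encircle C B M X \<alpha> \<in> carrier E"
proof -
  have nt: "P.nt X X (\<lambda>b. Far (Fob M X) (Cpt \<alpha> b))"
    by (rule P.nt_F[OF X]) (use \<alpha> in \<open>auto simp: End_id_iff\<close>)
  show ?thesis
    unfolding hom_space_simps(1) End_id_iff
    using P.tr_simps[OF nt X] P.tr_nat[OF nt X] Cpt_encircle[OF X \<alpha>[unfolded hom_space_simps]] by (simp add: encircle_sel Hom_iff)
qed

lemma E_eqI: assumes \<alpha>: "\<alpha> \<in> carrier E" "\<beta> \<in> carrier E" and eq: "\<And>i. i \<in> I \<Longrightarrow> B.scal i (Cpt \<alpha> i) = B.scal i (Cpt \<beta> i)"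
  shows "\<alpha> = \<beta>"
proof -
  note h = \<alpha>[unfolded hom_space_simps End_id_iff]
  have F: "lin_functor B B (id_fct B)" by (rule id_fct_functor) unfold_locales
  have nat: "nat_family B (id_fct B) (id_fct B) (Cpt \<alpha>)" "nat_family B (id_fct B) (id_fct B) (Cpt \<beta>)"
    using h by (auto simp: nat_family_def)
  have "Cpt \<alpha> b = Cpt \<beta> b" if b: "b \<in> Ob B" for b
  proof (rule B.nat_family_eqI[OF F F nat _ b])
    fix i assume i: "i \<in> I"
    then have "Cpt \<alpha> i \<in> Hom B i i" "Cpt \<beta> i \<in> Hom B i i" using h B.I_Ob by blast+
    then show "Cpt \<alpha> i = Cpt \<beta> i" using B.Scale_scal[OF i] eq[OF i] by metis
  qed
  then have "Cpt \<alpha> = Cpt \<beta>" using h by (intro extensionalityI[of _ "Ob B"]) auto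
  then show ?thesis using h by simp
qed

text \<open>Scalars on the representatives may be prescribed freely, by \<open>nat_ext\<close>.
  Together with \<open>E_eqI\<close> this identifies endotransformations of the identity with
  families of scalars.\<close>

lemma E_exists: "\<exists>\<alpha>\<in>carrier E. \<forall>i\<in>I. B.scal i (Cpt \<alpha> i) = v i"
proof -
  have F: "lin_functor B B (id_fct B)" by (rule id_fct_functor) unfold_locales
  let ?h = "\<lambda>i. Scale B (v i) (Id B i)"
  have h: "?h i \<in> Hom B (Fob (id_fct B) i) (Fob (id_fct B) i)" if "i \<in> I" for i using that by (simp add: Hom_iff)
  let ?\<eta> = "B.nat_ext (id_fct B) (id_fct B) ?h"
  have n: "nat_family B (id_fct B) (id_fct B) ?\<eta>" by (rule B.nat_ext_nat_family[OF F F h])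
  have s: "?\<eta> i = ?h i" if "i \<in> I" for i by (rule B.nat_ext_simple[OF F F h that])
  show ?thesis
    by (rule bexI[of _ "\<lparr>Src = id_fct B, Tgt = id_fct B, Cpt = restrict ?\<eta> (Ob B)\<rparr>"])
      (use n s in \<open>auto simp: End_id_iff nat_family_def\<close>)
qed

text \<open>In the coordinates \<open>d i * B.scal i (Cpt \<alpha> i)\<close> encircling by
  \<open>X\<close> is given by multiplicities. The action of a general element is computed in two
  stages, one over the Grothendieck group and one over its extension of scalars, since it is defined
  by two nested \<open>quot_lin\<close>.\<close>

lemma encircling_matrix_module:
  "\<exists>c. matrix_module (encircling_module C B M) (fusion_algebra C) I Q.R c"
proof -
  obtain d where d: "\<And>i. i \<in> I \<Longrightarrow> d i \<noteq> 0" and tr: "\<And>X i \<alpha>. \<lbrakk>X \<in> Ob C; i \<in> I; \<forall>b\<in>Ob B. \<alpha> b \<in> Hom B b b;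
      \<forall>g\<in>Ar B. \<alpha> (Cod B g) \<bullet>\<^bsub>B\<^esub> g = g \<bullet>\<^bsub>B\<^esub> \<alpha> (Dom B g)\<rbrakk> \<Longrightarrow>
      d i * B.scal i (P.tr X (\<lambda>b. Far (Fob M X) (\<alpha> b)) i) = (\<Sum>j\<in>I. B.mult i (MO X j) * (d j * B.scal j (\<alpha> j)))"
    using P.module_trace by blast
  define c where "c i \<alpha> = d i * B.scal i (Cpt \<alpha> i)" for i and \<alpha> :: "('p, 'n, 'p, 'n) ntrans"
  have EH: "Cpt \<alpha> i \<in> Hom B i i" if "\<alpha> \<in> carrier E" "i \<in> I" for \<alpha> i
    using that B.I_Ob by (auto simp: End_id_iff)
  have c_add: "c i (x \<oplus>\<^bsub>E\<^esub> y) = c i x + c i y" if "i \<in> I" "x \<in> carrier E" "y \<in> carrier E" for i x y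
    using that B.scal_Add[OF that(1) EH EH] by (simp add: c_def distrib_left)
  have c_smult: "c i (k \<odot>\<^bsub>E\<^esub> x) = k * c i x" if "i \<in> I" "x \<in> carrier E" for i k x
    using that B.scal_Sc[OF that(1) EH] by (simp add: c_def)
  have c_inj: "x = y" if "x \<in> carrier E" "y \<in> carrier E" "\<And>i. i \<in> I \<Longrightarrow> c i x = c i y" for x y
    by (rule E_eqI[OF that(1,2)]) (use that(3) d in \<open>simp add: c_def\<close>)
  have c_enc: "c i (encircle C B M X \<alpha>) = (\<Sum>j\<in>I. B.mult i (MO X j) * c j \<alpha>)"
    if "X \<in> Ob C" "i \<in> I" "\<alpha> \<in> carrier E" for X i \<alpha>
    using tr[of X i "Cpt \<alpha>"] that Cpt_encircle[of X \<alpha> i] by (simp add: c_def End_id_iff)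
  let ?q = "\<lambda>\<alpha> g. quot_lin E (\<lambda>X. encircle C B M X \<alpha>) g"
  have q: "?q \<alpha> g \<in> carrier E" "i \<in> I \<Longrightarrow> c i (?q \<alpha> g) = (\<Sum>j\<in>I. Q.rho i j g * c j \<alpha>)"
    if \<alpha>: "\<alpha> \<in> carrier E" and g: "g \<in> carrier (K0 C)" for \<alpha> g i
  proof -
    \<comment> \<open>Additivity of encircling on exact sequences is settled here: its coordinates
      depend on \<open>X\<close> through multiplicities, which vanish on the relators.\<close>
    have r: "ksum (\<lambda>X. \<Sum>j\<in>I. B.mult i (MO X j) * c j \<alpha>) r = 0" if "i \<in> I" "r \<in> K0_rels C" for i r
      unfolding ksum_fun_sum using Q.mult_act_rels that by simp
    note * = presentation.quot_lin_coord[OF C.K0_presentation E_module, where c = c and I = I and U = g and f = "\<lambda>X. encircle C B M X \<alpha>"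
        and w = "\<lambda>i X. \<Sum>j\<in>I. B.mult i (MO X j) * c j \<alpha>", OF encircle_closed[OF _ \<alpha>] c_add c_smult c_inj c_enc[OF _ _ \<alpha>] r g[unfolded K0_def]]
    show "?q \<alpha> g \<in> carrier E" by (rule *(1))
    have k: "i \<in> I \<Longrightarrow> c i (?q \<alpha> g) = ksumq (\<lambda>X. \<Sum>j\<in>I. B.mult i (MO X j) * c j \<alpha>) g" by (rule *(2))
    have e: "ksumq (\<lambda>X. \<Sum>j\<in>I. B.mult i (MO X j) * c j \<alpha>) g = (\<Sum>j\<in>I. Q.rho i j g * c j \<alpha>)"
      unfolding ksumq_def Q.rho_def by (rule ksum_fun_sum)
    show "i \<in> I \<Longrightarrow> c i (?q \<alpha> g) = (\<Sum>j\<in>I. Q.rho i j g * c j \<alpha>)"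
      by (rule trans[OF k e])
  qed
  let ?s = "\<lambda>a \<alpha>. quot_lin E (\<lambda>(g, k). k \<odot>\<^bsub>E\<^esub> ?q \<alpha> g) a"
  have s: "?s a \<alpha> \<in> carrier E" "i \<in> I \<Longrightarrow> c i (?s a \<alpha>) = (\<Sum>j\<in>I. Q.R i j a * c j \<alpha>)"
    if \<alpha>: "\<alpha> \<in> carrier E" and a: "a \<in> carrier (tensor_field (K0 C))" for \<alpha> a i
  proof -
    let ?w = "\<lambda>i x. \<Sum>j\<in>I. (case x of (g, k) \<Rightarrow> k * Q.rho i j g) * c j \<alpha>"
    have f: "(case x of (g, k) \<Rightarrow> k \<odot>\<^bsub>E\<^esub> ?q \<alpha> g) \<in> carrier E" if "x \<in> tensor_gens (K0 C)" for x
      using that q(1)[OF \<alpha>] module.smult_closed[OF E_module] by (auto simp: tensor_gens_def)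
    have w: "c i (case x of (g, k) \<Rightarrow> k \<odot>\<^bsub>E\<^esub> ?q \<alpha> g) = ?w i x" if "i \<in> I" "x \<in> tensor_gens (K0 C)" for i x
      using that q[OF \<alpha>] c_smult by (auto simp: tensor_gens_def sum_distrib_left mult.assoc)
    have r: "ksum (?w i) r = 0" if "i \<in> I" "r \<in> tensor_rels (K0 C)" for i r
      unfolding ksum_fun_sum using comm_group.tensor_rels_ksum[OF C.comm_group_K0 _ that(2), of "Q.rho i j" for j] Q.rho_mult[OF that(1)] by simp
    note * = presentation.quot_lin_coord[OF comm_group.tensor_presentation[OF C.comm_group_K0] E_module, where c = c and I = I and U = a
        and f = "\<lambda>(g, k). k \<odot>\<^bsub>E\<^esub> ?q \<alpha> g" and w = ?w, OF f c_add c_smult c_inj w r a[unfolded tensor_field_def]]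
    show "?s a \<alpha> \<in> carrier E" by (rule *(1))
    have k: "i \<in> I \<Longrightarrow> c i (?s a \<alpha>) = ksumq (?w i) a" by (rule *(2))
    have e: "ksumq (?w i) a = (\<Sum>j\<in>I. Q.R i j a * c j \<alpha>)"
      unfolding ksumq_def Q.R_def tcoord_def by (rule ksum_fun_sum)
    show "i \<in> I \<Longrightarrow> c i (?s a \<alpha>) = (\<Sum>j\<in>I. Q.R i j a * c j \<alpha>)"
      by (rule trans[OF k e])
  qed
  interpret E: module "ring_of_type_algebra :: 'k ring" E by (rule E_module)
  have "matrix_module (encircling_module C B M) (fusion_algebra C) I Q.R c"
  proof (rule Q.matrix_moduleI)
    show "abelian_group (encircling_module C B M)"
      unfolding encircling_module_def Let_def
      by (rule abelian_groupI) (use E.a_closed E.zero_closed E.l_zero E.a_assoc E.a_comm E.add.l_inv_ex in auto)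
    fix v :: "'p \<Rightarrow> 'k"
    obtain \<alpha> where \<alpha>: "\<alpha> \<in> carrier E" "\<And>i. i \<in> I \<Longrightarrow> B.scal i (Cpt \<alpha> i) = v i / d i"
      using E_exists[of "\<lambda>i. v i / d i"] by blast
    then have "\<exists>!\<alpha>. \<alpha> \<in> carrier E \<and> (\<forall>i\<in>I. c i \<alpha> = v i)"
      using d by (intro ex1I[of _ \<alpha>]) (auto simp: c_def intro!: c_inj)
    then show "\<exists>!x. x \<in> carrier (encircling_module C B M) \<and> (\<forall>i\<in>I. c i x = v i)"
      by (simp add: encircling_module_def Let_def)
  qed (use s c_add in \<open>simp_all add: encircling_module_def Let_def\<close>)
  then show ?thesis by blast
qed

lemma NIM_rep_encircling_iso: "left_modules_iso (fusion_algebra C) (NIM_rep B M) (encircling_module C B M)"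
proof -
  have "ring (fusion_algebra C)" by (rule fusion_ring[OF C.mon_category_axioms C.semisimple_reps_axioms C.simple_unit])
  then show ?thesis
    using matrix_modules_iso[OF _ Q.NIM_matrix_module[OF refl]] encircling_matrix_module by blast
qed

end

theorem theorem2p7:
  fixes C :: "('o, 'm, 'k :: {alg_closed_field, field_char_0}) pivcat"
    and B :: "('p, 'n, 'k) lincat"
    and M :: "('o, 'm, 'p, 'n) module_functor"
  assumes "spherical_fusion_category C"
    and "finite_pivotal_module_category C B M"
  shows "left_modules_iso (fusion_algebra C) (NIM_rep B M) (encircling_module C B M)"
proof -
  interpret C: spherical_fusion_category C by (rule assms(1))
  interpret M: finite_pivotal_module_category C B M by (rule assms(2))
  obtain J where J: "finite J" "\<forall>i\<in>J. simple_ob C i" "\<forall>i\<in>J. \<forall>j\<in>J. iso_obs C i j \<longrightarrow> i = j"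
    "\<forall>S. simple_ob C S \<longrightarrow> (\<exists>i\<in>J. iso_obs C S i)"
    using C.simple_reps_exist by blast
  obtain I where I: "finite I" "\<forall>i\<in>I. simple_ob B i" "\<forall>i\<in>I. \<forall>j\<in>I. iso_obs B i j \<longrightarrow> i = j"
    "\<forall>S. simple_ob B S \<longrightarrow> (\<exists>i\<in>I. iso_obs B S i)"
    using M.B.simple_reps_exist by blast
  have "semisimple_reps C J" using J by (intro semisimple_reps.intro semisimple_reps_axioms.intro C.finite_semisimple_category_axioms) auto
  moreover have "semisimple_reps B I" using I by (intro semisimple_reps.intro semisimple_reps_axioms.intro M.B.finite_semisimple_category_axioms) auto
  ultimately have "fusion_module_category C B M J I"
    by (intro fusion_module_category.intro assms(2) C.fusion_category_axioms)
  then show ?thesis by (rule fusion_module_category.NIM_rep_encircling_iso)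
qed

end
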